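(* Let $Q=\mathbb{R}^+\times\mathbb{R}^+$, $g_1,g_2\in\mathcal{S}([0,\infty))$, $h_1\in C^\infty([0,\infty))$, and let $f_1,f_2\in C^\infty(\overline{Q})$ be such that for every $T>0$ and $j=1,2$, $$\sup\Big\{x^E\Big|\frac{\partial^{n+l}f_j(x,t)}{\partial x^n\partial t^l}\Big|:\ x>0,\ 0\le t\le T\Big\}<\infty\quad\text{for all nonnegative integers } n,l,E.$$ Let $\Psi_1(x,t),\Psi_2(x,t)$ be the functions defined in the context for $x>0$, $t>0$, $x\neq t$. Then the following hold. (1) For nonnegative integers $n$ and $l$, the limits $$\lim_{t\to0^+}\frac{\partial^{n+l}\Psi_1(x,t)}{\partial x^n\partial t^l}\quad\text{and}\quad\lim_{t\to0^+}\frac{\partial^{n+l}\Psi_2(x,t)}{\partial x^n\partial t^l}$$ exist, uniformly for $x$ in compact subsets of $\mathbb{R}^+$, and define $C^\infty$ functions of $x\in\mathbb{R}^+$. (2) For nonnegative integers $n$ and $l$, the limits $$\lim_{x\to0^+}\frac{\partial^{n+l}\Psi_1(x,t)}{\partial x^n\partial t^l}\quad\text{and}\quad\lim_{x\to0^+}\frac{\partial^{n+l}\Psi_2(x,t)}{\partial x^n\partial t^l}$$ exist, uniformly for $t$ in compact subsets of $\mathbb{R}^+$, and define $C^\infty$ functions of $t\in\mathbb{R}^+$. (3) The functions $\Psi_1$ and $\Psi_2$ extend to $C^\infty$ functions in open neighborhoods of the open half-lines $\{(x,0):x>0\}$ and $\{(0,t):t>0\}$. (4) For every nonnegative integer $n$,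 $\lim_{t\to0^+}\dfrac{\partial^n\Psi_1(x,t)}{\partial x^n}=\dfrac{d^ng_1(x)}{dx^n}$ and $\lim_{t\to0^+}\dfrac{\partial^n\Psi_2(x,t)}{\partial x^n}=\dfrac{d^ng_2(x)}{dx^n}$, for $x\in\mathbb{R}^+$. (5) For every nonnegative integer $l$, $\lim_{x\to0^+}\dfrac{\partial^l\Psi_1(x,t)}{\partial t^l}=\dfrac{d^lh_1(t)}{dt^l}$, for $t\in\mathbb{R}^+$.
   Context: Fix a real number $m\ge 0$. $\mathbb{R}^+=(0,\infty)$. $\mathcal{S}([0,\infty))$ is the space of (complex-valued) $C^\infty$ functions $g$ on $[0,\infty)$ with $\sup_{x\ge0}x^a|g^{(b)}(x)|<\infty$ for all nonnegative integers $a,b$. For $\lambda\in\mathbb{R}$: $\rho(\lambda)=\sqrt{\lambda^2+m^2}$ (nonnegative root), $\omega_1(\lambda)=i\rho(\lambda)$, $\omega_2(\lambda)=-i\rho(\lambda)$, $\hat g_j(\lambda)=\int_0^\infty e^{-i\lambda y}g_j(y)\,dy$ ($j=1,2$). For $x>0$, $t>0$, $x\ne t$ set $$\mathcal{G}_{1,1}=\int_{-\infty}^{\infty}e^{i\lambda x-\omega_1(\lambda)t}\{\lambda\hat g_2(\lambda)+[i\omega_2(\lambda)+m]\hat g_1(\lambda)\}\tfrac{d\lambda}{2\rho(\lambda)},\quad \mathcal{G}_{1,2}=\int_{-\infty}^{\infty}e^{i\lambda x-\omega_1(\lambda)t}\{\lambda\hat g_2(-\lambda)-[i\omega_2(\lambda)+m]\hat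 g_1(-\lambda)\}\tfrac{d\lambda}{2\rho(\lambda)},$$ $$\mathcal{G}_{1,3}=\int_{-\infty}^{\infty}e^{i\lambda x-\omega_2(\lambda)t}\{\lambda\hat g_2(\lambda)+[i\omega_1(\lambda)+m]\hat g_1(\lambda)\}\tfrac{d\lambda}{2\rho(\lambda)},\quad \mathcal{G}_{1,4}=\int_{-\infty}^{\infty}e^{i\lambda x-\omega_2(\lambda)t}\{\lambda\hat g_2(-\lambda)-[i\omega_1(\lambda)+m]\hat g_1(-\lambda)\}\tfrac{d\lambda}{2\rho(\lambda)},$$ $$\mathcal{G}_{2,1}=\int_{-\infty}^{\infty}e^{i\lambda x-\omega_1(\lambda)t}\{\lambda\hat g_1(\lambda)-[i\omega_1(\lambda)+m]\hat g_2(\lambda)\}\tfrac{d\lambda}{2\rho(\lambda)},\quad \mathcal{G}_{2,2}=\int_{-\infty}^{\infty}e^{i\lambda x-\omega_1(\lambda)t}\{\lambda\hat g_1(-\lambda)+[i\omega_1(\lambda)+m]\hat g_2(-\lambda)\}\tfrac{d\lambda}{2\rho(\lambda)},$$ $$\mathcal{G}_{2,3}=\int_{-\infty}^{\infty}e^{i\lambda x-\omega_2(\lambda)t}\{\lambda\hat g_1(\lambda)-[i\omega_2(\lambda)+m]\hat g_2(\lambda)\}\tfrac{d\lambda}{2\rho(\lambda)},\quad \mathcal{G}_{2,4}=\int_{-\infty}^{\infty}e^{i\lambda x-\omega_2(\lambda)t}\{\lambda\hat g_1(-\lambda)+[i\omega_2(\lambda)+m]\hat g_2(-\lambda)\}\tfrac{d\lambda}{2\rho(\lambda)},$$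 and, for $s=1,2$, $$\mathcal{H}_{1,s}=\int_{-\infty}^{\infty}e^{i\lambda x-\omega_s(\lambda)t}\Big[\int_0^t h_1(\tau)e^{\omega_s(\lambda)\tau}d\tau\Big]\tfrac{\lambda\,d\lambda}{\rho(\lambda)},\quad \mathcal{H}_{2,s}=\int_{-\infty}^{\infty}e^{i\lambda x-\omega_s(\lambda)t}\Big[\int_0^t h_1(\tau)e^{\omega_s(\lambda)\tau}d\tau\Big]\tfrac{[i\omega_s(\lambda)+m]\,d\lambda}{\rho(\lambda)}.$$ The $\mathcal{G}$- and $\mathcal{H}$-integrals are understood in the generalized sense $\lim_{A\to\infty}\int_0^A+\lim_{A\to\infty}\int_{-A}^0$. For $f\in\{f_1,f_2\}$, $\omega\in\{\omega_1,\omega_2\}$: $\hat f(\lambda,t)=\int_0^\infty e^{-i\lambda y}f(y,t)\,dy$ and $\tilde{\hat f}(\lambda,\omega,t)=\int_0^te^{\omega(\lambda)\tau}\hat f(\lambda,\tau)\,d\tau$; in $\tilde{\hat f}(-\lambda,\omega,t)$ one replaces $\hat f(\lambda,\tau)$ by $\hat f(-\lambda,\tau)$ (note $\omega(-\lambda)=\omega(\lambda)$). Set $$\mathcal{F}_{1,1}=\int_{-\infty}^\infty e^{i\lambda x-\omega_1(\lambda)t}\{\lambda\tilde{\hat f}_2(\lambda,\omega_1,t)+[i\omega_2(\lambda)+m]\tilde{\hat f}_1(\lambda,\omega_1,t)\}\tfrac{d\lambda}{2\rho(\lambda)}+\int_{-\infty}^\infty e^{i\lambda x-\omega_1(\lambda)t}\{\lambda\tilde{\hat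 f}_2(-\lambda,\omega_1,t)-[i\omega_2(\lambda)+m]\tilde{\hat f}_1(-\lambda,\omega_1,t)\}\tfrac{d\lambda}{2\rho(\lambda)},$$ $$\mathcal{F}_{1,2}=-\int_{-\infty}^\infty e^{i\lambda x-\omega_2(\lambda)t}\{\lambda\tilde{\hat f}_2(\lambda,\omega_2,t)+[i\omega_1(\lambda)+m]\tilde{\hat f}_1(\lambda,\omega_2,t)\}\tfrac{d\lambda}{2\rho(\lambda)}-\int_{-\infty}^\infty e^{i\lambda x-\omega_2(\lambda)t}\{\lambda\tilde{\hat f}_2(-\lambda,\omega_2,t)-[i\omega_1(\lambda)+m]\tilde{\hat f}_1(-\lambda,\omega_2,t)\}\tfrac{d\lambda}{2\rho(\lambda)},$$ $$\mathcal{F}_{2,1}=\int_{-\infty}^\infty e^{i\lambda x-\omega_1(\lambda)t}\{\lambda\tilde{\hat f}_1(\lambda,\omega_1,t)-[i\omega_1(\lambda)+m]\tilde{\hat f}_2(\lambda,\omega_1,t)\}\tfrac{d\lambda}{2\rho(\lambda)}-\int_{-\infty}^\infty e^{i\lambda x-\omega_1(\lambda)t}\{\lambda\tilde{\hat f}_1(-\lambda,\omega_1,t)+[i\omega_1(\lambda)+m]\tilde{\hat f}_2(-\lambda,\omega_1,t)\}\tfrac{d\lambda}{2\rho(\lambda)},$$ $$\mathcal{F}_{2,2}=-\int_{-\infty}^\infty e^{i\lambda x-\omega_2(\lambda)t}\{\lambda\tilde{\hat f}_1(\lambda,\omega_2,t)-[i\omega_2(\lambda)+m]\tilde{\hat f}_2(\lambda,\omega_2,t)\}\tfrac{d\lambda}{2\rho(\lambda)}+\int_{-\infty}^\infty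 e^{i\lambda x-\omega_2(\lambda)t}\{\lambda\tilde{\hat f}_1(-\lambda,\omega_2,t)+[i\omega_2(\lambda)+m]\tilde{\hat f}_2(-\lambda,\omega_2,t)\}\tfrac{d\lambda}{2\rho(\lambda)}.$$ For $x>0$, $t>0$, $x\ne t$, the functions $\Psi_1,\Psi_2$ are defined by $$2\pi\Psi_1=\mathcal{G}_{1,1}+\mathcal{G}_{1,2}-\mathcal{G}_{1,3}-\mathcal{G}_{1,4}+\mathcal{H}_{1,1}-\mathcal{H}_{1,2}+\mathcal{F}_{1,1}+\mathcal{F}_{1,2},$$ $$2\pi\Psi_2=\mathcal{G}_{2,1}-\mathcal{G}_{2,2}-\mathcal{G}_{2,3}+\mathcal{G}_{2,4}-\mathcal{H}_{2,1}+\mathcal{H}_{2,2}+\mathcal{F}_{2,1}+\mathcal{F}_{2,2}.$$ *)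

theory Defs
  imports "HOL-Analysis.Analysis"
begin

text \<open>
  Derivatives are taken relative to the domain: one-sided at the endpoint of \<open>[0,\<infinity>)\<close> and
  at the boundary of the closed quadrant, ordinary at interior points. The values of a function
  outside its domain are therefore irrelevant.
\<close>

definition iter_deriv :: "real set \<Rightarrow> nat \<Rightarrow> (real \<Rightarrow> complex) \<Rightarrow> real \<Rightarrow> complex" where
  "iter_deriv S n = (\<lambda>g x. vector_derivative g (at x within S)) ^^ n"

definition smooth1 :: "real set \<Rightarrow> (real \<Rightarrow> complex) \<Rightarrow> bool" where
  "smooth1 S g \<longleftrightarrow> (\<forall>n. \<forall>x\<in>S. iter_deriv S n g differentiable (at x within S))"

definition schwartz_half_line :: "(real \<Rightarrow> complex) \<Rightarrow> bool" where
  "schwartz_half_line g \<longleftrightarrow> smooth1 {0..} g \<and>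
     (\<forall>a b. bdd_above ((\<lambda>x. x ^ a * norm (iter_deriv {0..} b g x)) ` {0..}))"

definition partial_x :: "(real \<times> real) set \<Rightarrow> (real \<times> real \<Rightarrow> complex) \<Rightarrow> real \<times> real \<Rightarrow> complex" where
  "partial_x S F = (\<lambda>(x, t). vector_derivative (\<lambda>y. F (y, t)) (at x within {y. (y, t) \<in> S}))"

definition partial_t :: "(real \<times> real) set \<Rightarrow> (real \<times> real \<Rightarrow> complex) \<Rightarrow> real \<times> real \<Rightarrow> complex" where
  "partial_t S F = (\<lambda>(x, t). vector_derivative (\<lambda>u. F (x, u)) (at t within {u. (x, u) \<in> S}))"

definition pderivs ::
  "(real \<times> real) set \<Rightarrow> nat \<Rightarrow> nat \<Rightarrow> (real \<times> real \<Rightarrow> complex) \<Rightarrow> real \<times> real \<Rightarrow> complex" where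
  "pderivs S n l F = (partial_x S ^^ n) ((partial_t S ^^ l) F)"

text \<open>The partial derivatives of all orders, taken in an arbitrary sequence.\<close>

inductive_set iterated_partials ::
  "(real \<times> real) set \<Rightarrow> (real \<times> real \<Rightarrow> complex) \<Rightarrow> (real \<times> real \<Rightarrow> complex) set"
  for S F where
  base: "F \<in> iterated_partials S F"
| step_x: "G \<in> iterated_partials S F \<Longrightarrow> partial_x S G \<in> iterated_partials S F"
| step_t: "G \<in> iterated_partials S F \<Longrightarrow> partial_t S G \<in> iterated_partials S F"

definition smooth2 :: "(real \<times> real) set \<Rightarrow> (real \<times> real \<Rightarrow> complex) \<Rightarrow> bool" where
  "smooth2 S F \<longleftrightarrow> (\<forall>G\<in>iterated_partials S F. continuous_on S G \<and>
     (\<forall>x t. (x, t) \<in> S \<longrightarrow>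
        (\<lambda>y. G (y, t)) differentiable (at x within {y. (y, t) \<in> S}) \<and>
        (\<lambda>u. G (x, u)) differentiable (at t within {u. (x, u) \<in> S})))"

definition closed_quadrant :: "(real \<times> real) set" where
  "closed_quadrant = {(x, t). 0 \<le> x \<and> 0 \<le> t}"

definition offdiag_quadrant :: "(real \<times> real) set" where
  "offdiag_quadrant = {(x, t). 0 < x \<and> 0 < t \<and> x \<noteq> t}"

definition rapidly_decreasing_force :: "(real \<times> real \<Rightarrow> complex) \<Rightarrow> bool" where
  "rapidly_decreasing_force f \<longleftrightarrow> smooth2 closed_quadrant f \<and>
     (\<forall>T>0. \<forall>n l E. bdd_above
        ((\<lambda>(x, t). x ^ E * norm (pderivs closed_quadrant n l f (x, t))) ` ({0<..} \<times> {0..T})))"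

definition gen_integral :: "(real \<Rightarrow> complex) \<Rightarrow> complex" where
  "gen_integral \<phi> = Lim at_top (\<lambda>A. integral {0..A} \<phi>) + Lim at_top (\<lambda>A. integral {-A..0} \<phi>)"

text \<open>The spectral variable is written \<open>k\<close>.\<close>

definition rho :: "real \<Rightarrow> real \<Rightarrow> real" where
  "rho m k = sqrt (k\<^sup>2 + m\<^sup>2)"

definition omega1 :: "real \<Rightarrow> real \<Rightarrow> complex" where
  "omega1 m k = \<i> * rho m k"

definition omega2 :: "real \<Rightarrow> real \<Rightarrow> complex" where
  "omega2 m k = - \<i> * rho m k"

definition hat :: "(real \<Rightarrow> complex) \<Rightarrow> real \<Rightarrow> complex" where
  "hat g k = integral {0..} (\<lambda>y. exp (- \<i> * k * y) * g y)"

text \<open>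
  Since \<open>\<omega>\<close> is even in \<open>k\<close>, evaluating \<open>tilde_hat f \<omega> t\<close> at \<open>- k\<close> only replaces the
  transform of \<open>f\<close> at \<open>k\<close> by the one at \<open>- k\<close>.
\<close>

definition tilde_hat ::
  "(real \<times> real \<Rightarrow> complex) \<Rightarrow> (real \<Rightarrow> complex) \<Rightarrow> real \<Rightarrow> real \<Rightarrow> complex" where
  "tilde_hat f \<omega> t k = integral {0..t} (\<lambda>\<tau>. exp (\<omega> k * \<tau>) * hat (\<lambda>y. f (y, \<tau>)) k)"

definition wave :: "(real \<Rightarrow> complex) \<Rightarrow> real \<Rightarrow> real \<Rightarrow> real \<Rightarrow> complex" where
  "wave \<omega> x t k = exp (\<i> * k * x - \<omega> k * t)"

definition G11 where
  "G11 m g1 g2 x t = gen_integral (\<lambda>k. wave (omega1 m) x t k *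
     (k * hat g2 k + (\<i> * omega2 m k + m) * hat g1 k) / (2 * rho m k))"

definition G12 where
  "G12 m g1 g2 x t = gen_integral (\<lambda>k. wave (omega1 m) x t k *
     (k * hat g2 (- k) - (\<i> * omega2 m k + m) * hat g1 (- k)) / (2 * rho m k))"

definition G13 where
  "G13 m g1 g2 x t = gen_integral (\<lambda>k. wave (omega2 m) x t k *
     (k * hat g2 k + (\<i> * omega1 m k + m) * hat g1 k) / (2 * rho m k))"

definition G14 where
  "G14 m g1 g2 x t = gen_integral (\<lambda>k. wave (omega2 m) x t k *
     (k * hat g2 (- k) - (\<i> * omega1 m k + m) * hat g1 (- k)) / (2 * rho m k))"

definition G21 where
  "G21 m g1 g2 x t = gen_integral (\<lambda>k. wave (omega1 m) x t k *
     (k * hat g1 k - (\<i> * omega1 m k + m) * hat g2 k) / (2 * rho m k))"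

definition G22 where
  "G22 m g1 g2 x t = gen_integral (\<lambda>k. wave (omega1 m) x t k *
     (k * hat g1 (- k) + (\<i> * omega1 m k + m) * hat g2 (- k)) / (2 * rho m k))"

definition G23 where
  "G23 m g1 g2 x t = gen_integral (\<lambda>k. wave (omega2 m) x t k *
     (k * hat g1 k - (\<i> * omega2 m k + m) * hat g2 k) / (2 * rho m k))"

definition G24 where
  "G24 m g1 g2 x t = gen_integral (\<lambda>k. wave (omega2 m) x t k *
     (k * hat g1 (- k) + (\<i> * omega2 m k + m) * hat g2 (- k)) / (2 * rho m k))"

definition H1 :: "real \<Rightarrow> (real \<Rightarrow> complex) \<Rightarrow> (real \<Rightarrow> complex) \<Rightarrow> real \<Rightarrow> real \<Rightarrow> complex" where
  "H1 m \<omega> h1 x t = gen_integral (\<lambda>k. wave \<omega> x t k *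
     integral {0..t} (\<lambda>\<tau>. h1 \<tau> * exp (\<omega> k * \<tau>)) * k / rho m k)"

definition H2 :: "real \<Rightarrow> (real \<Rightarrow> complex) \<Rightarrow> (real \<Rightarrow> complex) \<Rightarrow> real \<Rightarrow> real \<Rightarrow> complex" where
  "H2 m \<omega> h1 x t = gen_integral (\<lambda>k. wave \<omega> x t k *
     integral {0..t} (\<lambda>\<tau>. h1 \<tau> * exp (\<omega> k * \<tau>)) * (\<i> * \<omega> k + m) / rho m k)"

definition F11 where
  "F11 m f1 f2 x t =
     integral UNIV (\<lambda>k. wave (omega1 m) x t k *
       (k * tilde_hat f2 (omega1 m) t k
         + (\<i> * omega2 m k + m) * tilde_hat f1 (omega1 m) t k) / (2 * rho m k))
   + integral UNIV (\<lambda>k. wave (omega1 m) x t k *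
       (k * tilde_hat f2 (omega1 m) t (- k)
         - (\<i> * omega2 m k + m) * tilde_hat f1 (omega1 m) t (- k)) / (2 * rho m k))"

definition F12 where
  "F12 m f1 f2 x t =
   - integral UNIV (\<lambda>k. wave (omega2 m) x t k *
       (k * tilde_hat f2 (omega2 m) t k
         + (\<i> * omega1 m k + m) * tilde_hat f1 (omega2 m) t k) / (2 * rho m k))
   - integral UNIV (\<lambda>k. wave (omega2 m) x t k *
       (k * tilde_hat f2 (omega2 m) t (- k)
         - (\<i> * omega1 m k + m) * tilde_hat f1 (omega2 m) t (- k)) / (2 * rho m k))"

definition F21 where
  "F21 m f1 f2 x t =
     integral UNIV (\<lambda>k. wave (omega1 m) x t k *
       (k * tilde_hat f1 (omega1 m) t k
         - (\<i> * omega1 m k + m) * tilde_hat f2 (omega1 m) t k) / (2 * rho m k))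
   - integral UNIV (\<lambda>k. wave (omega1 m) x t k *
       (k * tilde_hat f1 (omega1 m) t (- k)
         + (\<i> * omega1 m k + m) * tilde_hat f2 (omega1 m) t (- k)) / (2 * rho m k))"

definition F22 where
  "F22 m f1 f2 x t =
   - integral UNIV (\<lambda>k. wave (omega2 m) x t k *
       (k * tilde_hat f1 (omega2 m) t k
         - (\<i> * omega2 m k + m) * tilde_hat f2 (omega2 m) t k) / (2 * rho m k))
   + integral UNIV (\<lambda>k. wave (omega2 m) x t k *
       (k * tilde_hat f1 (omega2 m) t (- k)
         + (\<i> * omega2 m k + m) * tilde_hat f2 (omega2 m) t (- k)) / (2 * rho m k))"

definition Psi1 where
  "Psi1 m g1 g2 h1 f1 f2 = (\<lambda>(x, t).
     (G11 m g1 g2 x t + G12 m g1 g2 x t - G13 m g1 g2 x t - G14 m g1 g2 x t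
      + H1 m (omega1 m) h1 x t - H1 m (omega2 m) h1 x t
      + F11 m f1 f2 x t + F12 m f1 f2 x t) / (2 * pi))"

definition Psi2 where
  "Psi2 m g1 g2 h1 f1 f2 = (\<lambda>(x, t).
     (G21 m g1 g2 x t - G22 m g1 g2 x t - G23 m g1 g2 x t + G24 m g1 g2 x t
      - H2 m (omega1 m) h1 x t + H2 m (omega2 m) h1 x t
      + F21 m f1 f2 x t + F22 m f1 f2 x t) / (2 * pi))"

text \<open>Partial derivatives of \<open>\<Psi>\<close> are taken on the set where \<open>\<Psi>\<close> is defined.\<close>

abbreviation dPsi :: "nat \<Rightarrow> nat \<Rightarrow> (real \<times> real \<Rightarrow> complex) \<Rightarrow> real \<times> real \<Rightarrow> complex" where
  "dPsi \<equiv> pderivs offdiag_quadrant"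

definition extends_smoothly_near :: "(real \<times> real) set \<Rightarrow> (real \<times> real \<Rightarrow> complex) \<Rightarrow> bool" where
  "extends_smoothly_near L \<Psi> \<longleftrightarrow> (\<exists>U \<Phi>. open U \<and> L \<subseteq> U \<and> smooth2 U \<Phi> \<and>
     (\<forall>p \<in> U \<inter> offdiag_quadrant. \<Phi> p = \<Psi> p))"

end

theory Submission
  imports Defs "HOL-Probability.Sinc_Integral" "HOL-Real_Asymp.Real_Asymp"
begin

text \<open>
  The expression \<open>2 \<pi> \<Psi>\<close> is a Fourier integral over the whole line. Added up, its integrands are
  \<open>exp (i k x)\<close> times the Duhamel formula, in the spectral variable, for the Dirac system
  \<open>\<partial>\<^sub>t v\<^sub>1 = - \<partial>\<^sub>x v\<^sub>2 - i m v\<^sub>1 + f\<^sub>1\<close>, \<open>\<partial>\<^sub>t v\<^sub>2 = - \<partial>\<^sub>x v\<^sub>1 + i m v\<^sub>2 + f\<^sub>2\<close>, driven by the odd part of the transforms of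
  \<open>g\<^sub>1, f\<^sub>1\<close>, the even part of those of \<open>g\<^sub>2, f\<^sub>2\<close>, and \<open>2 h\<^sub>1\<close>. The parity is that of the half-line
  transforms under \<open>k \<mapsto> - k\<close>, and \<open>2 h\<^sub>1\<close> replaces the boundary term \<open>2 v\<^sub>1(0, t)\<close> that an integration
  by parts over \<open>[0,\<infinity>)\<close> produces.

  The data are only given for \<open>x \<ge> 0\<close> and \<open>t \<ge> 0\<close>, so Seeley's reflection operator first extends them
  smoothly (\<open>seeley_ext_has_derivative\<close>, \<open>time_ext_has_derivative\<close>). The whole-line Cauchy problem with
  the extended data has a solution \<open>v\<close> that is smooth for \<open>t > - 1\<close> and decays in \<open>x\<close> for \<open>t \<ge> 0\<close> (locale
  \<open>dirac_cauchy\<close>). Its half-line transforms satisfy the same ordinary differential equations with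
  \<open>v\<^sub>1(0, t)\<close> in place of \<open>h\<^sub>1\<close>. Hence the integrand of \<open>\<Psi>\<close> minus the transform of \<open>v\<close> is the Duhamel
  integral of the defect \<open>h\<^sub>1 - v\<^sub>1(0, \<cdot>)\<close> alone (\<open>source_eq\<close>).

  That Duhamel integral can be read off in physical space: the propagator is the cosine or sine
  transform of a point mass on the characteristic \<open>x = t\<close> plus a Bessel kernel supported in \<open>x < t\<close>
  (\<open>propagator_as_bessel_integrals\<close>). So it is the transform of an explicit function \<open>w\<close> supported in
  \<open>0 \<le> x \<le> t\<close> (\<open>boundary_wave_transforms\<close>). Fourier inversion gives \<open>\<Psi> = v\<close> for \<open>x > t\<close> and
  \<open>\<Psi> = v + w\<close> for \<open>x < t\<close> (\<open>source_inversion\<close>, \<open>representation\<close>).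

  Both right-hand sides are smooth across the axis they touch: \<open>v\<close> on \<open>- 1 < t < x\<close>, a neighbourhood of
  the positive \<open>x\<close>-axis, where \<open>v(x, 0) = g(x)\<close>; and \<open>v + w\<close> on \<open>x < t\<close>, \<open>t > - 1\<close>, a neighbourhood of the
  positive \<open>t\<close>-axis, where \<open>v\<^sub>1(0, t) + w\<^sub>1(0, t) = h\<^sub>1(t)\<close>. Every claim about limits follows by
  restricting the derivatives of these extensions to the axes (\<open>limits_at_initial_axis\<close>,
  \<open>limits_at_boundary_axis\<close>).

  It remains to see that the separate generalized integrals converge, so that they may be added. Each
  integrand is a sum of waves \<open>c exp (i k s) / k\<close> with \<open>s \<in> {x, x + t, x - t}\<close>, up to \<open>O(1/k\<^sup>2)\<close>; the
  phases do not vanish because \<open>x > 0\<close>, \<open>t > 0\<close> and \<open>x \<noteq> t\<close> (\<open>initial_improper\<close>, \<open>boundary_pv\<close>). The integrands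
  of the forces are even \<open>O(1/k\<^sup>2)\<close>, because of the additional integration in time (\<open>force_pv\<close>).
\<close>

abbreviation cx :: "real => complex" where "cx \<equiv> complex_of_real"

abbreviation (input) hvd :: "(real => 'a::real_normed_vector) => 'a => real filter => bool" (infix "hvd" 50) where
  "f hvd d \<equiv> f has_vector_derivative d"

abbreviation (input) hrd :: "(real => real) => real => real filter => bool" (infix "hrd" 50) where
  "f hrd d \<equiv> f has_real_derivative d"

section \<open>Limits and derivatives under the integral sign\<close>

lemma continuous_on_dominated_integral:
  fixes f :: "'p::metric_space => 'a => complex"
  assumes meas: "\<And>p. p \<in> S ==> f p \<in> borel_measurable M"
    and w: "integrable M w"
    and bound: "\<And>p y. p \<in> S ==> y \<in> space M ==> norm (f p y) <= w y"
    and cont: "\<And>y. y \<in> space M ==> continuous_on S (%p. f p y)"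
  shows "continuous_on S (%p. integral\<^sup>L M (f p))"
  unfolding continuous_on_sequentially
proof (intro allI ballI impI)
  fix X p assume p: "p \<in> S" and X: "(\<forall>n. X n \<in> S) \<and> X \<longlonglongrightarrow> p"
  have "(%n. integral\<^sup>L M (f (X n))) \<longlonglongrightarrow> integral\<^sup>L M (f p)"
  proof (rule integral_dominated_convergence[where w = w])
    show "AE y in M. (%n. f (X n) y) \<longlonglongrightarrow> f p y"
      using cont p X unfolding continuous_on_sequentially by (auto simp: o_def)
  qed (use meas p X w bound in auto)
  then show "((%p. integral\<^sup>L M (f p)) \<circ> X) \<longlonglongrightarrow> integral\<^sup>L M (f p)"
    by (simp add: o_def)
qed

lemma vector_derivative_norm_bound:
  fixes f :: "real => complex"
  assumes "convex S" "\<And>s. s \<in> S ==> (f hvd f' s) (at s within S)"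
    and "\<And>s. s \<in> S ==> norm (f' s) <= B" and "x \<in> S" "y \<in> S"
  shows "norm (f x - f y) <= B * \<bar>x - y\<bar>"
proof -
  have "norm (f x - f y) <= B * norm (x - y)"
  proof (rule differentiable_bound[of S f "%s h. h *\<^sub>R f' s"])
    show "onorm (%h. h *\<^sub>R f' s) <= B" if "s \<in> S" for s
      by (rule onorm_le) (use mult_right_mono[OF assms(3)[OF that] abs_ge_zero] in \<open>simp add: mult.commute\<close>)
  qed (use assms in \<open>auto simp: has_vector_derivative_def\<close>)
  then show ?thesis by simp
qed

lemma has_vector_derivative_dominated_integral:
  fixes f :: "real => 'a => complex"
  assumes S: "convex S" "t \<in> S"
    and deriv: "\<And>s y. s \<in> S ==> y \<in> space M ==>
        ((%s. f s y) hvd f' s y) (at s within S)"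
    and bound: "\<And>s y. s \<in> S ==> y \<in> space M ==> norm (f' s y) <= w y"
    and w: "integrable M w"
    and int: "\<And>s. s \<in> S ==> integrable M (f s)"
    and meas: "f' t \<in> borel_measurable M"
  shows "((%s. integral\<^sup>L M (f s)) hvd integral\<^sup>L M (f' t)) (at t within S)"
  unfolding has_vector_derivative_def has_derivative_within tendsto_at_iff_sequentially
proof (intro conjI allI impI)
  show "bounded_linear (%h. h *\<^sub>R integral\<^sup>L M (f' t))" by (rule bounded_linear_scaleR_left)
  fix X assume X: "\<forall>n. X n \<in> S - {t}" "X \<longlonglongrightarrow> t"
  have int': "integrable M (f' t)"
    by (rule Bochner_Integration.integrable_bound[OF w meas]) (use bound S in \<open>force intro!: AE_I2\<close>)
  let ?h = "%n y. (1 / norm (X n - t)) *\<^sub>R (f (X n) y - (f t y + (X n - t) *\<^sub>R f' t y))"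
  have "(%n. integral\<^sup>L M (?h n)) \<longlonglongrightarrow> integral\<^sup>L M (%y. 0)"
  proof (rule integral_dominated_convergence[where w = "%y. 2 * w y"])
    show "AE y in M. (%n. ?h n y) \<longlonglongrightarrow> 0"
    proof (rule AE_I2)
      fix y assume "y \<in> space M"
      from deriv[OF S(2) this] show "(%n. ?h n y) \<longlonglongrightarrow> 0"
        unfolding has_vector_derivative_def has_derivative_within tendsto_at_iff_sequentially
        using X by (auto simp: o_def)
    qed
    show "AE y in M. norm (?h n y) <= 2 * w y" for n
    proof (rule AE_I2)
      fix y assume y: "y \<in> space M"
      have Xn: "X n \<in> S" "X n \<noteq> t" using X(1) by (auto dest: spec[of _ n])
      have "norm (f (X n) y - f t y) <= w y * \<bar>X n - t\<bar>"
        by (rule vector_derivative_norm_bound[OF S(1) deriv[OF _ y] bound[OF _ y]]) (use S Xn in auto)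
      moreover have "norm ((X n - t) *\<^sub>R f' t y) <= w y * \<bar>X n - t\<bar>"
        using bound[OF S(2) y] by (simp add: mult.commute mult_right_mono)
      ultimately have "norm (f (X n) y - (f t y + (X n - t) *\<^sub>R f' t y)) <= 2 * w y * \<bar>X n - t\<bar>"
        using norm_triangle_ineq4[of "f (X n) y - f t y" "(X n - t) *\<^sub>R f' t y"]
        by (simp add: algebra_simps)
      moreover have "\<bar>X n - t\<bar> > 0" using Xn(2) by simp
      ultimately show "norm (?h n y) <= 2 * w y"
        unfolding norm_scaleR by (simp add: pos_divide_le_eq)
    qed
    show "?h n \<in> borel_measurable M" for n
      using int[of "X n"] int[OF S(2)] meas X(1) by (auto intro!: borel_measurable_scaleR)
  qed (use w in auto)
  moreover have "integral\<^sup>L M (?h n) = (1 / norm (X n - t)) *\<^sub>R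
     (integral\<^sup>L M (f (X n)) - (integral\<^sup>L M (f t) + (X n - t) *\<^sub>R integral\<^sup>L M (f' t)))" for n
  proof -
    have "integrable M (f (X n))" using int X(1) by auto
    then show ?thesis using int[OF S(2)] int' by simp
  qed
  ultimately show "((%s. (1 / norm (s - t)) *\<^sub>R
     (integral\<^sup>L M (f s) - (integral\<^sup>L M (f t) + (s - t) *\<^sub>R integral\<^sup>L M (f' t)))) \<circ> X) \<longlonglongrightarrow> 0"
    unfolding o_def by (simp only: Bochner_Integration.integral_zero)
qed

section \<open>Fourier inversion\<close>

lemma has_vector_derivative_cexp:
  "((%k. exp (c * cx k)) hvd c * exp (c * k)) (at k within S)"
  by (rule has_vector_derivative_real_field) (auto intro!: derivative_eq_intros)

lemma integral_exp_symmetric: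
  fixes u :: real
  assumes "A > 0"
  shows "((%k. exp (\<i> * cx k * u)) has_integral
      cx (if u = 0 then 2 * A else 2 * sin (A * u) / u)) {-A..A}"
proof (cases "u = 0")
  case True
  then show ?thesis using has_integral_const_real[of "1::complex" "-A" A] assms
    by (simp add: scaleR_conv_of_real)
next
  case False
  have "((%k. exp (\<i> * cx k * u)) has_integral
      exp (\<i> * cx A * u) / (\<i> * u) - exp (\<i> * cx (-A) * u) / (\<i> * u)) {-A..A}"
  proof (rule fundamental_theorem_of_calculus)
    show "((%k. exp (\<i> * cx k * u) / (\<i> * u)) hvd
        exp (\<i> * cx k * u)) (at k within {-A..A})" for k
      using has_vector_derivative_divide[OF has_vector_derivative_cexp[of "\<i> * u"], of "\<i> * u" k "{-A..A}"] False
      by (simp add: mult_ac)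
  qed (use assms in auto)
  moreover have "exp (\<i> * cx A * u) / (\<i> * u) - exp (\<i> * cx (-A) * u) / (\<i> * u)
      = cx (2 * sin (A * u) / u)"
  proof -
    have "cx (sin (A * u)) = (exp (\<i> * cx A * u) - exp (\<i> * cx (-A) * u)) / (2 * \<i>)"
      unfolding sin_of_real[symmetric] sin_exp_eq by (simp add: mult.assoc)
    then show ?thesis using False by (simp add: divide_simps) (simp add: algebra_simps)
  qed
  ultimately show ?thesis using False by simp
qed

lemma integral_mult_by_parts:
  fixes f g :: "real => complex"
  assumes ab: "a <= b"
    and f: "\<And>y. y \<in> {a..b} ==> (f hvd f' y) (at y within {a..b})"
    and g: "\<And>y. y \<in> {a..b} ==> (g hvd g' y) (at y within {a..b})"
    and c: "continuous_on {a..b} f'" "continuous_on {a..b} g'"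
  shows "integral {a..b} (%y. f y * g' y) = f b * g b - f a * g a - integral {a..b} (%y. f' y * g y)"
proof -
  have fc: "continuous_on {a..b} f" "continuous_on {a..b} g"
    using has_vector_derivative_continuous[OF f] has_vector_derivative_continuous[OF g]
    by (auto simp: continuous_on_eq_continuous_within)
  have "((%y. f y * g' y + f' y * g y) has_integral f b * g b - f a * g a) {a..b}"
    by (rule fundamental_theorem_of_calculus[OF ab]) (rule has_vector_derivative_mult[OF f g])
  then have "integral {a..b} (%y. f y * g' y + f' y * g y) = f b * g b - f a * g a"
    by (rule integral_unique)
  moreover have "integral {a..b} (%y. f y * g' y + f' y * g y) =
      integral {a..b} (%y. f y * g' y) + integral {a..b} (%y. f' y * g y)"
    by (intro integral_add integrable_continuous_real continuous_intros fc c)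
  ultimately show ?thesis by (simp add: algebra_simps)
qed

lemma riemann_lebesgue_C1:
  fixes g g' :: "real => complex"
  assumes ab: "a <= b" and g: "\<And>y. y \<in> {a..b} ==> (g hvd g' y) (at y within {a..b})"
    and g': "continuous_on {a..b} g'"
  shows "\<exists>K. \<forall>A>0. norm (integral {a..b} (%y. g y * cx (sin (A * (x - y))))) <= K / A"
proof (intro exI allI impI)
  fix A :: real assume A: "A > 0"
  let ?c = "%y. cx (cos (A * (x - y)) / A)"
  have 1: "integral {a..b} (%y. g y * cx (sin (A * (x - y)))) =
      g b * ?c b - g a * ?c a - integral {a..b} (%y. g' y * ?c y)"
  proof (rule integral_mult_by_parts[OF ab g _ g'])
    have "((%y. cos (A * (x - y)) / A) hrd sin (A * (x - y))) (at y within {a..b})" for y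
      using A by (auto intro!: derivative_eq_intros)
    then show "(?c hvd cx (sin (A * (x - y)))) (at y within {a..b})" for y
      by (intro has_vector_derivative_of_real) (simp add: has_real_derivative_iff_has_vector_derivative)
  qed (use A in \<open>auto intro!: continuous_intros\<close>)
  have c: "norm (?c y) <= 1 / A" for y
    using A by (simp add: norm_divide divide_right_mono)
  have "norm (integral {a..b} (%y. g' y * ?c y)) <= integral {a..b} (%y. norm (g' y) * (1 / A))"
  proof (rule integral_norm_bound_integral)
    show "norm (g' y * ?c y) <= norm (g' y) * (1 / A)" for y
      unfolding norm_mult by (rule mult_left_mono[OF c]) simp
  qed (use A in \<open>auto intro!: integrable_continuous_real continuous_intros g'\<close>)
  also have "\<dots> = integral {a..b} (%y. norm (g' y)) / A" by simp
  finally have 2: "norm (integral {a..b} (%y. g' y * ?c y)) <= integral {a..b} (%y. norm (g' y)) / A" .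
  have 3: "norm (g y * ?c y) <= norm (g y) / A" for y
    using mult_left_mono[OF c[of y], of "norm (g y)"] by (simp only: norm_mult) simp
  have "norm (g b * ?c b - g a * ?c a - integral {a..b} (%y. g' y * ?c y))
    <= norm (g b) / A + norm (g a) / A + integral {a..b} (%y. norm (g' y)) / A"
    by (intro order_trans[OF norm_triangle_ineq4] add_mono 2 3)
  then show "norm (integral {a..b} (%y. g y * cx (sin (A * (x - y)))))
    <= (norm (g b) + norm (g a) + integral {a..b} (%y. norm (g' y))) / A"
    unfolding 1 by (simp add: add_divide_distrib)
qed

text \<open>Uniform approximation by polynomials reduces this to the continuously differentiable case, where one
integration by parts gains a factor \<open>1/A\<close>.\<close>

lemma riemann_lebesgue:
  fixes q :: "real => complex"
  assumes ab: "a <= b" and q: "continuous_on {a..b} q"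
  shows "((%A. integral {a..b} (%y. q y * cx (sin (A * (x - y))))) \<longlongrightarrow> 0) at_top"
proof (rule tendstoI)
  fix e :: real assume e: "e > 0"
  define d where "d = e / (2 * (b - a + 1))"
  have d: "d > 0" using e ab by (simp add: d_def)
  obtain g where g: "polynomial_function g" "\<And>y. y \<in> {a..b} ==> norm (q y - g y) < d"
    using Stone_Weierstrass_polynomial_function[OF _ q d] by auto
  obtain g' where g': "polynomial_function g'" "\<And>y. (g hvd g' y) (at y)"
    using has_vector_derivative_polynomial_function[OF g(1)] by metis
  obtain K where K: "\<And>A. A > 0 ==>
      norm (integral {a..b} (%y. g y * cx (sin (A * (x - y))))) <= K / A"
    using riemann_lebesgue_C1[OF ab, of g g' x] g'(2) continuous_on_polymonial_function[OF g'(1)]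
    by (meson has_vector_derivative_at_within)
  have "eventually (%A. A > max 0 (2 * K / e)) at_top" by (rule eventually_gt_at_top)
  then show "\<forall>\<^sub>F A in at_top. dist (integral {a..b} (%y. q y * cx (sin (A * (x - y))))) 0 < e"
  proof eventually_elim
    case (elim A)
    have gc: "continuous_on {a..b} g" by (rule continuous_on_polymonial_function[OF g(1)])
    let ?s = "%y. cx (sin (A * (x - y)))"
    have "integral {a..b} (%y. q y * ?s y) =
       integral {a..b} (%y. (q y - g y) * ?s y) + integral {a..b} (%y. g y * ?s y)"
      by (subst integral_add[symmetric])
         (auto intro!: integrable_continuous_real continuous_intros q gc simp: algebra_simps)
    moreover have "norm (integral {a..b} (%y. (q y - g y) * ?s y)) <= d * (b - a)"
    proof (rule integral_bound[OF ab])
      show "continuous_on {a..b} (%y. (q y - g y) * ?s y)"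
        by (intro continuous_intros q gc)
      show "\<And>y. y \<in> {a..b} ==> norm ((q y - g y) * ?s y) <= d"
        using g(2) mult_mono[of "norm (q _ - g _)" d "norm (?s _)" 1] d
        by (force simp: norm_mult)
    qed
    moreover have "d * (b - a) <= e / 2" using e ab by (simp add: d_def field_simps)
    moreover have "K / A < e / 2" using elim e by (simp add: field_simps)
    moreover have "norm (integral {a..b} (%y. g y * ?s y)) <= K / A" using K elim by simp
    moreover have "norm (integral {a..b} (%y. q y * ?s y)) \<le>
        norm (integral {a..b} (%y. (q y - g y) * ?s y)) + norm (integral {a..b} (%y. g y * ?s y))"
      by (simp only: calculation(1) norm_triangle_ineq)
    ultimately show ?case unfolding dist_norm diff_0_right by linarith
  qed
qed

definition ft_on :: "real set => (real => complex) => real => complex" where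
  "ft_on S \<phi> k = integral S (%y. exp (- \<i> * k * y) * \<phi> y)"

lemma fourier_partial_integral_swap:
  fixes \<phi> :: "real => complex"
  assumes ab: "a <= b" and \<phi>: "continuous_on {a..b} \<phi>" and A: "A > 0"
  shows "integral {-A..A} (%k. exp (\<i> * k * x) * ft_on {a..b} \<phi> k) =
     integral {a..b} (%y. \<phi> y * cx (if x = y then 2 * A else 2 * sin (A * (x - y)) / (x - y)))"
proof -
  have "integral {-A..A} (%k. exp (\<i> * k * x) * ft_on {a..b} \<phi> k) =
    integral (cbox (-A) A) (%k. integral (cbox a b) (%y. exp (\<i> * k * x) * (exp (- \<i> * k * y) * \<phi> y)))"
    by (simp add: ft_on_def)
  also have "\<dots> = integral (cbox a b) (%y. integral (cbox (-A) A) (%k. exp (\<i> * k * x) * (exp (- \<i> * k * y) * \<phi> y)))"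
  proof (rule integral_swap_continuous)
    have "continuous_on (cbox (- A, a) (A, b)) (%p. \<phi> (snd p))"
      by (rule continuous_on_compose2[OF \<phi>]) (auto intro!: continuous_intros)
    then show "continuous_on (cbox (- A, a) (A, b)) (%(k, y). exp (\<i> * cx k * cx x) *
        (exp (- \<i> * cx k * cx y) * \<phi> y))"
      by (auto intro!: continuous_intros simp: case_prod_unfold)
  qed
  also have "\<dots> = integral {a..b} (%y. \<phi> y * cx (if x = y then 2 * A else 2 * sin (A * (x - y)) / (x - y)))"
  proof -
    have "integral {-A..A} (%k. exp (\<i> * k * x) * (exp (- \<i> * k * y) * \<phi> y)) =
       \<phi> y * cx (if x = y then 2 * A else 2 * sin (A * (x - y)) / (x - y))" for y
    proof -
      have "(%k. exp (\<i> * cx k * x) * (exp (- \<i> * k * y) * \<phi> y)) =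
        (%k. \<phi> y * exp (\<i> * cx k * (x - y)))"
        by (auto simp: fun_eq_iff exp_add[symmetric] algebra_simps exp_diff exp_minus field_simps)
      then show ?thesis using integral_unique[OF integral_exp_symmetric[OF A, of "x - y"]]
        by simp
    qed
    then show ?thesis by simp
  qed
  finally show ?thesis .
qed

lemma integral_dirichlet_kernel:
  assumes A: "A > 0" and x: "a < x" "x < b"
  shows "((%y. cx (if x = y then 2 * A else 2 * sin (A * (x - y)) / (x - y))) has_integral
      cx (2 * Si (A * (x - a)) + 2 * Si (A * (b - x)))) {a..b}"
proof -
  let ?F = "%y. - 2 * Si (A * (x - y))"
  have "((%y. if x = y then 2 * A else 2 * sin (A * (x - y)) / (x - y)) has_integral ?F b - ?F a) {a..b}"
  proof (rule fundamental_theorem_of_calculus)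
    fix y
    have "((%y. Si (A * (x - y))) hrd sinc (A * (x - y)) * (- A)) (at y within {a..b})"
      by (rule DERIV_chain2[OF DERIV_Si]) (auto intro!: derivative_eq_intros)
    then have "(?F hrd 2 * A * sinc (A * (x - y))) (at y within {a..b})"
      by (auto intro!: derivative_eq_intros)
    moreover have "2 * A * sinc (A * (x - y)) = (if x = y then 2 * A else 2 * sin (A * (x - y)) / (x - y))"
      using A by auto
    ultimately show "(?F hvd
       (if x = y then 2 * A else 2 * sin (A * (x - y)) / (x - y))) (at y within {a..b})"
      by (simp add: has_real_derivative_iff_has_vector_derivative)
  qed (use x in auto)
  moreover have "Si (A * (x - b)) = - Si (A * (b - x))"
    using Si_neg[of "A * (b - x)"] A x by (simp add: algebra_simps)
  ultimately show ?thesis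
    by (intro has_integral_of_real) (simp add: add.commute)
qed

text \<open>Dini's test: after the order of integration is exchanged, the partial integral is a convolution with
\<open>sin (A y) / y\<close>. At a point of differentiability the difference quotient is continuous, so the
Riemann-Lebesgue lemma leaves only the total mass of the kernel, the Dirichlet integral.\<close>

lemma fourier_inversion_compact:
  fixes \<phi> :: "real => complex"
  assumes ab: "a <= b" and \<phi>: "continuous_on {a..b} \<phi>" and x: "x \<noteq> a" "x \<noteq> b"
    and d: "a < x ==> x < b ==> \<phi> differentiable (at x)"
  shows "((%A. integral {-A..A} (%k. exp (\<i> * k * x) * ft_on {a..b} \<phi> k)) \<longlongrightarrow>
     (if a < x \<and> x < b then 2 * pi * \<phi> x else 0)) at_top"
proof (cases "a < x \<and> x < b")
  case False
  then have x': "x \<notin> {a..b}" using x by auto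
  have q: "continuous_on {a..b} (%y. 2 * \<phi> y / cx (x - y))"
    using x' by (intro continuous_intros \<phi>) (auto simp flip: of_real_diff)
  have "\<forall>\<^sub>F A in at_top. integral {a..b} (%y. 2 * \<phi> y / cx (x - y) * cx (sin (A * (x - y))))
    = integral {-A..A} (%k. exp (\<i> * k * x) * ft_on {a..b} \<phi> k)"
    using eventually_gt_at_top[of 0]
  proof eventually_elim
    case (elim A)
    show ?case unfolding fourier_partial_integral_swap[OF ab \<phi> elim]
      using x' by (intro integral_cong) auto
  qed
  from Lim_transform_eventually[OF riemann_lebesgue[OF ab q, of x] this] show ?thesis using False by auto
next
  case True
  obtain D where D: "(\<phi> hvd D) (at x)"
    using d True vector_derivative_works by blast
  define q where "q = (%y. if y = x then - D else (\<phi> y - \<phi> x) / cx (x - y))"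
  have "((%y. (1 / norm (y - x)) *\<^sub>R (\<phi> y - (\<phi> x + (y - x) *\<^sub>R D))) \<longlongrightarrow> 0) (at x)"
    using D unfolding has_vector_derivative_def has_derivative_within by simp
  then have "((%y. norm ((1 / norm (y - x)) *\<^sub>R (\<phi> y - (\<phi> x + (y - x) *\<^sub>R D)))) \<longlongrightarrow> 0) (at x)"
    by (rule tendsto_norm_zero)
  moreover
  have "norm ((1 / norm (y - x)) *\<^sub>R (\<phi> y - (\<phi> x + (y - x) *\<^sub>R D))) = norm (q y - q x)" if "y \<noteq> x" for y
  proof -
    have "(1 / norm (y - x)) *\<^sub>R norm (\<phi> y - (\<phi> x + (y - x) *\<^sub>R D)) = norm ((\<phi> y - (\<phi> x + (y - x) *\<^sub>R D)) / cx (x - y))"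
      unfolding norm_divide norm_of_real by (simp add: abs_minus_commute)
    also have "(\<phi> y - (\<phi> x + (y - x) *\<^sub>R D)) / cx (x - y) = q y - q x"
      using that by (simp add: q_def scaleR_conv_of_real divide_simps) (simp add: algebra_simps)
    finally show ?thesis by simp
  qed
  then have "\<forall>\<^sub>F y in at x. norm ((1 / norm (y - x)) *\<^sub>R (\<phi> y - (\<phi> x + (y - x) *\<^sub>R D))) = norm (q y - q x)"
    by (auto simp: eventually_at_filter)
  ultimately have "((%y. norm (q y - q x)) \<longlongrightarrow> 0) (at x)"
    by (rule Lim_transform_eventually)
  then have qx: "(q \<longlongrightarrow> q x) (at x)"
    using LIM_zero_cancel tendsto_norm_zero_iff by blast
  have q: "continuous_on {a..b} (%y. 2 * q y)"
  proof (intro continuous_intros, unfold continuous_on_eq_continuous_within, intro ballI)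
    fix y assume y: "y \<in> {a..b}"
    show "continuous (at y within {a..b}) q"
    proof (cases "y = x")
      case True
      then show ?thesis using qx by (auto simp: continuous_within intro: tendsto_within_subset)
    next
      case False
      have "continuous (at y within {a..b}) (%y. (\<phi> y - \<phi> x) / cx (x - y))"
        using \<phi> y False by (auto intro!: continuous_intros simp: continuous_on_eq_continuous_within simp flip: of_real_diff)
      moreover have "\<forall>\<^sub>F z in at y within {a..b}. (\<phi> z - \<phi> x) / cx (x - z) = q z"
        using eventually_neq_at_within[of x y] by eventually_elim (simp add: q_def)
      ultimately show ?thesis using False
        unfolding continuous_within by (auto simp: q_def elim!: Lim_transform_eventually)
    qed
  qed
  have "((%A. Si (A * (x - a))) \<longlongrightarrow> pi / 2) at_top" "((%A. Si (A * (b - x))) \<longlongrightarrow> pi / 2) at_top"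
    using True by (auto intro!: filterlim_compose[OF Si_at_top] filterlim_at_top_mult_tendsto_pos[OF tendsto_const _ filterlim_ident])
  then have "((%A. integral {a..b} (%y. 2 * q y * cx (sin (A * (x - y)))) +
      \<phi> x * cx (2 * Si (A * (x - a)) + 2 * Si (A * (b - x)))) \<longlongrightarrow>
      0 + \<phi> x * cx (2 * (pi/2) + 2 * (pi/2))) at_top"
    by (intro tendsto_intros riemann_lebesgue ab q)
  moreover have "\<forall>\<^sub>F A in at_top. integral {a..b} (%y. 2 * q y * cx (sin (A * (x - y)))) +
      \<phi> x * cx (2 * Si (A * (x - a)) + 2 * Si (A * (b - x)))
    = integral {-A..A} (%k. exp (\<i> * k * x) * ft_on {a..b} \<phi> k)"
    using eventually_gt_at_top[of 0]
  proof eventually_elim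
    case (elim A)
    let ?D = "%y. cx (if x = y then 2 * A else 2 * sin (A * (x - y)) / (x - y))"
    have D: "(?D has_integral cx (2 * Si (A * (x - a)) + 2 * Si (A * (b - x)))) {a..b}"
      using integral_dirichlet_kernel[OF elim] True by blast
    have 1: "((%y. 2 * q y * cx (sin (A * (x - y))))
      has_integral integral {a..b} (%y. 2 * q y * cx (sin (A * (x - y))))) {a..b}"
      by (intro integrable_integral integrable_continuous_real continuous_intros q[simplified])
    have eq: "2 * q y * cx (sin (A * (x - y))) + \<phi> x * ?D y = \<phi> y * ?D y" for y
    proof (cases "x = y")
      case False
      then have "cx (x - y) \<noteq> 0" by simp
      then have "2 * ((\<phi> y - \<phi> x) / cx (x - y)) * s + \<phi> x * (2 * s / cx (x - y))
          = \<phi> y * (2 * s / cx (x - y))" for s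
        by (simp add: divide_simps) (simp add: algebra_simps)
      moreover have "q y = (\<phi> y - \<phi> x) / cx (x - y)"
        "?D y = 2 * cx (sin (A * (x - y))) / cx (x - y)"
        using False by (simp_all add: q_def)
      ultimately show ?thesis by metis
    qed (simp add: q_def)
    show ?case unfolding fourier_partial_integral_swap[OF ab \<phi> elim]
      using integral_unique[OF has_integral_add[OF 1 has_integral_mult_right[OF D, of "\<phi> x"]]]
      unfolding eq by simp
  qed
  ultimately show ?thesis using True by (auto simp: mult.commute elim: Lim_transform_eventually)
qed

definition ft :: "(real => complex) => real => complex" where
  "ft \<phi> k = (LINT y|lborel. exp (- \<i> * k * y) * \<phi> y)"

lemma integrable_inverse_square_weight: "integrable lborel (%x::real. C / (1 + x\<^sup>2))"
proof -
  have "integrable lborel (%x::real. inverse (1 + x\<^sup>2))"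
    using integrable_inverse_1_plus_square by (simp add: set_integrable_def)
  then have "integrable lborel (%x::real. C * inverse (1 + x\<^sup>2))" by simp
  then show ?thesis by (simp add: divide_inverse)
qed

lemma integrable_inverse_square_bound:
  fixes \<phi> :: "real => complex"
  assumes "\<phi> \<in> borel_measurable borel" "\<And>x. norm (\<phi> x) <= C / (1 + x\<^sup>2)"
  shows "integrable lborel \<phi>"
  by (rule Bochner_Integration.integrable_bound[OF integrable_inverse_square_weight[of C]])
     (use assms in \<open>auto intro!: AE_I2 order_trans[OF assms(2)] divide_right_mono\<close>)

lemma norm_exp_imaginary [simp]:
  "norm (exp (\<i> * cx k * cx x)) = 1"
  "norm (exp (- \<i> * cx k * cx x)) = 1"
  "norm (exp (- (\<i> * cx k * cx x))) = 1"
  by (auto simp: norm_exp_eq_Re)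

lemma ft_integrable:
  fixes \<phi> :: "real => complex" and k :: real
  assumes "integrable lborel \<phi>"
  shows "integrable lborel (%y. exp (- \<i> * k * y) * \<phi> y)"
proof -
  have "\<phi> \<in> borel_measurable borel" using assms by auto
  then show ?thesis
    by (intro Bochner_Integration.integrable_bound[OF assms])
      (auto simp: norm_mult intro!: borel_measurable_continuous_onI borel_measurable_times continuous_intros)
qed

lemma norm_ft_le:
  assumes "integrable lborel \<phi>"
  shows "norm (ft \<phi> k) <= (LINT y|lborel. norm (\<phi> y))"
  unfolding ft_def using integral_norm_bound[of lborel "%y. exp (- \<i> * k * y) * \<phi> y"]
  by (simp add: norm_mult)

lemma continuous_on_ft:
  assumes "integrable lborel \<phi>"
  shows "continuous_on UNIV (ft \<phi>)"
  unfolding ft_def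
proof (rule continuous_on_dominated_integral[where w = "%y. norm (\<phi> y)"])
  show "(%y. exp (- \<i> * cx k * y) * \<phi> y) \<in> borel_measurable lborel" for k
    using ft_integrable[OF assms, of k] by auto
qed (use assms in \<open>auto simp: norm_mult intro!: continuous_intros\<close>)

text \<open>The part of \<open>\<phi>\<close> far from \<open>x\<close> contributes little, uniformly in the cutoff \<open>A\<close>: the kernel
\<open>sin (A (x - y)) / (x - y)\<close> is at most the inverse distance. This carries inversion from bounded
intervals over to integrable functions.\<close>

lemma fourier_partial_integral_tail:
  fixes \<phi> :: "real => complex"
  assumes \<phi>: "integrable lborel \<phi>" and zero: "\<And>y. \<bar>y\<bar> <= b ==> \<phi> y = 0"
    and x: "\<bar>x\<bar> < b" and A: "A > 0"
  shows "norm (integral {-A..A} (%k. exp (\<i> * k * x) * ft \<phi> k)) <= 2 / (b - \<bar>x\<bar>) * (LINT y|lborel. norm (\<phi> y))"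
proof -
  let ?f = "%k y. indicator {-A..A} k *\<^sub>R (exp (\<i> * k * x) * (exp (- \<i> * k * y) * \<phi> y))"
  let ?D = "%y. cx (if x - y = 0 then 2 * A else 2 * sin (A * (x - y)) / (x - y))"
  have m[measurable]: "\<phi> \<in> borel_measurable borel" using \<phi> by auto
  have e[measurable]: "(%p::real\<times>real. exp (- \<i> * cx (fst p) * cx (snd p))) \<in> borel_measurable (lborel \<Otimes>\<^sub>M lborel)"
    by (simp add: lborel_prod) (intro borel_measurable_continuous_onI continuous_intros)
  have e2[measurable]: "(%k::real. exp (\<i> * cx k * x)) \<in> borel_measurable borel"
    by (intro borel_measurable_continuous_onI continuous_intros)
  have int: "integrable (lborel \<Otimes>\<^sub>M lborel) (case_prod ?f)"
  proof (rule lborel_pair.Fubini_integrable)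
    show "case_prod ?f \<in> borel_measurable (lborel \<Otimes>\<^sub>M lborel)"
      unfolding case_prod_beta by measurable
    have "integrable lborel (%k. indicator {-A..A} k *\<^sub>R (LINT y|lborel. norm (\<phi> y)))"
      by (rule integrable_scaleR_left) (auto simp: emeasure_lborel_Icc_eq)
    then show "integrable lborel (%k. LINT y|lborel. norm (case_prod ?f (k, y)))"
      by (simp add: norm_mult)
    show "AE k in lborel. integrable lborel (%y. case_prod ?f (k, y))"
      using ft_integrable[OF \<phi>] by (auto intro!: AE_I2 integrable_mult_right simp: mult.assoc)
  qed
  have cont: "continuous_on {-A..A} (%k. exp (\<i> * cx k * x) * ft \<phi> k)"
    by (intro continuous_intros continuous_on_subset[OF continuous_on_ft[OF \<phi>]]) auto
  have "integral {-A..A} (%k. exp (\<i> * k * x) * ft \<phi> k) = (LINT k:{-A..A}|lborel. exp (\<i> * k * x) * ft \<phi> k)"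
    by (rule set_borel_integral_eq_integral(2)[symmetric]) (rule borel_integrable_atLeastAtMost'[OF cont])
  also have "\<dots> = (LINT k|lborel. LINT y|lborel. ?f k y)"
    unfolding set_lebesgue_integral_def ft_def by simp
  also have "\<dots> = (LINT y|lborel. LINT k|lborel. ?f k y)"
    by (rule lborel_pair.Fubini_integral[symmetric, OF int])
  also have "\<dots> = (LINT y|lborel. \<phi> y * ?D y)"
  proof (rule Bochner_Integration.integral_cong[OF refl])
    fix y
    have "(LINT k|lborel. ?f k y) = (LINT k:{-A..A}|lborel. \<phi> y * exp (\<i> * cx k * (x - y)))"
      unfolding set_lebesgue_integral_def
      by (intro Bochner_Integration.integral_cong refl)
         (auto simp: algebra_simps exp_diff exp_minus field_simps)
    also have "\<dots> = integral {-A..A} (%k. \<phi> y * exp (\<i> * cx k * (x - y)))"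
      by (rule set_borel_integral_eq_integral(2)) (intro borel_integrable_atLeastAtMost' continuous_intros)
    also have "\<dots> = \<phi> y * ?D y"
      using integral_unique[OF integral_exp_symmetric[OF A, of "x - y"]] by simp
    finally show "(LINT k|lborel. ?f k y) = \<phi> y * ?D y" .
  qed
  finally have eq: "integral {-A..A} (%k. exp (\<i> * k * x) * ft \<phi> k) = (LINT y|lborel. \<phi> y * ?D y)" .
  have bd: "norm (\<phi> y * ?D y) <= 2 / (b - \<bar>x\<bar>) * norm (\<phi> y)" for y
  proof (cases "\<bar>y\<bar> <= b")
    case False
    then have "\<bar>x - y\<bar> >= b - \<bar>x\<bar>" "x - y \<noteq> 0" using x by auto
    moreover have "norm (?D y) = 2 * \<bar>sin (A * (x - y))\<bar> / \<bar>x - y\<bar>"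
      using calculation(2) by (simp only: if_False norm_of_real abs_divide abs_mult abs_numeral)
    moreover have "2 * \<bar>sin (A * (x - y))\<bar> / \<bar>x - y\<bar> <= 2 / (b - \<bar>x\<bar>)"
      using calculation(1) x abs_sin_le_one[of "A * (x - y)"] by (intro frac_le) linarith+
    ultimately have "norm (?D y) <= 2 / (b - \<bar>x\<bar>)" by simp
    from mult_left_mono[OF this, of "norm (\<phi> y)"] show ?thesis unfolding norm_mult by (simp only: mult.commute norm_ge_zero)
  qed (use zero x in auto)
  have "norm (LINT y|lborel. \<phi> y * ?D y) <= (LINT y|lborel. norm (\<phi> y * ?D y))"
    by (rule integral_norm_bound)
  also have "\<dots> <= (LINT y|lborel. 2 / (b - \<bar>x\<bar>) * norm (\<phi> y))"
    using bd x by (intro integral_mono') (use \<phi> in auto)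
  finally show ?thesis unfolding eq by simp
qed

lemma fourier_inversion_limit:
  fixes \<phi> :: "real => complex" and x B :: real
  assumes \<phi>: "integrable lborel \<phi>"
    and lim: "\<And>b. b > B ==> ((%A. integral {-A..A} (%k. exp (\<i> * k * x) * ft_on {-b..b} \<phi> k)) \<longlongrightarrow> L) at_top"
  shows "((%A. integral {-A..A} (%k. exp (\<i> * k * x) * ft \<phi> k)) \<longlongrightarrow> L) at_top"
proof (rule tendstoI)
  fix e :: real assume e: "e > 0"
  define N where "N = (LINT y|lborel. norm (\<phi> y))"
  have N: "N >= 0" by (simp add: N_def)
  define b :: real where "b = max (max B 0 + 1) (\<bar>x\<bar> + (4 * N + 1) / e)"
  have b: "b > B" "b > 0" "b - \<bar>x\<bar> >= (4 * N + 1) / e" by (auto simp: b_def)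
  have p: "(4 * N + 1) / e > 0" using N e by simp
  then have bx: "\<bar>x\<bar> < b" using b by linarith
  have small: "2 / (b - \<bar>x\<bar>) * N < e / 2"
  proof -
    have "4 * N < (b - \<bar>x\<bar>) * e" using b(3) e by (simp add: field_simps)
    then show ?thesis using bx e by (simp add: field_simps)
  qed
  define \<psi> where "\<psi> = (%y. indicator (- {-b..b}) y *\<^sub>R \<phi> y)"
  define \<phi>0 where "\<phi>0 = (%y. indicator {-b..b} y *\<^sub>R \<phi> y)"
  have int: "integrable lborel \<psi>" "integrable lborel \<phi>0"
    unfolding \<psi>_def \<phi>0_def by (auto intro!: integrable_mult_indicator \<phi>)
  have "(LINT y|lborel. norm (\<psi> y)) <= N"
    unfolding N_def by (rule integral_mono') (use \<phi> in \<open>auto simp: \<psi>_def indicator_def\<close>)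
  moreover have "2 / (b - \<bar>x\<bar>) >= 0" using bx by simp
  ultimately have le: "2 / (b - \<bar>x\<bar>) * (LINT y|lborel. norm (\<psi> y)) < e / 2"
    using small order_le_less_trans[OF mult_left_mono] by blast
  have chi: "ft \<phi>0 = ft_on {-b..b} \<phi>"
  proof
    fix k :: real
    have "set_integrable lborel {-b..b} (%y. exp (- \<i> * k * y) * \<phi> y)"
      unfolding set_integrable_def by (rule integrable_mult_indicator[OF _ ft_integrable[OF \<phi>]]) simp
    from set_borel_integral_eq_integral(2)[OF this] show "ft \<phi>0 k = ft_on {-b..b} \<phi> k"
      unfolding ft_def ft_on_def \<phi>0_def set_lebesgue_integral_def by (simp add: mult.commute mult.left_commute)
  qed
  have split: "ft \<phi> k = ft \<phi>0 k + ft \<psi> k" for k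
  proof -
    have "ft \<phi>0 k + ft \<psi> k = (LINT y|lborel. exp (- \<i> * k * y) * \<phi>0 y + exp (- \<i> * k * y) * \<psi> y)"
      unfolding ft_def by (rule Bochner_Integration.integral_add[symmetric]) (intro ft_integrable int)+
    also have "\<dots> = ft \<phi> k" unfolding ft_def
      by (intro Bochner_Integration.integral_cong) (auto simp: \<phi>0_def \<psi>_def indicator_def)
    finally show ?thesis by simp
  qed
  show "\<forall>\<^sub>F A in at_top. dist (integral {-A..A} (%k. exp (\<i> * k * x) * ft \<phi> k)) L < e"
    using tendstoD[OF lim[OF b(1)] half_gt_zero[OF e]] eventually_gt_at_top[of 0]
  proof eventually_elim
    case 2: (elim A)
    have sum: "integral {-A..A} (%k. exp (\<i> * k * x) * ft \<phi> k) =
      integral {-A..A} (%k. exp (\<i> * k * x) * ft \<phi>0 k) + integral {-A..A} (%k. exp (\<i> * k * x) * ft \<psi> k)"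
      unfolding split distrib_left
      by (intro integral_add integrable_continuous_real continuous_intros continuous_on_subset[OF continuous_on_ft] int) auto
    moreover have "norm (integral {-A..A} (%k. exp (\<i> * k * x) * ft \<psi> k)) < e / 2"
    proof (rule order_le_less_trans[OF fourier_partial_integral_tail[OF int(1) _ bx 2(2)] le])
      show "\<psi> y = 0" if "\<bar>y\<bar> <= b" for y using that by (simp add: \<psi>_def abs_le_iff)
    qed
    moreover have "norm (integral {-A..A} (%k. exp (\<i> * k * x) * ft \<phi>0 k) - L) < e / 2"
      using 2(1) unfolding chi dist_norm .
    ultimately have "norm ((integral {-A..A} (%k. exp (\<i> * k * x) * ft \<phi>0 k) - L) +
        integral {-A..A} (%k. exp (\<i> * k * x) * ft \<psi> k)) < e / 2 + e / 2"
      by (intro norm_add_less)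
    then show ?case
      using sum unfolding dist_norm by (simp add: algebra_simps)
  qed
qed

lemma fourier_inversion_line:
  fixes \<phi> :: "real => complex"
  assumes "continuous_on UNIV \<phi>" "\<And>y. norm (\<phi> y) <= C / (1 + y\<^sup>2)" "\<phi> differentiable (at x)"
  shows "((%A. integral {-A..A} (%k. exp (\<i> * k * x) * ft \<phi> k)) \<longlongrightarrow> 2 * pi * \<phi> x) at_top"
proof (rule fourier_inversion_limit[where B = "\<bar>x\<bar>"])
  show "integrable lborel \<phi>"
    by (rule integrable_inverse_square_bound[OF borel_measurable_continuous_onI assms(2)]) fact
  fix b assume b: "\<bar>x\<bar> < b"
  then have "- b < x \<and> x < b" by auto
  with fourier_inversion_compact[of "-b" b \<phi> x] b assms(3) continuous_on_subset[OF assms(1), of "{-b..b}"]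
  show "((%A. integral {-A..A} (%k. exp (\<i> * k * x) * ft_on {-b..b} \<phi> k)) \<longlongrightarrow> 2 * pi * \<phi> x) at_top"
    by auto
qed

lemma hat_eq_ft:
  assumes "integrable lborel (%y. indicator {0..} y *\<^sub>R \<phi> y)"
  shows "hat \<phi> k = ft (%y. indicator {0..} y *\<^sub>R \<phi> y) k"
proof -
  have eq: "(%y. exp (- \<i> * cx k * cx y) * (indicator {0..} y *\<^sub>R \<phi> y))
     = (%y. indicator {0..} y *\<^sub>R (exp (- \<i> * k * y) * \<phi> y))"
    by (simp add: mult.commute mult.left_commute)
  have "set_integrable lborel {0..} (%y. exp (- \<i> * k * y) * \<phi> y)"
    unfolding set_integrable_def using ft_integrable[OF assms, of k] unfolding eq .
  from set_borel_integral_eq_integral(2)[OF this] show ?thesis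
    unfolding hat_def ft_def eq set_lebesgue_integral_def by simp
qed

lemma integrable_half_line_bound:
  fixes \<phi> :: "real => complex"
  assumes "continuous_on {0..} \<phi>" "\<And>y. y >= 0 ==> norm (\<phi> y) <= C / (1 + y\<^sup>2)"
  shows "integrable lborel (%y. indicator {0..} y *\<^sub>R \<phi> y)"
proof (rule integrable_inverse_square_bound[where C = C])
  show "(%y. indicator {0..} y *\<^sub>R \<phi> y) \<in> borel_measurable borel"
    using borel_measurable_continuous_on_indicator[OF _ assms(1)] by simp
  have "norm (\<phi> 0) <= C" using assms(2)[of 0] by simp
  then have "C >= 0" using norm_ge_zero order_trans by blast
  then show "norm (indicator {0..} y *\<^sub>R \<phi> y) <= C / (1 + y\<^sup>2)" for y
    using assms(2)[of y] by (auto simp: indicator_def intro!: divide_nonneg_nonneg)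
qed

text \<open>For \<open>x < 0\<close> the transform of a function living on \<open>[0,\<infinity>)\<close> inverts to zero. This is why the terms with
\<open>- k\<close> in place of \<open>k\<close> do not contribute at points \<open>x > 0\<close>.\<close>

lemma fourier_inversion_half_line:
  fixes \<phi> :: "real => complex"
  assumes c: "continuous_on {0..} \<phi>" and bd: "\<And>y. y >= 0 ==> norm (\<phi> y) <= C / (1 + y\<^sup>2)"
    and x: "x \<noteq> 0" and d: "x > 0 ==> \<phi> differentiable (at x)"
  shows "((%A. integral {-A..A} (%k. exp (\<i> * k * x) * hat \<phi> k)) \<longlongrightarrow> (if x > 0 then 2 * pi * \<phi> x else 0)) at_top"
proof -
  note int = integrable_half_line_bound[OF c bd]
  have "((%A. integral {-A..A} (%k. exp (\<i> * k * x) * ft (%y. indicator {0..} y *\<^sub>R \<phi> y) k)) \<longlongrightarrow>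
     (if x > 0 then 2 * pi * \<phi> x else 0)) at_top"
  proof (rule fourier_inversion_limit[OF int, where B = "\<bar>x\<bar>"])
    fix b assume b: "\<bar>x\<bar> < b"
    have "ft_on {-b..b} (%y. indicator {0..} y *\<^sub>R \<phi> y) k = ft_on {0..b} \<phi> k" for k

    proof -
      have "ft_on {-b..b} (%y. indicator {0..} y *\<^sub>R \<phi> y) k =
         integral {-b..b} (%y. if y \<in> {0..b} then exp (- \<i> * k * y) * \<phi> y else 0)"
        unfolding ft_on_def by (intro integral_cong) auto
      also have "\<dots> = ft_on {0..b} \<phi> k"
        unfolding ft_on_def using b by (subst integral_restrict_Int) (simp add: max_absorb1)
      finally show ?thesis .
    qed
    then show "((%A. integral {-A..A} (%k. exp (\<i> * k * x) * ft_on {-b..b} (%y. indicator {0..} y *\<^sub>R \<phi> y) k)) \<longlongrightarrow>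
     (if x > 0 then 2 * pi * \<phi> x else 0)) at_top"
      using fourier_inversion_compact[of 0 b \<phi> x] b d x continuous_on_subset[OF c, of "{0..b}"] by auto
  qed simp
  then show ?thesis using hat_eq_ft[OF int] by simp
qed

section \<open>Improper oscillatory integrals\<close>

definition improper_half :: "(real => complex) => bool" where
  "improper_half \<phi> \<longleftrightarrow> (\<forall>A. \<phi> integrable_on {0..A}) \<and> (\<exists>L. ((%A. integral {0..A} \<phi>) \<longlongrightarrow> L) at_top)"

definition improper :: "(real => complex) => bool" where
  "improper \<phi> \<longleftrightarrow> improper_half \<phi> \<and> improper_half (%k. \<phi> (- k))"

lemma improper_integrable:
  assumes "improper \<phi>"
  shows "\<phi> integrable_on {-A..A}"
proof (cases "A >= 0")
  case True
  have "\<phi> integrable_on {0..A}" "(%k. \<phi> (- k)) integrable_on {0..A}"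
    using assms by (auto simp: improper_def improper_half_def)
  moreover from this(2) have "\<phi> integrable_on {-A..0}"
    using Henstock_Kurzweil_Integration.integrable_reflect_real[where f = "%k. \<phi> (- k)" and a = 0 and b = A] by simp
  ultimately show ?thesis using True
    by (intro Henstock_Kurzweil_Integration.integrable_combine[of "-A" 0 A]) auto
qed auto

text \<open>When both one-sided limits exist, the generalized integral is also the limit of the symmetric partial
integrals; the integrands can then be added before the limit is taken.\<close>

lemma gen_integral_symmetric_limit:
  assumes "improper \<phi>"
  shows "((%A. integral {-A..A} \<phi>) \<longlongrightarrow> gen_integral \<phi>) at_top"
proof -
  obtain L M where L: "((%A. integral {0..A} \<phi>) \<longlongrightarrow> L) at_top"
    and M: "((%A. integral {0..A} (%k. \<phi> (- k))) \<longlongrightarrow> M) at_top"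
    using assms by (auto simp: improper_def improper_half_def)
  have r: "integral {0..A} (%k. \<phi> (- k)) = integral {-A..0} \<phi>" for A
    using Henstock_Kurzweil_Integration.integral_reflect_real[where f = "%k. \<phi> (- k)" and a = 0 and b = A] by simp
  have "gen_integral \<phi> = L + M"
    unfolding gen_integral_def using tendsto_Lim[OF _ L] tendsto_Lim[OF _ M[unfolded r]] by simp
  moreover have "\<forall>\<^sub>F A in at_top. integral {0..A} \<phi> + integral {0..A} (%k. \<phi> (- k)) = integral {-A..A} \<phi>"
    using eventually_ge_at_top[of 0]
  proof eventually_elim
    case (elim A)
    then show ?case unfolding r
      using Henstock_Kurzweil_Integration.integral_combine[of "-A" 0 A \<phi>] improper_integrable[OF assms] by (simp add: add.commute)
  qed
  ultimately show ?thesis using Lim_transform_eventually[OF tendsto_add[OF L M]] by simp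
qed

lemma improper_half_integrable_tail:
  fixes r :: "real => complex"
  assumes "r \<in> borel_measurable borel" "\<And>k. k >= 1 ==> norm (r k) <= C / k\<^sup>2"
  shows "\<exists>L. ((%A. integral {1..A} r) \<longlongrightarrow> L) at_top"
proof -
  let ?r = "%k. indicator {1..} k *\<^sub>R r k"
  have C: "C >= 0" using order_trans[OF norm_ge_zero assms(2)[of 1]] by simp
  have "integrable lborel ?r"
  proof (rule integrable_inverse_square_bound[where C = "2 * C"])
    show "norm (?r k) <= 2 * C / (1 + k\<^sup>2)" for k
    proof (cases "k >= 1")
      case True
      then have "k\<^sup>2 >= 1" by simp
      then have "2 * C / (2 * k\<^sup>2) <= 2 * C / (1 + k\<^sup>2)" using C
        by (intro divide_left_mono mult_pos_pos) auto
      then have "C / k\<^sup>2 <= 2 * C / (1 + k\<^sup>2)" by simp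
      then show ?thesis using assms(2)[OF True] True by simp
    qed (use C in auto)
  qed (use assms in measurable)
  from tendsto_integral_at_top[OF _ this]
  have "((%A. LINT k|lborel. indicator {..A} k *\<^sub>R ?r k) \<longlongrightarrow> integral\<^sup>L lborel ?r) at_top" by simp
  moreover have "(LINT k|lborel. indicator {..A} k *\<^sub>R ?r k) = integral {1..A} r" for A
  proof -
    have "set_integrable lborel {1..A} r"
      unfolding set_integrable_def
    proof (rule Bochner_Integration.integrable_bound[OF \<open>integrable lborel ?r\<close>])
    qed (use assms in \<open>auto simp: indicator_def\<close>)
    from set_borel_integral_eq_integral(2)[OF this] show ?thesis
      unfolding set_lebesgue_integral_def
      by (subst (asm) eq_commute) (auto intro!: Bochner_Integration.integral_cong simp: indicator_def)
  qed
  ultimately show ?thesis by auto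
qed

lemma improper_half_exp_over_k:
  fixes s :: real
  assumes s: "s \<noteq> 0"
  shows "\<exists>L. ((%A. integral {1..A} (%k. exp (\<i> * k * s) / cx k)) \<longlongrightarrow> L) at_top"
proof -
  let ?e = "%k. exp (\<i> * cx k * s) / (\<i> * s)"
  let ?g = "%k. - (1 / cx (k\<^sup>2)) * ?e k"
  have ne: "norm (?e k) = 1 / \<bar>s\<bar>" for k by (simp add: norm_divide norm_mult)
  obtain L where L: "((%A. integral {1..A} ?g) \<longlongrightarrow> L) at_top"
  proof (rule exE[OF improper_half_integrable_tail[of ?g "1 / \<bar>s\<bar>"]])
    show "?g \<in> borel_measurable borel"
      by (intro borel_measurable_times borel_measurable_uminus borel_measurable_divide borel_measurable_of_real borel_measurable_continuous_onI continuous_intros)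
         (use s in auto)
    show "norm (?g k) <= 1 / \<bar>s\<bar> / k\<^sup>2" if "k >= 1" for k
      unfolding norm_mult ne by (simp add: norm_divide norm_power mult.commute)
  qed
  have "((%A. norm (1 / cx A * ?e A)) \<longlongrightarrow> 0) at_top"
  proof -
    have "((%A. 1 / \<bar>A\<bar> * (1 / \<bar>s\<bar>)) \<longlongrightarrow> 0 * (1 / \<bar>s\<bar>)) at_top"
      by (intro tendsto_intros real_tendsto_divide_at_top[OF tendsto_const] filterlim_abs_real)
    then show ?thesis unfolding norm_mult ne by (simp add: norm_divide)
  qed
  then have "((%A. 1 / cx A * ?e A) \<longlongrightarrow> 0) at_top"
    by (rule tendsto_norm_zero_cancel)
  then have "((%A. 1 / cx A * ?e A - ?e 1 - integral {1..A} ?g) \<longlongrightarrow> 0 - ?e 1 - L) at_top"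
    by (intro tendsto_intros L)
  moreover have "\<forall>\<^sub>F A in at_top. 1 / cx A * ?e A - ?e 1 - integral {1..A} ?g =
     integral {1..A} (%k. exp (\<i> * k * s) / cx k)"
    using eventually_ge_at_top[of 1]
  proof eventually_elim
    case (elim A)
    have "integral {1..A} (%k. 1 / cx k * exp (\<i> * cx k * s)) =
       1 / cx A * ?e A - 1 / cx 1 * ?e 1 - integral {1..A} ?g"
    proof (rule integral_mult_by_parts[OF elim])
      show "((%k. 1 / cx k) hvd - (1 / cx (k\<^sup>2))) (at k within {1..A})"
        if "k \<in> {1..A}" for k
        using that by (intro has_vector_derivative_real_field) (auto intro!: derivative_eq_intros simp: power2_eq_square)
      show "(?e hvd exp (\<i> * cx k * s)) (at k within {1..A})" for k
        using has_vector_derivative_divide[OF has_vector_derivative_cexp[of "\<i> * s"], of "\<i> * s" k "{1..A}"] s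
        by (simp add: mult_ac)
    qed (auto intro!: continuous_intros)
    then show ?case by simp
  qed
  ultimately have "((%A. integral {1..A} (%k. exp (\<i> * k * s) / cx k)) \<longlongrightarrow> 0 - ?e 1 - L) at_top"
    by (rule Lim_transform_eventually)
  then show ?thesis ..
qed

text \<open>Two waves are allowed because the boundary integrals carry the phase \<open>x\<close> as well as \<open>x - t\<close> or
\<open>x + t\<close>. A wave \<open>exp (i k s) / k\<close> is conditionally integrable at infinity if \<open>s \<noteq> 0\<close>, and
the remainder is absolutely integrable.\<close>

lemma oscillatory_improper_half:
  fixes \<phi> :: "real => complex"
  assumes m: "\<phi> \<in> borel_measurable borel"
    and b: "\<And>k. k >= 0 ==> norm (\<phi> k) <= B"
    and s: "s1 \<noteq> 0" "s2 \<noteq> 0"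
    and r: "\<And>k. k >= 1 ==> norm (\<phi> k - c1 * (exp (\<i> * k * cx s1) / k) - c2 * (exp (\<i> * k * cx s2) / k)) <= C / k\<^sup>2"
  shows "improper_half \<phi>"
proof -
  have int: "\<phi> integrable_on {0..A}" for A
  proof -
    have "set_integrable lborel {0..A} \<phi>"
    proof (rule set_integrable_bound)
      show "set_integrable lborel {0..A} (%_. B)"
        by (intro borel_integrable_atLeastAtMost' continuous_intros)
      show "set_borel_measurable lborel {0..A} \<phi>" using m unfolding set_borel_measurable_def by simp
      have "norm (\<phi> k) <= norm B" if "k \<in> {0..A}" for k using b[of k] that by simp
      then show "AE k in lborel. k \<in> {0..A} --> norm (\<phi> k) <= norm B" by simp
    qed
    then show ?thesis by (rule set_borel_integral_eq_integral)
  qed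
  let ?e = "%s k. exp (\<i> * cx k * cx s) / cx k"
  let ?r = "%k. \<phi> k - c1 * ?e s1 k - c2 * ?e s2 k"
  obtain L1 where L1: "((%A. integral {1..A} (?e s1)) \<longlongrightarrow> L1) at_top" using improper_half_exp_over_k[OF s(1)] by blast
  obtain L2 where L2: "((%A. integral {1..A} (?e s2)) \<longlongrightarrow> L2) at_top" using improper_half_exp_over_k[OF s(2)] by blast
  have me: "?e s \<in> borel_measurable borel" for s
    by (intro borel_measurable_divide borel_measurable_of_real borel_measurable_continuous_onI continuous_intros)
  obtain L3 where L3: "((%A. integral {1..A} ?r) \<longlongrightarrow> L3) at_top"
    using improper_half_integrable_tail[of ?r C, OF _ r] borel_measurable_diff[OF borel_measurable_diff[OF m
      borel_measurable_times[OF borel_measurable_const me]] borel_measurable_times[OF borel_measurable_const me]]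
    by blast
  have "((%A. integral {0..1} \<phi> + (integral {1..A} ?r + c1 * integral {1..A} (?e s1) + c2 * integral {1..A} (?e s2)))
     \<longlongrightarrow> integral {0..1} \<phi> + (L3 + c1 * L1 + c2 * L2)) at_top"
    by (intro tendsto_intros L1 L2 L3)
  moreover have "\<forall>\<^sub>F A in at_top. integral {0..1} \<phi> + (integral {1..A} ?r + c1 * integral {1..A} (?e s1) + c2 * integral {1..A} (?e s2))
     = integral {0..A} \<phi>"
    using eventually_ge_at_top[of 1]
  proof eventually_elim
    case (elim A)
    have ie: "?e s integrable_on {1..A}" for s
      by (intro integrable_continuous_real continuous_intros) auto
    have i1: "\<phi> integrable_on {1..A}"
      using int[of A] by (rule integrable_on_subinterval) auto
    have "integral {1..A} ?r + c1 * integral {1..A} (?e s1) + c2 * integral {1..A} (?e s2) = integral {1..A} \<phi>"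
    proof -
      have "(?r has_integral integral {1..A} \<phi> - c1 * integral {1..A} (?e s1) - c2 * integral {1..A} (?e s2)) {1..A}"
        by (intro has_integral_diff has_integral_mult_right integrable_integral ie i1)
      then show ?thesis by (simp add: integral_unique)
    qed
    then show ?case
      using Henstock_Kurzweil_Integration.integral_combine[of 0 1 A \<phi>] int[of A] elim by simp
  qed
  ultimately have "((%A. integral {0..A} \<phi>) \<longlongrightarrow> integral {0..1} \<phi> + (L3 + c1 * L1 + c2 * L2)) at_top"
    by (rule Lim_transform_eventually)
  then show ?thesis unfolding improper_half_def using int by auto
qed

section \<open>Smooth functions on open sets and their boundary traces\<close>

lemma open_slices:
  assumes "open S"
  shows "open {y. (y, t) \<in> S}" (is ?A) "open {u. (x, u) \<in> S}"
proof -
  have "open ((%y. (y, t)) -` S)" "open ((%u. (x, u)) -` S)"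
    by (intro open_vimage assms continuous_intros)+
  then show ?A "open {u. (x, u) \<in> S}" by (simp_all add: vimage_def)
qed

lemma has_vector_derivative_slice_x:
  assumes "open S" "(x, t) \<in> S" "\<And>p. p \<in> S ==> G' p = G p"
    and "((%y. G (y, t)) hvd d) (at x)"
  shows "((%y. G' (y, t)) hvd d) (at x within {y. (y, t) \<in> S})"
  using has_vector_derivative_transform_within_open[OF assms(4) open_slices(1)[OF assms(1)]] assms(2,3)
  by (force intro: has_vector_derivative_at_within)

lemma has_vector_derivative_slice_t:
  assumes "open S" "(x, t) \<in> S" "\<And>p. p \<in> S ==> G' p = G p"
    and "((%u. G (x, u)) hvd d) (at t)"
  shows "((%u. G' (x, u)) hvd d) (at t within {u. (x, u) \<in> S})"
  using has_vector_derivative_transform_within_open[OF assms(4) open_slices(2)[OF assms(1)]] assms(2,3)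
  by (force intro: has_vector_derivative_at_within)

lemma partial_x_eqI:
  assumes "open S" "(x, t) \<in> S" "((%y. G (y, t)) hvd d) (at x within {y. (y, t) \<in> S})"
  shows "partial_x S G (x, t) = d"
  using assms at_within_open[OF _ open_slices(1)[OF assms(1)], of x t]
  by (simp add: partial_x_def vector_derivative_at)

lemma partial_t_eqI:
  assumes "open S" "(x, t) \<in> S" "((%u. G (x, u)) hvd d) (at t within {u. (x, u) \<in> S})"
  shows "partial_t S G (x, t) = d"
  using assms at_within_open[OF _ open_slices(2)[OF assms(1)], of t x]
  by (simp add: partial_t_def vector_derivative_at)

text \<open>A class of continuous functions that contains, with every member, its partial derivatives consists of
smooth functions. This avoids tracking the sequence in which derivatives are taken.\<close>

lemma smooth2_coinduct:
  assumes S: "open S" and F: "F \<in> \<F>"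
    and cont: "\<And>G. G \<in> \<F> ==> continuous_on S G"
    and dx: "\<And>G. G \<in> \<F> ==> \<exists>H\<in>\<F>. \<forall>x t. (x, t) \<in> S --> ((%y. G (y, t)) hvd H (x, t)) (at x)"
    and dt: "\<And>G. G \<in> \<F> ==> \<exists>H\<in>\<F>. \<forall>x t. (x, t) \<in> S --> ((%u. G (x, u)) hvd H (x, t)) (at t)"
  shows "smooth2 S F"
proof -
  have *: "\<exists>G\<in>\<F>. \<forall>p\<in>S. G' p = G p" if "G' \<in> iterated_partials S F" for G'
    using that
  proof induction
    case base
    then show ?case using F by auto
  next
    case (step_x G')
    then obtain G where G: "G \<in> \<F>" "\<And>p. p \<in> S ==> G' p = G p" by auto
    obtain H where H: "H \<in> \<F>" "\<And>x t. (x, t) \<in> S ==> ((%y. G (y, t)) hvd H (x, t)) (at x)"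
      using dx[OF G(1)] by auto
    then have "partial_x S G' p = H p" if "p \<in> S" for p
      using partial_x_eqI[OF S _ has_vector_derivative_slice_x[OF S _ G(2) H(2)]] that by (cases p) auto
    then show ?case using H(1) by blast
  next
    case (step_t G')
    then obtain G where G: "G \<in> \<F>" "\<And>p. p \<in> S ==> G' p = G p" by auto
    obtain H where H: "H \<in> \<F>" "\<And>x t. (x, t) \<in> S ==> ((%u. G (x, u)) hvd H (x, t)) (at t)"
      using dt[OF G(1)] by auto
    then have "partial_t S G' p = H p" if "p \<in> S" for p
      using partial_t_eqI[OF S _ has_vector_derivative_slice_t[OF S _ G(2) H(2)]] that by (cases p) auto
    then show ?case using H(1) by blast
  qed
  show ?thesis unfolding smooth2_def
  proof (intro ballI conjI allI impI)
    fix G' assume "G' \<in> iterated_partials S F"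
    then obtain G where G: "G \<in> \<F>" "\<And>p. p \<in> S ==> G' p = G p" using * by blast
    show "continuous_on S G'" using cont[OF G(1)] G(2) by (simp cong: continuous_on_cong)
    fix x t assume xt: "(x, t) \<in> S"
    show "(%y. G' (y, t)) differentiable (at x within {y. (y, t) \<in> S})"
      using dx[OF G(1)] has_vector_derivative_slice_x[OF S xt, of G' G] G(2) xt
      by (meson differentiableI_vector)
    show "(%u. G' (x, u)) differentiable (at t within {u. (x, u) \<in> S})"
      using dt[OF G(1)] has_vector_derivative_slice_t[OF S xt, of G' G] G(2) xt
      by (meson differentiableI_vector)
  qed
qed

lemma iterated_partials_funpow:
  assumes "G \<in> iterated_partials S F"
  shows "(partial_x S ^^ n) G \<in> iterated_partials S F" "(partial_t S ^^ n) G \<in> iterated_partials S F"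
  by (induction n) (auto intro: assms iterated_partials.intros)

lemma pderivs_in_iterated_partials: "pderivs S n l F \<in> iterated_partials S F"
  unfolding pderivs_def by (intro iterated_partials_funpow iterated_partials.base)

lemma smooth2_has_partials:
  assumes U: "open U" and sm: "smooth2 U \<Phi>" and G: "G \<in> iterated_partials U \<Phi>" and xt: "(x, t) \<in> U"
  shows "((%y. G (y, t)) hvd partial_x U G (x, t)) (at x)" (is ?A)
    and "((%u. G (x, u)) hvd partial_t U G (x, t)) (at t)"
proof -
  have "at x within {y. (y, t) \<in> U} = at x" "at t within {u. (x, u) \<in> U} = at t"
    using xt by (auto intro!: at_within_open open_slices U)
  then show ?A
    "((%u. G (x, u)) hvd partial_t U G (x, t)) (at t)"
  proof -
    have "(%y. G (y, t)) differentiable (at x within {y. (y, t) \<in> U}) \<and>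
        (%u. G (x, u)) differentiable (at t within {u. (x, u) \<in> U})"
      using bspec[OF sm[unfolded smooth2_def] G] xt by blast
    then show ?A
      "((%u. G (x, u)) hvd partial_t U G (x, t)) (at t)"
      using \<open>at x within {y. (y, t) \<in> U} = at x\<close> \<open>at t within {u. (x, u) \<in> U} = at t\<close>
      unfolding partial_x_def partial_t_def by (simp_all add: vector_derivative_works)
  qed
qed

text \<open>On an open set, partial derivatives see only local values; this transports derivatives from an
extension to the function it extends.\<close>

lemma pderivs_agree:
  assumes U: "open U" and Q: "open Q" and sm: "smooth2 U \<Phi>" and eq: "\<And>p. p \<in> U \<inter> Q ==> \<Phi> p = \<Psi> p"
    and p: "p \<in> U \<inter> Q"
  shows "pderivs Q n l \<Psi> p = pderivs U n l \<Phi> p"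
proof -
  have W: "open (U \<inter> Q)" using U Q by auto
  have px: "partial_x Q G' p = partial_x U G p"
    if "G \<in> iterated_partials U \<Phi>" "\<And>p. p \<in> U \<inter> Q ==> G' p = G p" "p \<in> U \<inter> Q" for G G' p
  proof (cases p)
    case (Pair x t)
    have "((%y. G' (y, t)) hvd partial_x U G (x, t)) (at x within {y. (y, t) \<in> U \<inter> Q})"
      using that Pair by (intro has_vector_derivative_slice_x[OF W _ that(2)] smooth2_has_partials[OF U sm]) auto
    moreover have "at x within {y. (y, t) \<in> U \<inter> Q} = at x"
      by (rule at_within_open[OF _ open_slices(1)[OF W]]) (use that Pair in auto)
    ultimately show ?thesis using that Pair
      by (auto intro!: partial_x_eqI Q has_vector_derivative_at_within)
  qed
  have pt: "partial_t Q G' p = partial_t U G p"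
    if "G \<in> iterated_partials U \<Phi>" "\<And>p. p \<in> U \<inter> Q ==> G' p = G p" "p \<in> U \<inter> Q" for G G' p
  proof (cases p)
    case (Pair x t)
    have "((%u. G' (x, u)) hvd partial_t U G (x, t)) (at t within {u. (x, u) \<in> U \<inter> Q})"
      using that Pair by (intro has_vector_derivative_slice_t[OF W _ that(2)] smooth2_has_partials[OF U sm]) auto
    moreover have "at t within {u. (x, u) \<in> U \<inter> Q} = at t"
      by (rule at_within_open[OF _ open_slices(2)[OF W]]) (use that Pair in auto)
    ultimately show ?thesis using that Pair
      by (auto intro!: partial_t_eqI Q has_vector_derivative_at_within)
  qed
  have 1: "\<forall>p\<in>U \<inter> Q. (partial_t Q ^^ l) \<Psi> p = (partial_t U ^^ l) \<Phi> p"
    by (induction l) (auto simp: eq intro!: pt iterated_partials_funpow iterated_partials.base)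
  have "\<forall>p\<in>U \<inter> Q. (partial_x Q ^^ n) ((partial_t Q ^^ l) \<Psi>) p = (partial_x U ^^ n) ((partial_t U ^^ l) \<Phi>) p"
    by (induction n) (auto simp: 1 intro!: px iterated_partials_funpow iterated_partials.base)
  then show ?thesis using p by (simp add: pderivs_def)
qed

text \<open>A continuous function is uniformly continuous near a compact piece of the axis. The curve \<open>e\<close>
covers both axes at once.\<close>

lemma uniform_limit_trace:
  fixes e :: "real => real => real \<times> real" and G :: "real \<times> real => complex"
  assumes U: "open U" and G: "continuous_on U G" and e: "continuous_on UNIV (%(\<epsilon>, s). e \<epsilon> s)"
    and K: "compact K" and KU: "\<And>s. s \<in> K ==> e 0 s \<in> U"
  shows "uniform_limit K (%\<epsilon> s. G (e \<epsilon> s)) (%s. G (e 0 s)) (at_right 0)" (is ?A)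
    and "\<forall>\<^sub>F \<epsilon> in at_right 0. \<forall>s\<in>K. e \<epsilon> s \<in> U" (is ?B)
proof -
  let ?e = "%(\<epsilon>, s). e \<epsilon> s"
  have V: "open (?e -` U)" by (rule open_vimage[OF U e])
  have "compact ({0} \<times> K)" "{0} \<times> K \<subseteq> ?e -` U" using K KU by (auto intro: compact_Times)
  show ?A
    and "\<forall>\<^sub>F \<epsilon> in at_right 0. \<forall>s\<in>K. e \<epsilon> s \<in> U"
  proof -
    have "\<exists>r>0. K \<noteq> {} --> {x. infdist x ({0} \<times> K) <= r} \<subseteq> ?e -` U"
    proof (cases "K = {}")
      case False
      then show ?thesis
        using compact_in_open_separated[OF _ \<open>compact ({0} \<times> K)\<close> V \<open>{0} \<times> K \<subseteq> ?e -` U\<close>] by auto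
    qed (auto intro: exI[of _ 1])
    then obtain r where r: "r > 0" "K \<noteq> {} ==> {x. infdist x ({0} \<times> K) <= r} \<subseteq> ?e -` U" by blast
    define r' where "r' = (if K = {} then 1 else r)"
    have r': "r' > 0" using r by (auto simp: r'_def)
    have sub: "{0..r'} \<times> K \<subseteq> ?e -` U"
    proof (clarify)
      fix \<epsilon> s assume *: "\<epsilon> \<in> {0..r'}" "s \<in> K"
      then have "infdist (\<epsilon>, s) ({0} \<times> K) <= dist (\<epsilon>, s) (0, s)" by (intro infdist_le) auto
      also have "\<dots> <= r'" using * by (simp add: dist_Pair_Pair)
      finally have "(\<epsilon>, s) \<in> {x. infdist x ({0} \<times> K) <= r}" using * by (auto simp: r'_def split: if_splits)
      then show "(\<epsilon>, s) \<in> ?e -` U" using r * by blast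
    qed
    have ev: "\<forall>\<^sub>F \<epsilon> in at_right 0. 0 < \<epsilon> \<and> \<epsilon> < (d::real)" if "d > 0" for d
      using that by (auto simp: eventually_at_right_field)
    show ?B
      using ev[OF r']
    proof eventually_elim
      case (elim \<epsilon>)
      show ?case
      proof
        fix s assume "s \<in> K"
        then have "(\<epsilon>, s) \<in> {0..r'} \<times> K" using elim by simp
        from subsetD[OF sub this] show "e \<epsilon> s \<in> U" by simp
      qed
    qed
    have "uniformly_continuous_on ({0..r'} \<times> K) (%p. G (?e p))"
    proof (rule compact_uniformly_continuous)
      show "continuous_on ({0..r'} \<times> K) (%p. G (?e p))"
      proof (rule continuous_on_compose2[OF G continuous_on_subset[OF e]])
        show "?e ` ({0..r'} \<times> K) \<subseteq> U" using sub by (simp only: image_subset_iff_subset_vimage)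
      qed simp
      show "compact ({0..r'} \<times> K)" by (rule compact_Times[OF compact_Icc K])
    qed
    note uc = this[unfolded uniformly_continuous_on_def, rule_format]
    show ?A
    proof (rule uniform_limitI)
      fix \<eta> :: real assume "\<eta> > 0"
      from uc[OF this] obtain d where d: "d > 0" "\<And>p q. p \<in> {0..r'} \<times> K ==> q \<in> {0..r'} \<times> K ==> dist q p < d ==> dist (G (?e q)) (G (?e p)) < \<eta>"
        by blast
      have "min d r' > 0" using d r' by simp
      from ev[OF this] show "\<forall>\<^sub>F \<epsilon> in at_right 0. \<forall>s\<in>K. dist (G (e \<epsilon> s)) (G (e 0 s)) < \<eta>"
      proof eventually_elim
        case (elim \<epsilon>)
        show ?case
        proof
          fix s assume "s \<in> K"
          then show "dist (G (e \<epsilon> s)) (G (e 0 s)) < \<eta>"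
            using d(2)[of "(0, s)" "(\<epsilon>, s)"] elim by (simp add: dist_Pair_Pair)
        qed
      qed
    qed
  qed
qed

lemma iter_deriv_trace:
  assumes der: "\<And>j x. x > 0 ==> (D j hvd D (Suc j) x) (at x)"
    and eq: "\<And>x. x > 0 ==> \<phi> x = D 0 x"
  shows "smooth1 {0<..} \<phi>" "x > 0 ==> iter_deriv {0<..} j \<phi> x = D j x"
proof -
  have at: "at x within {0<..} = at x" if "x > 0" for x :: real using that by (intro at_within_open) auto
  have 1: "\<forall>x>0. iter_deriv {0<..} j \<phi> x = D j x" for j
  proof (induction j)
    case 0
    then show ?case by (simp add: iter_deriv_def eq)
  next
    case (Suc j)
    show ?case
    proof (intro allI impI)
      fix x :: real assume x: "x > 0"
      have "(iter_deriv {0<..} j \<phi> hvd D (Suc j) x) (at x)"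
        by (rule has_vector_derivative_transform_within_open[OF der[OF x], of "{0<..}"]) (use Suc x in auto)
      then show "iter_deriv {0<..} (Suc j) \<phi> x = D (Suc j) x"
        by (simp add: iter_deriv_def at[OF x] vector_derivative_at)
    qed
  qed
  show "x > 0 ==> iter_deriv {0<..} j \<phi> x = D j x" using 1 by blast
  show "smooth1 {0<..} \<phi>" unfolding smooth1_def
  proof (intro allI ballI)
    fix n and x :: real assume "x \<in> {0<..}"
    then have x: "x > 0" by simp
    have "(iter_deriv {0<..} n \<phi> hvd D (Suc n) x) (at x)"
      by (rule has_vector_derivative_transform_within_open[OF der[OF x], of "{0<..}"]) (use 1 x in auto)
    then show "iter_deriv {0<..} n \<phi> differentiable (at x within {0<..})"
      using at[OF x] by (simp add: differentiableI_vector)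
  qed
qed

lemma smooth1_half_line_derivs:
  assumes "smooth1 {0..} g"
  shows "x >= 0 ==> (iter_deriv {0..} n g hvd iter_deriv {0..} (Suc n) g x) (at x within {0..})"
    and "x > 0 ==> (iter_deriv {0..} n g hvd iter_deriv {0..} (Suc n) g x) (at x)"
proof -
  show *: "(iter_deriv {0..} n g hvd iter_deriv {0..} (Suc n) g x) (at x within {0..})" if "x >= 0" for x
    using assms that by (simp add: smooth1_def iter_deriv_def vector_derivative_works[symmetric])
  show "x > 0 ==> (iter_deriv {0..} n g hvd iter_deriv {0..} (Suc n) g x) (at x)"
    using *[of x] at_within_interior[of x "{0..}"] by simp
qed

lemma open_offdiag_quadrant: "open offdiag_quadrant"
proof -
  have "offdiag_quadrant = {p. 0 < fst p} \<inter> {p. 0 < snd p} \<inter> {p. fst p \<noteq> snd p}"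
    by (auto simp: offdiag_quadrant_def)
  also have "open \<dots>"
    by (intro open_Int open_Collect_less open_Collect_neq continuous_intros)
  finally show ?thesis .
qed

lemma limits_at_initial_axis:
  assumes U: "open U" and sm: "smooth2 U \<Phi>" and L: "\<And>x. x > 0 ==> (x, 0) \<in> U"
    and eq: "\<And>p. p \<in> U \<inter> offdiag_quadrant ==> \<Phi> p = \<Psi> p"
  shows "\<exists>\<phi>. smooth1 {0<..} \<phi> \<and> (\<forall>K. compact K \<and> K \<subseteq> {0<..} -->
           uniform_limit K (%t x. dPsi n l \<Psi> (x, t)) \<phi> (at_right 0))" (is ?A)
    and "smooth1 {0..} g ==> (\<And>x. x > 0 ==> \<Phi> (x, 0) = g x) ==> x > 0 ==>
           ((%t. dPsi n 0 \<Psi> (x, t)) \<longlongrightarrow> iter_deriv {0..} n g x) (at_right 0)"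
proof -
  note it = pderivs_in_iterated_partials[of U _ _ \<Phi>]
  have lim: "uniform_limit K (%t x. dPsi n l \<Psi> (x, t)) (%x. pderivs U n l \<Phi> (x, 0)) (at_right 0)"
    if K: "compact K" "K \<subseteq> {0<..}" for K n l
  proof -
    have c: "continuous_on U (pderivs U n l \<Phi>)" using sm it unfolding smooth2_def by blast
    have e: "continuous_on UNIV (%(\<epsilon>, s). (s, \<epsilon>) :: real \<times> real)"
      unfolding case_prod_unfold by (intro continuous_intros)
    note tr = uniform_limit_trace[where e = "%\<epsilon> s. (s, \<epsilon>)", OF U c e K(1)]
    have KU: "(s, 0) \<in> U" if "s \<in> K" for s using that K L by auto
    have tr1: "uniform_limit K (%\<epsilon> s. pderivs U n l \<Phi> (s, \<epsilon>)) (%s. pderivs U n l \<Phi> (s, 0)) (at_right 0)"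
      by (rule tr(1)) (use KU in auto)
    have tr2: "\<forall>\<^sub>F \<epsilon> in at_right 0. \<forall>s\<in>K. (s, \<epsilon>) \<in> U" by (rule tr(2)) (use KU in auto)
    have "\<forall>\<^sub>F t in at_right 0. \<forall>s\<in>K. t < s"
    proof (cases "K = {}")
      case False
      then obtain c where c: "c \<in> K" "\<And>s. s \<in> K ==> c <= s"
        using compact_attains_inf[OF K(1)] by auto
      then have "\<forall>\<^sub>F t in at_right 0. t < c" using K by (auto simp: eventually_at_right_field)
      then show ?thesis by eventually_elim (use c in force)
    qed simp
    moreover have "\<forall>\<^sub>F t::real in at_right 0. 0 < t" by (rule eventually_at_right_less)
    ultimately have "\<forall>\<^sub>F t in at_right 0. \<forall>s\<in>K. pderivs U n l \<Phi> (s, t) = dPsi n l \<Psi> (s, t)"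
      using tr2
    proof eventually_elim
      case (elim t)
      show ?case
        by (intro ballI pderivs_agree[symmetric, OF U open_offdiag_quadrant sm eq])
          (use elim K in \<open>auto simp: offdiag_quadrant_def\<close>)
    qed
    from uniform_limit_cong[OF this] tr1 show ?thesis by simp
  qed
  have der: "((%x. pderivs U j l \<Phi> (x, 0)) hvd pderivs U (Suc j) l \<Phi> (x, 0)) (at x)" if "x > 0" for j x l
    using smooth2_has_partials(1)[OF U sm it L[OF that], of j l] by (simp add: pderivs_def)
  show ?A
    using lim iter_deriv_trace(1)[where D = "%j x. pderivs U (n + j) l \<Phi> (x, 0)" and \<phi> = "%x. pderivs U n l \<Phi> (x, 0)"] der
    by auto
  show "((%t. dPsi n 0 \<Psi> (x, t)) \<longlongrightarrow> iter_deriv {0..} n g x) (at_right 0)"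
    if g: "smooth1 {0..} g" "\<And>x. x > 0 ==> \<Phi> (x, 0) = g x" and x: "x > 0"
  proof -
    have "iter_deriv {0<..} n g x = iter_deriv {0..} n g x"
      by (rule iter_deriv_trace(2)[where D = "%j. iter_deriv {0..} j g", OF smooth1_half_line_derivs(2)[OF g(1)] _ x])
         (simp_all add: iter_deriv_def)
    moreover have "iter_deriv {0<..} n g x = pderivs U n 0 \<Phi> (x, 0)"
      using iter_deriv_trace(2)[where D = "%j x. pderivs U j 0 \<Phi> (x, 0)", OF der[where l = 0] _ x, of g] g(2)
      by (simp add: pderivs_def)
    ultimately show ?thesis using tendsto_uniform_limitI[OF lim[of "{x}" n 0], of x] x by simp
  qed
qed

lemma limits_at_boundary_axis:
  assumes U: "open U" and sm: "smooth2 U \<Phi>" and L: "\<And>t. t > 0 ==> (0, t) \<in> U"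
    and eq: "\<And>p. p \<in> U \<inter> offdiag_quadrant ==> \<Phi> p = \<Psi> p"
  shows "\<exists>\<phi>. smooth1 {0<..} \<phi> \<and> (\<forall>K. compact K \<and> K \<subseteq> {0<..} -->
           uniform_limit K (%x t. dPsi n l \<Psi> (x, t)) \<phi> (at_right 0))" (is ?A)
    and "smooth1 {0..} h ==> (\<And>t. t > 0 ==> \<Phi> (0, t) = h t) ==> t > 0 ==>
           ((%x. dPsi 0 l \<Psi> (x, t)) \<longlongrightarrow> iter_deriv {0..} l h t) (at_right 0)"
proof -
  note it = pderivs_in_iterated_partials[of U _ _ \<Phi>]
  have lim: "uniform_limit K (%x t. dPsi n l \<Psi> (x, t)) (%t. pderivs U n l \<Phi> (0, t)) (at_right 0)"
    if K: "compact K" "K \<subseteq> {0<..}" for K n l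
  proof -
    have c: "continuous_on U (pderivs U n l \<Phi>)" using sm it unfolding smooth2_def by blast
    have e: "continuous_on UNIV (%(\<epsilon>, s). (\<epsilon>, s) :: real \<times> real)"
      unfolding case_prod_unfold by (intro continuous_intros)
    note tr = uniform_limit_trace[where e = "%\<epsilon> s. (\<epsilon>, s)", OF U c e K(1)]
    have KU: "(0, s) \<in> U" if "s \<in> K" for s using that K L by auto
    have tr1: "uniform_limit K (%\<epsilon> s. pderivs U n l \<Phi> (\<epsilon>, s)) (%s. pderivs U n l \<Phi> (0, s)) (at_right 0)"
      by (rule tr(1)) (use KU in auto)
    have tr2: "\<forall>\<^sub>F \<epsilon> in at_right 0. \<forall>s\<in>K. (\<epsilon>, s) \<in> U" by (rule tr(2)) (use KU in auto)
    have "\<forall>\<^sub>F t in at_right 0. \<forall>s\<in>K. t < s"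
    proof (cases "K = {}")
      case False
      then obtain c where c: "c \<in> K" "\<And>s. s \<in> K ==> c <= s"
        using compact_attains_inf[OF K(1)] by auto
      then have "\<forall>\<^sub>F t in at_right 0. t < c" using K by (auto simp: eventually_at_right_field)
      then show ?thesis by eventually_elim (use c in force)
    qed simp
    moreover have "\<forall>\<^sub>F t::real in at_right 0. 0 < t" by (rule eventually_at_right_less)
    ultimately have "\<forall>\<^sub>F t in at_right 0. \<forall>s\<in>K. pderivs U n l \<Phi> (t, s) = dPsi n l \<Psi> (t, s)"
      using tr2
    proof eventually_elim
      case (elim t)
      show ?case
        by (intro ballI pderivs_agree[symmetric, OF U open_offdiag_quadrant sm eq])
          (use elim K in \<open>auto simp: offdiag_quadrant_def\<close>)
    qed
    from uniform_limit_cong[OF this] tr1 show ?thesis by simp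
  qed
  have der: "((%t. (partial_t U ^^ j) (pderivs U n l \<Phi>) (0, t)) hvd
      (partial_t U ^^ Suc j) (pderivs U n l \<Phi>) (0, t)) (at t)" if "t > 0" for j t n l
    using smooth2_has_partials(2)[OF U sm iterated_partials_funpow(2)[OF it[of n l]] L[OF that], of j] by simp
  show ?A
    using lim iter_deriv_trace(1)[where D = "%j t. (partial_t U ^^ j) (pderivs U n l \<Phi>) (0, t)" and \<phi> = "%t. pderivs U n l \<Phi> (0, t)"] der[where n = n and l = l]
    by auto
  show "((%x. dPsi 0 l \<Psi> (x, t)) \<longlongrightarrow> iter_deriv {0..} l h t) (at_right 0)"
    if h: "smooth1 {0..} h" "\<And>t. t > 0 ==> \<Phi> (0, t) = h t" and t: "t > 0"
  proof -
    have "iter_deriv {0<..} l h t = iter_deriv {0..} l h t"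
      by (rule iter_deriv_trace(2)[where D = "%j. iter_deriv {0..} j h", OF smooth1_half_line_derivs(2)[OF h(1)] _ t])
         (simp_all add: iter_deriv_def)
    moreover have "iter_deriv {0<..} l h t = pderivs U 0 l \<Phi> (0, t)"
      using iter_deriv_trace(2)[where D = "%j t. (partial_t U ^^ j) (pderivs U 0 0 \<Phi>) (0, t)",
          OF der[where n = 0 and l = 0] _ t, of h] h(2)
      by (simp add: pderivs_def)
    ultimately show ?thesis using tendsto_uniform_limitI[OF lim[of "{t}" 0 l], of t] t by simp
  qed
qed

section \<open>Seeley's extension of smooth functions across a boundary point\<close>

text \<open>The coefficients of the entire function \<open>\<Prod>\<^sub>i (1 - z / 2\<^sup>i)\<close>, \<open>i \<ge> 1\<close>, whose zeros are the points \<open>2\<^sup>n\<close>,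
\<open>n \<ge> 1\<close>. They decrease faster than every geometric sequence.\<close>

definition euler_coeff :: "nat => real" where
  "euler_coeff k = (- 1) ^ k / (\<Prod>i=1..k. 2 ^ i - 1)"

lemma two_power_gt_one: "(2::real) ^ Suc k - 1 > 0"
  using one_less_power[of "2::real" "Suc k"] by simp

lemma euler_coeff_Suc: "euler_coeff (Suc k) * (2 ^ Suc k - 1) = - euler_coeff k"
proof -
  have "(\<Prod>i=1..Suc k. (2::real) ^ i - 1) = (\<Prod>i=1..k. 2 ^ i - 1) * (2 ^ Suc k - 1)"
    by simp
  moreover have "((- 1) ^ Suc k / (P * q)) * q = - ((- 1) ^ k / P)" if "q \<noteq> 0" for P q :: real
    using that by simp
  ultimately show ?thesis unfolding euler_coeff_def using two_power_gt_one[of k] by (metis less_irrefl)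
qed

lemma euler_coeff_rec:
  "euler_coeff 0 = 1" "euler_coeff (Suc k) = - euler_coeff k / (2 ^ Suc k - 1)"
proof -
  show "euler_coeff 0 = 1" by (simp add: euler_coeff_def)
  show "euler_coeff (Suc k) = - euler_coeff k / (2 ^ Suc k - 1)"
    unfolding euler_coeff_Suc[symmetric] using two_power_gt_one[of k] by simp
qed

lemma two_power_fraction_le_1: "(2::real) ^ k / (1 + 2 ^ k) <= 1"
  by (simp add: divide_le_eq add_pos_pos)

lemma summable_euler_coeff: "summable (%k. \<bar>euler_coeff k\<bar> * (2 ^ k) ^ n)"
proof (rule summable_ratio_test)
  fix k assume k: "n + 1 <= k"
  have "(2::real) ^ Suc k - 1 >= 2 ^ k" using one_le_power[of "2::real" k] by simp
  moreover have "(2::real) ^ k >= 2 ^ (n + 1)" using k by (intro power_increasing) auto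
  moreover have e: "(2::real) ^ (n + 1) = 2 * 2 ^ n" by simp
  ultimately have *: "(2::real) ^ Suc k - 1 >= 2 * 2 ^ n" by linarith
  have "\<bar>euler_coeff k\<bar> = \<bar>euler_coeff (Suc k)\<bar> * (2 ^ Suc k - 1)"
    using arg_cong[OF euler_coeff_Suc[of k], of abs] two_power_gt_one[of k] by (simp add: abs_mult del: power_Suc)
  then have "\<bar>euler_coeff (Suc k)\<bar> * (2 * 2 ^ n) <= \<bar>euler_coeff k\<bar>"
    using mult_left_mono[OF *, of "\<bar>euler_coeff (Suc k)\<bar>"] by simp
  then have "\<bar>euler_coeff (Suc k)\<bar> * (2 * 2 ^ n) * (2 ^ k) ^ n <= \<bar>euler_coeff k\<bar> * (2 ^ k) ^ n"
    by (rule mult_right_mono) simp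
  moreover have "\<bar>euler_coeff (Suc k)\<bar> * (2 * 2 ^ n) * (2 ^ k) ^ n = 2 * (\<bar>euler_coeff (Suc k)\<bar> * (2 ^ Suc k) ^ n)"
    by (simp add: power_mult_distrib)
  ultimately have "\<bar>euler_coeff (Suc k)\<bar> * (2 ^ Suc k) ^ n <= 1/2 * (\<bar>euler_coeff k\<bar> * (2 ^ k) ^ n)"
    by linarith
  then show "norm (\<bar>euler_coeff (Suc k)\<bar> * (2 ^ Suc k) ^ n) <= 1/2 * norm (\<bar>euler_coeff k\<bar> * (2 ^ k) ^ n)"
    by (simp only: real_norm_def abs_mult abs_idempotent power_abs abs_numeral)
qed simp

lemma two_power_fraction_abs_le_1: "\<bar>(2::real) ^ k / (1 + 2 ^ k)\<bar> <= 1"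
  using two_power_fraction_le_1[of k] by simp

lemma summable_abs_cancel: "summable (%k. \<bar>f k\<bar> * g k) ==> (\<And>k. g k >= 0) ==> summable (%k. f k * g k :: real)"
  by (rule summable_norm_cancel) (simp add: abs_mult)

lemma summable_euler_coeff': "summable (%k. euler_coeff k * (2 ^ k) ^ n)"
  by (rule summable_abs_cancel[OF summable_euler_coeff]) simp

lemma euler_moments: "(\<Sum>k. euler_coeff k * (2 ^ k) ^ Suc n) = 0"
proof -
  let ?Z = "%n. \<Sum>k. euler_coeff k * (2 ^ k) ^ n"
  have step: "?Z (Suc n) = (1 - 2 ^ n) * ?Z n" for n
  proof -
    let ?h = "%k. euler_coeff k * (2 ^ k - 1) * (2 ^ k) ^ n"
    have h: "?h k = euler_coeff k * (2 ^ k) ^ Suc n - euler_coeff k * (2 ^ k) ^ n" for k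
      by (simp add: algebra_simps)
    have "?Z (Suc n) - ?Z n = suminf ?h"
      unfolding h by (rule suminf_diff) (rule summable_euler_coeff')+
    also have "\<dots> = (\<Sum>k. ?h (Suc k))"
    proof -
      have "summable ?h" unfolding h by (intro summable_diff summable_euler_coeff')
      from suminf_split_head[OF this] show ?thesis by simp
    qed
    also have "\<dots> = (\<Sum>k. - (2 ^ n) * (euler_coeff k * (2 ^ k) ^ n))"
      unfolding euler_coeff_Suc by (simp add: power_mult_distrib mult_ac)
    also have "\<dots> = - (2 ^ n) * ?Z n" by (rule suminf_mult) (rule summable_euler_coeff')
    finally show ?thesis by (simp add: algebra_simps)
  qed
  show ?thesis
  proof (induction n)
    case 0
    show ?case using step[of 0] by simp
  next
    case (Suc n)
    then show ?case using step[of "Suc n"] by simp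
  qed
qed

lemma euler_coeff_tail: "\<bar>euler_coeff (k + 4)\<bar> <= 1 / 315 * (1 / 2) ^ k"
proof (induction k)
  case 0
  show ?case by (simp add: euler_coeff_rec eval_nat_numeral)
next
  case (Suc k)
  have "(2::real) ^ Suc (k + 4) - 1 >= 2"
    using power_increasing[of 2 "Suc (k + 4)" "2::real"] by simp
  moreover have "\<bar>euler_coeff (k + 4)\<bar> = \<bar>euler_coeff (Suc (k + 4))\<bar> * (2 ^ Suc (k + 4) - 1)"
    using arg_cong[OF euler_coeff_Suc[of "k + 4"], of abs] two_power_gt_one[of "k + 4"] by (simp add: abs_mult del: power_Suc)
  ultimately have "\<bar>euler_coeff (Suc (k + 4))\<bar> * 2 <= \<bar>euler_coeff (k + 4)\<bar>"
    using mult_left_mono[of 2 _ "\<bar>euler_coeff (Suc (k + 4))\<bar>"] by simp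
  then show ?case using Suc by simp
qed

text \<open>The value that has to be nonzero for the normalization of the moments. An explicit partial sum
dominates the tail, which is geometrically small.\<close>

lemma seeley_normalization_pos:
  "summable (%k. euler_coeff k * (2 ^ k / (1 + 2 ^ k)))"
  "(\<Sum>k. euler_coeff k * (2 ^ k / (1 + 2 ^ k))) > 0"
proof -
  let ?d = "%k. euler_coeff k * (2 ^ k / (1 + 2 ^ k))"
  have le: "\<bar>?d k\<bar> <= \<bar>euler_coeff k\<bar>" for k
    unfolding abs_mult by (rule mult_left_le[OF two_power_fraction_abs_le_1]) auto
  show s: "summable ?d"
    by (rule summable_comparison_test[OF _ summable_euler_coeff[of 0]]) (use le in auto)
  have "summable (%k. ?d (k + 4))" using s by (rule summable_ignore_initial_segment)
  have g: "(%k. 1 / 315 * (1 / 2) ^ k :: real) sums (1 / 315 * 2)"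
    using sums_mult[OF geometric_sums[of "1/2::real"], of "1/315"] by simp
  have "norm (\<Sum>k. ?d (k + 4)) <= (\<Sum>k. 1 / 315 * (1 / 2) ^ k :: real)"
    by (rule norm_suminf_le) (use order_trans[OF le euler_coeff_tail] sums_summable[OF g] in auto)
  then have "\<bar>\<Sum>k. ?d (k + 4)\<bar> <= 2 / 315" using sums_unique[OF g] by simp
  moreover have "suminf ?d = (\<Sum>k. ?d (k + 4)) + sum ?d {..<4}" by (rule suminf_split_initial_segment[OF s])
  moreover have "sum ?d {..<4} = 1/2 - 2/3 + (1/3) * (4/5) - (1/21) * (8/9)"
    by (simp add: euler_coeff_rec eval_nat_numeral lessThan_Suc)
  ultimately show "suminf ?d > 0" by simp
qed

definition seeley_mass :: real where
  "seeley_mass = (\<Sum>k. euler_coeff k * (2 ^ k / (1 + 2 ^ k)))"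

definition seeley_coeff :: "nat => real" where
  "seeley_coeff k = euler_coeff k * (2 ^ k / (1 + 2 ^ k)) / seeley_mass"

lemma seeley_mass_pos: "seeley_mass > 0"
  unfolding seeley_mass_def by (rule seeley_normalization_pos)

lemma summable_seeley_coeff: "summable (%k. \<bar>seeley_coeff k\<bar> * (2 ^ k) ^ n)"
proof -
  let ?M = seeley_mass
  note m = seeley_mass_pos seeley_coeff_def seeley_mass_def[symmetric]
  have "summable (%k. (1 / ?M) * (\<bar>euler_coeff k\<bar> * (2 ^ k) ^ n))"
    by (intro summable_mult summable_euler_coeff)
  moreover have "norm (\<bar>seeley_coeff k\<bar> * (2 ^ k) ^ n) <= (1 / ?M) * (\<bar>euler_coeff k\<bar> * (2 ^ k) ^ n)" for k
  proof -
    have "\<bar>euler_coeff k\<bar> * \<bar>2 ^ k / (1 + 2 ^ k)\<bar> <= \<bar>euler_coeff k\<bar>" by (rule mult_left_le[OF two_power_fraction_abs_le_1]) auto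
    then have "\<bar>euler_coeff k\<bar> * \<bar>2 ^ k / (1 + 2 ^ k)\<bar> / ?M <= \<bar>euler_coeff k\<bar> / ?M"
      by (rule divide_right_mono) (use m in linarith)
    then have "\<bar>seeley_coeff k\<bar> <= \<bar>euler_coeff k\<bar> / ?M"
      unfolding m(2) abs_divide[of _ ?M] abs_mult abs_of_pos[OF m(1)] .
    from mult_right_mono[OF this, of "(2 ^ k) ^ n"] show ?thesis by simp
  qed
  ultimately show ?thesis by (rule summable_comparison_test'[where N = 0])
qed

text \<open>The factor \<open>2\<^sup>k / (1 + 2\<^sup>k)\<close> makes consecutive moments telescope: the sum of the moments of order \<open>n\<close>
and \<open>n + 1\<close> is a value of the entire function at one of its zeros. So the moments alternate, and
\<open>seeley_mass\<close> normalizes the first to 1. These moments match all derivatives at 0.\<close>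

lemma seeley_moments: "(\<Sum>k. seeley_coeff k * (2 ^ k) ^ n) = (- 1) ^ n"
proof -
  let ?M = seeley_mass
  note m = seeley_mass_pos seeley_coeff_def seeley_mass_def[symmetric]
  have s: "summable (%k. seeley_coeff k * (2 ^ k) ^ n)" for n
    by (rule summable_abs_cancel[OF summable_seeley_coeff]) simp
  show ?thesis
  proof (induction n)
    case 0
    have "(\<Sum>k. seeley_coeff k) = ?M / ?M"
      unfolding m(2) m(3)[symmetric] by (rule suminf_divide[OF seeley_normalization_pos(1)])
    then show ?case using m by simp
  next
    case (Suc n)
    have "(\<Sum>k. seeley_coeff k * (2 ^ k) ^ Suc n) + (\<Sum>k. seeley_coeff k * (2 ^ k) ^ n) =
      (\<Sum>k. seeley_coeff k * (2 ^ k) ^ Suc n + seeley_coeff k * (2 ^ k) ^ n)"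
      by (rule suminf_add) (rule s)+
    also have "\<dots> = (\<Sum>k. euler_coeff k * (2 ^ k) ^ Suc n / ?M)"
    proof -
      have "seeley_coeff k * (2 ^ k) ^ Suc n + seeley_coeff k * (2 ^ k) ^ n = euler_coeff k * (2 ^ k) ^ Suc n / ?M" for k
      proof -
        have p: "(1 + 2 ^ k :: real) > 0" by (simp add: add_pos_pos)
        have "seeley_coeff k * (2 ^ k) ^ Suc n + seeley_coeff k * (2 ^ k) ^ n = seeley_coeff k * (1 + 2 ^ k) * (2 ^ k) ^ n"
          by (simp add: algebra_simps)
        also have "seeley_coeff k * (1 + 2 ^ k) = euler_coeff k * 2 ^ k / ?M"
          unfolding m(2) using p by simp
        finally show ?thesis by simp
      qed
      then show ?thesis by simp
    qed
    also have "\<dots> = (\<Sum>k. euler_coeff k * (2 ^ k) ^ Suc n) / ?M"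
      by (rule suminf_divide) (rule summable_euler_coeff')
    also have "\<dots> = 0" unfolding euler_moments by simp
    finally show ?case using Suc by simp
  qed
qed

text \<open>The second argument is the order of the derivative; \<open>F\<close> is the sequence of derivatives of a function
on \<open>[0,\<infinity>)\<close>, so that the extension commutes with differentiation.\<close>

definition seeley_ext :: "(nat => real => complex) => nat => real => complex" where
  "seeley_ext F n y = (if y >= 0 then F n y
     else (LINT k|count_space UNIV. cx (seeley_coeff k * (- (2 ^ k)) ^ n) * F n (- (2 ^ k) * y)))"

definition seeley_norm :: "nat => real" where
  "seeley_norm n = 1 + (\<Sum>k. \<bar>seeley_coeff k\<bar> * (2 ^ k) ^ n)"

lemma seeley_norm_ge_1: "seeley_norm n >= 1"
  unfolding seeley_norm_def using suminf_nonneg[OF summable_seeley_coeff[of n]] by simp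

lemma seeley_terms:
  fixes F :: "nat => complex"
  assumes "\<And>k. norm (F k) <= w"
  shows "norm (cx (seeley_coeff k * (- (2 ^ k)) ^ n) * F k) <= \<bar>seeley_coeff k\<bar> * (2 ^ k) ^ n * w"
    and "integrable (count_space UNIV) (%k. \<bar>seeley_coeff k\<bar> * (2 ^ k) ^ n * w)"
    and "integrable (count_space UNIV) (%k. cx (seeley_coeff k * (- (2 ^ k)) ^ n) * F k)"
    and "norm (LINT k|count_space UNIV. cx (seeley_coeff k * (- (2 ^ k)) ^ n) * F k) <= seeley_norm n * w" (is ?D)
proof -
  have w: "w >= 0" using order_trans[OF norm_ge_zero assms] .
  show 1: "norm (cx (seeley_coeff k * (- (2 ^ k)) ^ n) * F k) <= \<bar>seeley_coeff k\<bar> * (2 ^ k) ^ n * w" for k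
    unfolding norm_mult norm_of_real abs_mult power_abs by (simp add: assms mult_left_mono)
  have s: "summable (%k. \<bar>seeley_coeff k\<bar> * (2 ^ k) ^ n * w)"
    by (intro summable_mult2 summable_seeley_coeff)
  show 2: "integrable (count_space UNIV) (%k. \<bar>seeley_coeff k\<bar> * (2 ^ k) ^ n * w)"
    unfolding integrable_count_space_nat_iff using s w by (simp add: abs_mult)
  show 3: "integrable (count_space UNIV) (%k. cx (seeley_coeff k * (- (2 ^ k)) ^ n) * F k)"
    by (rule Bochner_Integration.integrable_bound[OF 2]) (use 1 w in \<open>auto intro!: AE_I2 simp: abs_mult\<close>)
  have "norm (LINT k|count_space UNIV. cx (seeley_coeff k * (- (2 ^ k)) ^ n) * F k) \<le>
     (LINT k|count_space UNIV. \<bar>seeley_coeff k\<bar> * (2 ^ k) ^ n * w)"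
    by (rule order_trans[OF integral_norm_bound]) (rule integral_mono[OF integrable_norm[OF 3] 2 1])
  also have "\<dots> = (\<Sum>k. \<bar>seeley_coeff k\<bar> * (2 ^ k) ^ n) * w"
    by (subst integral_count_space_nat[OF 2]) (rule suminf_mult2[symmetric], rule summable_seeley_coeff)
  also have "\<dots> <= seeley_norm n * w"
    using w by (simp add: seeley_norm_def mult_right_mono)
  finally show ?D .
qed

lemma norm_seeley_ext_le:
  assumes "\<And>k. norm (F n (2 ^ k * \<bar>y\<bar>)) <= w"
  shows "norm (seeley_ext F n y) <= seeley_norm n * w"
proof (cases "y >= 0")
  case True
  have "w >= 0" using order_trans[OF norm_ge_zero assms] .
  then have "w <= seeley_norm n * w" using mult_right_mono[OF seeley_norm_ge_1[of n]] by fastforce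
  then show ?thesis using assms[of 0] True by (simp add: seeley_ext_def)
next
  case False
  then show ?thesis
    using seeley_terms(4)[of "%k. F n (- (2 ^ k) * y)" w n] assms by (simp add: seeley_ext_def)
qed

lemma has_vector_derivative_at_glue:
  fixes f :: "real => complex"
  assumes "(f hvd d) (at x within {..x})" "(f hvd d) (at x within {x..})"
  shows "(f hvd d) (at x)"
proof -
  have "{..x} \<union> {x..} = UNIV" by auto
  then show ?thesis
    using assms at_within_union[of x "{..x}" "{x..}"]
    unfolding has_vector_derivative_def has_derivative_within by (auto intro: filterlim_sup)
qed

lemma seeley_ext_at_nonpos:
  assumes "\<And>y. y >= 0 ==> norm (F n y) <= B" "y <= 0"
  shows "seeley_ext F n y = (LINT k|count_space UNIV. cx (seeley_coeff k * (- (2 ^ k)) ^ n) * F n (- (2 ^ k) * y))"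
proof (cases "y = 0")
  case True
  have "norm (F n 0) <= B" using assms(1) by simp
  note t = seeley_terms(3)[of "%k. F n 0" B, OF this]
  have s: "summable (%k. seeley_coeff k * (- (2 ^ k)) ^ n)"
    by (rule summable_norm_cancel) (use summable_seeley_coeff[of n] in \<open>simp add: abs_mult power_abs\<close>)
  have "(\<Sum>k. seeley_coeff k * (- (2 ^ k)) ^ n) = (\<Sum>k. (- 1) ^ n * (seeley_coeff k * (2 ^ k) ^ n))"
    by (simp add: power_minus[of "2 ^ _"] mult_ac)
  also have "\<dots> = (- 1) ^ n * (\<Sum>k. seeley_coeff k * (2 ^ k) ^ n)"
    by (rule suminf_mult) (rule summable_abs_cancel[OF summable_seeley_coeff], simp)
  also have "\<dots> = 1" unfolding seeley_moments by (simp flip: power_mult_distrib)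
  finally have 1: "(\<Sum>k. seeley_coeff k * (- (2 ^ k)) ^ n) = 1" .
  have "(LINT k|count_space UNIV. cx (seeley_coeff k * (- (2 ^ k)) ^ n) * F n 0) =
     (\<Sum>k. cx (seeley_coeff k * (- (2 ^ k)) ^ n) * F n 0)"
    by (rule integral_count_space_nat[OF t])
  also have "\<dots> = (\<Sum>k. cx (seeley_coeff k * (- (2 ^ k)) ^ n)) * F n 0"
    by (rule suminf_mult2[symmetric]) (rule summable_of_real[OF s])
  also have "(\<Sum>k. cx (seeley_coeff k * (- (2 ^ k)) ^ n)) = 1"
    using suminf_of_real[OF s, where 'a = complex] 1 by simp
  finally show ?thesis using True by (simp add: seeley_ext_def)
qed (use assms in \<open>auto simp: seeley_ext_def\<close>)

text \<open>On each side the series may be differentiated termwise; at 0 the two one-sided derivatives agree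
because the moments of the coefficients are \<open>(- 1)\<^sup>n\<close>.\<close>

lemma seeley_ext_has_derivative:
  assumes der: "\<And>n y. y >= 0 ==> (F n hvd F (Suc n) y) (at y within {0..})"
    and bd: "\<And>n. \<exists>B. \<forall>y\<ge>0. norm (F n y) <= B"
  shows "(seeley_ext F n hvd seeley_ext F (Suc n) y) (at y)"
proof -
  obtain B where B: "\<And>y. y >= 0 ==> norm (F n y) <= B" using bd[of n] by auto
  obtain B' where B': "\<And>y. y >= 0 ==> norm (F (Suc n) y) <= B'" using bd[of "Suc n"] by auto
  let ?S = "%n y. LINT k|count_space UNIV. cx (seeley_coeff k * (- (2 ^ k)) ^ n) * F n (- (2 ^ k) * y)"
  have S: "(?S n hvd ?S (Suc n) y) (at y within {..0})" if y: "y <= 0" for y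
  proof (rule has_vector_derivative_dominated_integral[where w = "%k. \<bar>seeley_coeff k\<bar> * (2 ^ k) ^ Suc n * B'"])
    fix z :: real and k :: nat assume z: "z \<in> {..0}"
    have im: "(%y::real. - (2 ^ k) * y) ` {..0} \<subseteq> {0..}" by (auto simp: mult_nonneg_nonpos)
    have "(F n \<circ> (%y. - (2 ^ k) * y) hvd (- (2 ^ k)) *\<^sub>R F (Suc n) (- (2 ^ k) * z)) (at z within {..0})"
    proof (rule vector_diff_chain_within)
      show "((%y. - (2 ^ k) * y) hvd - (2 ^ k)) (at z within {..0})"
        by (auto intro!: derivative_eq_intros simp: has_real_derivative_iff_has_vector_derivative[symmetric])
      show "(F n hvd F (Suc n) (- (2 ^ k) * z)) (at (- (2 ^ k) * z) within (%y. - (2 ^ k) * y) ` {..0})"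
        using z by (intro has_vector_derivative_within_subset[OF der im]) (auto simp: mult_nonneg_nonpos)
    qed
    from has_vector_derivative_mult_right[OF this, of "cx (seeley_coeff k * (- (2 ^ k)) ^ n)"]
    show "((%y. cx (seeley_coeff k * (- (2 ^ k)) ^ n) * F n (- (2 ^ k) * y)) hvd
       cx (seeley_coeff k * (- (2 ^ k)) ^ Suc n) * F (Suc n) (- (2 ^ k) * z)) (at z within {..0})"
      by (simp add: o_def scaleR_conv_of_real mult_ac)
    show "norm (cx (seeley_coeff k * (- (2 ^ k)) ^ Suc n) * F (Suc n) (- (2 ^ k) * z)) <= \<bar>seeley_coeff k\<bar> * (2 ^ k) ^ Suc n * B'"
      by (rule seeley_terms(1)[of "%k. F (Suc n) (- (2 ^ k) * z)"]) (use z B' in \<open>auto simp: mult_nonneg_nonpos\<close>)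
  next
    show "integrable (count_space UNIV) (%k. \<bar>seeley_coeff k\<bar> * (2 ^ k) ^ Suc n * B')"
      by (rule seeley_terms(2)[of "%k. F (Suc n) 0"]) (use B' in auto)
    show "integrable (count_space UNIV) (%k. cx (seeley_coeff k * (- (2 ^ k)) ^ n) * F n (- (2 ^ k) * z))"
      if "z \<in> {..0}" for z
      by (rule seeley_terms(3)[of "%k. F n (- (2 ^ k) * z)" B]) (use B that in \<open>auto simp: mult_nonneg_nonpos\<close>)
  qed (use y in auto)
  have eS: "seeley_ext F n y = ?S n y" if "y <= 0" for y by (rule seeley_ext_at_nonpos[where F = F and n = n and y = y, OF B that])
  have eS': "seeley_ext F (Suc n) y = ?S (Suc n) y" if "y <= 0" for y by (rule seeley_ext_at_nonpos[where F = F and n = "Suc n" and y = y, OF B' that])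
  have left: "(seeley_ext F n hvd seeley_ext F (Suc n) y) (at y within {..0})" if "y <= 0" for y
    using has_vector_derivative_transform[OF _ eS S[OF that]] that eS'[OF that] by auto
  have right: "(seeley_ext F n hvd seeley_ext F (Suc n) y) (at y within {0..})" if "y >= 0" for y
    using has_vector_derivative_transform[OF _ _ der[OF that], where g = "seeley_ext F n"] that by (auto simp: seeley_ext_def)
  consider "y < 0" | "y = 0" | "y > 0" by linarith
  then show ?thesis
  proof cases
    case 1
    then show ?thesis using left[of y] at_within_interior[of y "{..0}"] by simp
  next
    case 2
    then show ?thesis using left[of 0] right[of 0] has_vector_derivative_at_glue by simp
  next
    case 3
    then show ?thesis using right[of y] at_within_interior[of y "{0..}"] by simp
  qed
qed

section \<open>A smooth cutoff and extension in time\<close>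

definition flat_exp :: "nat => real => real" where
  "flat_exp j x = (if x <= 0 then 0 else (1 / x) ^ j * exp (- (1 / x)))"

lemma flat_exp_limit: "(flat_exp j \<longlongrightarrow> 0) (at_right 0)"
proof -
  have "((%y::real. y ^ j / exp y) \<longlongrightarrow> 0) at_top" by (rule tendsto_power_div_exp_0)
  then have "((%x::real. (1 / x) ^ j / exp (1 / x)) \<longlongrightarrow> 0) (at_right 0)"
    using filterlim_compose[OF _ filterlim_inverse_at_top_right] by (force simp: divide_inverse)
  moreover have "\<forall>\<^sub>F x in at_right 0. (1 / x) ^ j / exp (1 / x) = flat_exp j x"
    using eventually_at_right_less[of "0::real"]
    by eventually_elim (simp add: flat_exp_def exp_minus divide_inverse)
  ultimately show ?thesis by (rule Lim_transform_eventually)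
qed

lemma flat_exp_has_derivative:
  "(flat_exp j hrd (flat_exp (j + 2) x - real j * flat_exp (j + 1) x)) (at x)"
proof -
  consider "x < 0" | "x = 0" | "x > 0" by linarith
  then show ?thesis
  proof cases
    case 1
    have "((%_. 0) hrd 0) (at x)" by simp
    then have "(flat_exp j hrd 0) (at x)"
      by (rule has_field_derivative_transform_within_open[of _ _ _ "{..<0}"]) (use 1 in \<open>auto simp: flat_exp_def\<close>)
    then show ?thesis using 1 by (simp add: flat_exp_def)
  next
    case 3
    have "((%x. (1 / x) ^ j * exp (- (1 / x))) hrd flat_exp (j + 2) x - real j * flat_exp (j + 1) x) (at x)"
      using 3 by (auto intro!: derivative_eq_intros simp: flat_exp_def power2_eq_square)
        (cases j; simp add: field_simps)
    then show ?thesis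
      by (rule has_field_derivative_transform_within_open[of _ _ _ "{0<..}"]) (use 3 in \<open>auto simp: flat_exp_def\<close>)
  next
    case 2
    have "((%y. flat_exp j y / y) \<longlongrightarrow> 0) (at_left 0)"
      by (rule Lim_transform_eventually[OF tendsto_const]) (auto simp: eventually_at_filter flat_exp_def)
    moreover have "((%y. flat_exp j y / y) \<longlongrightarrow> 0) (at_right 0)"
      by (rule Lim_transform_eventually[OF flat_exp_limit[of "Suc j"]]) (auto simp: eventually_at_filter flat_exp_def)
    ultimately have "((%y. flat_exp j y / y) \<longlongrightarrow> 0) (at 0)" by (rule filterlim_split_at)
    then show ?thesis using 2 by (simp add: has_field_derivative_iff flat_exp_def)
  qed
qed

inductive_set cutoff_algebra :: "(real => real) set" where
  "flat_exp j \<in> cutoff_algebra"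
| "(%s. flat_exp j (1 - s)) \<in> cutoff_algebra"
| "(%s. inverse (flat_exp 0 s + flat_exp 0 (1 - s))) \<in> cutoff_algebra"
| "(%s. c) \<in> cutoff_algebra"
| "f \<in> cutoff_algebra ==> g \<in> cutoff_algebra ==> (%s. f s + g s) \<in> cutoff_algebra"
| "f \<in> cutoff_algebra ==> g \<in> cutoff_algebra ==> (%s. f s * g s) \<in> cutoff_algebra"

lemma cutoff_denominator_pos: "flat_exp 0 s + flat_exp 0 (1 - s) > 0"
  by (auto simp: flat_exp_def add_pos_pos add_nonneg_pos add_pos_nonneg)

lemma flat_exp_reflected_has_derivative:
  "((%s. flat_exp j (1 - s)) hrd
     (-1) * (flat_exp (j + 2) (1 - s) + (- real j) * flat_exp (j + 1) (1 - s))) (at s)"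
proof -
  have "((%s. 1 - s) hrd (-1)) (at s)" by (auto intro!: derivative_eq_intros)
  from DERIV_chain2[where f = "flat_exp j" and g = "%s. 1 - s", OF flat_exp_has_derivative this]
  show ?thesis by (simp add: algebra_simps)
qed

lemma cutoff_algebra_derivative:
  assumes "f \<in> cutoff_algebra"
  shows "\<exists>g\<in>cutoff_algebra. \<forall>s. (f hrd g s) (at s)"
  using assms
proof induction
  case (1 j)
  have "(%s. flat_exp (j + 2) s + (- real j) * flat_exp (j + 1) s) \<in> cutoff_algebra"
    by (intro cutoff_algebra.intros)
  then show ?case using flat_exp_has_derivative[of j] by (force simp: algebra_simps)
next
  case (2 j)
  have "(%s. (-1) * (flat_exp (j + 2) (1 - s) + (- real j) * flat_exp (j + 1) (1 - s))) \<in> cutoff_algebra"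
    by (intro cutoff_algebra.intros)
  then show ?case by (intro bexI allI) (rule flat_exp_reflected_has_derivative)
next
  case 3
  let ?r = "%s. inverse (flat_exp 0 s + flat_exp 0 (1 - s))"
  let ?g = "%s. (-1) * (flat_exp 2 s + (-1) * flat_exp 2 (1 - s)) * (?r s * ?r s)"
  have "?g \<in> cutoff_algebra" by (intro cutoff_algebra.intros)
  moreover have "(?r hrd ?g s) (at s)" for s
  proof -
    have "((%s. flat_exp 0 s + flat_exp 0 (1 - s)) hrd (flat_exp 2 s + (-1) * flat_exp 2 (1 - s))) (at s)"
      using DERIV_add[OF flat_exp_has_derivative[of 0 s] flat_exp_reflected_has_derivative[of 0 s]] by (simp add: numeral_2_eq_2)
    from DERIV_inverse'[OF this] cutoff_denominator_pos[of s]
    have "(?r hrd - (?r s * (flat_exp 2 s + (-1) * flat_exp 2 (1 - s)) * ?r s)) (at s)" by simp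
    moreover have "- (r * D * r) = (-1) * D * (r * r)" for r D :: real by simp
    ultimately show ?thesis by (rule DERIV_cong)
  qed
  ultimately show ?case by (intro bexI[where x = ?g] allI)
next
  case (4 c)
  show ?case by (rule bexI[of _ "%s. 0"]) (auto intro: cutoff_algebra.intros)
next
  case (5 f g)
  then obtain f' g' where "f' \<in> cutoff_algebra" "g' \<in> cutoff_algebra"
    "\<And>s. (f hrd f' s) (at s)" "\<And>s. (g hrd g' s) (at s)" by blast
  then show ?case by (intro bexI[of _ "%s. f' s + g' s"]) (auto intro: cutoff_algebra.intros DERIV_add)
next
  case (6 f g)
  then obtain f' g' where *: "f' \<in> cutoff_algebra" "g' \<in> cutoff_algebra"
    "\<And>s. (f hrd f' s) (at s)" "\<And>s. (g hrd g' s) (at s)" by blast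
  have "((%s. f s * g s) hrd f' s * g s + g' s * f s) (at s)" for s
    by (rule DERIV_mult) (rule *)+
  then show ?case using * 6 by (intro bexI[of _ "%s. f' s * g s + g' s * f s"]) (auto intro: cutoff_algebra.intros)
qed

lemma locally_constant_derivative_zero:
  fixes f :: "real => real"
  assumes "(f hrd d) (at s)" and "\<And>u. u \<in> S ==> f u = c" and "s \<in> S" and "at s within S \<noteq> bot"
  shows "d = 0"
proof -
  have "(f hrd d) (at s within S)" using assms(1) by (rule has_field_derivative_at_within)
  moreover have "(f hrd 0) (at s within S)"
    using DERIV_const[of c "at s within S"]
    by (rule has_field_derivative_transform_within[where d = 1]) (use assms in auto)
  ultimately show ?thesis using assms(4) unfolding has_field_derivative_iff by (metis tendsto_unique)
qed

lemma at_within_half_lines_nontrivial: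
  "(s::real) <= b ==> at s within {..b} \<noteq> bot" "b <= s ==> at s within {b..} \<noteq> bot"
proof -
  have "at s within {..s} \<noteq> bot" "at s within {s..} \<noteq> bot"
    by (simp_all add: at_within_Iic_at_left at_within_Ici_at_right)
  moreover have "at s within {..s} <= at s within {..b}" if "s <= b" by (rule at_le) (use that in simp)
  moreover have "at s within {s..} <= at s within {b..}" if "b <= s" by (rule at_le) (use that in simp)
  ultimately show "s <= b ==> at s within {..b} \<noteq> bot" "b <= s ==> at s within {b..} \<noteq> bot"
    by (auto simp: bot_unique)
qed

text \<open>The quotient \<open>e(1 - s) / (e(s) + e(1 - s))\<close> with \<open>e(s) = exp (- 1/s)\<close>; all its derivatives stay in
\<open>cutoff_algebra\<close>, and those of positive order vanish where it is locally constant.\<close>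

lemma smooth_cutoff_exists:
  "\<exists>X :: nat => real => real. (\<forall>n s. (X n hrd X (Suc n) s) (at s)) \<and>
     X 0 0 = 1 \<and> (\<forall>n. X (Suc n) 0 = 0) \<and> (\<forall>n. \<forall>s\<ge>1. X n s = 0)"
proof -
  let ?f = "%s. flat_exp 0 (1 - s) * (inverse (flat_exp 0 s + flat_exp 0 (1 - s)))"
  define X where "X = (%n. (deriv ^^ n) ?f)"
  have in_alg: "X n \<in> cutoff_algebra" for n
  proof (induction n)
    case 0
    show ?case unfolding X_def funpow.simps id_apply by (intro cutoff_algebra.intros)
  next
    case (Suc n)
    then obtain g where g: "g \<in> cutoff_algebra" "\<And>s. (X n hrd g s) (at s)"
      using cutoff_algebra_derivative by blast
    then have "X (Suc n) = g" by (auto simp: X_def fun_eq_iff DERIV_imp_deriv)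
    then show ?case using g by simp
  qed
  have der: "(X n hrd X (Suc n) s) (at s)" for n s
  proof -
    obtain g where g: "\<And>s. (X n hrd g s) (at s)"
      using cutoff_algebra_derivative[OF in_alg] by blast
    have "X (Suc n) s = g s" using DERIV_imp_deriv[OF g] by (simp add: X_def)
    then show ?thesis using g[of s] by simp
  qed
  have low: "\<forall>s\<le>0. X n s = (if n = 0 then 1 else 0)" for n
  proof (induction n)
    case 0
    show ?case by (auto simp: X_def flat_exp_def)
  next
    case (Suc n)
    have "X (Suc n) s = 0" if "s <= 0" for s
      by (rule locally_constant_derivative_zero[OF der _ _ at_within_half_lines_nontrivial(1)[OF that],
            where c = "if n = 0 then 1 else 0"])
        (use Suc that in simp_all)
    then show ?case by simp
  qed
  have high: "\<forall>s\<ge>1. X n s = 0" for n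
  proof (induction n)
    case 0
    show ?case by (auto simp: X_def flat_exp_def)
  next
    case (Suc n)
    have "X (Suc n) s = 0" if "s >= 1" for s
      by (rule locally_constant_derivative_zero[OF der _ _ at_within_half_lines_nontrivial(2)[OF that], where c = 0])
        (use Suc that in simp_all)
    then show ?case by simp
  qed
  show ?thesis using der low high by (intro exI[of _ X]) auto
qed

definition cutoff :: "nat => real => real" where
  "cutoff = (SOME X. (\<forall>n s. (X n hrd X (Suc n) s) (at s)) \<and>
     X 0 0 = 1 \<and> (\<forall>n. X (Suc n) 0 = 0) \<and> (\<forall>n. \<forall>s\<ge>1. X n s = 0))"

lemma cutoff:
  "(cutoff n hrd cutoff (Suc n) s) (at s)"
  "cutoff 0 0 = 1" "cutoff (Suc n) 0 = 0" "s >= 1 ==> cutoff n s = 0"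
  using someI_ex[OF smooth_cutoff_exists, folded cutoff_def] by simp_all

text \<open>The derivative of order \<open>n\<close> of a product, for two sequences of derivatives.\<close>

primrec leibniz :: "nat => (nat => real => complex) => (nat => real => complex) => real => complex" where
  "leibniz 0 F G = (%s. F 0 s * G 0 s)"
| "leibniz (Suc n) F G = (%s. leibniz n (%i. F (Suc i)) G s + leibniz n F (%i. G (Suc i)) s)"

lemma leibniz_has_derivative:
  assumes "\<And>n. (F n hvd F (Suc n) s) (at s within S)"
    and "\<And>n. (G n hvd G (Suc n) s) (at s within S)"
  shows "(leibniz n F G hvd leibniz (Suc n) F G s) (at s within S)"
  using assms
proof (induction n arbitrary: F G)
  case 0
  show ?case using has_vector_derivative_mult[OF 0(1)[of 0] 0(2)[of 0]] by (simp add: add.commute)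
next
  case (Suc n)
  have "(leibniz n (%i. F (Suc i)) G hvd leibniz (Suc n) (%i. F (Suc i)) G s) (at s within S)"
    by (rule Suc.IH) (rule Suc.prems)+
  moreover have "(leibniz n F (%i. G (Suc i)) hvd leibniz (Suc n) F (%i. G (Suc i)) s) (at s within S)"
    by (rule Suc.IH) (rule Suc.prems)+
  ultimately show ?case unfolding leibniz.simps(2)[of "Suc n" F G] leibniz.simps(2)[of n F G]
    by (rule has_vector_derivative_add)
qed

lemma leibniz_zero: "(\<And>i. G i s = 0) ==> leibniz n F G s = 0"
  by (induction n arbitrary: F G) auto

lemma leibniz_flat: "G 0 s = 1 ==> (\<And>i. G (Suc i) s = 0) ==> leibniz n F G s = F n s"
  by (induction n arbitrary: F) (auto simp: leibniz_zero)

lemma leibniz_bound: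
  assumes "\<And>i. \<exists>b. \<forall>s\<in>S. norm (G i s) <= b"
  shows "\<exists>K\<ge>0. \<forall>F w s. s \<in> S --> (\<forall>i\<le>n. norm (F i s) <= w) --> norm (leibniz n F G s) <= K * w"
  using assms
proof (induction n arbitrary: G)
  case 0
  obtain b where b: "\<And>s. s \<in> S ==> norm (G 0 s) <= b" using 0[of 0] by blast
  have "norm (F 0 s * G 0 s) <= \<bar>b\<bar> * w" if "s \<in> S" "norm (F 0 s) <= w" for F :: "nat => real => complex" and w s
  proof -
    have "norm (F 0 s) * norm (G 0 s) <= w * \<bar>b\<bar>"
      using that b[OF that(1)] order_trans[OF norm_ge_zero that(2)] by (intro mult_mono) auto
    then show ?thesis by (simp add: norm_mult mult.commute)
  qed
  then show ?case by (intro exI[of _ "\<bar>b\<bar>"]) simp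
next
  case (Suc n)
  from Suc.IH[OF Suc.prems] obtain K1 where
    K1': "K1 >= 0 \<and> (\<forall>F w s. s \<in> S --> (\<forall>i\<le>n. norm (F i s) <= w) --> norm (leibniz n F G s) <= K1 * w)" ..
  note K1 = conjunct1[OF K1'] conjunct2[OF K1', rule_format]
  have "\<exists>b. \<forall>s\<in>S. norm (G (Suc i) s) <= b" for i by (rule Suc.prems)
  from Suc.IH[of "%i. G (Suc i)", OF this] obtain K2 where
    K2': "K2 >= 0 \<and> (\<forall>F w s. s \<in> S --> (\<forall>i\<le>n. norm (F i s) <= w) --> norm (leibniz n F (%i. G (Suc i)) s) <= K2 * w)" ..
  note K2 = conjunct1[OF K2'] conjunct2[OF K2', rule_format]
  have "norm (leibniz (Suc n) F G s) <= (K1 + K2) * w" if "s \<in> S" "\<forall>i\<le>Suc n. norm (F i s) <= w" for F w s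
  proof -
    have "norm (leibniz n (%i. F (Suc i)) G s) <= K1 * w" using that by (intro K1(2)) auto
    moreover have "norm (leibniz n F (%i. G (Suc i)) s) <= K2 * w" using that by (intro K2(2)) auto
    ultimately show ?thesis by (simp add: distrib_right norm_triangle_mono)
  qed
  then show ?case using K1(1) K2(1) by (intro exI[of _ "K1 + K2"] conjI allI impI) auto
qed

definition cut :: "(nat => real => complex) => nat => real => complex" where
  "cut F n = leibniz n F (%i s. cx (cutoff i s))"

text \<open>The series of Seeley samples arbitrarily large times, where nothing is known about \<open>F\<close>; a cutoff at
time 1, equal to 1 to infinite order at 0, removes this difficulty.\<close>

definition time_ext :: "(nat => real => complex) => nat => real => complex" where
  "time_ext F l t = (if t >= 0 then F l t else seeley_ext (cut F) l t)"

text \<open>The constant is uniform in \<open>F\<close>, which makes decay in a further parameter pass to the extension.\<close>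

lemma cut_bound:
  "\<exists>K\<ge>0. \<forall>F w s. s >= 0 --> w >= 0 --> (s <= 1 --> (\<forall>i\<le>n. norm (F i s) <= w)) --> norm (cut F n s) <= K * w"
proof -
  have "\<exists>b. \<forall>s\<in>{0..1}. norm (cx (cutoff i s)) <= b" for i
  proof -
    have "continuous_on {0..1} (cutoff i)"
      using DERIV_isCont[OF cutoff(1)] by (simp add: continuous_at_imp_continuous_on)
    then have "bounded (cutoff i ` {0..1})"
      by (intro compact_imp_bounded compact_continuous_image) auto
    then show ?thesis by (auto simp: bounded_iff)
  qed
  from leibniz_bound[of "{0..1}" "%i s. cx (cutoff i s)", OF this]
  obtain K where
    K': "K >= 0 \<and> (\<forall>F w s. s \<in> {0..1} --> (\<forall>i\<le>n. norm (F i s) <= w) --> norm (cut F n s) <= K * w)"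
    unfolding cut_def ..
  note K = conjunct1[OF K'] conjunct2[OF K', rule_format]
  have "norm (cut F n s) <= K * w" if "s >= 0" "w >= 0" "s <= 1 --> (\<forall>i\<le>n. norm (F i s) <= w)" for F w s
  proof (cases "s <= 1")
    case True
    then show ?thesis using that K(2) by simp
  next
    case False
    then have "cut F n s = 0" unfolding cut_def by (intro leibniz_zero) (simp add: cutoff(4))
    then show ?thesis using that K(1) by simp
  qed
  then show ?thesis using K(1) by (intro exI[of _ K] conjI allI impI)
qed

lemma time_ext_has_derivative:
  assumes der: "\<And>l t. t >= 0 ==> (F l hvd F (Suc l) t) (at t within {0..})"
  shows "(time_ext F l hvd time_ext F (Suc l) t) (at t)"
proof -
  have "(cut F n hvd cut F (Suc n) s) (at s within {0..})" if "s >= 0" for n s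
    unfolding cut_def
  proof (rule leibniz_has_derivative)
    show "(F i hvd F (Suc i) s) (at s within {0..})" for i by (rule der[OF that])
    show "((%s. cx (cutoff i s)) hvd cx (cutoff (Suc i) s)) (at s within {0..})" for i
      using cutoff(1)[of i s]
      by (intro has_vector_derivative_of_real) (simp add: has_real_derivative_iff_has_vector_derivative has_vector_derivative_at_within)
  qed
  moreover have "\<exists>B. \<forall>s\<ge>0. norm (cut F n s) <= B" for n
  proof -
    have "\<exists>b. \<forall>s\<in>{0..1}. norm (F i s) <= b" for i
    proof -
      have "continuous_on {0..} (F i)"
        using has_vector_derivative_continuous[OF der] by (auto simp: continuous_on_eq_continuous_within)
      then have "continuous_on {0..1} (F i)" by (rule continuous_on_subset) auto
      then have "bounded (F i ` {0..1})" by (intro compact_imp_bounded compact_continuous_image) auto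
      then show ?thesis by (auto simp: bounded_iff)
    qed
    then obtain b where b: "\<And>i s. s \<in> {0..1} ==> norm (F i s) <= b i" by metis
    from cut_bound[of n] obtain K where K': "K >= 0 \<and> (\<forall>F w s. s >= 0 --> w >= 0 --> (s <= 1 --> (\<forall>i\<le>n. norm (F i s) <= w)) --> norm (cut F n s) <= K * w)" ..
    note K = conjunct2[OF K']
    have b0: "b i >= 0" for i using order_trans[OF norm_ge_zero b[of 0 i]] by simp
    have "norm (cut F n s) <= K * (\<Sum>i\<le>n. b i)" if "s >= 0" for s
    proof (rule K[rule_format, OF that])
      show "0 <= sum b {..n}" using b0 by (intro sum_nonneg)
      fix i assume "s <= 1" "i <= n"
      then show "norm (F i s) <= sum b {..n}"
        using b[of s i] that member_le_sum[of i "{..n}" b] b0 by (force intro: order_trans)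
    qed
    then show ?thesis by blast
  qed
  ultimately have S: "(seeley_ext (cut F) n hvd seeley_ext (cut F) (Suc n) s) (at s)" for n s
    by (rule seeley_ext_has_derivative)
  have 0: "seeley_ext (cut F) n 0 = F n 0" for n
    unfolding seeley_ext_def cut_def by (simp add: leibniz_flat cutoff)
  have eq: "time_ext F n s = seeley_ext (cut F) n s" if "s <= 0" for n s
    using that 0[of n] by (cases "s = 0") (auto simp: time_ext_def)
  have left: "(time_ext F l hvd time_ext F (Suc l) t) (at t within {..0})" if "t <= 0" for t
  proof -
    have "(seeley_ext (cut F) l hvd seeley_ext (cut F) (Suc l) t) (at t within {..0})"
      by (rule has_vector_derivative_at_within[OF S])
    then have "(time_ext F l hvd seeley_ext (cut F) (Suc l) t) (at t within {..0})"
      by (rule has_vector_derivative_transform[rotated 2]) (use that eq in auto)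
    then show ?thesis using eq[OF that, of "Suc l"] by simp
  qed
  have right: "(time_ext F l hvd time_ext F (Suc l) t) (at t within {0..})" if "t >= 0" for t
    using has_vector_derivative_transform[OF _ _ der[OF that], where g = "time_ext F l"] that by (auto simp: time_ext_def)
  consider "t < 0" | "t = 0" | "t > 0" by linarith
  then show ?thesis
  proof cases
    case 1
    then show ?thesis using left[of t] at_within_interior[of t "{..0}"] by simp
  next
    case 2
    then show ?thesis using left[of 0] right[of 0] has_vector_derivative_at_glue by simp
  next
    case 3
    then show ?thesis using right[of t] at_within_interior[of t "{0..}"] by simp
  qed
qed

lemma norm_time_ext_le:
  "\<exists>K\<ge>0. \<forall>F w t. t < 0 --> (\<forall>i\<le>l. \<forall>s\<in>{0..1}. norm (F i s) <= w) --> norm (time_ext F l t) <= K * w"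
proof -
  from cut_bound[of l] obtain K where K': "K >= 0 \<and> (\<forall>F w s. s >= 0 --> w >= 0 --> (s <= 1 --> (\<forall>i\<le>l. norm (F i s) <= w)) --> norm (cut F l s) <= K * w)" ..
  note K = conjunct1[OF K'] conjunct2[OF K']
  have "norm (time_ext F l t) <= (seeley_norm l * K) * w" if t: "t < 0" and F: "\<forall>i\<le>l. \<forall>s\<in>{0..1}. norm (F i s) <= w" for F w t
  proof -
    have w: "w >= 0" using order_trans[OF norm_ge_zero, of "F 0 0" w] F by simp
    have "norm (seeley_ext (cut F) l t) <= seeley_norm l * (K * w)"
      by (rule norm_seeley_ext_le) (use K(2) F w in simp)
    then show ?thesis using t by (simp add: time_ext_def mult.assoc)
  qed
  moreover have "seeley_norm l * K >= 0" using K(1) seeley_norm_ge_1[of l] by simp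
  ultimately show ?thesis by (intro exI[of _ "seeley_norm l * K"] conjI allI impI)
qed

section \<open>Fourier transforms of rapidly decreasing families\<close>

text \<open>A sequence of iterated derivatives of a function on the line, each decaying like an integrable weight.\<close>

definition line_family :: "(nat => real => complex) => bool" where
  "line_family g \<longleftrightarrow> (\<forall>n y. (g n hvd g (Suc n) y) (at y)) \<and>
     (\<forall>n. \<exists>C. \<forall>y. norm (g n y) <= C / (1 + y\<^sup>2))"

text \<open>Decay is asked uniformly for \<open>t \<in> [0,T]\<close>. Time derivatives are only needed at \<open>n = 0\<close>, since derivatives in
\<open>x\<close> become powers of \<open>k\<close> after the Fourier transform.\<close>

definition force_family :: "(nat => nat => real => real => complex) => bool" where
  "force_family f \<longleftrightarrow>
     (\<forall>n l x t. t >= 0 --> ((%x. f n l x t) hvd f (Suc n) l x t) (at x)) \<and>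
     (\<forall>l x t. t >= 0 --> ((%t. f 0 l x t) hvd f 0 (Suc l) x t) (at t within {0..})) \<and>
     (\<forall>n l T. \<exists>C. \<forall>x t. 0 <= t --> t <= T --> norm (f n l x t) <= C / (1 + x\<^sup>2))"

lemma force_family_slice:
  assumes "force_family f" "t >= 0"
  shows "line_family (%n x. f n l x t)"
  unfolding line_family_def
proof (intro conjI allI)
  show "((%x. f n l x t) hvd f (Suc n) l y t) (at y)" for n y
    using assms by (simp add: force_family_def)
  fix n
  from assms(1) obtain C where "\<forall>x s. 0 <= s --> s <= t --> norm (f n l x s) <= C / (1 + x\<^sup>2)"
    unfolding force_family_def by presburger
  then show "\<exists>C. \<forall>y. norm (f n l y t) <= C / (1 + y\<^sup>2)"
    using assms(2) by (intro exI[of _ C]) simp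
qed

lemma line_family_bound:
  assumes "line_family g"
  shows "\<exists>C. \<forall>y. norm (g n y) <= C / (1 + y\<^sup>2)"
  using assms by (simp add: line_family_def)

lemma line_family_D:
  assumes "line_family g"
  shows "(g n hvd g (Suc n) y) (at y)" "continuous_on UNIV (g n)"
    "integrable lborel (g n)" "g n differentiable (at y)" (is ?D)
proof -
  show d: "(g n hvd g (Suc n) y) (at y)" for y using assms by (simp add: line_family_def)
  show c: "continuous_on UNIV (g n)"
    using has_vector_derivative_continuous[OF d] by (simp add: continuous_on_eq_continuous_within)
  from line_family_bound[OF assms, of n] obtain C where "\<forall>y. norm (g n y) <= C / (1 + y\<^sup>2)" ..
  then have "\<And>y. norm (g n y) <= C / (1 + y\<^sup>2)" by simp
  then show "integrable lborel (g n)"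
    by (rule integrable_inverse_square_bound[OF borel_measurable_continuous_onI[OF c]])
  show ?D using d[of y] by (rule differentiableI_vector)
qed

lemma inverse_square_weight_tendsto:
  "((%y. C / (1 + y\<^sup>2)) \<longlongrightarrow> 0) at_top" "((%y. C / (1 + y\<^sup>2)) \<longlongrightarrow> (0::real)) at_bot"
  by real_asymp+

lemma ft_derivative:
  assumes "line_family g"
  shows "ft (g (Suc n)) k = \<i> * cx k * ft (g n) k"
proof -
  note D = line_family_D[OF assms]
  let ?e = "%y. exp (- \<i> * cx k * cx y)"
  let ?F = "%y. ?e y * g n y"
  let ?f = "%y. ?e y * g (Suc n) y + - \<i> * cx k * ?e y * g n y"
  from line_family_bound[OF assms, of n] obtain C where "\<forall>y. norm (g n y) <= C / (1 + y\<^sup>2)" ..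
  then have C: "\<And>y. norm (g n y) <= C / (1 + y\<^sup>2)" by simp
  have i1: "integrable lborel (%y. ?e y * g (Suc n) y)" by (rule ft_integrable[OF D(3)])
  have "integrable lborel (%y. ?e y * g n y)" by (rule ft_integrable[OF D(3)])
  then have "integrable lborel (%y. - \<i> * cx k * (?e y * g n y))" by (rule integrable_mult_right)
  then have i2: "integrable lborel (%y. - \<i> * cx k * ?e y * g n y)" by (simp only: mult.assoc)
  have F: "(?F hvd ?f y) (at y)" for y
  proof -
    have "((%y. exp (- \<i> * cx k * cx y)) hvd - \<i> * cx k * ?e y) (at y)"
      using has_vector_derivative_cexp[of "- \<i> * cx k" y UNIV] by (simp add: mult.assoc)
    from has_vector_derivative_mult[OF this D(1)] show ?thesis .
  qed
  have lim: "(?F \<longlongrightarrow> 0) F" if "((%y. C / (1 + y\<^sup>2)) \<longlongrightarrow> 0) F" for F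
    by (rule Lim_null_comparison[OF _ that]) (use C in \<open>simp add: norm_mult\<close>)
  have "(LBINT y=-\<infinity>..\<infinity>. ?f y) = 0 - 0"
  proof (rule interval_integral_FTC_integrable[where F = ?F])
    show "isCont ?f x" for x
      using D(2) by (intro continuous_intros continuous_on_interior[OF D(2)]) auto
    show "set_integrable lborel (einterval (- \<infinity>) \<infinity>) ?f"
      using i1 i2 by (simp add: set_integrable_def)
    show "((?F \<circ> real_of_ereal) \<longlongrightarrow> 0) (at_right (- \<infinity>))"
      unfolding ereal_tendsto_simps by (rule lim[OF inverse_square_weight_tendsto(2)])
    show "((?F \<circ> real_of_ereal) \<longlongrightarrow> 0) (at_left \<infinity>)"
      unfolding ereal_tendsto_simps by (rule lim[OF inverse_square_weight_tendsto(1)])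
  qed (use F in auto)
  then have "(LINT y|lborel. ?f y) = 0"
    by (simp add: interval_lebesgue_integral_def set_lebesgue_integral_def)
  moreover have "(LINT y|lborel. ?f y) = ft (g (Suc n)) k + - \<i> * cx k * ft (g n) k"
  proof -
    have "(LINT y|lborel. ?f y) = (LINT y|lborel. ?e y * g (Suc n) y) + (LINT y|lborel. - \<i> * cx k * ?e y * g n y)"
      by (rule Bochner_Integration.integral_add[OF i1 i2])
    also have "(LINT y|lborel. - \<i> * cx k * ?e y * g n y) = - \<i> * cx k * ft (g n) k"
      unfolding ft_def by (subst integral_mult_right_zero[symmetric]) (simp only: mult.assoc)
    finally show ?thesis unfolding ft_def .
  qed
  ultimately show ?thesis by (simp add: eq_neg_iff_add_eq_0[symmetric])
qed

lemma ft_derivative_power: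
  assumes "line_family g"
  shows "ft (g n) k = (\<i> * cx k) ^ n * ft (g 0) k"
  by (induction n) (simp_all add: ft_derivative[OF assms] mult.assoc)

lemma norm_ft_le_weight:
  assumes "integrable lborel \<phi>" "\<And>y. norm (\<phi> y) <= C / (1 + y\<^sup>2)"
  shows "norm (ft \<phi> k) <= C * (LINT y|lborel. 1 / (1 + y\<^sup>2))"
proof -
  have "norm (ft \<phi> k) <= (LINT y|lborel. norm (\<phi> y))" by (rule norm_ft_le[OF assms(1)])
  also have "\<dots> <= (LINT y|lborel. C * (1 / (1 + y\<^sup>2)))"
    by (rule integral_mono[OF integrable_norm[OF assms(1)]])
       (use integrable_inverse_square_weight[of C] assms(2) in auto)
  also have "\<dots> = C * (LINT y|lborel. 1 / (1 + y\<^sup>2))" by (rule integral_mult_right_zero)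
  finally show ?thesis .
qed

definition fhat :: "(nat => nat => real => real => complex) => nat => real => real => complex" where
  "fhat f l k t = ft (%x. f 0 l x t) k"

text \<open>The extension to negative times is made after the Fourier transform in \<open>x\<close>, for each frequency.\<close>

definition fext :: "(nat => nat => real => real => complex) => nat => real => real => complex" where
  "fext f l k = time_ext (%l. fhat f l k) l"

lemma fhat_bound:
  assumes "force_family f"
  shows "\<exists>C. \<forall>k t. 0 <= t --> t <= T --> \<bar>k\<bar> ^ N * norm (fhat f l k t) <= C"
proof -
  from assms obtain C where C: "\<forall>x t. 0 <= t --> t <= T --> norm (f N l x t) <= C / (1 + x\<^sup>2)"
    unfolding force_family_def by presburger
  have "\<bar>k\<bar> ^ N * norm (fhat f l k t) <= C * (LINT y|lborel. 1 / (1 + y\<^sup>2))" if t: "0 <= t" "t <= T" for k t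
  proof -
    note L = force_family_slice[OF assms t(1), of l]
    have "norm (ft (%x. f N l x t) k) <= C * (LINT y|lborel. 1 / (1 + y\<^sup>2))"
      by (rule norm_ft_le_weight[OF line_family_D(3)[OF L]]) (use C t in simp)
    then show ?thesis unfolding ft_derivative_power[OF L, of N k] fhat_def
      by (simp add: norm_mult norm_power)
  qed
  then show ?thesis by (intro exI allI impI)
qed

lemma at_within_half_line_Icc:
  assumes "0 <= t" "t < (T::real)"
  shows "at t within {0..T} = at t within {0..}"
  by (rule at_within_nhd[of t "{..<T}"]) (use assms in auto)

lemma fhat_has_derivative:
  assumes f: "force_family f" and t: "t >= 0"
  shows "(fhat f l k hvd fhat f (Suc l) k t) (at t within {0..})"
proof -
  from f obtain C where C: "\<forall>x s. 0 <= s --> s <= t + 1 --> norm (f 0 (Suc l) x s) <= C / (1 + x\<^sup>2)"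
    unfolding force_family_def by presburger
  have L: "line_family (%n x. f n l x s)" if "s >= 0" for s l by (rule force_family_slice[OF f that])
  have "((%s. LINT x|lborel. exp (- \<i> * cx k * x) * f 0 l x s) hvd
      (LINT x|lborel. exp (- \<i> * cx k * x) * f 0 (Suc l) x t)) (at t within {0..t+1})"
  proof (rule has_vector_derivative_dominated_integral[where w = "%x. C / (1 + x\<^sup>2)"])
    fix s x assume s: "s \<in> {0..t+1}"
    have "((%t. f 0 l x t) hvd f 0 (Suc l) x s) (at s within {0..t+1})"
      by (rule has_vector_derivative_within_subset[where S = "{0..}"])
         (use f s in \<open>auto simp: force_family_def\<close>)
    then show "((%s. exp (- \<i> * cx k * x) * f 0 l x s) hvd
       exp (- \<i> * cx k * x) * f 0 (Suc l) x s) (at s within {0..t+1})"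
      by (rule has_vector_derivative_mult_right)
    show "norm (exp (- \<i> * cx k * x) * f 0 (Suc l) x s) <= C / (1 + x\<^sup>2)"
      using C s by (simp add: norm_mult)
  next
    show "integrable lborel (%x. C / (1 + x\<^sup>2))" by (rule integrable_inverse_square_weight)
    show "integrable lborel (%x. exp (- \<i> * cx k * x) * f 0 l x s)" if "s \<in> {0..t+1}" for s
      by (rule ft_integrable[OF line_family_D(3)[OF L]]) (use that in auto)
    have "integrable lborel (%x. exp (- \<i> * cx k * x) * f 0 (Suc l) x t)"
      by (rule ft_integrable[OF line_family_D(3)[OF L]]) (rule t)
    then show "(%x. exp (- \<i> * cx k * x) * f 0 (Suc l) x t) \<in> borel_measurable lborel" by auto
  qed (use t in auto)
  then show ?thesis unfolding fhat_def ft_def at_within_half_line_Icc[OF t less_add_one] .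
qed

lemma fext_has_derivative:
  "force_family f ==> (fext f l k hvd fext f (Suc l) k t) (at t)"
  unfolding fext_def by (rule time_ext_has_derivative) (rule fhat_has_derivative)

lemma fext_eq: "t >= 0 ==> fext f l k t = fhat f l k t"
  by (simp add: fext_def time_ext_def)

text \<open>Rapid decay in \<open>k\<close>, locally uniformly in time; the lower end \<open>- 1\<close> is an arbitrary negative time, which
leaves a neighbourhood of \<open>t = 0\<close>.\<close>

definition rapid :: "(real => real => complex) => bool" where
  "rapid V \<longleftrightarrow> (\<forall>N T. \<exists>C. \<forall>k t. - 1 <= t --> t <= T --> \<bar>k\<bar> ^ N * norm (V k t) <= C)"

lemma rapidD:
  assumes "rapid V"
  obtains C where "C >= 0" "\<And>k t. - 1 <= t ==> t <= T ==> \<bar>k\<bar> ^ N * norm (V k t) <= C"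
proof -
  from assms obtain C where C: "\<forall>k t. - 1 <= t --> t <= T --> \<bar>k\<bar> ^ N * norm (V k t) <= C"
    unfolding rapid_def by presburger
  show ?thesis
  proof (rule that[of "\<bar>C\<bar>"])
    show "\<bar>k\<bar> ^ N * norm (V k t) <= \<bar>C\<bar>" if "- 1 <= t" "t <= T" for k t
      using C[rule_format, OF that, of k] by linarith
  qed simp
qed

lemma fext_rapid:
  assumes f: "force_family f"
  shows "rapid (fext f l)"
  unfolding rapid_def
proof (intro allI)
  fix N and T :: real
  obtain C1 where C1: "\<forall>k t. 0 <= t --> t <= T --> \<bar>k\<bar> ^ N * norm (fhat f l k t) <= C1"
    using fhat_bound[OF f] by blast
  have "\<exists>C. \<forall>k t. 0 <= t --> t <= 1 --> \<bar>k\<bar> ^ N * norm (fhat f i k t) <= C" for i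
    by (rule fhat_bound[OF f])
  then obtain D where D: "\<And>i k t. 0 <= t ==> t <= 1 ==> \<bar>k\<bar> ^ N * norm (fhat f i k t) <= D i" by metis
  have D0: "D i >= 0" for i
    using order_trans[OF _ D[of 0 0 i]] by simp
  from norm_time_ext_le[of l] obtain K where
    K: "K >= 0 \<and> (\<forall>F w t. t < 0 --> (\<forall>i\<le>l. \<forall>s\<in>{0..1}. norm (F i s) <= w) --> norm (time_ext F l t) <= K * w)" ..
  have neg: "\<bar>k\<bar> ^ N * norm (fext f l k t) <= K * sum D {..l}" if t: "t < 0" for k t
  proof -
    let ?F = "%i s. cx (\<bar>k\<bar> ^ N) * fhat f i k s"
    have "\<forall>i\<le>l. \<forall>s\<in>{0..1}. norm (?F i s) <= sum D {..l}"
    proof (intro allI impI ballI)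
      fix i and s :: real assume "i <= l" "s \<in> {0..1}"
      then have "norm (?F i s) <= D i" using D[of s k i] by (simp add: norm_mult norm_power)
      also have "D i <= sum D {..l}" using \<open>i <= l\<close> D0 by (intro member_le_sum) auto
      finally show "norm (?F i s) <= sum D {..l}" .
    qed
    then have "norm (time_ext ?F l t) <= K * sum D {..l}"
      by (intro conjunct2[OF K, rule_format, OF t]) simp
    moreover have "time_ext ?F l t = cx (\<bar>k\<bar> ^ N) * fext f l k t"
    proof -
      have *: "leibniz n (%i s. c * F i s) G s = c * leibniz n F G s" for c :: complex and n F G s
        by (induction n arbitrary: F G) (simp_all add: algebra_simps)
      have "cut ?F n s = cx (\<bar>k\<bar> ^ N) * cut (%l. fhat f l k) n s" for n s
        unfolding cut_def by (rule *)
      then show ?thesis using t unfolding fext_def time_ext_def seeley_ext_def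
        by (simp add: mult.left_commute)
    qed
    ultimately show ?thesis by (simp add: norm_mult norm_power)
  qed
  show "\<exists>C. \<forall>k t. - 1 <= t --> t <= T --> \<bar>k\<bar> ^ N * norm (fext f l k t) <= C"
  proof (intro exI[of _ "max C1 (K * sum D {..l})"] allI impI)
    fix k t :: real assume "- 1 <= t" "t <= T"
    then show "\<bar>k\<bar> ^ N * norm (fext f l k t) <= max C1 (K * sum D {..l})"
      using neg[of t k] C1[rule_format, of t k] by (cases "t < 0") (auto simp: fext_eq le_max_iff_disj)
  qed
qed

lemma fhat_continuous_in_k:
  assumes "force_family f" "t >= 0"
  shows "continuous_on UNIV (%k. fhat f l k t)"
  using continuous_on_ft[OF line_family_D(3)[OF force_family_slice[OF assms, of l]]]
  unfolding fhat_def by simp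

lemma leibniz_continuous_param:
  fixes F :: "'p::topological_space => nat => real => complex"
  assumes "\<And>i. continuous_on S (%k. F k i s)"
  shows "continuous_on S (%k. leibniz n (F k) G s)"
  using assms
proof (induction n arbitrary: F G)
  case 0
  show ?case unfolding leibniz.simps by (intro continuous_intros 0)
next
  case (Suc n)
  have "continuous_on S (%k. leibniz n (%i. F k (Suc i)) G s)"
    using Suc.IH[of "%k i. F k (Suc i)"] Suc.prems by blast
  moreover have "continuous_on S (%k. leibniz n (F k) (%i. G (Suc i)) s)"
    by (rule Suc.IH) (rule Suc.prems)
  ultimately show ?case unfolding leibniz.simps by (rule continuous_on_add)
qed

lemma fext_continuous_in_k:
  assumes f: "force_family f"
  shows "continuous_on UNIV (%k. fext f l k t)"
proof (cases "t >= 0")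
  case True
  then show ?thesis using fhat_continuous_in_k[OF f True, of l] by (simp add: fext_eq)
next
  case False
  have "\<exists>C. \<forall>k t. 0 <= t --> t <= 1 --> \<bar>k\<bar> ^ 0 * norm (fhat f i k t) <= C" for i
    by (rule fhat_bound[OF f])
  then obtain D where D: "\<And>i k t. 0 <= t ==> t <= 1 ==> \<bar>k\<bar> ^ 0 * norm (fhat f i k t) <= D i" by metis
  have D0: "D i >= 0" for i
    using order_trans[OF _ D[of 0 0 i]] by simp
  from cut_bound[of l] obtain K where K: "K >= 0 \<and> (\<forall>F w s. s >= 0 --> w >= 0 --> (s <= 1 --> (\<forall>i\<le>l. norm (F i s) <= w)) --> norm (cut F l s) <= K * w)" ..
  have b: "norm (cut (%l. fhat f l k) l s) <= K * sum D {..l}" if s: "s >= 0" for k s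
  proof (rule conjunct2[OF K, rule_format, OF s])
    show "sum D {..l} >= 0" using D0 by (intro sum_nonneg)
    fix i assume "s <= 1" "i <= l"
    then have "norm (fhat f i k s) <= D i" using D[of s k i] s by simp
    also have "D i <= sum D {..l}" using \<open>i <= l\<close> D0 by (intro member_le_sum) auto
    finally show "norm (fhat f i k s) <= sum D {..l}" .
  qed
  have "continuous_on UNIV (%k. LINT j|count_space UNIV. cx (seeley_coeff j * (- (2 ^ j)) ^ l) * cut (%l. fhat f l k) l (- (2 ^ j) * t))"
  proof (rule continuous_on_dominated_integral[where w = "%j. \<bar>seeley_coeff j\<bar> * (2 ^ j) ^ l * (K * sum D {..l})"])
    have pos: "- (2 ^ j) * t >= 0" for j :: nat using False by (simp add: mult_nonneg_nonpos)
    show "integrable (count_space UNIV) (%j. \<bar>seeley_coeff j\<bar> * (2 ^ j) ^ l * (K * sum D {..l}))"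
      by (rule seeley_terms(2)[of "%j. cut (%l. fhat f l 0) l (- (2 ^ j) * t)"]) (rule b[OF pos])
    show "norm (cx (seeley_coeff j * (- (2 ^ j)) ^ l) * cut (%l. fhat f l k) l (- (2 ^ j) * t))
       <= \<bar>seeley_coeff j\<bar> * (2 ^ j) ^ l * (K * sum D {..l})" for j k
      by (rule seeley_terms(1)[of "%j. cut (%l. fhat f l k) l (- (2 ^ j) * t)"]) (rule b[OF pos])
    show "continuous_on UNIV (%k. cx (seeley_coeff j * (- (2 ^ j)) ^ l) * cut (%l. fhat f l k) l (- (2 ^ j) * t))" for j
      unfolding cut_def
      by (intro continuous_on_mult_left leibniz_continuous_param fhat_continuous_in_k[OF f pos])
  qed simp
  then show ?thesis using False by (simp add: fext_def time_ext_def seeley_ext_def)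
qed

section \<open>The free Dirac propagator in Fourier variables\<close>

text \<open>The matrix exponential of \<open>- i t M\<close>, with \<open>M\<close> the symmetric matrix with rows \<open>(m, k)\<close> and \<open>(k, - m)\<close>, has
these entries because \<open>M\<^sup>2 = \<rho>\<^sup>2\<close>. At \<open>\<rho> = 0\<close> the quotient \<open>sin (\<rho> t) / \<rho>\<close> has value 0
instead of its limit \<open>t\<close>, which does no harm since the factors \<open>m\<close> and \<open>k\<close> vanish there.\<close>

definition pc :: "real => real => real => real" where "pc m k t = cos (rho m k * t)"
definition pa :: "real => real => real => real" where "pa m k t = m * (sin (rho m k * t) / rho m k)"
definition pb :: "real => real => real => real" where "pb m k t = k * (sin (rho m k * t) / rho m k)"

lemma rho_squared: "(rho m k)\<^sup>2 = k\<^sup>2 + m\<^sup>2" by (simp add: rho_def)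

lemma rho_nonneg: "rho m k >= 0" by (simp add: rho_def)

lemma rho_zero: "rho m k = 0 ==> m = 0 \<and> k = 0"
  using rho_squared[of m k] by (simp add: sum_power2_eq_zero_iff)

lemma abs_le_rho: "\<bar>k\<bar> <= rho m k" "\<bar>m\<bar> <= rho m k"
proof -
  have "sqrt (k\<^sup>2) <= rho m k" "sqrt (m\<^sup>2) <= rho m k"
    unfolding rho_def by (rule real_sqrt_le_mono, simp)+
  then show "\<bar>k\<bar> <= rho m k" "\<bar>m\<bar> <= rho m k" by simp_all
qed

lemma pa_pb_relation: "m * pb m k t = k * pa m k t"
  unfolding pa_def pb_def by (rule mult.left_commute)

lemma prop_coeff_derivatives:
  "(pc m k hrd - (m * pa m k t + k * pb m k t)) (at t within S)"
  "(pa m k hrd m * pc m k t) (at t within S)"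
  "(pb m k hrd k * pc m k t) (at t within S)"
proof -
  have r: "m * (m * (s / rho m k)) + k * (k * (s / rho m k)) = rho m k * s" for s
  proof (cases "rho m k = 0")
    case True
    then show ?thesis using rho_zero[OF True] by simp
  next
    case False
    have "m * (m * (s / rho m k)) + k * (k * (s / rho m k)) = (rho m k)\<^sup>2 * s / rho m k"
      unfolding rho_squared by (simp add: power2_eq_square algebra_simps add_divide_distrib)
    then show ?thesis using False by (simp add: power2_eq_square)
  qed
  have "(pc m k hrd - (rho m k * sin (rho m k * t))) (at t within S)"
    unfolding pc_def by (auto intro!: derivative_eq_intros)
  then show "(pc m k hrd - (m * pa m k t + k * pb m k t)) (at t within S)"
    unfolding pa_def pb_def r .
  have s: "((%t. x * (sin (rho m k * t) / rho m k)) hrd x * pc m k t) (at t within S)"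
    if "rho m k = 0 --> x = 0" for x
  proof (cases "rho m k = 0")
    case False
    then show ?thesis unfolding pc_def by (auto intro!: derivative_eq_intros)
  qed (use that in simp)
  show "(pa m k hrd m * pc m k t) (at t within S)"
    unfolding pa_def by (rule s) (use rho_zero in blast)
  show "(pb m k hrd k * pc m k t) (at t within S)"
    unfolding pb_def by (rule s) (use rho_zero in blast)
qed

lemma prop_coeff_bounds: "\<bar>pc m k t\<bar> <= 1" "\<bar>pa m k t\<bar> <= 1" "\<bar>pb m k t\<bar> <= 1"
proof -
  show "\<bar>pc m k t\<bar> <= 1" by (simp add: pc_def)
  have s: "\<bar>x * (sin (rho m k * t) / rho m k)\<bar> <= 1" if "\<bar>x\<bar> <= rho m k" for x
  proof (cases "rho m k = 0")
    case False
    then have "rho m k > 0" using rho_nonneg[of m k] by simp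
    moreover have "\<bar>x\<bar> * \<bar>sin (rho m k * t)\<bar> <= rho m k * 1"
      using that by (intro mult_mono) auto
    ultimately show ?thesis by (simp add: abs_mult)
  qed simp
  show "\<bar>pa m k t\<bar> <= 1" "\<bar>pb m k t\<bar> <= 1"
    unfolding pa_def pb_def by (rule s, rule abs_le_rho)+
qed

lemma prop_coeff_zero [simp]: "pc m k 0 = 1" "pa m k 0 = 0" "pb m k 0 = 0"
  by (simp_all add: pc_def pa_def pb_def)

lemma prop_coeff_minus [simp]: "pc m k (- t) = pc m k t" "pa m k (- t) = - pa m k t" "pb m k (- t) = - pb m k t"
  by (simp_all add: pc_def pa_def pb_def)

lemma prop_coeff_add:
  "pc m k (s + t) = pc m k s * pc m k t - pa m k s * pa m k t - pb m k s * pb m k t"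
  "pa m k (s + t) = pa m k s * pc m k t + pc m k s * pa m k t"
  "pb m k (s + t) = pb m k s * pc m k t + pc m k s * pb m k t"
proof -
  have "pa m k s * pa m k t + pb m k s * pb m k t = sin (rho m k * s) * sin (rho m k * t)"
  proof (cases "rho m k = 0")
    case False
    have "pa m k s * pa m k t + pb m k s * pb m k t = (k\<^sup>2 + m\<^sup>2) * (sin (rho m k * s) * sin (rho m k * t)) / (rho m k)\<^sup>2"
      by (simp add: pa_def pb_def power2_eq_square algebra_simps add_divide_distrib)
    then show ?thesis using False by (simp add: rho_squared[symmetric])
  qed (simp add: pa_def pb_def)
  then show "pc m k (s + t) = pc m k s * pc m k t - pa m k s * pa m k t - pb m k s * pb m k t"
    unfolding pc_def distrib_left cos_add by linarith
  show "pa m k (s + t) = pa m k s * pc m k t + pc m k s * pa m k t"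
    "pb m k (s + t) = pb m k s * pc m k t + pc m k s * pb m k t"
    unfolding pc_def pa_def pb_def distrib_left sin_add by (simp_all add: algebra_simps add_divide_distrib)
qed

text \<open>The two components of the propagator applied to a vector.\<close>

definition prop1 :: "real => real => real => complex => complex => complex" where
  "prop1 m k t y z = (pc m k t - \<i> * pa m k t) * y - \<i> * pb m k t * z"
definition prop2 :: "real => real => real => complex => complex => complex" where
  "prop2 m k t y z = - \<i> * pb m k t * y + (pc m k t + \<i> * pa m k t) * z"

lemma prop_zero [simp]: "prop1 m k 0 y z = y" "prop2 m k 0 y z = z"
  by (simp_all add: prop1_def prop2_def)

lemma prop_prop:
  "prop1 m k s (prop1 m k t y z) (prop2 m k t y z) = prop1 m k (s + t) y z"
  "prop2 m k s (prop1 m k t y z) (prop2 m k t y z) = prop2 m k (s + t) y z"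
proof -
  have "pa m k s * pb m k t = pb m k s * pa m k t" by (simp add: pa_def pb_def)
  then have r: "cx (pa m k s) * pb m k t = cx (pb m k s) * pa m k t"
    by (simp flip: of_real_mult)
  have i: "\<i> * (\<i> * x) = - x" for x by (simp flip: mult.assoc)
  show "prop1 m k s (prop1 m k t y z) (prop2 m k t y z) = prop1 m k (s + t) y z"
    unfolding prop1_def prop2_def prop_coeff_add of_real_add of_real_diff of_real_mult
    using r by (simp add: algebra_simps i)
  show "prop2 m k s (prop1 m k t y z) (prop2 m k t y z) = prop2 m k (s + t) y z"
    unfolding prop1_def prop2_def prop_coeff_add of_real_add of_real_diff of_real_mult
    using r by (simp add: algebra_simps i)
qed

lemma norm_prop_le:
  "norm (prop1 m k t y z) <= 2 * (norm y + norm z)" "norm (prop2 m k t y z) <= 2 * (norm y + norm z)"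
proof -
  note b = prop_coeff_bounds[of m k t]
  have 1: "norm (cx (pc m k t) - \<i> * pa m k t) <= 2"
    by (rule order_trans[OF norm_triangle_ineq4]) (use b in \<open>simp add: norm_mult\<close>)
  have 2: "norm (cx (pc m k t) + \<i> * pa m k t) <= 2"
    by (rule order_trans[OF norm_triangle_ineq]) (use b in \<open>simp add: norm_mult\<close>)
  have 3: "norm (\<i> * cx (pb m k t)) <= 2" using b(3) by (simp add: norm_mult)
  have "norm (prop1 m k t y z) <= norm ((cx (pc m k t) - \<i> * pa m k t) * y) + norm (\<i> * pb m k t * z)"
    unfolding prop1_def by (rule norm_triangle_ineq4)
  also have "\<dots> <= 2 * norm y + 2 * norm z"
    unfolding norm_mult[of _ y] norm_mult[of _ z] by (intro add_mono mult_right_mono 1 3 norm_ge_zero)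
  finally show "norm (prop1 m k t y z) <= 2 * (norm y + norm z)" by simp
  have "norm (prop2 m k t y z) <= norm (- \<i> * pb m k t * y) + norm ((cx (pc m k t) + \<i> * pa m k t) * z)"
    unfolding prop2_def by (rule norm_triangle_ineq)
  also have "\<dots> = norm (\<i> * cx (pb m k t)) * norm y + norm (cx (pc m k t) + \<i> * pa m k t) * norm z"
    by (simp add: norm_mult)
  also have "\<dots> <= 2 * norm y + 2 * norm z"
    by (intro add_mono mult_right_mono 2 3 norm_ge_zero)
  finally show "norm (prop2 m k t y z) <= 2 * (norm y + norm z)" by simp
qed

lemma has_vector_derivative_of_real':
  "(f hrd d) F ==> ((%t. cx (f t)) hvd cx d) F"
  by (rule has_vector_derivative_of_real) (simp add: has_real_derivative_iff_has_vector_derivative)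

lemma prop_has_derivative:
  assumes Y: "(Y hvd Y') (at t within S)" and Z: "(Z hvd Z') (at t within S)"
  shows "((%t. prop1 m k t (Y t) (Z t)) hvd
      (- \<i> * m * prop1 m k t (Y t) (Z t) - \<i> * k * prop2 m k t (Y t) (Z t) + prop1 m k t Y' Z')) (at t within S)" (is ?A)
    and "((%t. prop2 m k t (Y t) (Z t)) hvd
      (- \<i> * k * prop1 m k t (Y t) (Z t) + \<i> * m * prop2 m k t (Y t) (Z t) + prop2 m k t Y' Z')) (at t within S)" (is ?B)
proof -
  note c = has_vector_derivative_of_real'[OF prop_coeff_derivatives(1)[of m k t S]]
  note a = has_vector_derivative_of_real'[OF prop_coeff_derivatives(2)[of m k t S]]
  note b = has_vector_derivative_of_real'[OF prop_coeff_derivatives(3)[of m k t S]]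
  have r: "cx m * pb m k t = cx k * pa m k t"
    using pa_pb_relation[of m k t] by (simp flip: of_real_mult)
  have i: "\<i> * (\<i> * x) = - x" for x by (simp flip: mult.assoc)
  note ia = has_vector_derivative_mult_right[OF a, of \<i>]
  note ib = has_vector_derivative_mult_right[OF b, of \<i>]
  note ib' = has_vector_derivative_mult_right[OF b, of "- \<i>"]
  have r': "cx m * (pb m k t * x) = cx k * (pa m k t * x)" for x
    using r by (simp flip: mult.assoc)
  show ?A
    unfolding prop1_def prop2_def
    by (rule has_vector_derivative_eq_rhs[OF has_vector_derivative_diff[OF
          has_vector_derivative_mult[OF has_vector_derivative_diff[OF c ia] Y] has_vector_derivative_mult[OF ib Z]]])
       (simp add: algebra_simps i r r')
  show ?B
    unfolding prop1_def prop2_def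
    by (rule has_vector_derivative_eq_rhs[OF has_vector_derivative_add[OF
          has_vector_derivative_mult[OF ib' Y] has_vector_derivative_mult[OF has_vector_derivative_add[OF c ia] Z]]])
       (simp add: algebra_simps i r r')
qed

lemma prop_coeff_continuous: "continuous_on S (pc m k)" "continuous_on S (pa m k)" "continuous_on S (pb m k)"
  using DERIV_continuous[OF prop_coeff_derivatives(1)] DERIV_continuous[OF prop_coeff_derivatives(2)]
    DERIV_continuous[OF prop_coeff_derivatives(3)]
  by (simp_all add: continuous_on_eq_continuous_within)

lemma prop_continuous:
  assumes "continuous_on S s" "continuous_on S Y" "continuous_on S Z"
  shows "continuous_on S (%\<tau>. prop1 m k (s \<tau>) (Y \<tau>) (Z \<tau>))" (is ?A) "continuous_on S (%\<tau>. prop2 m k (s \<tau>) (Y \<tau>) (Z \<tau>))" (is ?B)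
proof -
  have "continuous_on S (%\<tau>. pc m k (s \<tau>))" "continuous_on S (%\<tau>. pa m k (s \<tau>))" "continuous_on S (%\<tau>. pb m k (s \<tau>))"
    using continuous_on_compose2[OF prop_coeff_continuous(1)[of UNIV m k] assms(1)]
      continuous_on_compose2[OF prop_coeff_continuous(2)[of UNIV m k] assms(1)]
      continuous_on_compose2[OF prop_coeff_continuous(3)[of UNIV m k] assms(1)] by simp_all
  note c = this
  show ?A
    unfolding prop1_def by (intro continuous_intros assms c)
  show ?B
    unfolding prop2_def by (intro continuous_intros assms c)
qed

text \<open>The vector \<open>X\<close> solves the linear system with source \<open>b\<close>, and the propagator with time \<open>t - \<tau>\<close> turns it into
a function of \<open>\<tau>\<close> whose derivative is the integrand.\<close>

lemma duhamel_identity: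
  fixes X1 X2 b1 b2 :: "real => complex"
  assumes t: "t >= 0"
    and X1: "\<And>\<tau>. \<tau> \<in> {0..t} ==> (X1 hvd - \<i> * m * X1 \<tau> - \<i> * k * X2 \<tau> + b1 \<tau>) (at \<tau> within {0..t})"
    and X2: "\<And>\<tau>. \<tau> \<in> {0..t} ==> (X2 hvd - \<i> * k * X1 \<tau> + \<i> * m * X2 \<tau> + b2 \<tau>) (at \<tau> within {0..t})"
  shows "((%\<tau>. prop1 m k (t - \<tau>) (b1 \<tau>) (b2 \<tau>)) has_integral X1 t - prop1 m k t (X1 0) (X2 0)) {0..t}" (is ?A)
    and "((%\<tau>. prop2 m k (t - \<tau>) (b1 \<tau>) (b2 \<tau>)) has_integral X2 t - prop2 m k t (X1 0) (X2 0)) {0..t}" (is ?B)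
proof -
  have r: "cx m * pb m k u = cx k * pa m k u" for u
    using pa_pb_relation[of m k u] by (simp flip: of_real_mult)
  have r': "cx m * (pb m k u * x) = cx k * (pa m k u * x)" for x u
    using r by (simp flip: mult.assoc)
  have i: "\<i> * (\<i> * x) = - x" for x by (simp flip: mult.assoc)
  have sh: "((%\<tau>. h (t - \<tau>)) hvd - d) (at \<tau> within {0..t})"
    if "(h hvd d) (at (t - \<tau>))" for h :: "real => complex" and d \<tau>
  proof -
    have "((%\<tau>. t - \<tau>) hvd - 1) (at \<tau> within {0..t})"
      by (auto intro!: derivative_eq_intros simp: has_real_derivative_iff_has_vector_derivative[symmetric])
    from vector_diff_chain_within[OF this has_vector_derivative_at_within[OF that]] show ?thesis by (simp add: o_def)
  qed
  have c: "((%\<tau>. cx (pc m k (t - \<tau>))) hvd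
      - cx (- (m * pa m k (t - \<tau>) + k * pb m k (t - \<tau>)))) (at \<tau> within {0..t})" for \<tau>
    by (rule sh) (rule has_vector_derivative_of_real'[OF prop_coeff_derivatives(1)])
  have a: "((%\<tau>. \<i> * cx (pa m k (t - \<tau>))) hvd
      \<i> * - cx (m * pc m k (t - \<tau>))) (at \<tau> within {0..t})" for \<tau>
    by (rule has_vector_derivative_mult_right[OF sh]) (rule has_vector_derivative_of_real'[OF prop_coeff_derivatives(2)])
  have b: "((%\<tau>. \<i> * cx (pb m k (t - \<tau>))) hvd
      \<i> * - cx (k * pc m k (t - \<tau>))) (at \<tau> within {0..t})" for \<tau>
    by (rule has_vector_derivative_mult_right[OF sh]) (rule has_vector_derivative_of_real'[OF prop_coeff_derivatives(3)])
  have b': "((%\<tau>. - \<i> * cx (pb m k (t - \<tau>))) hvd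
      - \<i> * - cx (k * pc m k (t - \<tau>))) (at \<tau> within {0..t})" for \<tau>
    by (rule has_vector_derivative_mult_right[OF sh]) (rule has_vector_derivative_of_real'[OF prop_coeff_derivatives(3)])
  have d1: "((%\<tau>. prop1 m k (t - \<tau>) (X1 \<tau>) (X2 \<tau>)) hvd prop1 m k (t - \<tau>) (b1 \<tau>) (b2 \<tau>)) (at \<tau> within {0..t})"
    if "\<tau> \<in> {0..t}" for \<tau>
    unfolding prop1_def
    by (rule has_vector_derivative_eq_rhs[OF has_vector_derivative_diff[OF
          has_vector_derivative_mult[OF has_vector_derivative_diff[OF c a] X1[OF that]] has_vector_derivative_mult[OF b X2[OF that]]]])
       (simp add: algebra_simps i r r')
  have d2: "((%\<tau>. prop2 m k (t - \<tau>) (X1 \<tau>) (X2 \<tau>)) hvd prop2 m k (t - \<tau>) (b1 \<tau>) (b2 \<tau>)) (at \<tau> within {0..t})"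
    if "\<tau> \<in> {0..t}" for \<tau>
    unfolding prop2_def
    by (rule has_vector_derivative_eq_rhs[OF has_vector_derivative_add[OF
          has_vector_derivative_mult[OF b' X1[OF that]] has_vector_derivative_mult[OF has_vector_derivative_add[OF c a] X2[OF that]]]])
       (simp add: algebra_simps i r r')
  show ?A
    using fundamental_theorem_of_calculus[OF t d1] by simp
  show ?B
    using fundamental_theorem_of_calculus[OF t d2] by simp
qed

lemma propagator_continuous_in_k:
  "continuous_on UNIV (%k. pc m k t)" "continuous_on UNIV (%k. pa m k t)" "continuous_on UNIV (%k. pb m k t)"
proof -
  show "continuous_on UNIV (%k. pc m k t)" unfolding pc_def rho_def by (intro continuous_intros)
  show "continuous_on UNIV (%k. pa m k t)"
  proof (cases "m = 0")
    case False
    then have "sqrt (k\<^sup>2 + m\<^sup>2) \<noteq> 0" for k by (simp add: add_nonneg_eq_0_iff)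
    then show ?thesis unfolding pa_def rho_def by (intro continuous_intros) auto
  qed (simp add: pa_def)
  show "continuous_on UNIV (%k. pb m k t)"
  proof (cases "m = 0")
    case False
    then have "sqrt (k\<^sup>2 + m\<^sup>2) \<noteq> 0" for k by (simp add: add_nonneg_eq_0_iff)
    then show ?thesis unfolding pb_def rho_def by (intro continuous_intros) auto
  next
    case True
    have "pb m k t = sin (k * t)" for k
      unfolding pb_def rho_def True by (cases "k = 0"; cases "k > 0") (auto simp: abs_if)
    then show ?thesis by (auto intro!: continuous_intros)
  qed
qed

lemma prop_continuous_in_k:
  assumes "continuous_on UNIV Y" "continuous_on UNIV Z"
  shows "continuous_on UNIV (%k. prop1 m k t (Y k) (Z k))" (is ?A) "continuous_on UNIV (%k. prop2 m k t (Y k) (Z k))" (is ?B)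
proof -
  note c = propagator_continuous_in_k[of m t]
  show ?A
    unfolding prop1_def by (intro continuous_intros assms c)
  show ?B
    unfolding prop2_def by (intro continuous_intros assms c)
qed

lemma continuous_integral_param:
  fixes h :: "real => real => complex"
  assumes k: "\<And>\<tau>. \<tau> \<in> {a..b} ==> continuous_on UNIV (%k. h k \<tau>)"
    and t: "\<And>k. continuous_on {a..b} (h k)"
    and B: "\<And>k \<tau>. \<tau> \<in> {a..b} ==> norm (h k \<tau>) <= B"
  shows "continuous_on UNIV (%k. integral {a..b} (h k))"
proof -
  have eq: "integral {a..b} (h k) = (LINT \<tau>|lborel. indicator {a..b} \<tau> *\<^sub>R h k \<tau>)" for k
    using set_borel_integral_eq_integral(2)[OF borel_integrable_atLeastAtMost'[OF t[of k]]]
    by (simp add: set_lebesgue_integral_def)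
  show ?thesis unfolding eq
  proof (rule continuous_on_dominated_integral[where w = "%\<tau>. indicator {a..b} \<tau> *\<^sub>R \<bar>B\<bar>"])
    show "(%\<tau>. indicator {a..b} \<tau> *\<^sub>R h k \<tau>) \<in> borel_measurable lborel" for k
      using borel_integrable_atLeastAtMost'[OF t[of k]] unfolding set_integrable_def by auto
    show "integrable lborel (%\<tau>. indicator {a..b} \<tau> *\<^sub>R \<bar>B\<bar>)"
      by (rule integrable_scaleR_left) (auto simp: emeasure_lborel_Icc_eq)
    show "norm (indicator {a..b} \<tau> *\<^sub>R h k \<tau>) <= indicator {a..b} \<tau> *\<^sub>R \<bar>B\<bar>" for k \<tau>
      using B[of \<tau> k] by (auto simp: indicator_def)
    show "continuous_on UNIV (%k. indicator {a..b} \<tau> *\<^sub>R h k \<tau>)" for \<tau>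
      using k[of \<tau>] by (cases "\<tau> \<in> {a..b}") (auto simp: indicator_def)
  qed
qed

lemma rapidD_ex:
  assumes "rapid V"
  shows "\<exists>C. C >= 0 \<and> (\<forall>k t. - 1 <= t --> t <= T --> \<bar>k\<bar> ^ N * norm (V k t) <= C)"
proof (rule rapidD[OF assms, of T N])
  fix C assume "C >= 0" "\<And>k t. - 1 <= t ==> t <= T ==> \<bar>k\<bar> ^ N * norm (V k t) <= C"
  then show ?thesis by (intro exI[of _ C]) simp
qed

lemma rapid_combination:
  assumes V: "rapid V" and W: "rapid W"
    and le: "\<And>k t. - 1 <= t ==> norm (U k t) <= M * (norm (V k t) + norm (W k t))" and M: "M >= 0"
  shows "rapid U"
  unfolding rapid_def
proof (intro allI)
  fix N and T :: real
  from rapidD_ex[OF V] obtain C where C': "C >= 0 \<and> (\<forall>k t. - 1 <= t --> t <= T --> \<bar>k\<bar> ^ N * norm (V k t) <= C)" ..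
    note C = conjunct2[OF C', rule_format]
  from rapidD_ex[OF W] obtain D where D': "D >= 0 \<and> (\<forall>k t. - 1 <= t --> t <= T --> \<bar>k\<bar> ^ N * norm (W k t) <= D)" ..
    note D = conjunct2[OF D', rule_format]
  show "\<exists>C. \<forall>k t. - 1 <= t --> t <= T --> \<bar>k\<bar> ^ N * norm (U k t) <= C"
  proof (intro exI[of _ "M * (C + D)"] allI impI)
    fix k t :: real assume t: "- 1 <= t" "t <= T"
    have "\<bar>k\<bar> ^ N * norm (U k t) <= \<bar>k\<bar> ^ N * (M * (norm (V k t) + norm (W k t)))"
      by (rule mult_left_mono[OF le[OF t(1)]]) simp
    also have "\<dots> = M * (\<bar>k\<bar> ^ N * norm (V k t) + \<bar>k\<bar> ^ N * norm (W k t))" by (simp add: algebra_simps)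
    also have "\<dots> <= M * (C + D)" by (intro mult_left_mono add_mono C D t M)
    finally show "\<bar>k\<bar> ^ N * norm (U k t) <= M * (C + D)" .
  qed
qed

lemma rapid_times_k:
  assumes V: "rapid V" shows "rapid (%k t. cx k * V k t)"
  unfolding rapid_def
proof (intro allI)
  fix N and T :: real
  from rapidD_ex[OF V] obtain C where C': "C >= 0 \<and> (\<forall>k t. - 1 <= t --> t <= T --> \<bar>k\<bar> ^ Suc N * norm (V k t) <= C)" ..
    note C = conjunct2[OF C', rule_format]
  show "\<exists>C. \<forall>k t. - 1 <= t --> t <= T --> \<bar>k\<bar> ^ N * norm (cx k * V k t) <= C"
    using C by (intro exI[of _ C]) (simp add: norm_mult mult_ac)
qed

lemma rapid_cmult:
  assumes "rapid V" shows "rapid (%k t. c * V k t)"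
  by (rule rapid_combination[OF assms assms, of _ "norm c"]) (simp_all add: norm_mult distrib_left)

lemma rapid_add:
  assumes "rapid V" "rapid W" shows "rapid (%k t. V k t + W k t)"
  by (rule rapid_combination[OF assms, of _ 1]) (simp_all add: norm_triangle_ineq)

lemma rapid_diff:
  assumes "rapid V" "rapid W" shows "rapid (%k t. V k t - W k t)"
  by (rule rapid_combination[OF assms, of _ 1]) (simp_all add: norm_triangle_ineq4)

lemma rapid_ft:
  assumes "line_family g" shows "rapid (%k t. ft (g 0) k)"
  unfolding rapid_def
proof (intro allI)
  fix N and T :: real
  from line_family_bound[OF assms, of N] obtain C where C: "\<forall>y. norm (g N y) <= C / (1 + y\<^sup>2)" ..
  have le: "norm (ft (g N) k) <= C * (LINT y|lborel. 1 / (1 + y\<^sup>2))" for k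
    by (rule norm_ft_le_weight[OF line_family_D(3)[OF assms]]) (use C in simp)
  have "\<bar>k\<bar> ^ N * norm (ft (g 0) k) <= C * (LINT y|lborel. 1 / (1 + y\<^sup>2))" for k
    using le[of k] unfolding ft_derivative_power[OF assms, of N k] by (simp add: norm_mult norm_power)
  then show "\<exists>C. \<forall>k t. - 1 <= t --> t <= T --> \<bar>k\<bar> ^ N * norm (ft (g 0) k) <= C" by (intro exI allI impI)
qed

lemma rapid_integral:
  assumes V: "rapid V" and c: "\<And>k. continuous_on UNIV (V k)"
  shows "rapid (%k t. integral {-1..t} (V k))"
  unfolding rapid_def
proof (intro allI)
  fix N and T :: real
  from rapidD_ex[OF V] obtain C where C': "C >= 0 \<and> (\<forall>k t. - 1 <= t --> t <= T --> \<bar>k\<bar> ^ N * norm (V k t) <= C)" ..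
    note C = conjunct1[OF C'] conjunct2[OF C', rule_format]
  show "\<exists>C. \<forall>k t. - 1 <= t --> t <= T --> \<bar>k\<bar> ^ N * norm (integral {-1..t} (V k)) <= C"
  proof (intro exI[of _ "C * (T + 1)"] allI impI)
    fix k t :: real assume t: "- 1 <= t" "t <= T"
    have "norm (integral {-1..t} (%\<tau>. cx (\<bar>k\<bar> ^ N) * V k \<tau>)) <= C * (t - - 1)"
    proof (rule integral_bound[OF t(1)])
      show "continuous_on {-1..t} (%\<tau>. cx (\<bar>k\<bar> ^ N) * V k \<tau>)"
        by (intro continuous_intros continuous_on_subset[OF c]) simp
      show "norm (cx (\<bar>k\<bar> ^ N) * V k \<tau>) <= C" if "\<tau> \<in> {-1..t}" for \<tau>
        using C(2)[of \<tau> k] that t by (simp add: norm_mult norm_power)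
    qed
    also have "\<dots> <= C * (T + 1)" using t C(1) by (intro mult_left_mono) auto
    finally show "\<bar>k\<bar> ^ N * norm (integral {-1..t} (V k)) <= C * (T + 1)" by (simp add: norm_mult norm_power)
  qed
qed

lemma rapid_weight_ex:
  assumes "rapid V"
  shows "\<exists>C. C >= 0 \<and> (\<forall>k t. - 1 <= t --> t <= T --> \<bar>k\<bar> ^ n * norm (V k t) <= C / (1 + k\<^sup>2))"
proof -
  from rapidD_ex[OF assms] obtain C where C': "C >= 0 \<and> (\<forall>k t. - 1 <= t --> t <= T --> \<bar>k\<bar> ^ n * norm (V k t) <= C)" ..
    note C = conjunct1[OF C'] conjunct2[OF C', rule_format]
  from rapidD_ex[OF assms] obtain D where D': "D >= 0 \<and> (\<forall>k t. - 1 <= t --> t <= T --> \<bar>k\<bar> ^ (n + 2) * norm (V k t) <= D)" ..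
    note D = conjunct1[OF D'] conjunct2[OF D', rule_format]
  show ?thesis
  proof (intro exI[of _ "C + D"] conjI allI impI)
    fix k t :: real assume t: "- 1 <= t" "t <= T"
    have "(\<bar>k\<bar> ^ n * norm (V k t)) * (1 + k\<^sup>2) = \<bar>k\<bar> ^ n * norm (V k t) + \<bar>k\<bar> ^ (n + 2) * norm (V k t)"
      by (simp add: algebra_simps power_add power2_eq_square)
    also have "\<dots> <= C + D" by (intro add_mono C D t)
    finally show "\<bar>k\<bar> ^ n * norm (V k t) <= (C + D) / (1 + k\<^sup>2)"
      by (simp add: pos_le_divide_eq add_pos_nonneg)
  qed (use C(1) D(1) in simp)
qed

section \<open>Inverse Fourier transforms with a time parameter\<close>

text \<open>The factor \<open>(i k)\<^sup>n\<close> makes this the derivative of order \<open>n\<close> in \<open>x\<close> of an inverse transform.\<close>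

definition ift :: "(real => real => complex) => nat => real => real => complex" where
  "ift V n x t = (LINT k|lborel. (\<i> * cx k) ^ n * (exp (\<i> * k * x) * V k t)) / (2 * pi)"

definition admissible :: "(real => real => complex) => bool" where
  "admissible V \<longleftrightarrow> rapid V \<and> (\<forall>t\<ge>-1. continuous_on UNIV (%k. V k t))"

lemma norm_ift_integrand:
  "norm ((\<i> * cx k) ^ n * (exp (\<i> * k * cx x) * v)) = \<bar>k\<bar> ^ n * norm v"
  by (simp add: norm_mult norm_power)

lemma ift_integrable:
  assumes V: "admissible V" and t: "t >= - 1"
  shows "integrable lborel (%k. (\<i> * cx k) ^ n * (exp (\<i> * k * cx x) * V k t))"
proof -
  have r: "rapid V" using V by (simp add: admissible_def)
  from rapid_weight_ex[OF r] obtain C where C': "C >= 0 \<and> (\<forall>k s. - 1 <= s --> s <= t --> \<bar>k\<bar> ^ n * norm (V k s) <= C / (1 + k\<^sup>2))" ..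
    note C = conjunct1[OF C'] conjunct2[OF C', rule_format]
  show ?thesis
  proof (rule integrable_inverse_square_bound)
    show "(%k. (\<i> * cx k) ^ n * (exp (\<i> * k * cx x) * V k t)) \<in> borel_measurable borel"
      using V t by (intro borel_measurable_continuous_onI continuous_intros) (simp add: admissible_def)
    show "norm ((\<i> * cx k) ^ n * (exp (\<i> * k * cx x) * V k t)) <= C / (1 + k\<^sup>2)" for k
      unfolding norm_ift_integrand using C(2)[of t k] t by simp
  qed
qed

lemma ift_bound:
  assumes V: "admissible V"
  shows "\<exists>B. \<forall>x t. - 1 <= t --> t <= T --> norm (ift V n x t) <= B"
proof -
  have r: "rapid V" using V by (simp add: admissible_def)
  from rapid_weight_ex[OF r] obtain C where C': "C >= 0 \<and> (\<forall>k s. - 1 <= s --> s <= T --> \<bar>k\<bar> ^ n * norm (V k s) <= C / (1 + k\<^sup>2))" ..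
    note C = conjunct1[OF C'] conjunct2[OF C', rule_format]
  have "norm (ift V n x t) <= (LINT k|lborel. C / (1 + k\<^sup>2)) / (2 * pi)" if t: "- 1 <= t" "t <= T" for x t
  proof -
    let ?h = "%k. (\<i> * cx k) ^ n * (exp (\<i> * k * cx x) * V k t)"
    have "norm (integral\<^sup>L lborel ?h) <= (LINT k|lborel. norm (?h k))" by (rule integral_norm_bound)
    also have "\<dots> <= (LINT k|lborel. C / (1 + k\<^sup>2))"
      by (rule integral_mono[OF integrable_norm[OF ift_integrable[OF V t(1)]] integrable_inverse_square_weight])
         (unfold norm_ift_integrand, rule C(2)[OF t])
    finally show ?thesis unfolding ift_def by (simp add: norm_divide divide_right_mono)
  qed
  then show ?thesis by (intro exI allI impI)
qed

lemma ift_derivative_x: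
  assumes V: "admissible V" and t: "t >= - 1"
  shows "((%x. ift V n x t) hvd ift V (Suc n) x t) (at x)"
proof -
  have r: "rapid V" using V by (simp add: admissible_def)
  from rapid_weight_ex[OF r] obtain C where C': "C >= 0 \<and> (\<forall>k s. - 1 <= s --> s <= t --> \<bar>k\<bar> ^ Suc n * norm (V k s) <= C / (1 + k\<^sup>2))" ..
    note C = conjunct1[OF C'] conjunct2[OF C', rule_format]
  have "((%x. LINT k|lborel. (\<i> * cx k) ^ n * (exp (\<i> * k * cx x) * V k t)) hvd
     (LINT k|lborel. (\<i> * cx k) ^ Suc n * (exp (\<i> * k * cx x) * V k t))) (at x within UNIV)"
  proof (rule has_vector_derivative_dominated_integral[where w = "%k. C / (1 + k\<^sup>2)"])
    fix y k :: real
    have "((%y. exp (\<i> * k * cx y)) hvd \<i> * k * exp (\<i> * k * cx y)) (at y within UNIV)"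
      by (rule has_vector_derivative_cexp)
    from has_vector_derivative_mult_right[OF has_vector_derivative_mult_left[OF this, of "V k t"], of "(\<i> * cx k) ^ n"]
    show "((%y. (\<i> * cx k) ^ n * (exp (\<i> * k * cx y) * V k t)) hvd
       (\<i> * cx k) ^ Suc n * (exp (\<i> * k * cx y) * V k t)) (at y within UNIV)"
      by (simp add: mult_ac)
    show "norm ((\<i> * cx k) ^ Suc n * (exp (\<i> * k * cx y) * V k t)) <= C / (1 + k\<^sup>2)"
      unfolding norm_ift_integrand by (rule C(2)) (use t in auto)
  next
    show "(%k. (\<i> * cx k) ^ Suc n * (exp (\<i> * k * cx x) * V k t)) \<in> borel_measurable lborel"
      using ift_integrable[OF V t] by (rule borel_measurable_integrable)
  qed (auto intro: ift_integrable[OF V t] integrable_inverse_square_weight)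
  from has_vector_derivative_divide[OF this, of "2 * pi"] show ?thesis unfolding ift_def by simp
qed

text \<open>The derivatives in \<open>t\<close> and along the characteristics are both directional derivatives; treating them
together requires only one passage under the integral.\<close>

lemma ift_derivative_along_line:
  assumes V: "admissible V" and V': "admissible V'" and t: "t > - 1"
    and der: "\<And>k t. t > - 1 ==> (V k hvd V' k t) (at t)"
  shows "((%s. ift V n (x + \<sigma> * s) s) hvd
     ift (%k s. V' k s + cx \<sigma> * (\<i> * k * V k s)) n (x + \<sigma> * t) t) (at t)"
proof -
  have r: "rapid V" "rapid V'" using V V' by (simp_all add: admissible_def)
  from rapid_weight_ex[OF r(2)] obtain C where C': "C >= 0 \<and> (\<forall>k s. - 1 <= s --> s <= t + 1 --> \<bar>k\<bar> ^ n * norm (V' k s) <= C / (1 + k\<^sup>2))" ..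
    note C = conjunct1[OF C'] conjunct2[OF C', rule_format]
  from rapid_weight_ex[OF r(1)] obtain D where D': "D >= 0 \<and> (\<forall>k s. - 1 <= s --> s <= t + 1 --> \<bar>k\<bar> ^ Suc n * norm (V k s) <= D / (1 + k\<^sup>2))" ..
    note D = conjunct1[OF D'] conjunct2[OF D', rule_format]
  let ?S = "{-1<..<t+1}"
  have at: "at t within ?S = at t" by (rule at_within_open) (use t in auto)
  let ?U = "%k s. V' k s + cx \<sigma> * (\<i> * k * V k s)"
  have "((%s. LINT k|lborel. (\<i> * cx k) ^ n * (exp (\<i> * k * cx (x + \<sigma> * s)) * V k s)) hvd
     (LINT k|lborel. (\<i> * cx k) ^ n * (exp (\<i> * k * cx (x + \<sigma> * t)) * ?U k t))) (at t within ?S)"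
  proof (rule has_vector_derivative_dominated_integral[where w = "%k. (C + \<bar>\<sigma>\<bar> * D) / (1 + k\<^sup>2)"])
    fix s k :: real assume s: "s \<in> ?S"
    have 1: "((%s. exp (\<i> * k * cx (x + \<sigma> * s))) hvd
        \<sigma> *\<^sub>R (\<i> * k * exp (\<i> * k * cx (x + \<sigma> * s)))) (at s within ?S)"
    proof -
      have "((%s. x + \<sigma> * s) hvd \<sigma>) (at s within ?S)"
        by (auto intro!: derivative_eq_intros simp: has_real_derivative_iff_has_vector_derivative[symmetric])
      from vector_diff_chain_within[OF this has_vector_derivative_cexp[of "\<i> * k" "x + \<sigma> * s"]]
      show ?thesis by (simp add: o_def)
    qed
    have 2: "(V k hvd V' k s) (at s within ?S)"
      by (rule has_vector_derivative_at_within[OF der]) (use s in simp)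
    from has_vector_derivative_mult_right[OF has_vector_derivative_mult[OF 1 2], of "(\<i> * cx k) ^ n"]
    show "((%s. (\<i> * cx k) ^ n * (exp (\<i> * k * cx (x + \<sigma> * s)) * V k s)) hvd
      (\<i> * cx k) ^ n * (exp (\<i> * k * cx (x + \<sigma> * s)) * ?U k s)) (at s within ?S)"
      by (rule has_vector_derivative_eq_rhs) (simp add: algebra_simps scaleR_conv_of_real)
    have "norm (?U k s) <= norm (V' k s) + \<bar>\<sigma>\<bar> * (\<bar>k\<bar> * norm (V k s))"
      by (rule order_trans[OF norm_triangle_ineq]) (simp add: norm_mult)
    then have "\<bar>k\<bar> ^ n * norm (?U k s) <= \<bar>k\<bar> ^ n * (norm (V' k s) + \<bar>\<sigma>\<bar> * (\<bar>k\<bar> * norm (V k s)))"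
      by (rule mult_left_mono) simp
    also have "\<dots> = \<bar>k\<bar> ^ n * norm (V' k s) + \<bar>\<sigma>\<bar> * (\<bar>k\<bar> ^ Suc n * norm (V k s))" by (simp add: algebra_simps)
    also have "\<dots> <= C / (1 + k\<^sup>2) + \<bar>\<sigma>\<bar> * (D / (1 + k\<^sup>2))"
      using s by (intro add_mono mult_left_mono C D) auto
    also have "\<dots> = (C + \<bar>\<sigma>\<bar> * D) / (1 + k\<^sup>2)" by (simp add: add_divide_distrib)
    finally show "norm ((\<i> * cx k) ^ n * (exp (\<i> * k * cx (x + \<sigma> * s)) * ?U k s)) <= (C + \<bar>\<sigma>\<bar> * D) / (1 + k\<^sup>2)"
      unfolding norm_ift_integrand .
  next
    show "integrable lborel (%k. (\<i> * cx k) ^ n * (exp (\<i> * k * cx (x + \<sigma> * s)) * V k s))"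
      if "s \<in> ?S" for s using that by (intro ift_integrable[OF V]) auto
    have "continuous_on UNIV (%k. V k t)" "continuous_on UNIV (%k. V' k t)"
      using V V' t by (simp_all add: admissible_def)
    then show "(%k. (\<i> * cx k) ^ n * (exp (\<i> * k * cx (x + \<sigma> * t)) * ?U k t)) \<in> borel_measurable lborel"
      unfolding measurable_lborel2 by (intro borel_measurable_continuous_onI continuous_intros)
  qed (use t in \<open>auto intro: integrable_inverse_square_weight\<close>)
  from has_vector_derivative_divide[OF this, of "2 * pi"] show ?thesis unfolding ift_def at by simp
qed

lemma ift_derivative_t:
  assumes "admissible V" "admissible V'" "t > - 1" "\<And>k t. t > - 1 ==> (V k hvd V' k t) (at t)"
  shows "((%s. ift V n x s) hvd ift V' n x t) (at t)"
  using ift_derivative_along_line[OF assms, of n x 0] by simp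

lemma ift_continuous:
  assumes V: "admissible V" and c: "\<And>k. continuous_on {-1<..} (V k)"
  shows "continuous_on {p. snd p > - 1} (%(x, t). ift V n x t)"
proof -
  have r: "rapid V" using V by (simp add: admissible_def)
  have "continuous_on (UNIV \<times> {-1<..<T}) (%(x, t). ift V n x t)" for T
  proof -
    from rapid_weight_ex[OF r] obtain C where C': "C >= 0 \<and> (\<forall>k s. - 1 <= s --> s <= T --> \<bar>k\<bar> ^ n * norm (V k s) <= C / (1 + k\<^sup>2))" ..
    note C = conjunct1[OF C'] conjunct2[OF C', rule_format]
    have "continuous_on (UNIV \<times> {-1<..<T}) (%p. LINT k|lborel. (\<i> * cx k) ^ n * (exp (\<i> * k * cx (fst p)) * V k (snd p)))"
    proof (rule continuous_on_dominated_integral[where w = "%k. C / (1 + k\<^sup>2)"])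
      fix p :: "real \<times> real" assume p: "p \<in> UNIV \<times> {-1<..<T}"
      show "(%k. (\<i> * cx k) ^ n * (exp (\<i> * k * cx (fst p)) * V k (snd p))) \<in> borel_measurable lborel"
        by (rule borel_measurable_integrable[OF ift_integrable[OF V]]) (use p in auto)
      show "norm ((\<i> * cx k) ^ n * (exp (\<i> * k * cx (fst p)) * V k (snd p))) <= C / (1 + k\<^sup>2)" for k
        unfolding norm_ift_integrand by (rule C(2)) (use p in auto)
    next
      fix k
      have "continuous_on (UNIV \<times> {-1<..<T}) (%p::real\<times>real. V k (snd p))"
        by (rule continuous_on_compose2[OF c]) (auto intro!: continuous_intros)
      then show "continuous_on (UNIV \<times> {-1<..<T}) (%p. (\<i> * cx k) ^ n * (exp (\<i> * k * cx (fst p)) * V k (snd p)))"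
        by (intro continuous_intros)
    qed (rule integrable_inverse_square_weight)
    then show ?thesis unfolding ift_def case_prod_beta by (intro continuous_intros) auto
  qed
  then have "continuous_on (\<Union>T. UNIV \<times> {-1<..<T}) (%(x, t). ift V n x t)"
    by (intro continuous_on_open_UN) (auto intro: open_Times)
  moreover have "(\<Union>T. UNIV \<times> {-1<..<T}) = {p::real\<times>real. snd p > - 1}"
    by (auto intro: gt_ex)
  ultimately show ?thesis by simp
qed

lemma ift_of_ft:
  assumes g: "line_family g" and V: "\<And>k. V k t = ft (g 0) k"
  shows "ift V n x t = g n x"
proof -
  note D = line_family_D[OF g]
  have r: "rapid (%k t. ft (g 0) k)" by (rule rapid_ft[OF g])
  have a: "admissible (%k t. ft (g 0) k)" unfolding admissible_def using r continuous_on_ft[OF D(3)] by simp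
  have "integrable lborel (%k. (\<i> * cx k) ^ n * (exp (\<i> * k * cx x) * ft (g 0) k))"
    by (rule ift_integrable[OF a, of 0]) simp
  then have int: "integrable lborel (%k. exp (\<i> * k * cx x) * ft (g n) k)"
    unfolding ft_derivative_power[OF g, of n] by (simp add: mult_ac)
  let ?h = "%k. exp (\<i> * k * cx x) * ft (g n) k"
  have "((%A. LINT k|lborel. indicator {-A..A} k *\<^sub>R ?h k) \<longlongrightarrow> (LINT k|lborel. ?h k)) at_top"
  proof (rule integral_dominated_convergence_at_top[where w = "%k. norm (?h k)"])
    show "?h \<in> borel_measurable lborel" by (rule borel_measurable_integrable[OF int])
    then show "(%k. indicator {-A..A} k *\<^sub>R ?h k) \<in> borel_measurable lborel" for A
      by (intro borel_measurable_scaleR) auto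
    show "AE k in lborel. ((%A. indicator {-A..A} k *\<^sub>R ?h k) \<longlongrightarrow> ?h k) at_top"
    proof (rule AE_I2, rule tendsto_eventually)
      fix k :: real
      show "\<forall>\<^sub>F A in at_top. indicator {-A..A} k *\<^sub>R ?h k = ?h k"
        using eventually_ge_at_top[of "\<bar>k\<bar>"] by eventually_elim (auto simp: indicator_def abs_le_iff)
    qed
    show "\<forall>\<^sub>F A in at_top. AE k in lborel. norm (indicator {-A..A} k *\<^sub>R ?h k) <= norm (?h k)"
      by (intro always_eventually allI AE_I2) (simp add: indicator_def)
  qed (use int in simp)
  moreover have "(LINT k|lborel. indicator {-A..A} k *\<^sub>R ?h k) = integral {-A..A} ?h" for A
  proof -
    have "set_integrable lborel {-A..A} ?h"
      unfolding set_integrable_def by (rule integrable_mult_indicator[OF _ int]) simp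
    from set_borel_integral_eq_integral(2)[OF this] show ?thesis unfolding set_lebesgue_integral_def .
  qed
  ultimately have "((%A. integral {-A..A} ?h) \<longlongrightarrow> (LINT k|lborel. ?h k)) at_top" by simp
  moreover have "((%A. integral {-A..A} ?h) \<longlongrightarrow> 2 * pi * g n x) at_top"
  proof -
    from line_family_bound[OF g, of n] obtain C where "\<forall>y. norm (g n y) <= C / (1 + y\<^sup>2)" ..
    then show ?thesis using fourier_inversion_line[OF D(2) _ D(4), of n C] by simp
  qed
  ultimately have "(LINT k|lborel. ?h k) = 2 * pi * g n x"
    by (intro tendsto_unique[of at_top]) simp_all
  then show ?thesis unfolding ift_def V ft_derivative_power[OF g, of n, symmetric]
    by (simp add: ft_derivative_power[OF g, of n] mult_ac)
qed

section \<open>The Cauchy problem on the whole line\<close>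

lemma norm_prop_le':
  "norm (prop1 m k t y z) <= 2 * norm y + 2 * norm z" "norm (prop2 m k t y z) <= 2 * norm y + 2 * norm z"
  using norm_prop_le[of m k t y z] by simp_all

text \<open>Arbitrary smooth decaying data on the line. The solution is built in Fourier variables from Duhamel's
formula, with forces extended to \<open>t > - 1\<close>.\<close>

locale dirac_cauchy =
  fixes m :: real and g1 g2 :: "nat => real => complex" and f1 f2 :: "nat => nat => real => real => complex"
  assumes g1: "line_family g1" and g2: "line_family g2" and f1: "force_family f1" and f2: "force_family f2"
begin

definition src1 :: "real => real => complex" where
  "src1 k \<tau> = prop1 m k (- \<tau>) (fext f1 0 k \<tau>) (fext f2 0 k \<tau>)"
definition src2 :: "real => real => complex" where
  "src2 k \<tau> = prop2 m k (- \<tau>) (fext f1 0 k \<tau>) (fext f2 0 k \<tau>)"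
text \<open>The amplitude in the interaction picture. Written with the base point \<open>- 1\<close> so that negative times
need no oriented integrals.\<close>

definition W1 :: "real => real => complex" where
  "W1 k t = ft (g1 0) k - integral {-1..0} (src1 k) + integral {-1..t} (src1 k)"
definition W2 :: "real => real => complex" where
  "W2 k t = ft (g2 0) k - integral {-1..0} (src2 k) + integral {-1..t} (src2 k)"

text \<open>The time derivatives are generated by the differential equation itself, so that each of them is again
visibly a rapidly decaying function of \<open>k\<close>.\<close>

primrec VV :: "nat => real => real => complex \<times> complex" where
  "VV 0 = (%k t. (prop1 m k t (W1 k t) (W2 k t), prop2 m k t (W1 k t) (W2 k t)))"
| "VV (Suc l) = (%k t. (- \<i> * m * fst (VV l k t) - \<i> * k * snd (VV l k t) + fext f1 l k t,
     - \<i> * k * fst (VV l k t) + \<i> * m * snd (VV l k t) + fext f2 l k t))"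

definition V1 :: "nat => real => real => complex" where "V1 l k t = fst (VV l k t)"
definition V2 :: "nat => real => real => complex" where "V2 l k t = snd (VV l k t)"

lemma V_Suc:
  "V1 (Suc l) k t = - \<i> * m * V1 l k t - \<i> * k * V2 l k t + fext f1 l k t"
  "V2 (Suc l) k t = - \<i> * k * V1 l k t + \<i> * m * V2 l k t + fext f2 l k t"
  by (simp_all add: V1_def V2_def)

lemma fext_continuous_t:
  "continuous_on UNIV (fext f1 l k)" "continuous_on UNIV (fext f2 l k)"
  using has_vector_derivative_continuous[OF fext_has_derivative[OF f1]]
    has_vector_derivative_continuous[OF fext_has_derivative[OF f2]]
  by (simp_all add: continuous_on_eq_continuous_within)

lemma src_continuous: "continuous_on UNIV (src1 k)" "continuous_on UNIV (src2 k)"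
  unfolding src1_def src2_def by (intro prop_continuous fext_continuous_t continuous_intros)+

lemma src_rapid: "rapid src1" "rapid src2"
proof -
  note c = rapid_combination[OF fext_rapid[OF f1, of 0] fext_rapid[OF f2, of 0], of _ 2]
  show "rapid src1" by (rule c) (unfold src1_def, auto intro: norm_prop_le')
  show "rapid src2" by (rule c) (unfold src2_def, auto intro: norm_prop_le')
qed

lemma src_continuous_k: "continuous_on UNIV (%k. src1 k \<tau>)" "continuous_on UNIV (%k. src2 k \<tau>)"
  unfolding src1_def src2_def by (intro prop_continuous_in_k fext_continuous_in_k f1 f2)+

lemma src_integral_continuous_k:
  "continuous_on UNIV (%k. integral {-1..t} (src1 k))" "continuous_on UNIV (%k. integral {-1..t} (src2 k))"
proof -
  from rapidD_ex[OF src_rapid(1), of t 0] obtain B where "B >= 0 \<and> (\<forall>k s. - 1 <= s --> s <= t --> \<bar>k\<bar> ^ 0 * norm (src1 k s) <= B)" ..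
  then have "norm (src1 k s) <= B" if "s \<in> {-1..t}" for k s using that by simp
  then show "continuous_on UNIV (%k. integral {-1..t} (src1 k))"
    by (intro continuous_integral_param[of _ _ _ B] src_continuous_k continuous_on_subset[OF src_continuous(1)]) auto
  from rapidD_ex[OF src_rapid(2), of t 0] obtain B where "B >= 0 \<and> (\<forall>k s. - 1 <= s --> s <= t --> \<bar>k\<bar> ^ 0 * norm (src2 k s) <= B)" ..
  then have "norm (src2 k s) <= B" if "s \<in> {-1..t}" for k s using that by simp
  then show "continuous_on UNIV (%k. integral {-1..t} (src2 k))"
    by (intro continuous_integral_param[of _ _ _ B] src_continuous_k continuous_on_subset[OF src_continuous(2)]) auto
qed

lemma rapid_freeze: "rapid V ==> rapid (%k t. V k 0)"
  unfolding rapid_def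
proof (intro allI)
  fix N T assume "\<forall>N T. \<exists>C. \<forall>k t. - 1 <= t --> t <= T --> \<bar>k\<bar> ^ N * norm (V k t) <= C"
  then have "\<exists>C. \<forall>k t. - 1 <= t --> t <= 0 --> \<bar>k\<bar> ^ N * norm (V k t) <= C" by simp
  then obtain C where "\<forall>k t. - 1 <= t --> t <= 0 --> \<bar>k\<bar> ^ N * norm (V k t) <= C" ..
  then show "\<exists>C. \<forall>k t. - 1 <= t --> t <= T --> \<bar>k\<bar> ^ N * norm (V k 0) <= C" by (intro exI[of _ C]) simp
qed

lemma W_admissible: "admissible W1" "admissible W2"
proof -
  note r1 = rapid_integral[OF src_rapid(1) src_continuous(1)]
  note r2 = rapid_integral[OF src_rapid(2) src_continuous(2)]
  have "rapid W1" "rapid W2"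
    unfolding W1_def[abs_def] W2_def[abs_def]
    by (rule rapid_add[OF rapid_diff[OF rapid_ft[OF g1] rapid_freeze[OF r1]] r1]
             rapid_add[OF rapid_diff[OF rapid_ft[OF g2] rapid_freeze[OF r2]] r2])+
  then show "admissible W1" "admissible W2"
    unfolding admissible_def W1_def W2_def
    using src_integral_continuous_k continuous_on_ft[OF line_family_D(3)[OF g1, of 0]] continuous_on_ft[OF line_family_D(3)[OF g2, of 0]]
    by (auto intro!: continuous_intros)
qed

lemma V_admissible: "admissible (V1 l)" "admissible (V2 l)"
proof (induction l)
  case 0
  have e: "V1 0 = (%k t. prop1 m k t (W1 k t) (W2 k t))" "V2 0 = (%k t. prop2 m k t (W1 k t) (W2 k t))"
    by (simp_all add: V1_def V2_def fun_eq_iff)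
  have r: "rapid W1" "rapid W2" using W_admissible by (simp_all add: admissible_def)
  have "rapid (V1 0)" "rapid (V2 0)"
    unfolding e by (rule rapid_combination[OF r, of _ 2]; simp add: norm_prop_le')+
  moreover have "continuous_on UNIV (%k. V1 0 k t)" "continuous_on UNIV (%k. V2 0 k t)" if "t >= - 1" for t
    using W_admissible that unfolding e admissible_def by (simp_all add: prop_continuous_in_k)
  ultimately show "admissible (V1 0)" "admissible (V2 0)" by (simp_all add: admissible_def)
next
  case (Suc l)
  have e: "V1 (Suc l) = (%k t. (- \<i> * m) * V1 l k t - \<i> * (k * V2 l k t) + fext f1 l k t)"
    "V2 (Suc l) = (%k t. (- \<i>) * (k * V1 l k t) + (\<i> * m) * V2 l k t + fext f2 l k t)"
    by (simp_all add: V_Suc fun_eq_iff)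
  have r: "rapid (V1 l)" "rapid (V2 l)" and c: "\<And>t. t >= - 1 ==> continuous_on UNIV (%k. V1 l k t)" "\<And>t. t >= - 1 ==> continuous_on UNIV (%k. V2 l k t)"
    using Suc by (simp_all add: admissible_def)
  have "rapid (V1 (Suc l))" unfolding e
    by (rule rapid_add[OF rapid_diff[OF rapid_cmult[OF r(1)] rapid_cmult[OF rapid_times_k[OF r(2)]]] fext_rapid[OF f1]])
  moreover have "rapid (V2 (Suc l))" unfolding e
    by (rule rapid_add[OF rapid_add[OF rapid_cmult[OF rapid_times_k[OF r(1)]] rapid_cmult[OF r(2)]] fext_rapid[OF f2]])
  moreover have "continuous_on UNIV (%k. V1 (Suc l) k t)" "continuous_on UNIV (%k. V2 (Suc l) k t)" if "t >= - 1" for t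
    unfolding e by (intro continuous_intros c[OF that] fext_continuous_in_k f1 f2)+
  ultimately show "admissible (V1 (Suc l))" "admissible (V2 (Suc l))" by (simp_all add: admissible_def)
qed

lemma W_derivative:
  assumes t: "t > - 1"
  shows "(W1 k hvd src1 k t) (at t)" (is ?A) "(W2 k hvd src2 k t) (at t)" (is ?B)
proof -
  have at: "at t within {-1..t+1} = at t" by (rule at_within_interior) (use t in auto)
  have "((%u. integral {-1..u} (src1 k)) hvd src1 k t) (at t within {-1..t+1})"
    by (rule integral_has_vector_derivative) (use t in \<open>auto intro: continuous_on_subset[OF src_continuous(1)]\<close>)
  then show ?A unfolding at W1_def
    by (rule has_vector_derivative_eq_rhs[OF has_vector_derivative_add[OF has_vector_derivative_const]]) simp
  have "((%u. integral {-1..u} (src2 k)) hvd src2 k t) (at t within {-1..t+1})"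
    by (rule integral_has_vector_derivative) (use t in \<open>auto intro: continuous_on_subset[OF src_continuous(2)]\<close>)
  then show ?B unfolding at W2_def
    by (rule has_vector_derivative_eq_rhs[OF has_vector_derivative_add[OF has_vector_derivative_const]]) simp
qed

lemma V_derivative:
  assumes t: "t > - 1"
  shows "(V1 l k hvd V1 (Suc l) k t) (at t)" "(V2 l k hvd V2 (Suc l) k t) (at t)"
proof (induction l)
  case 0
  have e: "V1 0 k = (%t. prop1 m k t (W1 k t) (W2 k t))" "V2 0 k = (%t. prop2 m k t (W1 k t) (W2 k t))"
    by (simp_all add: V1_def V2_def fun_eq_iff)
  have s: "prop1 m k t (src1 k t) (src2 k t) = fext f1 0 k t" "prop2 m k t (src1 k t) (src2 k t) = fext f2 0 k t"
    unfolding src1_def src2_def prop_prop by simp_all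
  note p = prop_has_derivative[OF W_derivative[OF t, of k], of m k, unfolded s]
  show "(V1 0 k hvd V1 (Suc 0) k t) (at t)" "(V2 0 k hvd V2 (Suc 0) k t) (at t)"
    unfolding V_Suc unfolding e by (rule p)+
next
  case (Suc l)
  have d1: "((%t. - \<i> * m * V1 l k t - \<i> * k * V2 l k t + fext f1 l k t) hvd
      - \<i> * m * V1 (Suc l) k t - \<i> * k * V2 (Suc l) k t + fext f1 (Suc l) k t) (at t)"
    by (intro has_vector_derivative_add has_vector_derivative_diff has_vector_derivative_mult_right Suc fext_has_derivative f1)
  have d2: "((%t. - \<i> * k * V1 l k t + \<i> * m * V2 l k t + fext f2 l k t) hvd
      - \<i> * k * V1 (Suc l) k t + \<i> * m * V2 (Suc l) k t + fext f2 (Suc l) k t) (at t)"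
    by (intro has_vector_derivative_add has_vector_derivative_diff has_vector_derivative_mult_right Suc fext_has_derivative f2)
  show "(V1 (Suc l) k hvd V1 (Suc (Suc l)) k t) (at t)"
    using d1 unfolding V_Suc(1)[of "Suc l"] V_Suc(1)[of l k, abs_def] .
  show "(V2 (Suc l) k hvd V2 (Suc (Suc l)) k t) (at t)"
    using d2 unfolding V_Suc(2)[of "Suc l"] V_Suc(2)[of l k, abs_def] .
qed

lemma V_initial: "V1 0 k 0 = ft (g1 0) k" "V2 0 k 0 = ft (g2 0) k"
  by (simp_all add: V1_def V2_def W1_def W2_def)

definition v1 :: "nat => nat => real => real => complex" where "v1 n l = ift (V1 l) n"
definition v2 :: "nat => nat => real => real => complex" where "v2 n l = ift (V2 l) n"

lemma v_derivatives:
  "t > - 1 ==> ((%x. v1 n l x t) hvd v1 (Suc n) l x t) (at x)"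
  "t > - 1 ==> ((%x. v2 n l x t) hvd v2 (Suc n) l x t) (at x)"
  "t > - 1 ==> ((%t. v1 n l x t) hvd v1 n (Suc l) x t) (at t)"
  "t > - 1 ==> ((%t. v2 n l x t) hvd v2 n (Suc l) x t) (at t)"
  unfolding v1_def v2_def
  by (auto intro!: ift_derivative_x ift_derivative_t V_admissible V_derivative)

lemma v_continuous:
  "continuous_on {p. snd p > - 1} (%(x, t). v1 n l x t)" "continuous_on {p. snd p > - 1} (%(x, t). v2 n l x t)"
proof -
  have at: "at t within {-1<..} = at t" if "t > - 1" for t :: real by (rule at_within_open) (use that in auto)
  have "continuous_on {-1<..} (V1 l k)" "continuous_on {-1<..} (V2 l k)" for k
    using has_vector_derivative_continuous[OF V_derivative(1)] has_vector_derivative_continuous[OF V_derivative(2)]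
    by (auto simp: continuous_on_eq_continuous_within at)
  note c = this
  show "continuous_on {p. snd p > - 1} (%(x, t). v1 n l x t)"
    unfolding v1_def by (rule ift_continuous[OF V_admissible(1) c(1)])
  show "continuous_on {p. snd p > - 1} (%(x, t). v2 n l x t)"
    unfolding v2_def by (rule ift_continuous[OF V_admissible(2) c(2)])
qed

lemma v_initial: "v1 n 0 x 0 = g1 n x" "v2 n 0 x 0 = g2 n x"
  unfolding v1_def v2_def by (rule ift_of_ft[OF g1], rule V_initial, rule ift_of_ft[OF g2], rule V_initial)

lemma ift_fext:
  assumes "t >= 0"
  shows "ift (fext f1 0) n x t = f1 n 0 x t" (is ?A) "ift (fext f2 0) n x t = f2 n 0 x t" (is ?B)
proof -
  show ?A
    using ift_of_ft[OF force_family_slice[OF f1 assms, of 0], of "fext f1 0" t n x]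
    by (simp add: fext_eq[OF assms] fhat_def)
  show ?B
    using ift_of_ft[OF force_family_slice[OF f2 assms, of 0], of "fext f2 0" t n x]
    by (simp add: fext_eq[OF assms] fhat_def)
qed

lemma fext_admissible: "admissible (fext f1 l)" "admissible (fext f2 l)"
  unfolding admissible_def using fext_rapid fext_continuous_in_k f1 f2 by simp_all

lemma ift_linear:
  assumes "admissible A" "admissible B" "t >= - 1"
  shows "ift (%k t. A k t + B k t) n x t = ift A n x t + ift B n x t" (is ?A)
    "ift (%k t. c * A k t) n x t = c * ift A n x t" (is ?B)
    "ift (%k t. \<i> * k * A k t) n x t = ift A (Suc n) x t" (is ?C)
proof -
  note ia = ift_integrable[OF assms(1,3), of n x] and ib = ift_integrable[OF assms(2,3), of n x]
  show ?A
    unfolding ift_def distrib_left add_divide_distrib[symmetric] Bochner_Integration.integral_add[OF ia ib] ..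
  show ?B
    unfolding ift_def times_divide_eq_right integral_mult_right_zero[symmetric] by (simp add: mult_ac)
  show ?C
    unfolding ift_def by (simp add: mult_ac)
qed

lemma admissible_combinations:
  "admissible A ==> admissible B ==> admissible (%k t. A k t + B k t)"
  "admissible A ==> admissible (%k t. c * A k t)"
  "admissible A ==> admissible (%k t. \<i> * k * A k t)"
proof -
  show "admissible A ==> admissible B ==> admissible (%k t. A k t + B k t)"
    unfolding admissible_def by (auto intro: rapid_add continuous_intros)
  show "admissible A ==> admissible (%k t. c * A k t)"
    unfolding admissible_def by (auto intro: rapid_cmult continuous_intros)
  assume A: "admissible A"
  have "rapid (%k t. \<i> * (k * A k t))" by (rule rapid_cmult[OF rapid_times_k]) (use A in \<open>simp add: admissible_def\<close>)
  then show "admissible (%k t. \<i> * k * A k t)"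
    using A unfolding admissible_def mult.assoc by (auto intro!: continuous_intros)
qed

text \<open>The equations hold only for \<open>t \<ge> 0\<close>: at negative times the extended transform of the force is not the
transform of a given force.\<close>

lemma dirac_equations:
  assumes t: "t >= 0"
  shows "v1 n 1 x t = - v2 (Suc n) 0 x t - \<i> * m * v1 n 0 x t + f1 n 0 x t" (is ?A)
    "v2 n 1 x t = - v1 (Suc n) 0 x t + \<i> * m * v2 n 0 x t + f2 n 0 x t" (is ?B)
proof -
  note A = V_admissible fext_admissible admissible_combinations
  have t': "t >= - 1" using t by simp
  have e1: "V1 1 = (%k t. (- \<i> * m * V1 0 k t + (- 1) * (\<i> * k * V2 0 k t)) + fext f1 0 k t)"
    and e2: "V2 1 = (%k t. ((- 1) * (\<i> * k * V1 0 k t) + \<i> * m * V2 0 k t) + fext f2 0 k t)"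
    by (simp_all add: V_Suc fun_eq_iff)
  have "v1 n 1 x t = ift (%k t. - \<i> * m * V1 0 k t + (- 1) * (\<i> * k * V2 0 k t)) n x t + ift (fext f1 0) n x t"
    unfolding v1_def e1
    by (rule ift_linear(1)[where A = "%k t. - \<i> * m * V1 0 k t + (- 1) * (\<i> * k * V2 0 k t)" and B = "fext f1 0", OF _ _ t']) (intro A)+
  also have "ift (%k t. - \<i> * m * V1 0 k t + (- 1) * (\<i> * k * V2 0 k t)) n x t =
      ift (%k t. - \<i> * m * V1 0 k t) n x t + ift (%k t. (- 1) * (\<i> * k * V2 0 k t)) n x t"
    by (rule ift_linear(1)[where A = "%k t. - \<i> * m * V1 0 k t" and B = "%k t. (- 1) * (\<i> * k * V2 0 k t)", OF _ _ t']) (intro A)+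
  also have "ift (%k t. - \<i> * m * V1 0 k t) n x t = - \<i> * m * ift (V1 0) n x t"
    by (rule ift_linear(2)[OF V_admissible(1) V_admissible(1) t'])
  also have "ift (%k t. (- 1) * (\<i> * k * V2 0 k t)) n x t = (- 1) * ift (%k t. \<i> * k * V2 0 k t) n x t"
    by (rule ift_linear(2)[where A = "%k t. \<i> * k * V2 0 k t", OF _ V_admissible(1) t']) (intro A)
  also have "ift (%k t. \<i> * k * V2 0 k t) n x t = ift (V2 0) (Suc n) x t"
    by (rule ift_linear(3)[OF V_admissible(2) V_admissible(1) t'])
  finally show ?A
    unfolding ift_fext[OF t] v1_def v2_def by simp
  have "v2 n 1 x t = ift (%k t. (- 1) * (\<i> * k * V1 0 k t) + \<i> * m * V2 0 k t) n x t + ift (fext f2 0) n x t"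
    unfolding v2_def e2
    by (rule ift_linear(1)[where A = "%k t. (- 1) * (\<i> * k * V1 0 k t) + \<i> * m * V2 0 k t" and B = "fext f2 0", OF _ _ t']) (intro A)+
  also have "ift (%k t. (- 1) * (\<i> * k * V1 0 k t) + \<i> * m * V2 0 k t) n x t =
      ift (%k t. (- 1) * (\<i> * k * V1 0 k t)) n x t + ift (%k t. \<i> * m * V2 0 k t) n x t"
    by (rule ift_linear(1)[where A = "%k t. (- 1) * (\<i> * k * V1 0 k t)" and B = "%k t. \<i> * m * V2 0 k t", OF _ _ t']) (intro A)+
  also have "ift (%k t. \<i> * m * V2 0 k t) n x t = \<i> * m * ift (V2 0) n x t"
    by (rule ift_linear(2)[OF V_admissible(2) V_admissible(1) t'])
  also have "ift (%k t. (- 1) * (\<i> * k * V1 0 k t)) n x t = (- 1) * ift (%k t. \<i> * k * V1 0 k t) n x t"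
    by (rule ift_linear(2)[where A = "%k t. \<i> * k * V1 0 k t", OF _ V_admissible(1) t']) (intro A)
  also have "ift (%k t. \<i> * k * V1 0 k t) n x t = ift (V1 0) (Suc n) x t"
    by (rule ift_linear(3)[OF V_admissible(1) V_admissible(1) t'])
  finally show ?B
    unfolding ift_fext[OF t] v1_def v2_def by simp
qed

end

lemma inverse_square_weight_shift:
  assumes "\<bar>y - x\<bar> <= T"
  shows "1 / (1 + y\<^sup>2) <= 2 * (1 + T\<^sup>2) / (1 + (x::real)\<^sup>2)"
proof -
  have "0 <= (2 * y - x)\<^sup>2" by simp
  then have "x\<^sup>2 <= 2 * y\<^sup>2 + 2 * (y - x)\<^sup>2" by (simp add: power2_eq_square algebra_simps)
  moreover have "(y - x)\<^sup>2 <= T\<^sup>2" using assms by (simp add: abs_le_square_iff[symmetric])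
  moreover have "2 * (1 + T\<^sup>2) * (1 + y\<^sup>2) = 2 + 2 * y\<^sup>2 + 2 * T\<^sup>2 + 2 * (T\<^sup>2 * y\<^sup>2)" by (simp add: algebra_simps)
  moreover have "T\<^sup>2 * y\<^sup>2 >= 0" by simp
  ultimately have "1 + x\<^sup>2 <= 2 * (1 + T\<^sup>2) * (1 + y\<^sup>2)" by linarith
  moreover have "1 + y\<^sup>2 > 0" "1 + x\<^sup>2 > 0" by (simp_all add: add_pos_nonneg)
  ultimately show ?thesis by (simp add: field_simps)
qed

lemma characteristic_integral_bound:
  fixes h :: "real => complex"
  assumes t: "t >= 0" and h: "(h has_integral I) {0..t}" and lam: "lam > 0"
    and le: "\<And>s. s \<in> {0..t} ==> norm (h s) <= a * exp (lam * s) + b * (s ^ j / fact j) + c"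
  shows "norm I <= a * (exp (lam * t) - 1) / lam + b * (t ^ Suc j / fact (Suc j)) + c * t"
proof -
  let ?G = "%s. a / lam * exp (lam * s) + b * (s ^ Suc j / fact (Suc j)) + c * s"
  have F: "((%s. a * exp (lam * s) + b * (s ^ j / fact j) + c) has_integral ?G t - ?G 0) {0..t}"
  proof (rule fundamental_theorem_of_calculus[OF t])
    fix s
    have "((%s. s ^ Suc j / fact (Suc j)) hrd (real (Suc j) * s ^ j / fact (Suc j))) (at s within {0..t})"
      using DERIV_cdivide[OF DERIV_pow[of "Suc j" s "{0..t}"], of "fact (Suc j)"] by simp
    moreover have "real (Suc j) * s ^ j / fact (Suc j) = s ^ j / fact j"
      by (simp del: of_nat_Suc)
    ultimately have 1: "((%s. s ^ Suc j / fact (Suc j)) hrd s ^ j / fact j) (at s within {0..t})" by simp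
    have 2: "((%s. a / lam * exp (lam * s)) hrd a * exp (lam * s)) (at s within {0..t})"
      using lam by (auto intro!: derivative_eq_intros)
    have 3: "((%s. c * s) hrd c) (at s within {0..t})" by (auto intro!: derivative_eq_intros)
    from DERIV_add[OF DERIV_add[OF 2 DERIV_cmult[OF 1, of b]] 3]
    show "(?G hvd a * exp (lam * s) + b * (s ^ j / fact j) + c) (at s within {0..t})"
      by (simp add: has_real_derivative_iff_has_vector_derivative)
  qed
  have e: "?G t - ?G 0 = a * (exp (lam * t) - 1) / lam + b * (t ^ Suc j / fact (Suc j)) + c * t"
    by (simp add: algebra_simps diff_divide_distrib)
  have G: "((%s. a * exp (lam * s) + b * (s ^ j / fact j) + c) has_integral
      a * (exp (lam * t) - 1) / lam + b * (t ^ Suc j / fact (Suc j)) + c * t) {0..t}" by (rule F[unfolded e])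
  have "norm (integral {0..t} h) <= integral {0..t} (%s. a * exp (lam * s) + b * (s ^ j / fact j) + c)"
    by (rule integral_norm_bound_integral[OF has_integral_integrable[OF h] has_integral_integrable[OF G] le])
  then show ?thesis unfolding integral_unique[OF h] integral_unique[OF G] .
qed

context dirac_cauchy
begin

text \<open>The Riemann invariants \<open>v\<^sub>1 \<plusminus> v\<^sub>2\<close>, transported along the characteristics \<open>x \<plusminus> t\<close> up to terms of order
zero.\<close>

definition ch :: "nat => real => real => real => complex" where
  "ch n \<sigma> x t = v1 n 0 x t + cx \<sigma> * v2 n 0 x t"

lemma v_derivative_along_line:
  assumes t: "t > - 1"
  shows "((%s. v1 n 0 (x + \<sigma> * s) s) hvd
     v1 n 1 (x + \<sigma> * t) t + cx \<sigma> * v1 (Suc n) 0 (x + \<sigma> * t) t) (at t)" (is ?A)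
    "((%s. v2 n 0 (x + \<sigma> * s) s) hvd
     v2 n 1 (x + \<sigma> * t) t + cx \<sigma> * v2 (Suc n) 0 (x + \<sigma> * t) t) (at t)" (is ?B)
proof -
  have t': "t >= - 1" using t by simp
  have lin: "ift (%k s. V' k s + cx \<sigma> * (\<i> * k * V k s)) n y t = ift V' n y t + cx \<sigma> * ift V (Suc n) y t"
    if V: "admissible V" and V': "admissible V'" for V V' y
  proof -
    have k: "admissible (%k s. \<i> * k * V k s)" by (rule admissible_combinations(3)[OF V])
    have "ift (%k s. V' k s + cx \<sigma> * (\<i> * k * V k s)) n y t =
      ift V' n y t + ift (%k s. cx \<sigma> * (\<i> * k * V k s)) n y t"
      by (rule ift_linear(1)[OF V' admissible_combinations(2)[OF k] t'])
    also have "ift (%k s. cx \<sigma> * (\<i> * k * V k s)) n y t = cx \<sigma> * ift (%k s. \<i> * k * V k s) n y t"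
      by (rule ift_linear(2)[OF k k t'])
    also have "ift (%k s. \<i> * k * V k s) n y t = ift V (Suc n) y t"
      by (rule ift_linear(3)[OF V V t'])
    finally show ?thesis .
  qed
  show ?A
    using ift_derivative_along_line[OF V_admissible(1)[of 0] V_admissible(1)[of "Suc 0"] t V_derivative(1), of n x \<sigma>]
    unfolding v1_def lin[OF V_admissible(1)[of 0] V_admissible(1)[of "Suc 0"]] One_nat_def .
  show ?B
    using ift_derivative_along_line[OF V_admissible(2)[of 0] V_admissible(2)[of "Suc 0"] t V_derivative(2), of n x \<sigma>]
    unfolding v2_def lin[OF V_admissible(2)[of 0] V_admissible(2)[of "Suc 0"]] One_nat_def .
qed

lemma characteristic_equation:
  assumes t: "t >= 0" and \<sigma>: "\<sigma> = 1 \<or> \<sigma> = - 1"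
  shows "((%s. ch n \<sigma> (x + \<sigma> * s) s) hvd
     (- \<i> * m * ch n (- \<sigma>) (x + \<sigma> * t) t + (f1 n 0 (x + \<sigma> * t) t + cx \<sigma> * f2 n 0 (x + \<sigma> * t) t))) (at t)"
proof -
  have t': "t > - 1" using t by simp
  have s2: "cx \<sigma> * (cx \<sigma> * z) = z" for z using \<sigma> by auto
  show ?thesis unfolding ch_def
    by (rule has_vector_derivative_eq_rhs[OF has_vector_derivative_add[OF v_derivative_along_line(1)[OF t']
          has_vector_derivative_mult_right[OF v_derivative_along_line(2)[OF t']]]])
       (simp only: dirac_equations[OF t] distrib_left right_diff_distrib s2 of_real_minus, simp add: algebra_simps)
qed

text \<open>Spatial decay at rate \<open>1/x\<^sup>2\<close> propagates at finite speed. Iterating the integral equation along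
characteristics starting from a crude bound gives the estimate with a Picard remainder
\<open>t\<^sup>j / j!\<close>, which tends to zero.\<close>

lemma ch_decay:
  assumes T: "T >= 0"
  shows "\<exists>C. \<forall>\<sigma> x t. (\<sigma> = 1 \<or> \<sigma> = - 1) --> 0 <= t --> t <= T --> norm (ch n \<sigma> x t) <= C / (1 + x\<^sup>2)"
proof -
  have V: "\<exists>B. \<forall>x t. - 1 <= t --> t <= T --> norm (v1 n 0 x t) <= B" "\<exists>B. \<forall>x t. - 1 <= t --> t <= T --> norm (v2 n 0 x t) <= B"
    unfolding v1_def v2_def by (rule ift_bound[OF V_admissible(1)], rule ift_bound[OF V_admissible(2)])
  from V(1) obtain B1 where B1: "\<forall>x t. - 1 <= t --> t <= T --> norm (v1 n 0 x t) <= B1" ..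
  from V(2) obtain B2 where B2: "\<forall>x t. - 1 <= t --> t <= T --> norm (v2 n 0 x t) <= B2" ..
  from line_family_bound[OF g1, of n] obtain C1 where C1: "\<forall>y. norm (g1 n y) <= C1 / (1 + y\<^sup>2)" ..
  from line_family_bound[OF g2, of n] obtain C2 where C2: "\<forall>y. norm (g2 n y) <= C2 / (1 + y\<^sup>2)" ..
  have "\<exists>C. \<forall>x t. 0 <= t --> t <= T --> norm (f1 n 0 x t) <= C / (1 + x\<^sup>2)"
    using f1 unfolding force_family_def by presburger
  then obtain C3 where C3: "\<forall>x t. 0 <= t --> t <= T --> norm (f1 n 0 x t) <= C3 / (1 + x\<^sup>2)" ..
  have "\<exists>C. \<forall>x t. 0 <= t --> t <= T --> norm (f2 n 0 x t) <= C / (1 + x\<^sup>2)"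
    using f2 unfolding force_family_def by presburger
  then obtain C4 where C4: "\<forall>x t. 0 <= t --> t <= T --> norm (f2 n 0 x t) <= C4 / (1 + x\<^sup>2)" ..
  define B where "B = B1 + B2"
  define C where "C = \<bar>C1\<bar> + \<bar>C2\<bar> + \<bar>C3\<bar> + \<bar>C4\<bar>"
  define K where "K = 2 * (1 + T\<^sup>2)"
  define L where "L = \<bar>m\<bar> * K + 1"
  define A where "A = K * C * (1 + T)"
  have K: "K > 0" by (simp add: K_def add_pos_nonneg)
  have C: "C >= 0" by (simp add: C_def)
  have A: "A >= 0" using K C T by (simp add: A_def)
  have L: "L > 0" using K by (simp add: L_def add_nonneg_pos)
  have sg: "norm (a + cx \<sigma> * b) <= norm a + norm b" if "\<sigma> = 1 \<or> \<sigma> = - 1" for a b :: complex and \<sigma>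
    using norm_triangle_ineq[of a "cx \<sigma> * b"] that by (auto simp: norm_mult)
  have frac: "X1 / w + X2 / w <= C / w" if "\<bar>X1\<bar> + \<bar>X2\<bar> <= C" "w > 0" for X1 X2 w
    using that by (simp add: add_divide_distrib[symmetric] divide_right_mono)
  have pos: "1 + y\<^sup>2 > (0::real)" for y :: real by (simp add: add_pos_nonneg)
  have chB: "norm (ch n \<sigma> x t) <= B" if "\<sigma> = 1 \<or> \<sigma> = - 1" "0 <= t" "t <= T" for \<sigma> x t
  proof -
    have "norm (v1 n 0 x t) <= B1" "norm (v2 n 0 x t) <= B2" using B1 B2 that by auto
    then show ?thesis using sg[OF that(1), of "v1 n 0 x t" "v2 n 0 x t"] unfolding ch_def B_def by linarith
  qed
  have ini: "norm (ch n \<sigma> y 0) <= C / (1 + y\<^sup>2)" if "\<sigma> = 1 \<or> \<sigma> = - 1" for \<sigma> y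
  proof -
    have "norm (ch n \<sigma> y 0) <= norm (g1 n y) + norm (g2 n y)" unfolding ch_def v_initial by (rule sg[OF that])
    also have "\<dots> <= C1 / (1 + y\<^sup>2) + C2 / (1 + y\<^sup>2)" using C1 C2 by (intro add_mono) auto
    also have "\<dots> <= C / (1 + y\<^sup>2)" by (rule frac[OF _ pos]) (simp add: C_def)
    finally show ?thesis .
  qed
  have frc: "norm (f1 n 0 y s + cx \<sigma> * f2 n 0 y s) <= C / (1 + y\<^sup>2)" if "\<sigma> = 1 \<or> \<sigma> = - 1" "0 <= s" "s <= T" for \<sigma> y s
  proof -
    have "norm (f1 n 0 y s + cx \<sigma> * f2 n 0 y s) <= norm (f1 n 0 y s) + norm (f2 n 0 y s)" by (rule sg[OF that(1)])
    also have "\<dots> <= C3 / (1 + y\<^sup>2) + C4 / (1 + y\<^sup>2)" using C3 C4 that by (intro add_mono) auto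
    also have "\<dots> <= C / (1 + y\<^sup>2)" by (rule frac[OF _ pos]) (simp add: C_def)
    finally show ?thesis .
  qed
  have main: "\<forall>\<sigma> x t. (\<sigma> = 1 \<or> \<sigma> = - 1) --> 0 <= t --> t <= T -->
      norm (ch n \<sigma> x t) <= A * exp (L * t) / (1 + x\<^sup>2) + (B * \<bar>m\<bar> ^ j) * (t ^ j / fact j)" for j
  proof (induction j)
    case 0
    show ?case
    proof (intro allI impI)
      fix \<sigma> x t :: real assume *: "\<sigma> = 1 \<or> \<sigma> = - 1" "0 <= t" "t <= T"
      have "0 <= A * exp (L * t) / (1 + x\<^sup>2)" using A pos[of x] by simp
      then show "norm (ch n \<sigma> x t) <= A * exp (L * t) / (1 + x\<^sup>2) + (B * \<bar>m\<bar> ^ 0) * (t ^ 0 / fact 0)"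
        using chB[OF *, of x] by simp
    qed
  next
    case (Suc j)
    show ?case
    proof (intro allI impI)
      fix \<sigma> x t :: real assume \<sigma>: "\<sigma> = 1 \<or> \<sigma> = - 1" and t: "0 <= t" "t <= T"
      let ?x = "x - \<sigma> * t"
      let ?h = "%s. - \<i> * m * ch n (- \<sigma>) (?x + \<sigma> * s) s + (f1 n 0 (?x + \<sigma> * s) s + cx \<sigma> * f2 n 0 (?x + \<sigma> * s) s)"
      let ?w = "1 + x\<^sup>2"
      have sh: "1 / (1 + (?x + \<sigma> * s)\<^sup>2) <= K / ?w" if "s \<in> {0..t}" for s
        unfolding K_def by (rule inverse_square_weight_shift) (use \<sigma> t that in auto)
      have hI: "(?h has_integral ch n \<sigma> (?x + \<sigma> * t) t - ch n \<sigma> (?x + \<sigma> * 0) 0) {0..t}"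
        by (rule fundamental_theorem_of_calculus[OF t(1)])
           (rule has_vector_derivative_at_within[OF characteristic_equation[OF _ \<sigma>]], simp)
      have bd: "norm (?h s) <= (\<bar>m\<bar> * A * K / ?w) * exp (L * s) + (B * \<bar>m\<bar> ^ Suc j) * (s ^ j / fact j) + C * K / ?w"
        if s: "s \<in> {0..t}" for s
      proof -
        let ?y = "?x + \<sigma> * s"
        have "norm (ch n (- \<sigma>) ?y s) <= A * exp (L * s) / (1 + ?y\<^sup>2) + (B * \<bar>m\<bar> ^ j) * (s ^ j / fact j)"
          using Suc \<sigma> s t by force
        also have "A * exp (L * s) / (1 + ?y\<^sup>2) <= A * exp (L * s) * (K / ?w)"
          using mult_left_mono[OF sh[OF s], of "A * exp (L * s)"] A by simp
        finally have 1: "norm (ch n (- \<sigma>) ?y s) <= A * exp (L * s) * (K / ?w) + (B * \<bar>m\<bar> ^ j) * (s ^ j / fact j)" by simp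
        have "norm (f1 n 0 ?y s + cx \<sigma> * f2 n 0 ?y s) <= C / (1 + ?y\<^sup>2)"
          by (rule frc[OF \<sigma>]) (use s t in auto)
        also have "\<dots> <= C * (K / ?w)" using mult_left_mono[OF sh[OF s] C] by simp
        finally have 2: "norm (f1 n 0 ?y s + cx \<sigma> * f2 n 0 ?y s) <= C * (K / ?w)" .
        have "norm (?h s) <= norm (- \<i> * m * ch n (- \<sigma>) ?y s) + norm (f1 n 0 ?y s + cx \<sigma> * f2 n 0 ?y s)"
          by (rule norm_triangle_ineq)
        also have "norm (- \<i> * m * ch n (- \<sigma>) ?y s) = \<bar>m\<bar> * norm (ch n (- \<sigma>) ?y s)" by (simp add: norm_mult)
        also have "\<bar>m\<bar> * norm (ch n (- \<sigma>) ?y s) <= \<bar>m\<bar> * (A * exp (L * s) * (K / ?w) + (B * \<bar>m\<bar> ^ j) * (s ^ j / fact j))"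
          by (rule mult_left_mono[OF 1]) simp
        finally have "norm (?h s) <= \<bar>m\<bar> * (A * exp (L * s) * (K / ?w) + (B * \<bar>m\<bar> ^ j) * (s ^ j / fact j)) + C * (K / ?w)"
          using 2 by simp
        also have "\<dots> = (\<bar>m\<bar> * A * K / ?w) * exp (L * s) + (B * \<bar>m\<bar> ^ Suc j) * (s ^ j / fact j) + C * K / ?w"
          by (simp add: algebra_simps)
        finally show ?thesis .
      qed
      from characteristic_integral_bound[OF t(1) hI L bd]
      have "norm (ch n \<sigma> x t - ch n \<sigma> ?x 0) <= (\<bar>m\<bar> * A * K / ?w) * (exp (L * t) - 1) / L + (B * \<bar>m\<bar> ^ Suc j) * (t ^ Suc j / fact (Suc j)) + C * K / ?w * t"
        by simp
      moreover have "(\<bar>m\<bar> * A * K / ?w) * (exp (L * t) - 1) / L <= A * (exp (L * t) - 1) / ?w"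
      proof -
        have "\<bar>m\<bar> * K / L <= 1" using L by (simp add: L_def)
        moreover have "A * (exp (L * t) - 1) / ?w >= 0" using A L t pos[of x] by simp
        ultimately have "\<bar>m\<bar> * K / L * (A * (exp (L * t) - 1) / ?w) <= 1 * (A * (exp (L * t) - 1) / ?w)"
          by (rule mult_right_mono)
        then show ?thesis by (simp add: mult_ac)
      qed
      moreover have "C * K / ?w * t <= C * K / ?w * T" using t C K pos[of x] by (intro mult_left_mono) auto
      moreover have "norm (ch n \<sigma> ?x 0) <= C * K / ?w"
      proof -
        have "norm (ch n \<sigma> ?x 0) <= C / (1 + ?x\<^sup>2)" by (rule ini[OF \<sigma>])
        also have "\<dots> <= C * (K / ?w)" using mult_left_mono[OF sh[of 0] C] t by simp
        finally show ?thesis by simp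
      qed
      moreover have "norm (ch n \<sigma> x t) <= norm (ch n \<sigma> x t - ch n \<sigma> ?x 0) + norm (ch n \<sigma> ?x 0)"
        using norm_triangle_ineq[of "ch n \<sigma> x t - ch n \<sigma> ?x 0" "ch n \<sigma> ?x 0"] by simp
      moreover have "A * exp (L * t) / ?w = A * (exp (L * t) - 1) / ?w + (C * K / ?w * T + C * K / ?w)"
        by (simp add: A_def algebra_simps add_divide_distrib diff_divide_distrib)
      ultimately show "norm (ch n \<sigma> x t) <= A * exp (L * t) / ?w + (B * \<bar>m\<bar> ^ Suc j) * (t ^ Suc j / fact (Suc j))"
        by linarith
    qed
  qed
  have "norm (ch n \<sigma> x t) <= A * exp (L * T) / (1 + x\<^sup>2)" if *: "\<sigma> = 1 \<or> \<sigma> = - 1" "0 <= t" "t <= T" for \<sigma> x t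
  proof -
    have "(%j. inverse (fact j) * (\<bar>m\<bar> * t) ^ j) \<longlonglongrightarrow> 0"
      by (rule summable_LIMSEQ_zero[OF summable_exp])
    then have lim: "(%j. A * exp (L * t) / (1 + x\<^sup>2) + B * (inverse (fact j) * (\<bar>m\<bar> * t) ^ j)) \<longlonglongrightarrow> A * exp (L * t) / (1 + x\<^sup>2) + B * 0"
      by (intro tendsto_intros)
    have bd: "norm (ch n \<sigma> x t) <= A * exp (L * t) / (1 + x\<^sup>2) + B * (inverse (fact j) * (\<bar>m\<bar> * t) ^ j)" for j
    proof -
      have "(B * \<bar>m\<bar> ^ j) * (t ^ j / fact j) = B * (inverse (fact j) * (\<bar>m\<bar> * t) ^ j)"
        by (simp add: power_mult_distrib divide_inverse mult_ac)
      then show ?thesis using main[of j, rule_format, OF *, of x] by simp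
    qed
    have "norm (ch n \<sigma> x t) <= A * exp (L * t) / (1 + x\<^sup>2) + B * 0"
      by (rule LIMSEQ_le_const[OF lim]) (use bd in blast)
    also have "\<dots> <= A * exp (L * T) / (1 + x\<^sup>2)"
      using that A L pos[of x] by (simp add: divide_right_mono mult_left_mono)
    finally show ?thesis .
  qed
  then show ?thesis by (intro exI allI impI)
qed

lemma v_decay:
  assumes "T >= 0"
  shows "\<exists>C. \<forall>x t. 0 <= t --> t <= T --> norm (v1 n 0 x t) <= C / (1 + x\<^sup>2) \<and> norm (v2 n 0 x t) <= C / (1 + x\<^sup>2)"
proof -
  from ch_decay[OF assms, of n] obtain C where
    C: "\<forall>\<sigma> x t. (\<sigma> = 1 \<or> \<sigma> = - 1) --> 0 <= t --> t <= T --> norm (ch n \<sigma> x t) <= C / (1 + x\<^sup>2)" ..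
  have "norm (v1 n 0 x t) <= C / (1 + x\<^sup>2) \<and> norm (v2 n 0 x t) <= C / (1 + x\<^sup>2)" if t: "0 <= t" "t <= T" for x t
  proof -
    have "norm (ch n 1 x t) <= C / (1 + x\<^sup>2)" "norm (ch n (- 1) x t) <= C / (1 + x\<^sup>2)" using C t by auto
    moreover have "2 * v1 n 0 x t = ch n 1 x t + ch n (- 1) x t" "2 * v2 n 0 x t = ch n 1 x t - ch n (- 1) x t"
      by (simp_all add: ch_def)
    then have "2 * norm (v1 n 0 x t) <= norm (ch n 1 x t) + norm (ch n (- 1) x t)"
      "2 * norm (v2 n 0 x t) <= norm (ch n 1 x t) + norm (ch n (- 1) x t)"
      using norm_triangle_ineq[of "ch n 1 x t" "ch n (- 1) x t"] norm_triangle_ineq4[of "ch n 1 x t" "ch n (- 1) x t"]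
      by (metis norm_mult norm_numeral)+
    ultimately show ?thesis by linarith
  qed
  then show ?thesis by (intro exI allI impI)
qed

lemma v_time_derivative_decay:
  assumes T: "T >= 0"
  shows "\<exists>C. \<forall>x t. 0 <= t --> t <= T --> norm (v1 0 1 x t) <= C / (1 + x\<^sup>2) \<and> norm (v2 0 1 x t) <= C / (1 + x\<^sup>2)"
proof -
  from v_decay[OF T, of 0] obtain C where C: "\<forall>x t. 0 <= t --> t <= T --> norm (v1 0 0 x t) <= C / (1 + x\<^sup>2) \<and> norm (v2 0 0 x t) <= C / (1 + x\<^sup>2)" ..
  from v_decay[OF T, of "Suc 0"] obtain D where D: "\<forall>x t. 0 <= t --> t <= T --> norm (v1 (Suc 0) 0 x t) <= D / (1 + x\<^sup>2) \<and> norm (v2 (Suc 0) 0 x t) <= D / (1 + x\<^sup>2)" ..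
  have "\<exists>C. \<forall>x t. 0 <= t --> t <= T --> norm (f1 0 0 x t) <= C / (1 + x\<^sup>2)"
    using f1 unfolding force_family_def by presburger
  then obtain C3 where C3: "\<forall>x t. 0 <= t --> t <= T --> norm (f1 0 0 x t) <= C3 / (1 + x\<^sup>2)" ..
  have "\<exists>C. \<forall>x t. 0 <= t --> t <= T --> norm (f2 0 0 x t) <= C / (1 + x\<^sup>2)"
    using f2 unfolding force_family_def by presburger
  then obtain C4 where C4: "\<forall>x t. 0 <= t --> t <= T --> norm (f2 0 0 x t) <= C4 / (1 + x\<^sup>2)" ..
  have tri: "norm (- a - z * b + c) <= norm a + norm z * norm b + norm c" "norm (- a + z * b + c) <= norm a + norm z * norm b + norm c" for a b c z :: complex
    using norm_triangle_ineq[of "- a - z * b" c] norm_triangle_ineq4[of "- a" "z * b"]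
      norm_triangle_ineq[of "- a + z * b" c] norm_triangle_ineq[of "- a" "z * b"]
    by (simp_all add: norm_mult)
  have M: "\<bar>m\<bar> * (C / w) = \<bar>m\<bar> * C / w" for w by simp
  have "norm (v1 0 1 x t) <= (D + \<bar>m\<bar> * C + (\<bar>C3\<bar> + \<bar>C4\<bar>)) / (1 + x\<^sup>2) \<and> norm (v2 0 1 x t) <= (D + \<bar>m\<bar> * C + (\<bar>C3\<bar> + \<bar>C4\<bar>)) / (1 + x\<^sup>2)"
    if t: "0 <= t" "t <= T" for x t
  proof -
    have p: "1 + x\<^sup>2 > 0" by (simp add: add_pos_nonneg)
    have b: "norm (v1 0 0 x t) <= C / (1 + x\<^sup>2)" "norm (v2 0 0 x t) <= C / (1 + x\<^sup>2)"
      "norm (v1 (Suc 0) 0 x t) <= D / (1 + x\<^sup>2)" "norm (v2 (Suc 0) 0 x t) <= D / (1 + x\<^sup>2)"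
      "norm (f1 0 0 x t) <= C3 / (1 + x\<^sup>2)" "norm (f2 0 0 x t) <= C4 / (1 + x\<^sup>2)"
      using C D C3 C4 t by auto
    have c: "C3 / (1 + x\<^sup>2) <= (\<bar>C3\<bar> + \<bar>C4\<bar>) / (1 + x\<^sup>2)" "C4 / (1 + x\<^sup>2) <= (\<bar>C3\<bar> + \<bar>C4\<bar>) / (1 + x\<^sup>2)"
      using p by (intro divide_right_mono; linarith)+
    have n: "norm (\<i> * cx m) = \<bar>m\<bar>" by (simp add: norm_mult)
    have "norm (v1 0 1 x t) <= norm (v2 (Suc 0) 0 x t) + \<bar>m\<bar> * norm (v1 0 0 x t) + norm (f1 0 0 x t)"
      unfolding dirac_equations(1)[OF t(1)] n[symmetric] by (rule tri)
    also have "\<dots> <= D / (1 + x\<^sup>2) + \<bar>m\<bar> * (C / (1 + x\<^sup>2)) + (\<bar>C3\<bar> + \<bar>C4\<bar>) / (1 + x\<^sup>2)"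
      using b c by (intro add_mono mult_left_mono) auto
    finally have 1: "norm (v1 0 1 x t) <= (D + \<bar>m\<bar> * C + (\<bar>C3\<bar> + \<bar>C4\<bar>)) / (1 + x\<^sup>2)"
      unfolding M add_divide_distrib .
    have "norm (v2 0 1 x t) <= norm (v1 (Suc 0) 0 x t) + \<bar>m\<bar> * norm (v2 0 0 x t) + norm (f2 0 0 x t)"
      unfolding dirac_equations(2)[OF t(1)] n[symmetric] by (rule tri)
    also have "\<dots> <= D / (1 + x\<^sup>2) + \<bar>m\<bar> * (C / (1 + x\<^sup>2)) + (\<bar>C3\<bar> + \<bar>C4\<bar>) / (1 + x\<^sup>2)"
      using b c by (intro add_mono mult_left_mono) auto
    finally have 2: "norm (v2 0 1 x t) <= (D + \<bar>m\<bar> * C + (\<bar>C3\<bar> + \<bar>C4\<bar>)) / (1 + x\<^sup>2)"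
      unfolding M add_divide_distrib .
    show ?thesis using 1 2 by simp
  qed
  then show ?thesis by (intro exI allI impI)
qed

end

section \<open>Integrals with moving limits\<close>

lemma continuous_on_slices:
  assumes c: "continuous_on (P \<times> Q) (%(p, \<tau>). \<phi> p \<tau>)"
  shows "p \<in> P ==> continuous_on Q (%\<tau>. \<phi> p \<tau>)" "\<tau> \<in> Q ==> continuous_on P (%p. \<phi> p \<tau>)"
proof -
  assume p: "p \<in> P"
  have "continuous_on Q (%\<tau>. case (p, \<tau>) of (p, \<tau>) => \<phi> p \<tau>)"
    by (rule continuous_on_compose2[OF c continuous_on_Pair[OF continuous_on_const continuous_on_id]]) (use p in auto)
  then show "continuous_on Q (%\<tau>. \<phi> p \<tau>)" by simp
next
  assume t: "\<tau> \<in> Q"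
  have "continuous_on P (%p. case (p, \<tau>) of (p, \<tau>) => \<phi> p \<tau>)"
    by (rule continuous_on_compose2[OF c continuous_on_Pair[OF continuous_on_id continuous_on_const]]) (use t in auto)
  then show "continuous_on P (%p. \<phi> p \<tau>)" by simp
qed

lemma integral_rescale:
  fixes \<psi> :: "real => complex"
  assumes "r >= 0" and c: "continuous_on {0..r} \<psi>"
  shows "integral {0..r} \<psi> = r *\<^sub>R integral {0..1} (%\<sigma>. \<psi> (r * \<sigma>))"
proof (cases "r = 0")
  case False
  then have r: "r > 0" using assms by simp
  have "(\<psi> has_integral integral {0..r} \<psi>) {0..r}"
    by (rule integrable_integral[OF integrable_continuous_real[OF c]])
  from has_integral_stretch_real[OF this, of r] r
  have "((%x. \<psi> (r * x)) has_integral (1 / r) *\<^sub>R integral {0..r} \<psi>) ((%x. x / r) ` {0..r})" by simp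
  moreover have "(%x. x / r) ` {0..r} = {0..1}"
    using r by (auto simp: image_divide_atLeastAtMost)
  ultimately have "integral {0..1} (%x. \<psi> (r * x)) = (1 / r) *\<^sub>R integral {0..r} \<psi>"
    by (simp add: integral_unique)
  then show ?thesis using r by simp
qed simp

lemma continuous_on_moving_integral:
  fixes \<psi> :: "'p::metric_space => real => complex"
  assumes c: "continuous_on (P \<times> {0..d}) (%(p, \<tau>). \<psi> p \<tau>)"
    and r: "continuous_on P r" "\<And>p. p \<in> P ==> r p \<in> {0..d}"
  shows "continuous_on P (%p. integral {0..r p} (\<psi> p))"
proof -
  have s: "continuous_on {0..d} (\<psi> p)" if "p \<in> P" for p
    by (rule continuous_on_slices(1)[OF c that])
  have "continuous_on (P \<times> cbox 0 1) (%z. case (fst z, r (fst z) * snd z) of (p, \<tau>) => \<psi> p \<tau>)"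
  proof (rule continuous_on_compose2[OF c])
    have "continuous_on (P \<times> cbox 0 1) (%z. r (fst z))"
      by (rule continuous_on_compose2[OF r(1)]) (auto intro!: continuous_intros)
    then show "continuous_on (P \<times> cbox 0 1) (%z. (fst z, r (fst z) * snd z))" by (intro continuous_intros)
    show "(%z. (fst z, r (fst z) * snd z)) ` (P \<times> cbox 0 1) \<subseteq> P \<times> {0..d}"
    proof (rule image_subsetI)
      fix z assume z: "z \<in> P \<times> cbox 0 (1::real)"
      then have "0 <= r (fst z)" "r (fst z) <= d" "0 <= snd z" "snd z <= 1" using r(2)[of "fst z"] by auto
      then have "0 <= r (fst z) * snd z" "r (fst z) * snd z <= d" using mult_left_le[of "snd z" "r (fst z)"] by auto
      then show "(fst z, r (fst z) * snd z) \<in> P \<times> {0..d}" using z by auto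
    qed
  qed
  then have "continuous_on (P \<times> cbox 0 1) (%(p, \<sigma>). \<psi> p (r p * \<sigma>))" by (simp add: case_prod_beta)
  then have "continuous_on P (%p. integral (cbox 0 1) (%\<sigma>. \<psi> p (r p * \<sigma>)))"
    by (rule integral_continuous_on_param)
  then have "continuous_on P (%p. r p *\<^sub>R integral {0..1} (%\<sigma>. \<psi> p (r p * \<sigma>)))"
    by (intro continuous_intros r) simp
  moreover have "integral {0..r p} (\<psi> p) = r p *\<^sub>R integral {0..1} (%\<sigma>. \<psi> p (r p * \<sigma>))" if "p \<in> P" for p
    by (rule integral_rescale) (use r(2)[OF that] in \<open>auto intro: continuous_on_subset[OF s[OF that]]\<close>)
  ultimately show ?thesis by (simp cong: continuous_on_cong)
qed

text \<open>The chain rule for \<open>(\<rho>, p) \<mapsto> \<integral>\<^sub>0\<^sup>\<rho> \<phi>(p, \<tau>) d\<tau>\<close>, composed with \<open>p \<mapsto> (r(p), p)\<close>.\<close>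

lemma leibniz_moving_limit:
  fixes \<phi> \<phi>' :: "real => real => complex"
  assumes p0: "p0 \<in> {a..b}"
    and c: "continuous_on ({a..b} \<times> {0..d}) (%(p, \<tau>). \<phi> p \<tau>)"
    and c': "continuous_on ({a..b} \<times> {0..d}) (%(p, \<tau>). \<phi>' p \<tau>)"
    and der: "\<And>p \<tau>. p \<in> {a..b} ==> \<tau> \<in> {0..d} ==> ((%p. \<phi> p \<tau>) hvd \<phi>' p \<tau>) (at p within {a..b})"
    and r: "\<And>p. p \<in> {a..b} ==> r p \<in> {0..d}" "(r hrd r') (at p0 within {a..b})"
  shows "((%p. integral {0..r p} (\<phi> p)) hvd
     r' *\<^sub>R \<phi> p0 (r p0) + integral {0..r p0} (\<phi>' p0)) (at p0 within {a..b})"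
proof -
  have s: "continuous_on {0..d} (\<phi> p)" "continuous_on {0..d} (\<phi>' p)" if "p \<in> {a..b}" for p
    by (rule continuous_on_slices(1)[OF c that], rule continuous_on_slices(1)[OF c' that])
  have r0: "r p0 \<in> {0..d}" by (rule r(1)[OF p0])
  let ?f = "%\<rho> p. integral {0..\<rho>} (\<phi> p)"
  let ?fy = "%\<rho> p. blinfun_scaleR_left (integral {0..\<rho>} (\<phi>' p))"
  have D: "((%(\<rho>, p). ?f \<rho> p) has_derivative (%(tx, ty). tx *\<^sub>R \<phi> p0 (r p0) + blinfun_apply (?fy (r p0) p0) ty))
      (at (r p0, p0) within {0..d} \<times> {a..b})"
  proof (rule has_derivative_partialsI)
    show "((%\<rho>. ?f \<rho> p0) has_derivative (%tx. tx *\<^sub>R \<phi> p0 (r p0))) (at (r p0) within {0..d})"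
      using integral_has_vector_derivative[OF s(1)[OF p0] r0] by (simp add: has_vector_derivative_def)
    show "((%p. ?f \<rho> p) has_derivative blinfun_apply (?fy \<rho> p)) (at p within {a..b})"
      if "\<rho> \<in> {0..d}" "p \<in> {a..b}" for \<rho> p
    proof -
      have "((%p. integral (cbox 0 \<rho>) (\<phi> p)) hvd integral (cbox 0 \<rho>) (\<phi>' p)) (at p within {a..b})"
      proof (rule leibniz_rule_vector_derivative)
        show "((%x. \<phi> x t) hvd \<phi>' x t) (at x within {a..b})" if "x \<in> {a..b}" "t \<in> cbox 0 \<rho>" for x t
          using der that \<open>\<rho> \<in> {0..d}\<close> by simp
        show "\<phi> x integrable_on cbox 0 \<rho>" if "x \<in> {a..b}" for x
          using integrable_continuous_real[OF continuous_on_subset[OF s(1)[OF that], of "{0..\<rho>}"]] \<open>\<rho> \<in> {0..d}\<close> by simp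
        show "continuous_on ({a..b} \<times> cbox 0 \<rho>) (%(x, t). \<phi>' x t)"
          by (rule continuous_on_subset[OF c']) (use \<open>\<rho> \<in> {0..d}\<close> in auto)
      qed (use that in auto)
      then show ?thesis by (simp add: has_vector_derivative_eq_has_derivative_blinfun)
    qed
    have "continuous_on ({0..d} \<times> {a..b}) (%q. integral {0..fst q} (\<phi>' (snd q)))"
    proof (rule continuous_on_moving_integral)
      have "continuous_on (({0..d} \<times> {a..b}) \<times> {0..d}) (%z. case (snd (fst z), snd z) of (p, \<tau>) => \<phi>' p \<tau>)"
        by (rule continuous_on_compose2[OF c']) (auto intro!: continuous_intros)
      then show "continuous_on (({0..d} \<times> {a..b}) \<times> {0..d}) (%(q, \<tau>). \<phi>' (snd q) \<tau>)"
        unfolding case_prod_unfold by simp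
    qed (auto intro!: continuous_intros)
    then have "continuous_on ({0..d} \<times> {a..b}) (%q. ?fy (fst q) (snd q))"
      by (intro bounded_linear.continuous_on[OF bounded_linear_blinfun_scaleR_left])
    then show "continuous (at (r p0, p0) within {0..d} \<times> {a..b}) (%(\<rho>, p). ?fy \<rho> p)"
      using r0 p0 unfolding case_prod_unfold continuous_on_eq_continuous_within by simp
  qed (use p0 in auto)
  have R: "((%p. (r p, p)) has_derivative (%h. (r' * h, h))) (at p0 within {a..b})"
    using r(2) by (auto intro!: derivative_eq_intros simp: has_field_derivative_def)
  have sub: "(%p. (r p, p)) ` {a..b} \<subseteq> {0..d} \<times> {a..b}" using r(1) by auto
  have "((%(\<rho>, p). ?f \<rho> p) \<circ> (%p. (r p, p)) has_derivative
      (%(tx, ty). tx *\<^sub>R \<phi> p0 (r p0) + blinfun_apply (?fy (r p0) p0) ty) \<circ> (%h. (r' * h, h))) (at p0 within {a..b})"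
    by (rule diff_chain_within[OF R has_derivative_subset[OF D sub]])
  then show ?thesis unfolding has_vector_derivative_def
    by (simp add: o_def scaleR_add_right mult.commute)
qed

text \<open>Fubini's theorem on the triangle \<open>x, \<tau> \<ge> 0\<close>, \<open>x + \<tau> \<le> t\<close>.\<close>

lemma triangle_swap:
  fixes \<phi> :: "real => real => complex"
  assumes c: "continuous_on ({0..t} \<times> {0..t}) (%(x, \<tau>). \<phi> x \<tau>)" and t: "t >= 0"
  shows "integral {0..t} (%x. integral {0..t - x} (%\<tau>. \<phi> x \<tau>)) = integral {0..t} (%\<tau>. integral {0..t - \<tau>} (%x. \<phi> x \<tau>))"
proof -
  let ?T = "{p::real\<times>real. 0 <= fst p \<and> 0 <= snd p \<and> fst p + snd p <= t}"
  let ?f = "%x \<tau>. indicator ?T (x, \<tau>) *\<^sub>R \<phi> x \<tau>"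
  have sub: "?T \<subseteq> {0..t} \<times> {0..t}" by auto
  have "closed ?T" by (intro closed_Collect_conj closed_Collect_le continuous_intros)
  moreover have "bounded ?T" by (rule bounded_subset[OF _ sub]) (intro bounded_Times bounded_closed_interval)
  ultimately have K: "compact ?T" by (simp add: compact_eq_bounded_closed)
  have "integrable lborel (%p. indicator ?T p *\<^sub>R (%(x, \<tau>). \<phi> x \<tau>) p)"
    by (rule borel_integrable_compact[OF K continuous_on_subset[OF c sub]])
  moreover have "(%p. indicator ?T p *\<^sub>R (%(x, \<tau>). \<phi> x \<tau>) p) = case_prod ?f" by (simp add: fun_eq_iff)
  ultimately have int: "integrable (lborel \<Otimes>\<^sub>M lborel) (case_prod ?f)" unfolding lborel_prod by simp
  have eqA: "integral {0..t} G = (LINT x|lborel. indicator {0..t} x *\<^sub>R G x)" if "continuous_on {0..t} G" for G :: "real => complex" and t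
    using set_borel_integral_eq_integral(2)[OF borel_integrable_atLeastAtMost'[OF that]] by (simp add: set_lebesgue_integral_def)
  have s1: "continuous_on {0..t} (%\<tau>. \<phi> x \<tau>)" if "x \<in> {0..t}" for x
    by (rule continuous_on_slices(1)[OF c that])
  have s2: "continuous_on {0..t} (%x. \<phi> x \<tau>)" if "\<tau> \<in> {0..t}" for \<tau>
    by (rule continuous_on_slices(2)[OF c that])
  have c2: "continuous_on ({0..t} \<times> {0..t}) (%(\<tau>, x). \<phi> x \<tau>)"
  proof -
    have "continuous_on ({0..t} \<times> {0..t}) (%p. case (snd p, fst p) of (x, \<tau>) => \<phi> x \<tau>)"
      by (rule continuous_on_compose2[OF c]) (auto intro!: continuous_intros)
    then show ?thesis by (simp add: case_prod_beta)
  qed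
  have "continuous_on {0..t} (%x. integral {0..t - x} (\<phi> x))"
    by (rule continuous_on_moving_integral[OF c]) (auto intro!: continuous_intros)
  then have "integral {0..t} (%x. integral {0..t - x} (\<phi> x)) = (LINT x|lborel. indicator {0..t} x *\<^sub>R integral {0..t - x} (\<phi> x))"
    by (rule eqA)
  also have "\<dots> = (LINT x|lborel. LINT \<tau>|lborel. ?f x \<tau>)"
  proof (rule Bochner_Integration.integral_cong[OF refl])
    fix x
    show "indicator {0..t} x *\<^sub>R integral {0..t - x} (\<phi> x) = (LINT \<tau>|lborel. ?f x \<tau>)"
    proof (cases "x \<in> {0..t}")
      case True
      have "continuous_on {0..t - x} (\<phi> x)" by (rule continuous_on_subset[OF s1[OF True]]) (use True in auto)
      from eqA[OF this] have "integral {0..t - x} (\<phi> x) = (LINT \<tau>|lborel. indicator {0..t - x} \<tau> *\<^sub>R \<phi> x \<tau>)" .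
      also have "\<dots> = (LINT \<tau>|lborel. ?f x \<tau>)"
        by (intro Bochner_Integration.integral_cong refl) (use True in \<open>auto simp: indicator_def\<close>)
      finally show ?thesis using True by simp
    next
      case False
      then have z: "?f x \<tau> = 0" for \<tau> by (auto simp: indicator_def)
      show ?thesis using False unfolding z by simp
    qed
  qed
  also have "\<dots> = (LINT \<tau>|lborel. LINT x|lborel. ?f x \<tau>)" by (rule lborel_pair.Fubini_integral[symmetric, OF int])
  also have "\<dots> = (LINT \<tau>|lborel. indicator {0..t} \<tau> *\<^sub>R integral {0..t - \<tau>} (%x. \<phi> x \<tau>))"
  proof (rule Bochner_Integration.integral_cong[OF refl])
    fix \<tau>
    show "(LINT x|lborel. ?f x \<tau>) = indicator {0..t} \<tau> *\<^sub>R integral {0..t - \<tau>} (%x. \<phi> x \<tau>)"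
    proof (cases "\<tau> \<in> {0..t}")
      case True
      have "continuous_on {0..t - \<tau>} (%x. \<phi> x \<tau>)" by (rule continuous_on_subset[OF s2[OF True]]) (use True in auto)
      from eqA[OF this] have "integral {0..t - \<tau>} (%x. \<phi> x \<tau>) = (LINT x|lborel. indicator {0..t - \<tau>} x *\<^sub>R \<phi> x \<tau>)" .
      also have "\<dots> = (LINT x|lborel. ?f x \<tau>)"
        by (intro Bochner_Integration.integral_cong refl) (use True in \<open>auto simp: indicator_def\<close>)
      finally show ?thesis using True by simp
    next
      case False
      then have z: "?f x \<tau> = 0" for x by (auto simp: indicator_def)
      show ?thesis using False unfolding z by simp
    qed
  qed
  also have "\<dots> = integral {0..t} (%\<tau>. integral {0..t - \<tau>} (%x. \<phi> x \<tau>))"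
    by (rule eqA[symmetric], rule continuous_on_moving_integral[OF c2]) (auto intro!: continuous_intros)
  finally show ?thesis .
qed

section \<open>The Bessel kernel\<close>

definition bessel_coeff :: "real => nat => real" where
  "bessel_coeff m n = (- (m\<^sup>2 / 4)) ^ n / (fact n)\<^sup>2"

text \<open>As a function of \<open>z = t\<^sup>2 - x\<^sup>2\<close>, \<open>J m 0\<close> is the Bessel function \<open>J\<^sub>0(m \<surd>z)\<close>, which is entire in \<open>z\<close>; the index
\<open>j\<close> counts derivatives in \<open>z\<close>.\<close>

definition J :: "real => nat => real => real" where
  "J m j z = (\<Sum>n. (diffs ^^ j) (bessel_coeff m) n * z ^ n)"

lemma bessel_summable: "summable (%n. (diffs ^^ j) (bessel_coeff m) n * z ^ n)"
proof (induction j arbitrary: z)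
  case 0
  have le: "norm (bessel_coeff m n * z ^ n) <= inverse (fact n) * (m\<^sup>2 / 4 * \<bar>z\<bar>) ^ n" for n
  proof -
    have "(1::real) <= fact n" by (rule fact_ge_1)
    then have "1 / (fact n)\<^sup>2 <= 1 / (fact n :: real)" by (intro divide_left_mono) (auto simp: self_le_power)
    then have "(m\<^sup>2 / 4) ^ n * \<bar>z\<bar> ^ n * (1 / (fact n)\<^sup>2) <= (m\<^sup>2 / 4) ^ n * \<bar>z\<bar> ^ n * (1 / fact n)"
      by (intro mult_left_mono) auto
    moreover have "norm (bessel_coeff m n * z ^ n) = (m\<^sup>2 / 4) ^ n * \<bar>z\<bar> ^ n * (1 / (fact n)\<^sup>2)"
      by (simp add: bessel_coeff_def abs_mult power_abs)
    moreover have "(m\<^sup>2 / 4) ^ n * \<bar>z\<bar> ^ n * (1 / fact n) = inverse (fact n) * (m\<^sup>2 / 4 * \<bar>z\<bar>) ^ n"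
      unfolding power_mult_distrib by (simp only: divide_inverse mult_1 mult.commute)
    ultimately show ?thesis by simp
  qed
  have "summable (%n. bessel_coeff m n * z ^ n)"
    by (rule summable_comparison_test'[OF summable_exp[of "m\<^sup>2 / 4 * \<bar>z\<bar>"], of 0]) (rule le)
  then show ?case by simp
next
  case (Suc j)
  show ?case using termdiff_converges_all[of "(diffs ^^ j) (bessel_coeff m)" z, OF Suc] by simp
qed

lemma J_derivative: "(J m j hrd J m (Suc j) z) (at z within S)"
  using termdiffs_strong_converges_everywhere[of "(diffs ^^ j) (bessel_coeff m)" z, OF bessel_summable]
  unfolding J_def[abs_def] by (simp add: has_field_derivative_at_within)

lemma J_continuous: "continuous_on S (J m j)"
  using DERIV_continuous[OF J_derivative] by (simp add: continuous_on_eq_continuous_within)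

lemma J_0_0: "J m 0 0 = 1"
proof -
  have "(%n. bessel_coeff m n * 0 ^ n) sums bessel_coeff m 0" by (rule powser_sums_zero)
  then show ?thesis by (simp add: J_def sums_iff bessel_coeff_def)
qed

lemma bessel_equation: "z * J m 2 z + J m 1 z + m\<^sup>2 / 4 * J m 0 z = 0"
proof -
  let ?a = "bessel_coeff m" and ?b = "diffs (bessel_coeff m)"
  have s0: "summable (%n. ?a n * z ^ n)" using bessel_summable[of 0 m z] by simp
  have s1: "summable (%n. ?b n * z ^ n)" using bessel_summable[of 1 m z] by simp
  have s2: "summable (%n. diffs ?b n * z ^ n)" using bessel_summable[of 2 m z] by (simp add: numeral_2_eq_2)
  have 2: "z * J m 2 z = (\<Sum>n. real n * ?b n * z ^ n)"
  proof -
    have e: "z * (diffs ?b n * z ^ n) = real (Suc n) * ?b (Suc n) * z ^ Suc n" for n by (simp add: diffs_def)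
    have "z * J m 2 z = (\<Sum>n. z * (diffs ?b n * z ^ n))"
      unfolding J_def numeral_2_eq_2 by (simp add: suminf_mult[OF s2])
    also have "\<dots> = (\<Sum>n. real (Suc n) * ?b (Suc n) * z ^ Suc n)" unfolding e ..
    also have "\<dots> = (\<Sum>n. real n * ?b n * z ^ n)"
    proof -
      have "summable (%n. real (Suc n) * ?b (Suc n) * z ^ Suc n)" unfolding e[symmetric] by (rule summable_mult[OF s2])
      then have "summable (%n. real n * ?b n * z ^ n)" by (subst (asm) summable_Suc_iff)
      from suminf_split_head[OF this] show ?thesis by simp
    qed
    finally show ?thesis .
  qed
  have s3: "summable (%n. real n * ?b n * z ^ n)"
  proof -
    have "summable (%n. z * (diffs ?b n * z ^ n))" by (rule summable_mult[OF s2])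
    moreover have "z * (diffs ?b n * z ^ n) = real (Suc n) * ?b (Suc n) * z ^ Suc n" for n by (simp add: diffs_def)
    ultimately have "summable (%n. real (Suc n) * ?b (Suc n) * z ^ Suc n)" by simp
    then show ?thesis by (subst (asm) summable_Suc_iff)
  qed
  have coeff0: "real n * ?b n * z ^ n + ?b n * z ^ n + m\<^sup>2 / 4 * (?a n * z ^ n) = 0" for n
  proof -
    have "?a (Suc n) * (real (Suc n))\<^sup>2 = - (m\<^sup>2 / 4) * ?a n"
      by (simp add: bessel_coeff_def power2_eq_square divide_simps del: of_nat_Suc)
    moreover have "real n * ?b n + ?b n = ?a (Suc n) * (real (Suc n))\<^sup>2"
      by (simp add: diffs_def power2_eq_square algebra_simps)
    ultimately have "real n * ?b n + ?b n + m\<^sup>2 / 4 * ?a n = 0" by simp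
    then have "(real n * ?b n + ?b n + m\<^sup>2 / 4 * ?a n) * z ^ n = 0" by simp
    then show ?thesis by (simp add: algebra_simps)
  qed
  have J1: "J m 1 z = (\<Sum>n. ?b n * z ^ n)" "J m 0 z = (\<Sum>n. ?a n * z ^ n)" by (simp_all add: J_def)
  have "z * J m 2 z + J m 1 z + m\<^sup>2 / 4 * J m 0 z =
      (\<Sum>n. real n * ?b n * z ^ n + ?b n * z ^ n) + (\<Sum>n. m\<^sup>2 / 4 * (?a n * z ^ n))"
    unfolding 2 J1 suminf_add[OF s3 s1] suminf_mult[OF s0] ..
  also have "\<dots> = (\<Sum>n. real n * ?b n * z ^ n + ?b n * z ^ n + m\<^sup>2 / 4 * (?a n * z ^ n))"
    by (rule suminf_add[OF summable_add[OF s3 s1] summable_mult[OF s0]])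
  also have "\<dots> = 0" unfolding coeff0 by simp
  finally show ?thesis .
qed

lemma J_continuous_compose [continuous_intros]:
  "continuous_on S f ==> continuous_on S (%p. J m j (f p))"
  by (rule continuous_on_compose2[OF J_continuous[of UNIV]]) auto

lemma J_chain_derivatives:
  "((%t. J m j (t\<^sup>2 - x\<^sup>2)) hrd J m (Suc j) (t\<^sup>2 - x\<^sup>2) * (2 * t)) (at t within S)"
  "((%x. J m j (t\<^sup>2 - x\<^sup>2)) hrd J m (Suc j) (t\<^sup>2 - x\<^sup>2) * (- 2 * x)) (at x within S)"
  "((%t. J m j ((t - u)\<^sup>2 - x\<^sup>2)) hrd J m (Suc j) ((t - u)\<^sup>2 - x\<^sup>2) * (2 * (t - u))) (at t within S)"
  by (rule DERIV_chain2[where f = "J m j", OF J_derivative]; auto intro!: derivative_eq_intros)+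

lemma real_integral_by_parts:
  fixes f g :: "real => real"
  assumes t: "0 <= t"
    and f: "\<And>y. (f hrd f' y) (at y within {0..t})"
    and g: "\<And>y. (g hrd g' y) (at y within {0..t})"
    and c: "continuous_on {0..t} f'" "continuous_on {0..t} g'"
  shows "integral {0..t} (%y. f y * g' y) = f t * g t - f 0 * g 0 - integral {0..t} (%y. f' y * g y)"
proof -
  have fc: "continuous_on {0..t} f" "continuous_on {0..t} g"
    using DERIV_continuous[OF f] DERIV_continuous[OF g] by (simp_all add: continuous_on_eq_continuous_within)
  have "((%y. f y * g' y + f' y * g y) has_integral f t * g t - f 0 * g 0) {0..t}"
  proof (rule fundamental_theorem_of_calculus[OF t])
    fix y
    from DERIV_mult[OF f g, of y] show "((%y. f y * g y) hvd f y * g' y + f' y * g y) (at y within {0..t})"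
      by (simp add: has_real_derivative_iff_has_vector_derivative[symmetric] add.commute mult.commute)
  qed
  then have "integral {0..t} (%y. f y * g' y + f' y * g y) = f t * g t - f 0 * g 0" by (rule integral_unique)
  moreover have "integral {0..t} (%y. f y * g' y + f' y * g y) =
      integral {0..t} (%y. f y * g' y) + integral {0..t} (%y. f' y * g y)"
    by (intro integral_add integrable_continuous_real continuous_intros fc c)
  ultimately show ?thesis by simp
qed

text \<open>The cosine transform of the Bessel kernel; \<open>bess_F\<close> is its derivative in time.\<close>

definition bess_E :: "real => real => real => real" where
  "bess_E m k t = integral {0..t} (%x. cos (k * x) * J m 0 (t\<^sup>2 - x\<^sup>2))"
definition bess_F :: "real => real => real => real" where
  "bess_F m k t = cos (k * t) + integral {0..t} (%x. cos (k * x) * (J m 1 (t\<^sup>2 - x\<^sup>2) * (2 * t)))"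

lemma real_leibniz_moving_limit:
  fixes \<phi> \<phi>' :: "real => real => real"
  assumes t: "t \<in> {0..T}"
    and c: "continuous_on ({0..T} \<times> {0..T}) (%(p, \<tau>). \<phi> p \<tau>)"
    and c': "continuous_on ({0..T} \<times> {0..T}) (%(p, \<tau>). \<phi>' p \<tau>)"
    and der: "\<And>p \<tau>. ((%p. \<phi> p \<tau>) hrd \<phi>' p \<tau>) (at p within {0..T})"
  shows "((%p. integral {0..p} (\<phi> p)) hrd \<phi> t t + integral {0..t} (\<phi>' t)) (at t within {0..T})"
proof -
  have cof: "continuous_on ({0..T} \<times> {0..T}) (%(p, \<tau>). cx (h p \<tau>))"
    if "continuous_on ({0..T} \<times> {0..T}) (%(p, \<tau>). h p \<tau>)" for h
    using bounded_linear.continuous_on[OF bounded_linear_of_real[where 'a = complex] that] by (simp add: case_prod_unfold)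
  note cc = cof[OF c] cof[OF c']
  have "((%p. integral {0..p} (%\<tau>. cx (\<phi> p \<tau>))) hvd
     1 *\<^sub>R cx (\<phi> t t) + integral {0..t} (%\<tau>. cx (\<phi>' t \<tau>))) (at t within {0..T})"
    by (rule leibniz_moving_limit[where r = "%p. p", OF t cc]) (auto intro!: has_vector_derivative_of_real' der derivative_eq_intros)
  moreover have "integral {0..p} (%\<tau>. cx (h p \<tau>)) = cx (integral {0..p} (h p))"
    if "continuous_on ({0..T} \<times> {0..T}) (%(p, \<tau>). h p \<tau>)" "p \<in> {0..T}" for h p
  proof -
    have "continuous_on {0..p} (h p)"
      by (rule continuous_on_subset[OF continuous_on_slices(1)[OF that]]) (use that(2) in auto)
    then have "(h p has_integral integral {0..p} (h p)) {0..p}" by (intro integrable_integral integrable_continuous_real)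
    from integral_unique[OF has_integral_of_real[OF this, where 'b = complex]] show ?thesis .
  qed
  note eq = this
  ultimately have "((%p. integral {0..p} (%\<tau>. cx (\<phi> p \<tau>))) hvd
     cx (\<phi> t t + integral {0..t} (\<phi>' t))) (at t within {0..T})"
    using eq[OF c' t] by simp
  then have "((%p. cx (integral {0..p} (\<phi> p))) hvd
     cx (\<phi> t t + integral {0..t} (\<phi>' t))) (at t within {0..T})"
    by (rule has_vector_derivative_transform[OF t, rotated]) (use eq[OF c] in simp)
  from bounded_linear.has_vector_derivative[OF bounded_linear_Re this] show ?thesis by (simp add: has_real_derivative_iff_has_vector_derivative)
qed

text \<open>The Bessel kernel solves the Klein-Gordon equation by \<open>bessel_equation\<close>. Two integrations by parts in
\<open>x\<close> turn this into an oscillator equation of frequency \<open>\<rho>\<close>; all terms on the characteristic cancel.\<close>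

lemma bess_derivatives:
  assumes t: "t \<in> {0..T}"
  shows "(bess_E m k hrd bess_F m k t) (at t within {0..T})" (is ?A)
    "(bess_F m k hrd - (k\<^sup>2 + m\<^sup>2) * bess_E m k t) (at t within {0..T})" (is ?B)
proof -
  have "((%p. integral {0..p} (%x. cos (k * x) * J m 0 (p\<^sup>2 - x\<^sup>2))) hrd
     cos (k * t) * J m 0 (t\<^sup>2 - t\<^sup>2) + integral {0..t} (%x. cos (k * x) * (J m 1 (t\<^sup>2 - x\<^sup>2) * (2 * t)))) (at t within {0..T})"
    unfolding One_nat_def
    by (rule real_leibniz_moving_limit[OF t]; (rule DERIV_cmult, rule J_chain_derivatives)?)
       (auto simp: case_prod_unfold intro!: continuous_intros)
  then show ?A
    unfolding bess_E_def[abs_def] bess_F_def by (simp add: J_0_0)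
  let ?J = "%j x. J m j (t\<^sup>2 - x\<^sup>2)"
  let ?C = "%x. cos (k * x)" and ?S = "%x. sin (k * x)"
  have t0: "0 <= t" using t by simp
  have dF: "((%p. integral {0..p} (%x. cos (k * x) * (J m 1 (p\<^sup>2 - x\<^sup>2) * (2 * p)))) hrd
     cos (k * t) * (J m 1 (t\<^sup>2 - t\<^sup>2) * (2 * t)) +
     integral {0..t} (%x. cos (k * x) * (J m 2 (t\<^sup>2 - x\<^sup>2) * (2 * t) * (2 * t) + J m 1 (t\<^sup>2 - x\<^sup>2) * 2))) (at t within {0..T})"
  proof (rule real_leibniz_moving_limit[OF t])
    show "((%p. cos (k * x) * (J m 1 (p\<^sup>2 - x\<^sup>2) * (2 * p))) hrd
       cos (k * x) * (J m 2 (p\<^sup>2 - x\<^sup>2) * (2 * p) * (2 * p) + J m 1 (p\<^sup>2 - x\<^sup>2) * 2)) (at p within {0..T})" for p x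
    proof -
      have 2: "((%p. 2 * p) hrd 2) (at p within {0..T})" by (auto intro!: derivative_eq_intros)
      show ?thesis
        by (rule DERIV_cmult, rule DERIV_cong[OF DERIV_mult[OF J_chain_derivatives(1) 2]])
           (simp add: numeral_2_eq_2 algebra_simps)
    qed
  qed (auto simp: case_prod_unfold intro!: continuous_intros)
  have p1: "integral {0..t} (%x. ?C x * (?J 2 x * (4 * x\<^sup>2) - 2 * ?J 1 x)) =
      ?C t * (- 2 * t * ?J 1 t) + k * integral {0..t} (%x. ?S x * (- 2 * x * ?J 1 x))"
  proof -
    have "((%x. - 2 * x * ?J 1 x) hrd ?J 2 x * (4 * x\<^sup>2) - 2 * ?J 1 x) (at x within {0..t})" for x
    proof -
      have 2: "((%x. - 2 * x) hrd - 2) (at x within {0..t})" by (auto intro!: derivative_eq_intros)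
      show ?thesis
        by (rule DERIV_cong[OF DERIV_mult[OF 2 J_chain_derivatives(2)]])
           (simp add: numeral_2_eq_2 power2_eq_square algebra_simps)
    qed
    moreover have "(?C hrd - k * ?S x) (at x within {0..t})" for x
      by (auto intro!: derivative_eq_intros)
    ultimately have "integral {0..t} (%x. ?C x * (?J 2 x * (4 * x\<^sup>2) - 2 * ?J 1 x)) =
      ?C t * (- 2 * t * ?J 1 t) - ?C 0 * (- 2 * 0 * ?J 1 0) - integral {0..t} (%x. - k * ?S x * (- 2 * x * ?J 1 x))"
      by (intro real_integral_by_parts[OF t0] continuous_intros)
    moreover have "integral {0..t} (%x. - k * ?S x * (- 2 * x * ?J 1 x)) = - k * integral {0..t} (%x. ?S x * (- 2 * x * ?J 1 x))"
      by (subst integral_mult_right[symmetric]) (simp only: mult.assoc)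
    ultimately show ?thesis by simp
  qed
  have p2: "integral {0..t} (%x. ?S x * (- 2 * x * ?J 1 x)) = ?S t - k * bess_E m k t"
  proof -
    have "(?J 0 hrd - 2 * x * ?J 1 x) (at x within {0..t})" for x
      by (rule DERIV_cong[OF J_chain_derivatives(2)]) simp
    moreover have "(?S hrd k * ?C x) (at x within {0..t})" for x
      by (auto intro!: derivative_eq_intros)
    ultimately have "integral {0..t} (%x. ?S x * (- 2 * x * ?J 1 x)) =
       ?S t * ?J 0 t - ?S 0 * ?J 0 0 - integral {0..t} (%x. k * ?C x * ?J 0 x)"
      by (intro real_integral_by_parts[OF t0] continuous_intros)
    moreover have "integral {0..t} (%x. k * ?C x * ?J 0 x) = k * bess_E m k t"
      unfolding bess_E_def by (subst integral_mult_right[symmetric]) (simp only: mult.assoc)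
    ultimately show ?thesis by (simp add: J_0_0)
  qed
  have "integral {0..t} (%x. ?C x * (?J 2 x * (2 * t) * (2 * t) + ?J 1 x * 2)) =
     integral {0..t} (%x. ?C x * (?J 2 x * (4 * x\<^sup>2) - 2 * ?J 1 x) - m\<^sup>2 * (?C x * ?J 0 x))"
  proof (rule integral_cong)
    fix x
    have "(t\<^sup>2 - x\<^sup>2) * ?J 2 x + ?J 1 x + m\<^sup>2 / 4 * ?J 0 x = 0" by (rule bessel_equation)
    then have e: "?J 2 x * (2 * t) * (2 * t) + ?J 1 x * 2 = ?J 2 x * (4 * x\<^sup>2) - 2 * ?J 1 x - m\<^sup>2 * ?J 0 x"
      by (simp add: power2_eq_square algebra_simps)
    show "?C x * (?J 2 x * (2 * t) * (2 * t) + ?J 1 x * 2) = ?C x * (?J 2 x * (4 * x\<^sup>2) - 2 * ?J 1 x) - m\<^sup>2 * (?C x * ?J 0 x)"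
      unfolding e by (simp add: algebra_simps)
  qed
  also have "\<dots> = integral {0..t} (%x. ?C x * (?J 2 x * (4 * x\<^sup>2) - 2 * ?J 1 x)) - integral {0..t} (%x. m\<^sup>2 * (?C x * ?J 0 x))"
    by (intro integral_diff integrable_continuous_real continuous_intros)
  also have "integral {0..t} (%x. m\<^sup>2 * (?C x * ?J 0 x)) = m\<^sup>2 * bess_E m k t"
    unfolding bess_E_def by (rule integral_mult_right)
  finally have e: "integral {0..t} (%x. ?C x * (?J 2 x * (2 * t) * (2 * t) + ?J 1 x * 2)) =
      ?C t * (- 2 * t * ?J 1 t) + k * (?S t - k * bess_E m k t) - m\<^sup>2 * bess_E m k t"
    unfolding p1 p2 .
  have "((%p. cos (k * p)) hrd - k * ?S t) (at t within {0..T})"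
    by (auto intro!: derivative_eq_intros)
  from DERIV_add[OF this dF]
  show ?B
    unfolding bess_F_def[abs_def] e
    by (rule DERIV_cong) (simp add: power2_eq_square algebra_simps)
qed

text \<open>Both sides solve the oscillator equation with the same initial values; the two constant Wronskians
determine the solution.\<close>

lemma bess_eq_propagator:
  assumes r: "rho m k \<noteq> 0" and t: "t >= 0"
  shows "bess_E m k t = sin (rho m k * t) / rho m k" "bess_F m k t = pc m k t"
proof -
  let ?r = "rho m k"
  let ?c = "%s. cos (?r * s)" and ?s = "%s. sin (?r * s) / ?r"
  have dc: "(?c hrd - ?r\<^sup>2 * ?s u) (at u within {0..t})" for u
    using r by (auto intro!: derivative_eq_intros simp: power2_eq_square)
  have ds: "(?s hrd ?c u) (at u within {0..t})" for u
    using r by (auto intro!: derivative_eq_intros)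
  note d = bess_derivatives[of _ t m k, folded rho_squared]
  have const: "f t = f 0" if "\<And>u. u \<in> {0..t} ==> (f hrd 0) (at u within {0..t})" for f :: "real => real"
  proof -
    have "((%u. 0) has_integral f t - f 0) {0..t}"
      by (rule fundamental_theorem_of_calculus[OF t])
         (use that in \<open>simp add: has_real_derivative_iff_has_vector_derivative[symmetric]\<close>)
    then have "f t - f 0 = 0" by (rule has_integral_unique) simp
    then show ?thesis by simp
  qed
  have "bess_E m k t * ?c t - bess_F m k t * ?s t = bess_E m k 0 * ?c 0 - bess_F m k 0 * ?s 0"
  proof (rule const)
    fix u assume u: "u \<in> {0..t}"
    show "((%u. bess_E m k u * ?c u - bess_F m k u * ?s u) hrd 0) (at u within {0..t})"
      by (rule DERIV_cong[OF DERIV_diff[OF DERIV_mult[OF d(1)[OF u] dc] DERIV_mult[OF d(2)[OF u] ds]]])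
         (simp add: algebra_simps)
  qed
  then have 1: "bess_E m k t * ?c t = bess_F m k t * ?s t" by (simp add: bess_E_def)
  have "bess_F m k t * ?c t + ?r\<^sup>2 * (bess_E m k t * ?s t) = bess_F m k 0 * ?c 0 + ?r\<^sup>2 * (bess_E m k 0 * ?s 0)"
  proof (rule const)
    fix u assume u: "u \<in> {0..t}"
    show "((%u. bess_F m k u * ?c u + ?r\<^sup>2 * (bess_E m k u * ?s u)) hrd 0) (at u within {0..t})"
      by (rule DERIV_cong[OF DERIV_add[OF DERIV_mult[OF d(2)[OF u] dc] DERIV_cmult[OF DERIV_mult[OF d(1)[OF u] ds]]]])
         (simp add: algebra_simps)
  qed
  then have 2: "bess_F m k t * ?c t + ?r\<^sup>2 * (bess_E m k t * ?s t) = 1" by (simp add: bess_F_def)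
  have 3: "?c t * ?c t + ?r\<^sup>2 * (?s t * ?s t) = 1"
    using r sin_cos_squared_add[of "?r * t"] by (simp add: power2_eq_square)
  have "bess_E m k t = bess_E m k t * (?c t * ?c t + ?r\<^sup>2 * (?s t * ?s t))" unfolding 3 by simp
  also have "\<dots> = ?c t * (bess_E m k t * ?c t) + ?s t * (?r\<^sup>2 * (bess_E m k t * ?s t))" by (simp only: algebra_simps)
  also have "?r\<^sup>2 * (bess_E m k t * ?s t) = 1 - bess_F m k t * ?c t" using 2 by simp
  finally show "bess_E m k t = sin (?r * t) / ?r" unfolding 1 by (simp add: algebra_simps)
  have "bess_F m k t = bess_F m k t * (?c t * ?c t + ?r\<^sup>2 * (?s t * ?s t))" unfolding 3 by simp
  also have "\<dots> = ?c t * (bess_F m k t * ?c t) + ?r\<^sup>2 * ?s t * (bess_F m k t * ?s t)" by (simp only: algebra_simps)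
  also have "bess_F m k t * ?c t = 1 - ?r\<^sup>2 * (bess_E m k t * ?s t)" using 2 by simp
  also have "bess_F m k t * ?s t = bess_E m k t * ?c t" using 1 by simp
  finally show "bess_F m k t = pc m k t" unfolding pc_def by (simp add: algebra_simps)
qed

text \<open>This exhibits the finite propagation speed: each entry is the transform of a point mass at \<open>x = t\<close> and
a kernel supported in \<open>x < t\<close>.\<close>

lemma propagator_as_bessel_integrals:
  assumes r: "rho m k \<noteq> 0" and t: "t >= 0"
  shows "pa m k t = integral {0..t} (%x. cos (k * x) * (m * J m 0 (t\<^sup>2 - x\<^sup>2)))" (is ?A)
    "pc m k t = cos (k * t) + integral {0..t} (%x. cos (k * x) * (J m 1 (t\<^sup>2 - x\<^sup>2) * (2 * t)))" (is ?B)
    "pb m k t = sin (k * t) + integral {0..t} (%x. sin (k * x) * (2 * x * J m 1 (t\<^sup>2 - x\<^sup>2)))" (is ?C)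
proof -
  have E: "bess_E m k t = sin (rho m k * t) / rho m k" by (rule bess_eq_propagator[OF r t])
  have "m * bess_E m k t = integral {0..t} (%x. m * (cos (k * x) * J m 0 (t\<^sup>2 - x\<^sup>2)))"
    unfolding bess_E_def by (rule integral_mult_right[symmetric])
  then show ?A
    unfolding pa_def E[symmetric] by (simp only: mult.left_commute)
  show ?B
    unfolding bess_eq_propagator(2)[OF r t, symmetric] bess_F_def ..
  let ?J = "%j x. J m j (t\<^sup>2 - x\<^sup>2)"
  have "(?J 0 hrd - (2 * x * ?J 1 x)) (at x within {0..t})" for x
    by (rule DERIV_cong[OF J_chain_derivatives(2)]) simp
  moreover have "((%x. sin (k * x)) hrd k * cos (k * x)) (at x within {0..t})" for x
    by (auto intro!: derivative_eq_intros)
  ultimately have "integral {0..t} (%x. sin (k * x) * - (2 * x * ?J 1 x)) =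
     sin (k * t) * ?J 0 t - sin (k * 0) * ?J 0 0 - integral {0..t} (%x. k * cos (k * x) * ?J 0 x)"
    by (intro real_integral_by_parts[OF t] continuous_intros)
  moreover have "integral {0..t} (%x. k * cos (k * x) * ?J 0 x) = k * bess_E m k t"
    unfolding bess_E_def by (subst integral_mult_right[symmetric]) (simp only: mult.assoc)
  moreover have "integral {0..t} (%x. sin (k * x) * - (2 * x * ?J 1 x)) = - integral {0..t} (%x. sin (k * x) * (2 * x * ?J 1 x))"
    by (subst integral_neg[symmetric]) (simp only: mult_minus_right)
  ultimately show ?C
    unfolding pb_def E[symmetric] by (simp add: J_0_0)
qed

section \<open>The correction carried by the boundary datum\<close>

text \<open>Products occur when moving limits are differentiated, so a family closed under products as well as
sums is convenient for \<open>smooth2_coinduct\<close>.\<close>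

inductive_set generated_algebra :: "('a => complex) set => ('a => complex) set" for \<G> where
  gen: "G \<in> \<G> ==> G \<in> generated_algebra \<G>"
| const: "(%p. c) \<in> generated_algebra \<G>"
| add: "A \<in> generated_algebra \<G> ==> B \<in> generated_algebra \<G> ==> (%p. A p + B p) \<in> generated_algebra \<G>"
| mult: "A \<in> generated_algebra \<G> ==> B \<in> generated_algebra \<G> ==> (%p. A p * B p) \<in> generated_algebra \<G>"

lemma smooth2_generated_algebra:
  assumes S: "open S" and F: "F \<in> generated_algebra \<G>"
    and cont: "\<And>G. G \<in> \<G> ==> continuous_on S G"
    and dx: "\<And>G. G \<in> \<G> ==> \<exists>H\<in>generated_algebra \<G>. \<forall>x t. (x, t) \<in> S --> ((%y. G (y, t)) hvd H (x, t)) (at x)"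
    and dt: "\<And>G. G \<in> \<G> ==> \<exists>H\<in>generated_algebra \<G>. \<forall>x t. (x, t) \<in> S --> ((%u. G (x, u)) hvd H (x, t)) (at t)"
  shows "smooth2 S F"
proof (rule smooth2_coinduct[OF S F])
  show "continuous_on S G" if "G \<in> generated_algebra \<G>" for G
    using that by induction (auto intro: cont continuous_intros)
  show "\<exists>H\<in>generated_algebra \<G>. \<forall>x t. (x, t) \<in> S --> ((%y. G (y, t)) hvd H (x, t)) (at x)"
    if "G \<in> generated_algebra \<G>" for G
    using that
  proof induction
    case (const c)
    show ?case by (rule bexI[OF _ generated_algebra.const[of 0]]) (auto intro!: derivative_eq_intros)
  next
    case (add A B)
    then obtain A' B' where "A' \<in> generated_algebra \<G>" "\<forall>x t. (x, t) \<in> S --> ((%y. A (y, t)) hvd A' (x, t)) (at x)"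
      "B' \<in> generated_algebra \<G>" "\<forall>x t. (x, t) \<in> S --> ((%y. B (y, t)) hvd B' (x, t)) (at x)" by blast
    then show ?case
      by (intro bexI[OF _ generated_algebra.add[of A' _ B']]) (auto intro!: has_vector_derivative_add)
  next
    case (mult A B)
    then obtain A' B' where "A' \<in> generated_algebra \<G>" "\<forall>x t. (x, t) \<in> S --> ((%y. A (y, t)) hvd A' (x, t)) (at x)"
      "B' \<in> generated_algebra \<G>" "\<forall>x t. (x, t) \<in> S --> ((%y. B (y, t)) hvd B' (x, t)) (at x)" by blast
    then show ?case using mult.hyps
      by (intro bexI[OF _ generated_algebra.add[OF generated_algebra.mult[of A _ B'] generated_algebra.mult[of A' _ B]]])
         (auto intro!: has_vector_derivative_mult)
  qed (rule dx)
  show "\<exists>H\<in>generated_algebra \<G>. \<forall>x t. (x, t) \<in> S --> ((%u. G (x, u)) hvd H (x, t)) (at t)"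
    if "G \<in> generated_algebra \<G>" for G
    using that
  proof induction
    case (const c)
    show ?case by (rule bexI[OF _ generated_algebra.const[of 0]]) (auto intro!: derivative_eq_intros)
  next
    case (add A B)
    then obtain A' B' where "A' \<in> generated_algebra \<G>" "\<forall>x t. (x, t) \<in> S --> ((%y. A (x, y)) hvd A' (x, t)) (at t)"
      "B' \<in> generated_algebra \<G>" "\<forall>x t. (x, t) \<in> S --> ((%y. B (x, y)) hvd B' (x, t)) (at t)" by blast
    then show ?case
      by (intro bexI[OF _ generated_algebra.add[of A' _ B']]) (auto intro!: has_vector_derivative_add)
  next
    case (mult A B)
    then obtain A' B' where "A' \<in> generated_algebra \<G>" "\<forall>x t. (x, t) \<in> S --> ((%y. A (x, y)) hvd A' (x, t)) (at t)"
      "B' \<in> generated_algebra \<G>" "\<forall>x t. (x, t) \<in> S --> ((%y. B (x, y)) hvd B' (x, t)) (at t)" by blast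
    then show ?case using mult.hyps
      by (intro bexI[OF _ generated_algebra.add[OF generated_algebra.mult[of A _ B'] generated_algebra.mult[of A' _ B]]])
         (auto intro!: has_vector_derivative_mult)
  qed (rule dt)
qed

definition bk :: "real => nat => nat => real => real => real" where
  "bk m j a s x = J m j (s\<^sup>2 - x\<^sup>2) * s ^ a"

lemma bk_derivatives:
  "(bk m j a s hrd - 2 * x * bk m (Suc j) a s x) (at x within S)"
  "((%u. bk m j a (u - \<tau>) x) hrd
     2 * bk m (Suc j) (Suc a) (u - \<tau>) x + a * bk m j (a - 1) (u - \<tau>) x) (at u within S)"
proof -
  show "(bk m j a s hrd - 2 * x * bk m (Suc j) a s x) (at x within S)"
    unfolding bk_def[abs_def]
    by (rule DERIV_cong[OF DERIV_cmult_right[OF J_chain_derivatives(2)]]) simp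
  have "((%u. (u - \<tau>) ^ a) hrd a * (u - \<tau>) ^ (a - 1)) (at u within S)"
    by (auto intro!: derivative_eq_intros)
  from DERIV_mult[OF J_chain_derivatives(3) this]
  show "((%u. bk m j a (u - \<tau>) x) hrd
     2 * bk m (Suc j) (Suc a) (u - \<tau>) x + a * bk m j (a - 1) (u - \<tau>) x) (at u within S)"
    unfolding bk_def by (rule DERIV_cong) (simp add: algebra_simps)
qed

lemma bk_continuous [continuous_intros]:
  "continuous_on S u ==> continuous_on S w ==> continuous_on S (%p. bk m j a (u p) (w p))"
  unfolding bk_def by (intro continuous_intros)

text \<open>These integrals over the past boundary values form, together with powers of \<open>x\<close> and the boundary values
at the retarded time \<open>t - x\<close>, a class closed under both partial derivatives.\<close>

definition retarded :: "real => (real => complex) => nat => nat => real \<times> real => complex" where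
  "retarded m h j a = (%(x, t). integral {0..t - x} (%\<tau>. h \<tau> * cx (bk m j a (t - \<tau>) x)))"

lemma retarded_continuous:
  assumes h: "continuous_on {0..} h"
  shows "continuous_on {(x, t). x <= t} (retarded m h j a)"
proof -
  have *: "continuous_on {p. 0 <= snd p - fst p \<and> snd p - fst p <= d} (retarded m h j a)" for d
  proof -
    have "continuous_on {p. 0 <= snd p - fst p \<and> snd p - fst p <= d}
       (%p. integral {0..snd p - fst p} (%\<tau>. h \<tau> * cx (bk m j a (snd p - \<tau>) (fst p))))"
    proof (rule continuous_on_moving_integral[where d = d])
      have "continuous_on ({p. 0 <= snd p - fst p \<and> snd p - fst p <= d} \<times> {0..d}) (%z. h (snd z))"
        by (rule continuous_on_compose2[OF h]) (auto intro!: continuous_intros)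
      then show "continuous_on ({p. 0 <= snd p - fst p \<and> snd p - fst p <= d} \<times> {0..d})
         (%(p, \<tau>). h \<tau> * cx (bk m j a (snd p - \<tau>) (fst p)))"
        unfolding case_prod_unfold by (intro continuous_intros)
    qed (auto intro!: continuous_intros)
    then show ?thesis by (simp add: retarded_def case_prod_unfold)
  qed
  show ?thesis unfolding continuous_on_eq_continuous_within
  proof
    fix p :: "real \<times> real" assume p: "p \<in> {(x, t). x <= t}"
    let ?d = "snd p - fst p + 1"
    have "continuous (at p within {q. 0 <= snd q - fst q \<and> snd q - fst q <= ?d}) (retarded m h j a)"
      using *[of ?d] p by (auto simp: continuous_on_eq_continuous_within)
    moreover have "at p within {q. 0 <= snd q - fst q \<and> snd q - fst q <= ?d} = at p within {(x, t). x <= t}"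
      by (rule at_within_nhd[where S = "{q. snd q - fst q < ?d}"])
         (auto intro!: open_Collect_less continuous_intros)
    ultimately show "continuous (at p within {(x, t). x <= t}) (retarded m h j a)" by simp
  qed
qed

lemma retarded_derivatives:
  assumes h: "continuous_on {0..} h" and xt: "x < t"
  shows "((%y. retarded m h j a (y, t)) hvd
      - (h (t - x) * cx (J m j 0 * x ^ a)) + (- 2 * cx x) * retarded m h (Suc j) a (x, t)) (at x)" (is ?A)
    and "((%u. retarded m h j a (x, u)) hvd
      h (t - x) * cx (J m j 0 * x ^ a) + (2 * retarded m h (Suc j) (Suc a) (x, t) + of_nat a * retarded m h j (a - 1) (x, t))) (at t)" (is ?B)
proof -
  define \<delta> where "\<delta> = (t - x) / 2"
  have \<delta>: "\<delta> > 0" "t - x = 2 * \<delta>" using xt by (simp_all add: \<delta>_def)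
  have hc: "continuous_on (P \<times> {0..3 * \<delta>}) (%z. h (snd z))" for P :: "real set"
    by (rule continuous_on_compose2[OF h]) (auto intro!: continuous_intros)
  have hs: "continuous_on {0..t - x} h" by (rule continuous_on_subset[OF h]) auto
  have inter: "at x within {x - \<delta>..x + \<delta>} = at x" "at t within {t - \<delta>..t + \<delta>} = at t"
    by (rule at_within_Icc_at; use \<delta>(1) in simp)+
  have r: "((%y. t - y) hrd - 1) (at x within {x - \<delta>..x + \<delta>})"
    "((%u. u - x) hrd 1) (at t within {t - \<delta>..t + \<delta>})"
    by (auto intro!: derivative_eq_intros)
  have "((%y. integral {0..t - y} (%\<tau>. h \<tau> * cx (bk m j a (t - \<tau>) y))) hvd
     (- 1) *\<^sub>R (h (t - x) * cx (bk m j a (t - (t - x)) x)) +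
     integral {0..t - x} (%\<tau>. h \<tau> * cx (- 2 * x * bk m (Suc j) a (t - \<tau>) x))) (at x within {x - \<delta>..x + \<delta>})"
  proof (rule leibniz_moving_limit[OF _ _ _ _ _ r(1), where d = "3 * \<delta>"])
    show "((%y. h \<tau> * cx (bk m j a (t - \<tau>) y)) hvd
       h \<tau> * cx (- 2 * y * bk m (Suc j) a (t - \<tau>) y)) (at y within {x - \<delta>..x + \<delta>})" for y \<tau>
      by (intro has_vector_derivative_mult_right has_vector_derivative_of_real' bk_derivatives)
    show "continuous_on ({x - \<delta>..x + \<delta>} \<times> {0..3 * \<delta>}) (%(y, \<tau>). h \<tau> * cx (bk m j a (t - \<tau>) y))"
      "continuous_on ({x - \<delta>..x + \<delta>} \<times> {0..3 * \<delta>}) (%(y, \<tau>). h \<tau> * cx (- 2 * y * bk m (Suc j) a (t - \<tau>) y))"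
      unfolding case_prod_unfold by (intro continuous_intros hc)+
  qed (use \<delta> in auto)
  moreover have "integral {0..t - x} (%\<tau>. h \<tau> * cx (- 2 * x * bk m (Suc j) a (t - \<tau>) x)) = (- 2 * cx x) * retarded m h (Suc j) a (x, t)"
    unfolding retarded_def case_prod_conv by (subst integral_mult_right[symmetric]) (simp add: mult_ac)
  ultimately show ?A
    unfolding inter by (simp add: retarded_def bk_def)
  let ?D = "%u \<tau>. h \<tau> * cx (2 * bk m (Suc j) (Suc a) (u - \<tau>) x + a * bk m j (a - 1) (u - \<tau>) x)"
  have "((%u. integral {0..u - x} (%\<tau>. h \<tau> * cx (bk m j a (u - \<tau>) x))) hvd
     1 *\<^sub>R (h (t - x) * cx (bk m j a (t - (t - x)) x)) + integral {0..t - x} (?D t)) (at t within {t - \<delta>..t + \<delta>})"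
  proof (rule leibniz_moving_limit[OF _ _ _ _ _ r(2), where d = "3 * \<delta>"])
    show "((%u. h \<tau> * cx (bk m j a (u - \<tau>) x)) hvd ?D u \<tau>) (at u within {t - \<delta>..t + \<delta>})" for u \<tau>
      by (intro has_vector_derivative_mult_right has_vector_derivative_of_real' bk_derivatives)
    show "continuous_on ({t - \<delta>..t + \<delta>} \<times> {0..3 * \<delta>}) (%(u, \<tau>). h \<tau> * cx (bk m j a (u - \<tau>) x))"
      "continuous_on ({t - \<delta>..t + \<delta>} \<times> {0..3 * \<delta>}) (%(u, \<tau>). ?D u \<tau>)"
      unfolding case_prod_unfold by (intro continuous_intros hc)+
  qed (use \<delta> in auto)
  moreover have "integral {0..t - x} (?D t) = 2 * retarded m h (Suc j) (Suc a) (x, t) + of_nat a * retarded m h j (a - 1) (x, t)"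
  proof -
    have "integral {0..t - x} (?D t) = integral {0..t - x} (%\<tau>. 2 * (h \<tau> * cx (bk m (Suc j) (Suc a) (t - \<tau>) x))
        + of_nat a * (h \<tau> * cx (bk m j (a - 1) (t - \<tau>) x)))"
      by (rule integral_cong) (simp add: algebra_simps)
    also have "\<dots> = integral {0..t - x} (%\<tau>. 2 * (h \<tau> * cx (bk m (Suc j) (Suc a) (t - \<tau>) x)))
        + integral {0..t - x} (%\<tau>. of_nat a * (h \<tau> * cx (bk m j (a - 1) (t - \<tau>) x)))"
      by (intro integral_add integrable_continuous_real continuous_intros hs)
    finally show ?thesis unfolding integral_mult_right retarded_def case_prod_conv .
  qed
  ultimately show ?B
    unfolding inter by (simp add: retarded_def bk_def)
qed

lemma propagator_as_kernel_integrals: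
  assumes "rho m k \<noteq> 0" "s >= 0"
  shows "pa m k s = integral {0..s} (%x. cos (k * x) * (m * bk m 0 0 s x))"
    "pc m k s = cos (k * s) + integral {0..s} (%x. cos (k * x) * (2 * bk m 1 1 s x))"
    "pb m k s = sin (k * s) + integral {0..s} (%x. sin (k * x) * (2 * x * bk m 1 0 s x))"
  unfolding propagator_as_bessel_integrals[OF assms] bk_def by (simp_all add: mult_ac)

text \<open>The functions whose transforms are the Duhamel integral with boundary source \<open>2 h\<close>: a wave
\<open>h(t - x)\<close> running along the characteristics and its tail behind the front.\<close>

definition bw1 :: "real => (real => complex) => real \<times> real => complex" where
  "bw1 m h = (%p. h (snd p - fst p) + 2 * cx (fst p) * retarded m h 1 0 p)"
definition bw2 :: "real => (real => complex) => real \<times> real => complex" where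
  "bw2 m h = (%p. h (snd p - fst p) + (2 * retarded m h 1 1 p + \<i> * m * retarded m h 0 0 p))"

text \<open>The reflection \<open>\<tau> \<mapsto> t - x\<close> in the term of the point mass and the exchange of integrals over the triangle
in the tail turn a transform in the kernel into a transform of the solution.\<close>

lemma volterra_transform:
  fixes h \<psi> :: "real => complex" and \<kappa> :: "real => real => complex"
  assumes t: "t >= 0" and h: "continuous_on {0..t} h" and \<psi>: "continuous_on UNIV \<psi>"
    and \<kappa>: "continuous_on UNIV (%(s, x). \<kappa> s x)"
  shows "integral {0..t} (%\<tau>. h \<tau> * (\<psi> (t - \<tau>) + integral {0..t - \<tau>} (%x. \<psi> x * \<kappa> (t - \<tau>) x))) =
    integral {0..t} (%x. \<psi> x * (h (t - x) + integral {0..t - x} (%\<tau>. h \<tau> * \<kappa> (t - \<tau>) x)))"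
proof -
  have K: "continuous_on S (%p. \<kappa> (u p) (w p))" if "continuous_on S u" "continuous_on S w" for S :: "'z::topological_space set" and u w
    using continuous_on_compose2[OF \<kappa> continuous_on_Pair[OF that]] by simp
  have P: "continuous_on S (%p. \<psi> (u p))" if "continuous_on S u" for S :: "'z::topological_space set" and u
    using continuous_on_compose2[OF \<psi> that] by simp
  have h': "continuous_on {0..t} (%x. h (t - x))"
    by (rule continuous_on_compose2[OF h]) (auto intro!: continuous_intros)
  have hc1: "continuous_on ({0..t} \<times> {0..t}) (%z. h (snd z))" "continuous_on ({0..t} \<times> {0..t}) (%z. h (fst z))"
    by (rule continuous_on_compose2[OF h]; auto intro!: continuous_intros)+
  have c1: "continuous_on ({0..t} \<times> {0..t}) (%(\<tau>, x). h \<tau> * (\<psi> x * \<kappa> (t - \<tau>) x))"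
    "continuous_on ({0..t} \<times> {0..t}) (%(x, \<tau>). h \<tau> * \<kappa> (t - \<tau>) x)"
    unfolding case_prod_unfold by (intro continuous_intros hc1 K P)+
  have m1: "continuous_on {0..t} (%\<tau>. integral {0..t - \<tau>} (%x. h \<tau> * (\<psi> x * \<kappa> (t - \<tau>) x)))"
    "continuous_on {0..t} (%x. integral {0..t - x} (%\<tau>. h \<tau> * \<kappa> (t - \<tau>) x))"
    by (rule continuous_on_moving_integral[OF c1(1)]; auto intro!: continuous_intros)
       (rule continuous_on_moving_integral[OF c1(2)]; auto intro!: continuous_intros)
  have refl: "integral {0..t} (%\<tau>. h \<tau> * \<psi> (t - \<tau>)) = integral {0..t} (%x. \<psi> x * h (t - x))"
  proof -
    have "((%\<tau>. h \<tau> * \<psi> (t - \<tau>)) has_integral integral {0..t} (%\<tau>. h \<tau> * \<psi> (t - \<tau>))) {0..t}"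
      by (intro integrable_integral integrable_continuous_real continuous_intros h P)
    from has_integral_affinity[OF this[folded box_real(2)], of "- 1" t]
    have "((%x. \<psi> x * h (t - x)) has_integral integral {0..t} (%\<tau>. h \<tau> * \<psi> (t - \<tau>))) ((%x. t - x) ` {0..t})"
      by (simp add: algebra_simps)
    moreover have "(%x. t - x) ` {0..t} = {0..t}" by simp
    ultimately show ?thesis by (simp add: integral_unique)
  qed
  have "integral {0..t} (%\<tau>. h \<tau> * (\<psi> (t - \<tau>) + integral {0..t - \<tau>} (%x. \<psi> x * \<kappa> (t - \<tau>) x))) =
     integral {0..t} (%\<tau>. h \<tau> * \<psi> (t - \<tau>) + integral {0..t - \<tau>} (%x. h \<tau> * (\<psi> x * \<kappa> (t - \<tau>) x)))"
    unfolding distrib_left integral_mult_right ..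
  also have "\<dots> = integral {0..t} (%\<tau>. h \<tau> * \<psi> (t - \<tau>)) + integral {0..t} (%\<tau>. integral {0..t - \<tau>} (%x. h \<tau> * (\<psi> x * \<kappa> (t - \<tau>) x)))"
    by (intro integral_add integrable_continuous_real continuous_intros h P m1)
  also have "\<dots> = integral {0..t} (%x. \<psi> x * h (t - x)) + integral {0..t} (%x. integral {0..t - x} (%\<tau>. h \<tau> * (\<psi> x * \<kappa> (t - \<tau>) x)))"
    unfolding refl triangle_swap[OF c1(1) t] ..
  also have "\<dots> = integral {0..t} (%x. \<psi> x * h (t - x)) + integral {0..t} (%x. \<psi> x * integral {0..t - x} (%\<tau>. h \<tau> * \<kappa> (t - \<tau>) x))"
    unfolding mult.left_commute[of "h _"] integral_mult_right ..
  also have "\<dots> = integral {0..t} (%x. \<psi> x * h (t - x) + \<psi> x * integral {0..t - x} (%\<tau>. h \<tau> * \<kappa> (t - \<tau>) x))"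
    by (intro integral_add[symmetric] integrable_continuous_real continuous_intros h' P m1)
  finally show ?thesis unfolding distrib_left .
qed

text \<open>Sine and cosine appear as the odd and even parts of \<open>exp (- i k x)\<close>; hence the terms at \<open>- k\<close>.\<close>

lemma boundary_wave_transforms:
  fixes h :: "real => complex"
  assumes h: "continuous_on {0..} h" and t: "t >= 0" and r: "rho m k \<noteq> 0"
  shows "integral {0..t} (%\<tau>. prop1 m k (t - \<tau>) 0 (2 * h \<tau>)) =
      ft_on {0..t} (%x. bw1 m h (x, t)) k - ft_on {0..t} (%x. bw1 m h (x, t)) (- k)" (is ?A)
    and "integral {0..t} (%\<tau>. prop2 m k (t - \<tau>) 0 (2 * h \<tau>)) =
      ft_on {0..t} (%x. bw2 m h (x, t)) k + ft_on {0..t} (%x. bw2 m h (x, t)) (- k)" (is ?B)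
proof -
  have ht: "continuous_on {0..t} h" by (rule continuous_on_subset[OF h]) auto
  have slice: "continuous_on {0..t} (%x. retarded m h j a (x, t))" for j a
    by (rule continuous_on_compose2[OF retarded_continuous[OF h]]) (auto intro!: continuous_intros)
  have h': "continuous_on {0..t} (%x. h (t - x))"
    by (rule continuous_on_compose2[OF h]) (auto intro!: continuous_intros)
  have w: "continuous_on {0..t} (%x. bw1 m h (x, t))" "continuous_on {0..t} (%x. bw2 m h (x, t))"
    unfolding bw1_def bw2_def fst_conv snd_conv by (intro continuous_intros slice h')+
  have pm: "ft_on {0..t} w k + c * ft_on {0..t} w (- k) = integral {0..t} (%x. (exp (- \<i> * k * x) + c * exp (\<i> * k * x)) * w x)"
    if "continuous_on {0..t} w" for w :: "real => complex" and c :: complex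
  proof -
    have "integral {0..t} (%x. (exp (- \<i> * k * x) + c * exp (\<i> * k * x)) * w x) =
        integral {0..t} (%x. exp (- \<i> * k * x) * w x) + integral {0..t} (%x. c * (exp (\<i> * k * x) * w x))"
      unfolding distrib_right mult.assoc[of c]
      by (intro integral_add integrable_continuous_real continuous_intros that)
    then show ?thesis unfolding ft_on_def by simp
  qed
  have "integral {0..t} (%\<tau>. prop1 m k (t - \<tau>) 0 (2 * h \<tau>)) = integral {0..t} (%\<tau>. (- 2 * \<i>) *
      (h \<tau> * (cx (sin (k * (t - \<tau>))) + integral {0..t - \<tau>} (%x. cx (sin (k * x)) * cx (2 * x * bk m 1 0 (t - \<tau>) x)))))"
  proof (rule integral_cong)
    fix \<tau> assume "\<tau> \<in> {0..t}"
    then have s: "t - \<tau> >= 0" by simp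
    have "(((%x. cx (sin (k * x) * (2 * x * bk m 1 0 (t - \<tau>) x)))) has_integral
       cx (integral {0..t - \<tau>} (%x. sin (k * x) * (2 * x * bk m 1 0 (t - \<tau>) x)))) {0..t - \<tau>}"
      by (intro has_integral_of_real integrable_integral integrable_continuous_real continuous_intros)
    from integral_unique[OF this] show "prop1 m k (t - \<tau>) 0 (2 * h \<tau>) = (- 2 * \<i>) * (h \<tau> * (cx (sin (k * (t - \<tau>))) +
       integral {0..t - \<tau>} (%x. cx (sin (k * x)) * cx (2 * x * bk m 1 0 (t - \<tau>) x))))"
      unfolding prop1_def propagator_as_kernel_integrals(3)[OF r s] by simp
  qed
  also have "\<dots> = (- 2 * \<i>) * integral {0..t} (%x. cx (sin (k * x)) *
      (h (t - x) + integral {0..t - x} (%\<tau>. h \<tau> * cx (2 * x * bk m 1 0 (t - \<tau>) x))))"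
    unfolding integral_mult_right
    by (subst volterra_transform[OF t ht, where \<kappa> = "%s x. cx (2 * x * bk m 1 0 s x)"])
       (auto simp: case_prod_unfold intro!: continuous_intros)
  also have "\<dots> = integral {0..t} (%x. (exp (- \<i> * k * x) + (- 1) * exp (\<i> * k * x)) * bw1 m h (x, t))"
  proof -
    have "integral {0..t - x} (%\<tau>. h \<tau> * cx (2 * x * bk m 1 0 (t - \<tau>) x)) = 2 * cx x * retarded m h 1 0 (x, t)" for x
      unfolding retarded_def case_prod_conv by (subst integral_mult_right[symmetric]) (simp add: mult_ac)
    moreover have "(- 2 * \<i>) * cx (sin (k * x)) = exp (- \<i> * k * x) + (- 1) * exp (\<i> * k * x)" for x
      by (simp add: complex_eq_iff Re_exp Im_exp)
    ultimately show ?thesis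
      by (subst integral_mult_right[symmetric]) (simp add: bw1_def mult.assoc[symmetric])
  qed
  finally show ?A
    using pm[OF w(1), of "- 1"] by simp
  let ?\<kappa> = "%s x. cx (2 * bk m 1 1 s x) + \<i> * cx (m * bk m 0 0 s x)"
  have "integral {0..t} (%\<tau>. prop2 m k (t - \<tau>) 0 (2 * h \<tau>)) = integral {0..t} (%\<tau>. 2 *
      (h \<tau> * (cx (cos (k * (t - \<tau>))) + integral {0..t - \<tau>} (%x. cx (cos (k * x)) * ?\<kappa> (t - \<tau>) x))))"
  proof (rule integral_cong)
    fix \<tau> assume "\<tau> \<in> {0..t}"
    then have s: "t - \<tau> >= 0" by simp
    let ?s = "t - \<tau>"
    have i1: "((%x. cx (cos (k * x) * (2 * bk m 1 1 ?s x))) has_integral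
       cx (integral {0..?s} (%x. cos (k * x) * (2 * bk m 1 1 ?s x)))) {0..?s}"
      by (intro has_integral_of_real integrable_integral integrable_continuous_real continuous_intros)
    have i2: "((%x. cx (cos (k * x) * (m * bk m 0 0 ?s x))) has_integral
       cx (integral {0..?s} (%x. cos (k * x) * (m * bk m 0 0 ?s x)))) {0..?s}"
      by (intro has_integral_of_real integrable_integral integrable_continuous_real continuous_intros)
    have "integral {0..?s} (%x. cx (cos (k * x)) * ?\<kappa> ?s x) =
       cx (integral {0..?s} (%x. cos (k * x) * (2 * bk m 1 1 ?s x))) +
       \<i> * cx (integral {0..?s} (%x. cos (k * x) * (m * bk m 0 0 ?s x)))"
      using integral_unique[OF has_integral_add[OF i1 has_integral_mult_right[OF i2, of \<i>]]]
      by (simp add: distrib_left mult.left_commute)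
    then show "prop2 m k ?s 0 (2 * h \<tau>) = 2 * (h \<tau> * (cx (cos (k * ?s)) +
        integral {0..?s} (%x. cx (cos (k * x)) * ?\<kappa> ?s x)))"
      unfolding prop2_def propagator_as_kernel_integrals(1,2)[OF r s] by (simp add: algebra_simps)
  qed
  also have "\<dots> = 2 * integral {0..t} (%x. cx (cos (k * x)) * (h (t - x) + integral {0..t - x} (%\<tau>. h \<tau> * ?\<kappa> (t - \<tau>) x)))"
    unfolding integral_mult_right
    by (subst volterra_transform[OF t ht, where \<kappa> = ?\<kappa>])
       (auto simp: case_prod_unfold intro!: continuous_intros)
  also have "\<dots> = integral {0..t} (%x. (exp (- \<i> * k * x) + 1 * exp (\<i> * k * x)) * bw2 m h (x, t))"
  proof -
    have "integral {0..t - x} (%\<tau>. h \<tau> * ?\<kappa> (t - \<tau>) x) = 2 * retarded m h 1 1 (x, t) + \<i> * m * retarded m h 0 0 (x, t)" if "x \<in> {0..t}" for x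
    proof -
      have hx: "continuous_on {0..t - x} h" by (rule continuous_on_subset[OF ht]) (use that in auto)
      have "integral {0..t - x} (%\<tau>. h \<tau> * ?\<kappa> (t - \<tau>) x) = integral {0..t - x} (%\<tau>. 2 * (h \<tau> * cx (bk m 1 1 (t - \<tau>) x))
          + \<i> * m * (h \<tau> * cx (bk m 0 0 (t - \<tau>) x)))"
        by (rule integral_cong) (simp add: algebra_simps)
      also have "\<dots> = integral {0..t - x} (%\<tau>. 2 * (h \<tau> * cx (bk m 1 1 (t - \<tau>) x)))
          + integral {0..t - x} (%\<tau>. \<i> * m * (h \<tau> * cx (bk m 0 0 (t - \<tau>) x)))"
        by (intro integral_add integrable_continuous_real continuous_intros hx)
      finally show ?thesis unfolding integral_mult_right retarded_def case_prod_conv .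
    qed
    moreover have "2 * cx (cos (k * x)) = exp (- \<i> * k * x) + 1 * exp (\<i> * k * x)" for x
      by (simp add: complex_eq_iff Re_exp Im_exp)
    ultimately show ?thesis
      by (subst integral_mult_right[symmetric]) (rule integral_cong, simp add: bw2_def mult.assoc[symmetric])
  qed
  finally show ?B
    using pm[OF w(2), of 1] by simp
qed

section \<open>Extending the data to the whole line\<close>

lemma weight_from_moments:
  assumes "x >= 0" "norm (z :: complex) <= B" "x\<^sup>2 * norm z <= C"
  shows "norm z <= (B + C) / (1 + (x::real)\<^sup>2)"
proof -
  have "1 + x\<^sup>2 > 0" by (simp add: add_pos_nonneg)
  moreover have "norm z * (1 + x\<^sup>2) <= B + C" using assms(2,3) by (simp add: algebra_simps)
  ultimately show ?thesis by (simp add: pos_le_divide_eq)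
qed

lemma weight_dilation:
  assumes "C >= (0::real)" shows "C / (1 + (2 ^ k * \<bar>y\<bar>)\<^sup>2) <= C / (1 + y\<^sup>2)"
proof (rule divide_left_mono)
  have "\<bar>y\<bar> <= 2 ^ k * \<bar>y\<bar>" using mult_right_mono[of 1 "2 ^ k" "\<bar>y\<bar>"] by simp
  from power_mono[OF this, of 2] show "1 + y\<^sup>2 <= 1 + (2 ^ k * \<bar>y\<bar>)\<^sup>2" by simp
qed (use assms in \<open>auto simp: add_pos_nonneg\<close>)

lemma weight_const_nonneg: "norm (z :: complex) <= C / (1 + (y::real)\<^sup>2) ==> C >= 0"
proof -
  assume "norm z <= C / (1 + y\<^sup>2)"
  moreover have p: "1 + y\<^sup>2 > 0" by (simp add: add_pos_nonneg)
  ultimately have "norm z * (1 + y\<^sup>2) <= C" by (simp add: pos_le_divide_eq)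
  moreover have "norm z * (1 + y\<^sup>2) >= 0" using p by simp
  ultimately show ?thesis by linarith
qed

lemma norm_seeley_ext_weight:
  assumes "\<And>y. y >= 0 ==> norm (F n y) <= C / (1 + y\<^sup>2)"
  shows "norm (seeley_ext F n y) <= seeley_norm n * C / (1 + y\<^sup>2)"
proof -
  have C: "C >= 0" by (rule weight_const_nonneg[OF assms[of 0]]) simp
  have "norm (F n (2 ^ k * \<bar>y\<bar>)) <= C / (1 + y\<^sup>2)" for k
    by (rule order_trans[OF assms weight_dilation[OF C]]) simp
  from norm_seeley_ext_le[where F = F and n = n and y = y, OF this] show ?thesis by simp
qed

lemma weight_le_const: "C >= 0 ==> C / (1 + (y::real)\<^sup>2) <= C"
  using divide_left_mono[of 1 "1 + y\<^sup>2" C] by (simp add: add_pos_nonneg)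

lemma schwartz_half_line_weight:
  assumes "schwartz_half_line g"
  shows "\<exists>C. \<forall>y\<ge>0. norm (iter_deriv {0..} n g y) <= C / (1 + y\<^sup>2)"
proof -
  have "bdd_above ((%x. x ^ a * norm (iter_deriv {0..} n g x)) ` {0..})" for a
    using assms by (simp add: schwartz_half_line_def)
  from this[of 0] this[of 2] obtain B C where
    "\<forall>x\<in>{0..}. norm (iter_deriv {0..} n g x) <= B" "\<forall>x\<in>{0..}. x\<^sup>2 * norm (iter_deriv {0..} n g x) <= C"
    unfolding bdd_above_def by force
  then have "\<forall>y\<ge>0. norm (iter_deriv {0..} n g y) <= (B + C) / (1 + y\<^sup>2)"
    using weight_from_moments[where z = "iter_deriv {0..} n g _"] by simp
  then show ?thesis ..
qed

definition line_extension :: "(real => complex) => nat => real => complex" where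
  "line_extension g = seeley_ext (%n. iter_deriv {0..} n g)"

lemma line_extension_family:
  assumes g: "schwartz_half_line g"
  shows "line_family (line_extension g)"
  unfolding line_family_def
proof (intro conjI allI)
  have "smooth1 {0..} g" using g by (simp add: schwartz_half_line_def)
  note der = smooth1_half_line_derivs(1)[OF this]
  fix n y
  have "\<exists>B. \<forall>y\<ge>0. norm (iter_deriv {0..} n g y) <= B" for n
  proof -
    from schwartz_half_line_weight[OF g, of n] obtain C where C: "\<forall>y\<ge>0. norm (iter_deriv {0..} n g y) <= C / (1 + y\<^sup>2)" ..
    have "C >= 0" by (rule weight_const_nonneg[OF C[rule_format, of 0]]) simp
    then have "\<forall>y\<ge>0. norm (iter_deriv {0..} n g y) <= C" using C weight_le_const order_trans by meson
    then show ?thesis ..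
  qed
  then show "(line_extension g n hvd line_extension g (Suc n) y) (at y)"
    unfolding line_extension_def by (intro seeley_ext_has_derivative der)
  from schwartz_half_line_weight[OF g, of n] obtain C where C: "\<forall>y\<ge>0. norm (iter_deriv {0..} n g y) <= C / (1 + y\<^sup>2)" ..
  have "\<forall>y. norm (line_extension g n y) <= seeley_norm n * C / (1 + y\<^sup>2)"
    unfolding line_extension_def by (intro allI norm_seeley_ext_weight) (use C in simp)
  then show "\<exists>C. \<forall>y. norm (line_extension g n y) <= C / (1 + y\<^sup>2)" ..
qed

lemma line_extension_eq: "y >= 0 ==> line_extension g n y = iter_deriv {0..} n g y"
  by (simp add: line_extension_def seeley_ext_def)

lemma closed_quadrant_slices:
  "t >= 0 ==> {y. (y, t) \<in> closed_quadrant} = {0..}" "x >= 0 ==> {u. (x, u) \<in> closed_quadrant} = {0..}"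
  by (auto simp: closed_quadrant_def)

lemma force_partials:
  assumes "smooth2 closed_quadrant f" "x >= 0" "t >= 0"
  shows "((%y. pderivs closed_quadrant n l f (y, t)) hvd pderivs closed_quadrant (Suc n) l f (x, t)) (at x within {0..})" (is ?A)
    and "((%u. pderivs closed_quadrant 0 l f (x, u)) hvd pderivs closed_quadrant 0 (Suc l) f (x, t)) (at t within {0..})" (is ?B)
proof -
  have xt: "(x, t) \<in> closed_quadrant" using assms by (simp add: closed_quadrant_def)
  have d: "(%y. pderivs closed_quadrant n l f (y, t)) differentiable (at x within {0..})"
    "(%u. pderivs closed_quadrant n l f (x, u)) differentiable (at t within {0..})" for n l
  proof -
    have "(%y. pderivs closed_quadrant n l f (y, t)) differentiable (at x within {y. (y, t) \<in> closed_quadrant})"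
      "(%u. pderivs closed_quadrant n l f (x, u)) differentiable (at t within {u. (x, u) \<in> closed_quadrant})"
      using assms(1) pderivs_in_iterated_partials[of closed_quadrant n l f] xt unfolding smooth2_def by blast+
    then show "(%y. pderivs closed_quadrant n l f (y, t)) differentiable (at x within {0..})"
      "(%u. pderivs closed_quadrant n l f (x, u)) differentiable (at t within {0..})"
      unfolding closed_quadrant_slices(1)[OF assms(3)] closed_quadrant_slices(2)[OF assms(2)] .
  qed
  from d(1)[of n l] show ?A
    by (simp add: vector_derivative_works pderivs_def partial_x_def closed_quadrant_slices assms)
  from d(2)[of 0 l] show ?B
    by (simp add: vector_derivative_works pderivs_def partial_t_def closed_quadrant_slices assms)
qed

text \<open>The hypothesis bounds the derivatives only for \<open>x > 0\<close>; continuity on the closed quadrant extends the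
bound to \<open>x = 0\<close>.\<close>

lemma force_weight:
  assumes f: "rapidly_decreasing_force f"
  shows "\<exists>C\<ge>0. \<forall>x\<ge>0. \<forall>t\<in>{0..T}. norm (pderivs closed_quadrant n l f (x, t)) <= C / (1 + x\<^sup>2)"
proof -
  let ?D = "pderivs closed_quadrant n l f"
  have sm: "smooth2 closed_quadrant f" using f by (simp add: rapidly_decreasing_force_def)
  have "bdd_above ((%(x, t). x ^ E * norm (?D (x, t))) ` ({0<..} \<times> {0..\<bar>T\<bar> + 1}))" for E
    using f by (simp add: rapidly_decreasing_force_def)
  from this[of 0] this[of 2] obtain B C where
    "\<forall>p\<in>{0<..} \<times> {0..\<bar>T\<bar> + 1}. norm (?D p) <= B" "\<forall>p\<in>{0<..} \<times> {0..\<bar>T\<bar> + 1}. (fst p)\<^sup>2 * norm (?D p) <= C"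
    unfolding bdd_above_def case_prod_unfold by force
  then have le: "norm (?D (x, t)) <= (B + C) / (1 + x\<^sup>2)" if "x > 0" "t \<in> {0..T}" for x t
    using that by (intro weight_from_moments) auto
  have le0: "norm (?D (x, t)) * (1 + x\<^sup>2) <= B + C" if x: "x >= 0" and t: "t \<in> {0..T}" for x t
  proof (rule continuous_le_on_closure[where S = "{0<..}" and f = "%x. norm (?D (x, t)) * (1 + x\<^sup>2)"])
    have "continuous (at x within {0..}) (%x. ?D (x, t))" if "x >= 0" for x
      using force_partials(1)[OF sm that] t by (intro has_vector_derivative_continuous) auto
    then have "continuous_on {0..} (%x. ?D (x, t))" by (simp add: continuous_on_eq_continuous_within)
    then show "continuous_on (closure {0<..}) (%x. norm (?D (x, t)) * (1 + x\<^sup>2))"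
      by (simp add: continuous_intros)
    show "x \<in> closure {0<..}" using x by simp
    show "norm (?D (y, t)) * (1 + y\<^sup>2) <= B + C" if "y \<in> {0<..}" for y
      using le[of y t] that t by (simp add: pos_le_divide_eq add_pos_nonneg)
  qed
  have "\<forall>x\<ge>0. \<forall>t\<in>{0..T}. norm (?D (x, t)) <= \<bar>B + C\<bar> / (1 + x\<^sup>2)"
    using order_trans[OF le0 abs_ge_self] by (simp add: pos_le_divide_eq add_pos_nonneg)
  then show ?thesis by (intro exI[of _ "\<bar>B + C\<bar>"]) simp
qed

definition force_extension :: "(real \<times> real => complex) => nat => nat => real => real => complex" where
  "force_extension f n l x t = seeley_ext (%n y. pderivs closed_quadrant n l f (y, t)) n x"

lemma force_extension_eq: "x >= 0 ==> force_extension f n l x t = pderivs closed_quadrant n l f (x, t)"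
  by (simp add: force_extension_def seeley_ext_def)

text \<open>For \<open>x < 0\<close> time derivatives are taken termwise in the series of Seeley.\<close>

lemma force_extension_family:
  assumes f: "rapidly_decreasing_force f"
  shows "force_family (force_extension f)"
  unfolding force_family_def
proof (intro conjI allI impI)
  have sm: "smooth2 closed_quadrant f" using f by (simp add: rapidly_decreasing_force_def)
  fix n l :: nat and x t T :: real
  have bd: "\<exists>B. \<forall>y\<ge>0. \<forall>t\<in>{0..T}. norm (pderivs closed_quadrant n l f (y, t)) <= B" for n l T
  proof -
    from force_weight[OF f, of T n l] obtain C where "C >= 0"
      "\<forall>x\<ge>0. \<forall>t\<in>{0..T}. norm (pderivs closed_quadrant n l f (x, t)) <= C / (1 + x\<^sup>2)" by blast
    then have "\<forall>y\<ge>0. \<forall>t\<in>{0..T}. norm (pderivs closed_quadrant n l f (y, t)) <= C"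
      using weight_le_const order_trans by meson
    then show ?thesis ..
  qed
  show "((%x. force_extension f n l x t) hvd force_extension f (Suc n) l x t) (at x)" if t: "0 <= t"
  proof -
    have "\<exists>B. \<forall>y\<ge>0. norm (pderivs closed_quadrant n l f (y, t)) <= B" for n
    proof -
      from bd[of t n l] obtain B where "\<forall>y\<ge>0. \<forall>t\<in>{0..t}. norm (pderivs closed_quadrant n l f (y, t)) <= B" ..
      then have "\<forall>y\<ge>0. norm (pderivs closed_quadrant n l f (y, t)) <= B" using t by simp
      then show ?thesis ..
    qed
    then show ?thesis unfolding force_extension_def
      using seeley_ext_has_derivative[of "%n y. pderivs closed_quadrant n l f (y, t)", OF force_partials(1)[OF sm _ t]]
      by simp
  qed
  show "(force_extension f 0 l x hvd force_extension f 0 (Suc l) x t) (at t within {0..})" if t: "0 <= t"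
  proof (cases "x >= 0")
    case True
    then have "force_extension f 0 l x = (%u. pderivs closed_quadrant 0 l f (x, u))" for l
      by (simp add: fun_eq_iff force_extension_eq)
    then show ?thesis using force_partials(2)[OF sm True t, of l] by simp
  next
    case False
    then have x: "x < 0" by simp
    let ?D = "%l s k. pderivs closed_quadrant 0 l f (- (2 ^ k) * x, s)"
    let ?c = "%k. cx (seeley_coeff k * (- (2 ^ k)) ^ 0)"
    have pos: "- (2 ^ k) * x >= 0" for k :: nat using x by (simp add: mult_nonneg_nonpos)
    from bd[of "t + 1" 0 l] obtain B where B: "\<forall>y\<ge>0. \<forall>t\<in>{0..t + 1}. norm (pderivs closed_quadrant 0 l f (y, t)) <= B" ..
    from bd[of "t + 1" 0 "Suc l"] obtain B' where B': "\<forall>y\<ge>0. \<forall>t\<in>{0..t + 1}. norm (pderivs closed_quadrant 0 (Suc l) f (y, t)) <= B'" ..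
    have "((%s. LINT k|count_space UNIV. ?c k * ?D l s k) hvd (LINT k|count_space UNIV. ?c k * ?D (Suc l) t k)) (at t within {0..t + 1})"
    proof (rule has_vector_derivative_dominated_integral)
      show "((%s. ?c k * ?D l s k) hvd ?c k * ?D (Suc l) s k) (at s within {0..t + 1})" if "s \<in> {0..t + 1}" for s k
        by (intro has_vector_derivative_mult_right has_vector_derivative_within_subset[OF force_partials(2)[OF sm pos]]) (use that in auto)
      show "norm (?c k * ?D (Suc l) s k) <= \<bar>seeley_coeff k\<bar> * (2 ^ k) ^ 0 * B'" if "s \<in> {0..t + 1}" for s k
        by (rule seeley_terms(1)[where F = "%k. ?D (Suc l) s k"]) (use B' pos that in blast)
      show "integrable (count_space UNIV) (%k. \<bar>seeley_coeff k\<bar> * (2 ^ k) ^ 0 * B')"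
        by (rule seeley_terms(2)[where F = "%k. ?D (Suc l) t k"]) (use B' pos t in auto)
      show "integrable (count_space UNIV) (%k. ?c k * ?D l s k)" if "s \<in> {0..t + 1}" for s
        by (rule seeley_terms(3)[where F = "%k. ?D l s k"]) (use B pos that in blast)
    qed (use t in auto)
    moreover have "force_extension f 0 l x = (%s. LINT k|count_space UNIV. ?c k * ?D l s k)" for l
      using x by (simp add: force_extension_def seeley_ext_def fun_eq_iff)
    ultimately have "(force_extension f 0 l x hvd force_extension f 0 (Suc l) x t) (at t within {0..t + 1})"
      by simp
    then show ?thesis using at_within_half_line_Icc[of t "t + 1"] t by simp
  qed
  from force_weight[OF f, of T n l] obtain C where C: "\<forall>x\<ge>0. \<forall>t\<in>{0..T}. norm (pderivs closed_quadrant n l f (x, t)) <= C / (1 + x\<^sup>2)"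
    by blast
  have "norm (force_extension f n l x t) <= seeley_norm n * C / (1 + x\<^sup>2)" if "0 <= t" "t <= T" for x t
    unfolding force_extension_def by (rule norm_seeley_ext_weight) (use C that in simp)
  then show "\<exists>C. \<forall>x t. 0 <= t --> t <= T --> norm (force_extension f n l x t) <= C / (1 + x\<^sup>2)" by blast
qed

section \<open>Half-line transforms\<close>

lemma hat_cong: "(\<And>y. y >= 0 ==> \<phi> y = \<psi> y) ==> hat \<phi> k = hat \<psi> k"
  unfolding hat_def by (intro integral_cong) simp

definition decaying :: "(real => complex) => bool" where
  "decaying \<phi> \<longleftrightarrow> continuous_on {0..} \<phi> \<and> (\<exists>C. \<forall>y\<ge>0. norm (\<phi> y) <= C / (1 + y\<^sup>2))"

lemma decaying_integrable: "decaying \<phi> ==> integrable lborel (%y. indicator {0..} y *\<^sub>R \<phi> y)"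
  unfolding decaying_def using integrable_half_line_bound by blast

lemma decaying_hat_integrable: "decaying \<phi> ==> (%y. exp (- \<i> * cx k * cx y) * \<phi> y) integrable_on {0..}"
proof -
  assume "decaying \<phi>"
  from ft_integrable[OF decaying_integrable[OF this], of k]
  have "set_integrable lborel {0..} (%y. exp (- \<i> * cx k * cx y) * \<phi> y)"
    unfolding set_integrable_def by (simp add: mult.left_commute scaleR_conv_of_real)
  then show ?thesis by (rule set_borel_integral_eq_integral(1))
qed

lemma hat_add: "decaying \<phi> ==> decaying \<psi> ==> hat (%y. \<phi> y + \<psi> y) k = hat \<phi> k + hat \<psi> k"
  unfolding hat_def distrib_left by (intro integral_add decaying_hat_integrable)

lemma hat_cmult: "hat (%y. c * \<phi> y) k = c * hat \<phi> k"
  unfolding hat_def mult.left_commute[of _ c] by simp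

lemma decaying_cmult: "decaying \<phi> ==> decaying (%y. c * \<phi> y)"
proof -
  assume d: "decaying \<phi>"
  then obtain C where C: "\<forall>y\<ge>0. norm (\<phi> y) <= C / (1 + y\<^sup>2)" unfolding decaying_def by blast
  have "\<forall>y\<ge>0. norm (c * \<phi> y) <= (norm c * C) / (1 + y\<^sup>2)"
    using mult_left_mono[OF C[rule_format], of _ "norm c"] by (simp add: norm_mult)
  then show ?thesis using d unfolding decaying_def by (blast intro: continuous_on_mult_left)
qed

lemma decaying_add: "decaying \<phi> ==> decaying \<psi> ==> decaying (%y. \<phi> y + \<psi> y)"
proof -
  assume d: "decaying \<phi>" "decaying \<psi>"
  then obtain C D where C: "\<forall>y\<ge>0. norm (\<phi> y) <= C / (1 + y\<^sup>2)" "\<forall>y\<ge>0. norm (\<psi> y) <= D / (1 + y\<^sup>2)"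
    unfolding decaying_def by blast
  have "\<forall>y\<ge>0. norm (\<phi> y + \<psi> y) <= (C + D) / (1 + y\<^sup>2)"
    using norm_triangle_mono[OF C(1)[rule_format] C(2)[rule_format]] by (simp add: add_divide_distrib)
  then show ?thesis using d unfolding decaying_def by (blast intro: continuous_on_add)
qed

lemma continuous_on_hat: "decaying \<phi> ==> continuous_on S (hat \<phi>)"
proof -
  assume "decaying \<phi>"
  note i = decaying_integrable[OF this]
  have "hat \<phi> = ft (%y. indicator {0..} y *\<^sub>R \<phi> y)" using hat_eq_ft[OF i] by (simp add: fun_eq_iff)
  then show ?thesis using continuous_on_subset[OF continuous_on_ft[OF i] subset_UNIV] by simp
qed

lemma norm_hat_le:
  assumes c: "continuous_on {0..} \<phi>" and le: "\<And>y. y >= 0 ==> norm (\<phi> y) <= C / (1 + y\<^sup>2)"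
  shows "norm (hat \<phi> k) <= C * (LINT y|lborel. 1 / (1 + y\<^sup>2))"
proof -
  have C: "C >= 0" by (rule weight_const_nonneg[OF le[of 0]]) simp
  have i: "integrable lborel (%y. indicator {0..} y *\<^sub>R \<phi> y)" by (rule integrable_half_line_bound[OF c le])
  show ?thesis unfolding hat_eq_ft[OF i]
    by (rule norm_ft_le_weight[OF i]) (use le C in \<open>simp add: indicator_def\<close>)
qed

text \<open>The boundary term \<open>- \<phi>(0)\<close> is the source of the term \<open>2 v\<^sub>1(0, t)\<close> in the transformed system.\<close>

lemma hat_by_parts:
  assumes d: "\<And>y. (\<phi> hvd \<phi>' y) (at y)" and c': "continuous_on UNIV \<phi>'"
    and decay: "decaying \<phi>" "decaying \<phi>'"
  shows "hat \<phi>' k = - \<phi> 0 + \<i> * k * hat \<phi> k"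
proof -
  have c: "continuous_on UNIV \<phi>"
    using has_vector_derivative_continuous[OF d] by (simp add: continuous_on_eq_continuous_within)
  let ?e = "%y. exp (- \<i> * cx k * cx y)"
  let ?F = "%y. ?e y * \<phi> y"
  let ?f = "%y. ?e y * \<phi>' y + - \<i> * cx k * ?e y * \<phi> y"
  have F: "(?F hvd ?f y) (at y)" for y
  proof -
    have "((%y. exp (- \<i> * cx k * cx y)) hvd - \<i> * cx k * ?e y) (at y)"
      using has_vector_derivative_cexp[of "- \<i> * cx k" y UNIV] by (simp add: mult.assoc)
    from has_vector_derivative_mult[OF this d] show ?thesis .
  qed
  have Fc: "continuous_on UNIV ?F" by (intro continuous_intros c)
  have set: "set_integrable lborel {0<..} (%y. ?e y * \<psi> y)" if "decaying \<psi>" for \<psi>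
  proof (rule set_integrable_subset)
    show "set_integrable lborel {0..} (%y. ?e y * \<psi> y)"
      using ft_integrable[OF decaying_integrable[OF that], of k] unfolding set_integrable_def
      by (simp add: mult.left_commute scaleR_conv_of_real)
  qed auto
  have seti: "set_integrable lborel {0<..} ?f"
    using set_integral_add(1)[OF set[OF decay(2)] set_integrable_mult_right[OF set[OF decay(1)], of "- \<i> * cx k"]]
    by (simp only: mult.assoc)
  have "(LBINT y=ereal 0..\<infinity>. ?f y) = 0 - \<phi> 0"
  proof (rule interval_integral_FTC_integrable[where F = ?F])
    show "isCont ?f x" for x
      by (intro continuous_intros continuous_on_interior[OF c'] continuous_on_interior[OF c]) auto
    show "set_integrable lborel (einterval (ereal 0) \<infinity>) ?f" using seti by simp
    have "(?F \<longlongrightarrow> ?F 0) (at_right 0)"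
      using continuous_on_interior[OF Fc, of 0] by (auto simp: isCont_def intro: tendsto_within_subset)
    then show "((?F \<circ> real_of_ereal) \<longlongrightarrow> \<phi> 0) (at_right (ereal 0))" unfolding ereal_tendsto_simps by simp
    from decay(1) obtain C where C: "\<forall>y\<ge>0. norm (\<phi> y) <= C / (1 + y\<^sup>2)" unfolding decaying_def by blast
    have "(?F \<longlongrightarrow> 0) at_top"
      by (rule Lim_null_comparison[OF _ inverse_square_weight_tendsto(1)[of C]])
         (use C in \<open>auto simp: norm_mult intro!: eventually_mono[OF eventually_ge_at_top[of 0]]\<close>)
    then show "((?F \<circ> real_of_ereal) \<longlongrightarrow> 0) (at_left \<infinity>)" unfolding ereal_tendsto_simps .
  qed (use F in auto)
  then have "integral {0<..} ?f = - \<phi> 0"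
    using set_borel_integral_eq_integral(2)[OF seti] by (simp add: interval_integral_to_infinity_eq)
  moreover have "integral {0<..} ?f = integral {0..} ?f"
  proof (rule integral_spike_set)
    show "negligible {x \<in> {0<..} - {0..}. ?f x \<noteq> 0}" by (rule negligible_subset[of "{}"]) auto
    show "negligible {x \<in> {0..} - {0<..}. ?f x \<noteq> 0}" by (rule negligible_subset[of "{0}"]) auto
  qed
  moreover have "integral {0..} ?f = hat \<phi>' k + (- \<i> * cx k) * hat \<phi> k"
  proof -
    have "integral {0..} ?f = hat \<phi>' k + integral {0..} (%y. - \<i> * cx k * (?e y * \<phi> y))"
      unfolding hat_def mult.assoc[of "- \<i> * cx k" "?e _"]
      by (intro integral_add integrable_on_mult_right decaying_hat_integrable decay)
    then show ?thesis unfolding hat_def by simp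
  qed
  ultimately show ?thesis by (simp add: algebra_simps)
qed

lemma hat_has_time_derivative:
  fixes \<phi> \<phi>' :: "real => real => complex"
  assumes t: "t \<in> {0..T}"
    and d: "\<And>s y. s \<in> {0..T} ==> ((%s. \<phi> y s) hvd \<phi>' y s) (at s within {0..T})"
    and c: "\<And>s. s \<in> {0..T} ==> continuous_on UNIV (%y. \<phi> y s)" "\<And>s. s \<in> {0..T} ==> continuous_on UNIV (%y. \<phi>' y s)"
    and b: "\<And>s y. s \<in> {0..T} ==> norm (\<phi> y s) <= C / (1 + y\<^sup>2)" "\<And>s y. s \<in> {0..T} ==> norm (\<phi>' y s) <= C' / (1 + y\<^sup>2)"
  shows "((%s. hat (%y. \<phi> y s) k) hvd hat (%y. \<phi>' y t) k) (at t within {0..T})"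
proof -
  have C': "C' >= 0" by (rule weight_const_nonneg[OF b(2)[OF t, of 0]])
  let ?g = "%\<phi> s y. exp (- \<i> * cx k * cx y) * (indicator {0..} y *\<^sub>R \<phi> y s)"
  have i: "integrable lborel (%y. indicator {0..} y *\<^sub>R \<phi> y s)" "integrable lborel (%y. indicator {0..} y *\<^sub>R \<phi>' y s)" if "s \<in> {0..T}" for s
    by (rule integrable_half_line_bound[OF continuous_on_subset[OF c(1)[OF that]] b(1)[OF that]], simp)
       (rule integrable_half_line_bound[OF continuous_on_subset[OF c(2)[OF that]] b(2)[OF that]], simp)
  have D: "((%s. LINT y|lborel. ?g \<phi> s y) hvd (LINT y|lborel. ?g \<phi>' t y)) (at t within {0..T})"
  proof (rule has_vector_derivative_dominated_integral)
    show "((%s. ?g \<phi> s y) hvd ?g \<phi>' s y) (at s within {0..T})" if "s \<in> {0..T}" for s y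
      by (intro has_vector_derivative_mult_right bounded_linear.has_vector_derivative[OF bounded_linear_scaleR_right] d that)
    show "norm (?g \<phi>' s y) <= C' / (1 + y\<^sup>2)" if "s \<in> {0..T}" for s y
      using b(2)[OF that, of y] C' by (simp add: norm_mult indicator_def)
    show "integrable lborel (?g \<phi> s)" if "s \<in> {0..T}" for s
      by (rule ft_integrable[OF i(1)[OF that]])
    show "?g \<phi>' t \<in> borel_measurable lborel"
      using ft_integrable[OF i(2)[OF t], of k] by (rule borel_measurable_integrable)
  qed (use t integrable_inverse_square_weight[of C'] in auto)
  have e: "hat (%y. \<phi> y s) k = (LINT y|lborel. ?g \<phi> s y)" if "s \<in> {0..T}" for s
    using hat_eq_ft[OF i(1)[OF that]] by (simp add: ft_def)
  have e': "hat (%y. \<phi>' y t) k = (LINT y|lborel. ?g \<phi>' t y)"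
    using hat_eq_ft[OF i(2)[OF t]] by (simp add: ft_def)
  show ?thesis unfolding e' by (rule has_vector_derivative_transform[OF t e D])
qed

definition odd_hat :: "(real => complex) => real => complex" where "odd_hat \<phi> k = hat \<phi> k - hat \<phi> (- k)"
definition even_hat :: "(real => complex) => real => complex" where "even_hat \<phi> k = hat \<phi> k + hat \<phi> (- k)"

lemma parity_hat_linear:
  "decaying \<phi> ==> decaying \<psi> ==> odd_hat (%y. \<phi> y + \<psi> y) k = odd_hat \<phi> k + odd_hat \<psi> k"
  "decaying \<phi> ==> decaying \<psi> ==> even_hat (%y. \<phi> y + \<psi> y) k = even_hat \<phi> k + even_hat \<psi> k"
  "odd_hat (%y. c * \<phi> y) k = c * odd_hat \<phi> k" "even_hat (%y. c * \<phi> y) k = c * even_hat \<phi> k"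
  by (simp_all add: odd_hat_def even_hat_def hat_add hat_cmult algebra_simps)

lemma parity_hat_by_parts:
  assumes "\<And>y. (\<phi> hvd \<phi>' y) (at y)" "continuous_on UNIV \<phi>'" "decaying \<phi>" "decaying \<phi>'"
  shows "odd_hat \<phi>' k = \<i> * k * even_hat \<phi> k" "even_hat \<phi>' k = - 2 * \<phi> 0 + \<i> * k * odd_hat \<phi> k"
  by (simp_all add: odd_hat_def even_hat_def hat_by_parts[OF assms] algebra_simps)

section \<open>The transformed problem\<close>

context dirac_cauchy
begin

lemma v_slice_continuous:
  "t > - 1 ==> continuous_on S (%x. v1 n l x t)" "t > - 1 ==> continuous_on S (%x. v2 n l x t)"
  using has_vector_derivative_continuous[OF v_derivatives(1)] has_vector_derivative_continuous[OF v_derivatives(2)]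
  by (auto simp: continuous_on_eq_continuous_within intro: continuous_at_imp_continuous_at_within)

lemma v_decaying:
  assumes t: "t >= 0"
  shows "decaying (%x. v1 n 0 x t)" (is ?A) "decaying (%x. v2 n 0 x t)"
    "decaying (%x. f1 n l x t)" (is ?C) "decaying (%x. f2 n l x t)"
proof -
  from v_decay[OF t, of n] obtain C where
    "\<forall>x s. 0 <= s --> s <= t --> norm (v1 n 0 x s) <= C / (1 + x\<^sup>2) \<and> norm (v2 n 0 x s) <= C / (1 + x\<^sup>2)" ..
  then have "\<forall>y\<ge>0. norm (v1 n 0 y t) <= C / (1 + y\<^sup>2)" "\<forall>y\<ge>0. norm (v2 n 0 y t) <= C / (1 + y\<^sup>2)" using t by auto
  then show ?A "decaying (%x. v2 n 0 x t)"
    unfolding decaying_def using v_slice_continuous[of t] t by auto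
  have "decaying (%x. f n l x t)" if f: "force_family f" for f
  proof -
    note s = force_family_slice[OF f t, of l]
    from line_family_bound[OF s, of n] have "\<exists>C. \<forall>y\<ge>0. norm (f n l y t) <= C / (1 + y\<^sup>2)" by auto
    then show ?thesis unfolding decaying_def using continuous_on_subset[OF line_family_D(2)[OF s]] by auto
  qed
  then show ?C "decaying (%x. f2 n l x t)" using f1 f2 by auto
qed

text \<open>The odd part of \<open>v\<^sub>1\<close> and the even part of \<open>v\<^sub>2\<close> are the combinations for which only \<open>v\<^sub>1(0, t)\<close>
survives from the boundary terms.\<close>

lemma transformed_equations:
  assumes t: "t \<in> {0..T}"
  shows "((%t. odd_hat (%x. v1 0 0 x t) k) hvd
      - \<i> * m * odd_hat (%x. v1 0 0 x t) k - \<i> * k * even_hat (%x. v2 0 0 x t) k + odd_hat (%x. f1 0 0 x t) k) (at t within {0..T})" (is ?A)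
    and "((%t. even_hat (%x. v2 0 0 x t) k) hvd
      - \<i> * k * odd_hat (%x. v1 0 0 x t) k + \<i> * m * even_hat (%x. v2 0 0 x t) k + (even_hat (%x. f2 0 0 x t) k + 2 * v1 0 0 0 t)) (at t within {0..T})" (is ?B)
proof -
  have t0: "t >= 0" "T >= 0" "t > - 1" using t by auto
  from v_decay[OF t0(2), of 0] obtain C where C: "\<forall>x t. 0 <= t --> t <= T --> norm (v1 0 0 x t) <= C / (1 + x\<^sup>2) \<and> norm (v2 0 0 x t) <= C / (1 + x\<^sup>2)" ..
  from v_time_derivative_decay[OF t0(2)] obtain C' where C': "\<forall>x t. 0 <= t --> t <= T --> norm (v1 0 1 x t) <= C' / (1 + x\<^sup>2) \<and> norm (v2 0 1 x t) <= C' / (1 + x\<^sup>2)" ..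
  have d1: "((%s. hat (%x. v1 0 0 x s) k) hvd hat (%x. v1 0 1 x t) k) (at t within {0..T})" for k
    by (rule hat_has_time_derivative[OF t]; (rule has_vector_derivative_at_within, rule v_derivatives(3)[of _ 0 0, folded One_nat_def])?)
       (use C C' v_slice_continuous in auto)
  have d2: "((%s. hat (%x. v2 0 0 x s) k) hvd hat (%x. v2 0 1 x t) k) (at t within {0..T})" for k
    by (rule hat_has_time_derivative[OF t]; (rule has_vector_derivative_at_within, rule v_derivatives(4)[of _ 0 0, folded One_nat_def])?)
       (use C C' v_slice_continuous in auto)
  note dec = v_decaying[OF t0(1)]
  note bp1 = parity_hat_by_parts[OF v_derivatives(1)[OF t0(3)] v_slice_continuous(1)[OF t0(3)] dec(1) dec(1)]
  note bp2 = parity_hat_by_parts[OF v_derivatives(2)[OF t0(3)] v_slice_continuous(2)[OF t0(3)] dec(2) dec(2)]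
  have "v1 0 1 x t = (- 1) * v2 1 0 x t + (- \<i> * m) * v1 0 0 x t + f1 0 0 x t"
    "v2 0 1 x t = (- 1) * v1 1 0 x t + (\<i> * m) * v2 0 0 x t + f2 0 0 x t" for x
    using dirac_equations[OF t0(1), of 0 x] by simp_all
  then have "odd_hat (%x. v1 0 1 x t) k = (- 1) * odd_hat (%x. v2 1 0 x t) k + (- \<i> * m) * odd_hat (%x. v1 0 0 x t) k + odd_hat (%x. f1 0 0 x t) k"
    "even_hat (%x. v2 0 1 x t) k = (- 1) * even_hat (%x. v1 1 0 x t) k + (\<i> * m) * even_hat (%x. v2 0 0 x t) k + even_hat (%x. f2 0 0 x t) k"
    by (simp_all only: parity_hat_linear decaying_add decaying_cmult dec)
  then have e: "odd_hat (%x. v1 0 1 x t) k = - \<i> * m * odd_hat (%x. v1 0 0 x t) k - \<i> * k * even_hat (%x. v2 0 0 x t) k + odd_hat (%x. f1 0 0 x t) k"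
    "even_hat (%x. v2 0 1 x t) k = - \<i> * k * odd_hat (%x. v1 0 0 x t) k + \<i> * m * even_hat (%x. v2 0 0 x t) k + (even_hat (%x. f2 0 0 x t) k + 2 * v1 0 0 0 t)"
    using bp2(1)[of 0 k] bp1(2)[of 0 k] by (simp_all add: algebra_simps)
  show ?A
    unfolding e(1)[symmetric] unfolding odd_hat_def by (rule has_vector_derivative_diff[OF d1 d1])
  show ?B
    unfolding e(2)[symmetric] unfolding even_hat_def by (rule has_vector_derivative_add[OF d2 d2])
qed

end

text \<open>The first component of the full spectral integrand of \<open>\<Psi>\<close> without the factor \<open>exp (i k x)\<close>.\<close>

definition source1 where
  "source1 m g1 g2 f1 f2 h t k = prop1 m k t (odd_hat g1 k) (even_hat g2 k) +
     integral {0..t} (%\<tau>. prop1 m k (t - \<tau>) (odd_hat (f1 \<tau>) k) (even_hat (f2 \<tau>) k + 2 * h \<tau>))"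
definition source2 where
  "source2 m g1 g2 f1 f2 h t k = prop2 m k t (odd_hat g1 k) (even_hat g2 k) +
     integral {0..t} (%\<tau>. prop2 m k (t - \<tau>) (odd_hat (f1 \<tau>) k) (even_hat (f2 \<tau>) k + 2 * h \<tau>))"

locale dirac_half_line = dirac_cauchy +
  fixes h :: "nat => real => complex"
  assumes h: "\<And>i s. s >= 0 ==> (h i hvd h (Suc i) s) (at s within {0..})"
begin

definition defect :: "nat => real => complex" where "defect i s = h i s - v1 0 i 0 s"

lemma defect_derivative:
  assumes "s >= 0" shows "(defect i hvd defect (Suc i) s) (at s within {0..})"
proof -
  have "((%s. v1 0 i 0 s) hvd v1 0 (Suc i) 0 s) (at s within {0..})"
    by (rule has_vector_derivative_at_within, rule v_derivatives(3)) (use assms in simp)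
  from has_vector_derivative_diff[OF h[OF assms] this] show ?thesis unfolding defect_def[abs_def] .
qed

lemma defect_continuous: "continuous_on {0..} (defect i)"
  using has_vector_derivative_continuous[OF defect_derivative] by (simp add: continuous_on_eq_continuous_within)

text \<open>Duhamel's formula for the transforms of \<open>v\<close> has \<open>2 v\<^sub>1(0, \<cdot>)\<close> where the spectral integrand has \<open>2 h\<close>; by
linearity the difference is the boundary wave of the defect.\<close>

lemma source_eq:
  assumes t: "t >= 0" and r: "rho m k \<noteq> 0"
  shows "source1 m (g1 0) (g2 0) (%\<tau> x. f1 0 0 x \<tau>) (%\<tau> x. f2 0 0 x \<tau>) (h 0) t k =
      odd_hat (%x. v1 0 0 x t) k + (ft_on {0..t} (%x. bw1 m (defect 0) (x, t)) k - ft_on {0..t} (%x. bw1 m (defect 0) (x, t)) (- k))" (is ?A)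
    and "source2 m (g1 0) (g2 0) (%\<tau> x. f1 0 0 x \<tau>) (%\<tau> x. f2 0 0 x \<tau>) (h 0) t k =
      even_hat (%x. v2 0 0 x t) k + (ft_on {0..t} (%x. bw2 m (defect 0) (x, t)) k + ft_on {0..t} (%x. bw2 m (defect 0) (x, t)) (- k))" (is ?B)
proof -
  have dc: "continuous_on {0..t} (%\<tau>. 2 * defect 0 \<tau>)"
    by (intro continuous_intros continuous_on_subset[OF defect_continuous]) auto
  have pc: "continuous_on {0..t} (%\<tau>. prop1 m k (t - \<tau>) 0 (2 * defect 0 \<tau>))" "continuous_on {0..t} (%\<tau>. prop2 m k (t - \<tau>) 0 (2 * defect 0 \<tau>))"
    by (intro prop_continuous continuous_intros dc)+
  have D: "((%\<tau>. prop1 m k (t - \<tau>) (odd_hat (%x. f1 0 0 x \<tau>) k) (even_hat (%x. f2 0 0 x \<tau>) k + 2 * v1 0 0 0 \<tau>)) has_integral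
      odd_hat (%x. v1 0 0 x t) k - prop1 m k t (odd_hat (%x. v1 0 0 x 0) k) (even_hat (%x. v2 0 0 x 0) k)) {0..t}"
    "((%\<tau>. prop2 m k (t - \<tau>) (odd_hat (%x. f1 0 0 x \<tau>) k) (even_hat (%x. f2 0 0 x \<tau>) k + 2 * v1 0 0 0 \<tau>)) has_integral
      even_hat (%x. v2 0 0 x t) k - prop2 m k t (odd_hat (%x. v1 0 0 x 0) k) (even_hat (%x. v2 0 0 x 0) k)) {0..t}"
    by (rule duhamel_identity(1)[OF t transformed_equations]; assumption)
       (rule duhamel_identity(2)[OF t transformed_equations]; assumption)
  have s: "prop1 m k u y (even_hat (%x. f2 0 0 x \<tau>) k + 2 * v1 0 0 0 \<tau>) + prop1 m k u 0 (2 * defect 0 \<tau>) = prop1 m k u y (even_hat (%x. f2 0 0 x \<tau>) k + 2 * h 0 \<tau>)"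
    "prop2 m k u y (even_hat (%x. f2 0 0 x \<tau>) k + 2 * v1 0 0 0 \<tau>) + prop2 m k u 0 (2 * defect 0 \<tau>) = prop2 m k u y (even_hat (%x. f2 0 0 x \<tau>) k + 2 * h 0 \<tau>)" for u y \<tau>
    by (simp_all add: prop1_def prop2_def defect_def algebra_simps)
  note I1 = integral_unique[OF has_integral_add[OF D(1) integrable_integral[OF integrable_continuous_real[OF pc(1)]]], unfolded s]
  note I2 = integral_unique[OF has_integral_add[OF D(2) integrable_integral[OF integrable_continuous_real[OF pc(2)]]], unfolded s]
  note B = boundary_wave_transforms[OF defect_continuous[of 0] t r]
  show ?A
    unfolding source1_def I1 B(1) by (simp add: v_initial)
  show ?B
    unfolding source2_def I2 B(2) by (simp add: v_initial)
qed

end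

section \<open>Principal values\<close>

text \<open>Symmetric partial integrals are a common home for the generalized integrals, for the absolutely
convergent ones and for Fourier inversion.\<close>

definition pv :: "(real => complex) => complex => bool" where
  "pv \<phi> L \<longleftrightarrow> (\<forall>A. \<phi> integrable_on {-A..A}) \<and> ((%A. integral {-A..A} \<phi>) \<longlongrightarrow> L) at_top"

lemma pv_unique: "pv \<phi> L ==> pv \<phi> L' ==> L = L'"
  unfolding pv_def using tendsto_unique[OF trivial_limit_at_top_linorder] by blast

lemma pv_add: "pv \<phi> L ==> pv \<psi> L' ==> pv (%k. \<phi> k + \<psi> k) (L + L')"
  unfolding pv_def by (auto simp: integral_add intro!: integrable_add tendsto_add)

lemma pv_diff: "pv \<phi> L ==> pv \<psi> L' ==> pv (%k. \<phi> k - \<psi> k) (L - L')"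
  unfolding pv_def by (auto simp: integral_diff intro!: integrable_diff tendsto_diff)

text \<open>The point \<open>k = 0\<close> is exceptional when \<open>m = 0\<close>, for then \<open>\<rho>(0) = 0\<close>.\<close>

lemma pv_cong:
  assumes "pv \<phi> L" and eq: "\<And>k. k \<noteq> 0 ==> \<psi> k = \<phi> k"
  shows "pv \<psi> L"
proof -
  have "\<psi> integrable_on {-A..A}" for A
    by (rule integrable_spike[where S = "{0}" and f = \<phi>]) (use assms in \<open>auto simp: pv_def\<close>)
  moreover have "integral {-A..A} \<psi> = integral {-A..A} \<phi>" for A
    by (rule integral_spike[where S = "{0}", symmetric]) (use eq in auto)
  ultimately show ?thesis using assms(1) by (simp add: pv_def)
qed

lemma pv_reflect: "pv \<phi> L ==> pv (%k. \<phi> (- k)) L"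
proof -
  assume p: "pv \<phi> L"
  have "(%k. \<phi> (- k)) integrable_on {-A..A}" for A
  proof -
    have "\<phi> integrable_on {-A..A}" using p by (simp add: pv_def)
    then show ?thesis using Henstock_Kurzweil_Integration.integrable_reflect_real[of \<phi> A "-A"] by simp
  qed
  moreover have "integral {-A..A} (%k. \<phi> (- k)) = integral {-A..A} \<phi>" for A
    using Henstock_Kurzweil_Integration.integral_reflect_real[of A "-A" \<phi>] by simp
  ultimately show ?thesis using p by (simp add: pv_def)
qed

lemma pv_gen_integral: "improper \<phi> ==> pv \<phi> (gen_integral \<phi>)"
  unfolding pv_def using improper_integrable gen_integral_symmetric_limit by blast

lemma pv_integral:
  assumes i: "integrable lborel \<phi>"
  shows "pv \<phi> (integral UNIV \<phi>)"
proof -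
  have s: "set_integrable lborel {-A..A} \<phi>" for A
    unfolding set_integrable_def by (intro integrable_mult_indicator i) auto
  have "((%A. LINT k|lborel. indicator {-A..A} k *\<^sub>R \<phi> k) \<longlongrightarrow> (LINT k|lborel. \<phi> k)) at_top"
  proof (rule integral_dominated_convergence_at_top[where w = "%k. norm (\<phi> k)"])
    show "AE k in lborel. ((%A. indicator {-A..A} k *\<^sub>R \<phi> k) \<longlongrightarrow> \<phi> k) at_top"
    proof (rule AE_I2)
      show "((%A. indicator {-A..A} k *\<^sub>R \<phi> k) \<longlongrightarrow> \<phi> k) at_top" for k
        by (rule tendsto_eventually, rule eventually_mono[OF eventually_ge_at_top[of "\<bar>k\<bar>"]]) (auto simp: indicator_def)
    qed
    show "\<forall>\<^sub>F A in at_top. AE k in lborel. norm (indicator {-A..A} k *\<^sub>R \<phi> k) <= norm (\<phi> k)"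
      by (intro always_eventually allI AE_I2) (auto simp: indicator_def)
  qed (use i in auto)
  then show ?thesis unfolding pv_def
    using set_borel_integral_eq_integral[OF s] integral_lborel[OF i]
    by (simp add: set_lebesgue_integral_def)
qed

lemma pv_hat:
  fixes \<phi> :: "real => complex"
  assumes d: "decaying \<phi>" and x: "x > 0" "\<phi> differentiable (at x)"
  shows "pv (%k. exp (\<i> * k * x) * hat \<phi> k) (2 * pi * \<phi> x)" (is ?A) "pv (%k. exp (\<i> * k * x) * hat \<phi> (- k)) 0" (is ?B)
proof -
  from conjunct2[OF d[unfolded decaying_def]] obtain C where "\<forall>y\<ge>0. norm (\<phi> y) <= C / (1 + y\<^sup>2)" ..
  then have C: "continuous_on {0..} \<phi>" "\<And>y. y >= 0 ==> norm (\<phi> y) <= C / (1 + y\<^sup>2)"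
    using d by (simp_all add: decaying_def)
  have i: "(%k. exp (\<i> * cx k * cx x) * hat \<phi> k) integrable_on {-A..A}" for A x
    by (intro integrable_continuous_real continuous_intros continuous_on_hat d)
  show ?A
    unfolding pv_def using i fourier_inversion_half_line[OF C, of x] x by simp
  have "pv (%k. exp (\<i> * k * cx (- x)) * hat \<phi> k) 0"
    unfolding pv_def using i[of "- x"] fourier_inversion_half_line[OF C, of "- x"] x by simp
  from pv_reflect[OF this] show ?B by simp
qed

lemma pv_ft_on:
  fixes w :: "real => complex"
  assumes c: "continuous_on {0..t} w" and x: "x > 0" "x \<noteq> t" "t > 0" and d: "x < t ==> w differentiable (at x)"
  shows "pv (%k. exp (\<i> * k * x) * ft_on {0..t} w k) (if x < t then 2 * pi * w x else 0)" (is ?A)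
    "pv (%k. exp (\<i> * k * x) * ft_on {0..t} w (- k)) 0" (is ?B)
proof -
  have "continuous_on (UNIV \<times> cbox 0 t) (%z. exp (- \<i> * cx (fst z) * cx (snd z)) * w (snd z))"
    by (intro continuous_intros continuous_on_compose2[OF c]) auto
  then have "continuous_on UNIV (%k. integral (cbox 0 t) (%y. exp (- \<i> * cx k * cx y) * w y))"
    by (intro integral_continuous_on_param) (simp add: case_prod_unfold)
  then have "continuous_on UNIV (ft_on {0..t} w)" unfolding ft_on_def[abs_def] by simp
  then have fc: "continuous_on S (ft_on {0..t} w)" for S by (rule continuous_on_subset) simp
  have i: "(%k. exp (\<i> * cx k * cx x) * ft_on {0..t} w k) integrable_on {-A..A}" for A x
    by (intro integrable_continuous_real continuous_intros fc)
  show ?A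
    unfolding pv_def using i fourier_inversion_compact[of 0 t w x] x c d by auto
  have "pv (%k. exp (\<i> * k * cx (- x)) * ft_on {0..t} w k) 0"
    unfolding pv_def using i[of "- x"] fourier_inversion_compact[of 0 t w "- x"] x c by auto
  from pv_reflect[OF this] show ?B by simp
qed

section \<open>The solution and its extensions across the axes\<close>

context dirac_half_line
begin

lemma defect_shift_derivatives:
  assumes "x < t"
  shows "((%y. defect i (t - y)) hvd - defect (Suc i) (t - x)) (at x)" (is ?A)
    "((%u. defect i (u - x)) hvd defect (Suc i) (t - x)) (at t)"
proof -
  have "at (t - x) within {0..} = at (t - x)"
    by (rule at_within_interior) (use assms in simp)
  then have d: "(defect i hvd defect (Suc i) (t - x)) (at (t - x))"
    using defect_derivative[of "t - x" i] assms by simp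
  have "((%y. t - y) hvd - 1) (at x)" "((%u. u - x) hvd 1) (at t)"
    by (auto intro!: derivative_eq_intros)
  from vector_diff_chain_at[OF this(1) d] vector_diff_chain_at[OF this(2) d]
  show ?A
    "((%u. defect i (u - x)) hvd defect (Suc i) (t - x)) (at t)"
    by (simp_all add: o_def)
qed

definition initial_side :: "(real \<times> real) set" where "initial_side = {p. - 1 < snd p \<and> snd p < fst p}"
definition boundary_side :: "(real \<times> real) set" where "boundary_side = {p. - 1 < snd p \<and> fst p < snd p}"

lemma open_sides: "open initial_side" "open boundary_side"
  unfolding initial_side_def boundary_side_def by (intro open_Collect_conj open_Collect_less continuous_intros)+

lemma smooth_initial_side:
  "smooth2 initial_side (%(x, t). v1 0 0 x t)" "smooth2 initial_side (%(x, t). v2 0 0 x t)"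
proof -
  have c: "continuous_on initial_side (%(x, t). v1 n l x t)" "continuous_on initial_side (%(x, t). v2 n l x t)" for n l
    by (rule continuous_on_subset[OF v_continuous(1)], force simp: initial_side_def)
       (rule continuous_on_subset[OF v_continuous(2)], force simp: initial_side_def)
  have t: "t > - 1" if "(x, t) \<in> initial_side" for x t using that by (simp add: initial_side_def)
  show "smooth2 initial_side (%(x, t). v1 0 0 x t)"
  proof (rule smooth2_coinduct[where \<F> = "{F. \<exists>n l. F = (%(x, t). v1 n l x t)}", OF open_sides(1)])
    fix G assume "G \<in> {F. \<exists>n l. F = (%(x, t). v1 n l x t)}"
    then obtain n l where G: "G = (%(x, t). v1 n l x t)" by blast
    show "continuous_on initial_side G" unfolding G by (rule c)
    show "\<exists>H\<in>{F. \<exists>n l. F = (%(x, t). v1 n l x t)}. \<forall>x t. (x, t) \<in> initial_side --> ((%y. G (y, t)) hvd H (x, t)) (at x)"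
      unfolding G by (rule bexI[of _ "%(x, t). v1 (Suc n) l x t"]) (use v_derivatives(1) t in auto)
    show "\<exists>H\<in>{F. \<exists>n l. F = (%(x, t). v1 n l x t)}. \<forall>x t. (x, t) \<in> initial_side --> ((%u. G (x, u)) hvd H (x, t)) (at t)"
      unfolding G by (rule bexI[of _ "%(x, t). v1 n (Suc l) x t"]) (use v_derivatives(3) t in auto)
  qed auto
  show "smooth2 initial_side (%(x, t). v2 0 0 x t)"
  proof (rule smooth2_coinduct[where \<F> = "{F. \<exists>n l. F = (%(x, t). v2 n l x t)}", OF open_sides(1)])
    fix G assume "G \<in> {F. \<exists>n l. F = (%(x, t). v2 n l x t)}"
    then obtain n l where G: "G = (%(x, t). v2 n l x t)" by blast
    show "continuous_on initial_side G" unfolding G by (rule c)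
    show "\<exists>H\<in>{F. \<exists>n l. F = (%(x, t). v2 n l x t)}. \<forall>x t. (x, t) \<in> initial_side --> ((%y. G (y, t)) hvd H (x, t)) (at x)"
      unfolding G by (rule bexI[of _ "%(x, t). v2 (Suc n) l x t"]) (use v_derivatives(2) t in auto)
    show "\<exists>H\<in>{F. \<exists>n l. F = (%(x, t). v2 n l x t)}. \<forall>x t. (x, t) \<in> initial_side --> ((%u. G (x, u)) hvd H (x, t)) (at t)"
      unfolding G by (rule bexI[of _ "%(x, t). v2 n (Suc l) x t"]) (use v_derivatives(4) t in auto)
  qed auto
qed

inductive_set generators :: "(real \<times> real => complex) set" where
  gen_v1: "(%(x, t). v1 n l x t) \<in> generators"
| gen_v2: "(%(x, t). v2 n l x t) \<in> generators"
| gen_x: "(%p. cx (fst p)) \<in> generators"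
| gen_defect: "(%p. defect i (snd p - fst p)) \<in> generators"
| gen_retarded: "retarded m (defect 0) j a \<in> generators"

lemma power_x_in_algebra: "(%p. cx (c * fst p ^ a)) \<in> generated_algebra generators"
proof (induction a)
  case (Suc a)
  from generated_algebra.mult[OF generated_algebra.gen[OF gen_x] Suc] show ?case by (simp add: mult_ac)
qed (simp add: generated_algebra.const)

lemma smooth_boundary_side:
  assumes F: "F \<in> generated_algebra generators"
  shows "smooth2 boundary_side F"
proof (rule smooth2_generated_algebra[OF open_sides(2) F])
  let ?A = "generated_algebra generators"
  have t: "t > - 1" "x < t" if "(x, t) \<in> boundary_side" for x t using that by (simp_all add: boundary_side_def)
  note alg = generated_algebra.intros(2-4) and g = generated_algebra.gen
  note dc = defect_continuous[of 0]
  have scaled: "(%p. c * A p) \<in> ?A" if "A \<in> ?A" for A c by (rule alg(3)[OF alg(1) that])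
  fix G assume "G \<in> generators"
  then show "continuous_on boundary_side G"
  proof cases
    case (gen_v1 n l)
    show ?thesis unfolding gen_v1
      by (rule continuous_on_subset[OF v_continuous(1)]) (force simp: boundary_side_def)
  next
    case (gen_v2 n l)
    show ?thesis unfolding gen_v2
      by (rule continuous_on_subset[OF v_continuous(2)]) (force simp: boundary_side_def)
  next
    case (gen_defect i)
    show ?thesis unfolding gen_defect
      by (rule continuous_on_compose2[OF defect_continuous]) (auto simp: boundary_side_def intro!: continuous_intros)
  next
    case (gen_retarded j a)
    show ?thesis unfolding gen_retarded
      by (rule continuous_on_subset[OF retarded_continuous[OF dc]]) (auto simp: boundary_side_def)
  qed (auto intro!: continuous_intros)
  have wit: "\<exists>H\<in>?A. \<forall>x t. (x, t) \<in> boundary_side --> P H x t" if "H \<in> ?A" "\<And>x t. (x, t) \<in> boundary_side ==> P H x t" for P H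
    using that by blast
  have edge: "(%p. defect 0 (snd p - fst p) * cx (J m j 0 * fst p ^ a)) \<in> ?A" for j a
    by (rule alg(3)[OF g[OF generators.gen_defect] power_x_in_algebra])
  from \<open>G \<in> generators\<close> show "\<exists>H\<in>?A. \<forall>x t. (x, t) \<in> boundary_side --> ((%y. G (y, t)) hvd H (x, t)) (at x)"
  proof cases
    case (gen_v1 n l)
    show ?thesis by (rule wit[OF g[OF generators.gen_v1[of "Suc n" l]]]) (use v_derivatives(1) t in \<open>simp add: gen_v1\<close>)
  next
    case (gen_v2 n l)
    show ?thesis by (rule wit[OF g[OF generators.gen_v2[of "Suc n" l]]]) (use v_derivatives(2) t in \<open>simp add: gen_v2\<close>)
  next
    case gen_x
    show ?thesis by (rule wit[OF alg(1)[of 1]]) (auto simp: gen_x intro!: has_vector_derivative_of_real' derivative_eq_intros)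
  next
    case (gen_defect i)
    show ?thesis by (rule wit[OF scaled[OF g[OF generators.gen_defect[of "Suc i"]], of "- 1"]])
      (use defect_shift_derivatives(1) t in \<open>simp add: gen_defect\<close>)
  next
    case (gen_retarded j a)
    show ?thesis
    proof (rule wit[OF alg(2)[OF scaled[OF edge[of j a], of "- 1"]
          alg(3)[OF scaled[OF g[OF generators.gen_x], of "- 2"] g[OF generators.gen_retarded[of "Suc j" a]]]]])
      fix x t assume "(x, t) \<in> boundary_side"
      from retarded_derivatives(1)[OF dc t(2)[OF this], of m j a]
      show "((%y. G (y, t)) hvd - 1 * (defect 0 (snd (x, t) - fst (x, t)) * cx (J m j 0 * fst (x, t) ^ a)) +
          - 2 * cx (fst (x, t)) * retarded m (defect 0) (Suc j) a (x, t)) (at x)"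
        by (simp add: gen_retarded)
    qed
  qed
  from \<open>G \<in> generators\<close> show "\<exists>H\<in>?A. \<forall>x t. (x, t) \<in> boundary_side --> ((%u. G (x, u)) hvd H (x, t)) (at t)"
  proof cases
    case (gen_v1 n l)
    show ?thesis by (rule wit[OF g[OF generators.gen_v1[of n "Suc l"]]]) (use v_derivatives(3) t in \<open>simp add: gen_v1\<close>)
  next
    case (gen_v2 n l)
    show ?thesis by (rule wit[OF g[OF generators.gen_v2[of n "Suc l"]]]) (use v_derivatives(4) t in \<open>simp add: gen_v2\<close>)
  next
    case gen_x
    show ?thesis by (rule wit[OF alg(1)[of 0]]) (auto simp: gen_x intro!: derivative_eq_intros)
  next
    case (gen_defect i)
    show ?thesis by (rule wit[OF g[OF generators.gen_defect[of "Suc i"]]])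
      (use defect_shift_derivatives(2) t in \<open>simp add: gen_defect\<close>)
  next
    case (gen_retarded j a)
    show ?thesis
    proof (rule wit[OF alg(2)[OF edge[of j a] alg(2)[OF scaled[OF g[OF generators.gen_retarded[of "Suc j" "Suc a"]], of 2]
          scaled[OF g[OF generators.gen_retarded[of j "a - 1"]], of "of_nat a"]]]])
      fix x t assume "(x, t) \<in> boundary_side"
      from retarded_derivatives(2)[OF dc t(2)[OF this], of m j a]
      show "((%u. G (x, u)) hvd defect 0 (snd (x, t) - fst (x, t)) * cx (J m j 0 * fst (x, t) ^ a) +
          (2 * retarded m (defect 0) (Suc j) (Suc a) (x, t) + of_nat a * retarded m (defect 0) j (a - 1) (x, t))) (at t)"
        by (simp add: gen_retarded)
    qed
  qed
qed

lemma boundary_wave_in_algebra: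
  "bw1 m (defect 0) \<in> generated_algebra generators" "bw2 m (defect 0) \<in> generated_algebra generators"
  unfolding bw1_def bw2_def
  by (intro generated_algebra.add generated_algebra.mult generated_algebra.const
      generated_algebra.gen generators.intros)+

text \<open>The extension across the boundary axis.\<close>

definition near1 :: "real \<times> real => complex" where "near1 p = v1 0 0 (fst p) (snd p) + bw1 m (defect 0) p"
definition near2 :: "real \<times> real => complex" where "near2 p = v2 0 0 (fst p) (snd p) + bw2 m (defect 0) p"

lemma smooth_near: "smooth2 boundary_side near1" "smooth2 boundary_side near2"
  unfolding near1_def[abs_def] near2_def[abs_def]
  by (rule smooth_boundary_side[OF generated_algebra.add[OF generated_algebra.gen[OF gen_v1[unfolded case_prod_unfold]] boundary_wave_in_algebra(1)]])
     (rule smooth_boundary_side[OF generated_algebra.add[OF generated_algebra.gen[OF gen_v2[unfolded case_prod_unfold]] boundary_wave_in_algebra(2)]])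

lemma near1_boundary: "near1 (0, t) = h 0 t"
  by (simp add: near1_def bw1_def defect_def)

lemma source_inversion:
  assumes x: "x > 0" and t: "t > 0" and xt: "x \<noteq> t"
  shows "pv (%k. exp (\<i> * k * x) * source1 m (g1 0) (g2 0) (%\<tau> x. f1 0 0 x \<tau>) (%\<tau> x. f2 0 0 x \<tau>) (h 0) t k)
      (2 * pi * (if x < t then near1 (x, t) else v1 0 0 x t))" (is ?A)
    and "pv (%k. exp (\<i> * k * x) * source2 m (g1 0) (g2 0) (%\<tau> x. f1 0 0 x \<tau>) (%\<tau> x. f2 0 0 x \<tau>) (h 0) t k)
      (2 * pi * (if x < t then near2 (x, t) else v2 0 0 x t))" (is ?B)
proof -
  have t': "t >= 0" "t > - 1" using t by auto
  have r: "rho m k \<noteq> 0" if "k \<noteq> 0" for k using rho_zero[of m k] that by blast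
  have wc: "continuous_on {0..t} (%x. retarded m (defect 0) j a (x, t))" for j a
    by (rule continuous_on_compose2[OF retarded_continuous[OF defect_continuous]]) (auto intro!: continuous_intros)
  have dc: "continuous_on {0..t} (%x. defect 0 (t - x))"
    by (rule continuous_on_compose2[OF defect_continuous]) (auto intro!: continuous_intros)
  have c: "continuous_on {0..t} (%x. bw1 m (defect 0) (x, t))" "continuous_on {0..t} (%x. bw2 m (defect 0) (x, t))"
    unfolding bw1_def bw2_def fst_conv snd_conv by (intro continuous_intros wc dc)+
  have diff: "(%y. F (y, t)) differentiable (at x)" if "F \<in> generated_algebra generators" "x < t" for F
    by (rule differentiableI_vector[OF smooth2_has_partials(1)[OF open_sides(2) smooth_boundary_side[OF that(1)] iterated_partials.base]])
       (use that t in \<open>simp add: boundary_side_def\<close>)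
  note b1 = pv_ft_on[OF c(1) x xt t diff[OF boundary_wave_in_algebra(1)]]
  note b2 = pv_ft_on[OF c(2) x xt t diff[OF boundary_wave_in_algebra(2)]]
  note w1 = pv_hat[OF v_decaying(1)[OF t'(1), of 0] x differentiableI_vector[OF v_derivatives(1)[OF t'(2)]]]
  note w2 = pv_hat[OF v_decaying(2)[OF t'(1), of 0] x differentiableI_vector[OF v_derivatives(2)[OF t'(2)]]]
  have "pv (%k. exp (\<i> * k * x) * source1 m (g1 0) (g2 0) (%\<tau> x. f1 0 0 x \<tau>) (%\<tau> x. f2 0 0 x \<tau>) (h 0) t k)
      (2 * pi * v1 0 0 x t - 0 + ((if x < t then 2 * pi * bw1 m (defect 0) (x, t) else 0) - 0))"
    by (rule pv_cong[OF pv_add[OF pv_diff[OF w1] pv_diff[OF b1]]])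
       (assumption, assumption, simp add: source_eq[OF t'(1) r] odd_hat_def algebra_simps)
  then show ?A
    by (simp add: near1_def distrib_left split: if_splits)
  have "pv (%k. exp (\<i> * k * x) * source2 m (g1 0) (g2 0) (%\<tau> x. f1 0 0 x \<tau>) (%\<tau> x. f2 0 0 x \<tau>) (h 0) t k)
      (2 * pi * v2 0 0 x t + 0 + ((if x < t then 2 * pi * bw2 m (defect 0) (x, t) else 0) + 0))"
    by (rule pv_cong[OF pv_add[OF pv_add[OF w2] pv_add[OF b2]]])
       (assumption, assumption, simp add: source_eq[OF t'(1) r] even_hat_def algebra_simps)
  then show ?B
    by (simp add: near2_def distrib_left split: if_splits)
qed

end

section \<open>Asymptotics of the oscillatory integrands\<close>

text \<open>The leading behaviour \<open>c exp (i k s) / k\<^sup>d\<close> as \<open>k \<rightarrow> \<infinity>\<close>, with an error smaller by one power of \<open>k\<close>. Such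
expansions multiply, with amplitudes multiplied and phases added (\<open>asym_mult\<close>), so that each integrand can be
treated factor by factor.\<close>

definition asym :: "nat => (real => complex) => complex => real => bool" where
  "asym d \<phi> c s \<longleftrightarrow> (\<exists>C. \<forall>k\<ge>1. norm (\<phi> k - c * exp (\<i> * k * s) / cx k ^ d) <= C / k ^ Suc d)"

lemma asymI: "(\<And>k. k >= 1 ==> norm (\<phi> k - c * exp (\<i> * cx k * cx s) / cx k ^ d) <= C / k ^ Suc d) ==> asym d \<phi> c s"
  unfolding asym_def by (intro exI[of _ C]) simp

lemma asym_const: "asym 0 (%k. c) c 0"
  by (rule asymI[where C = 0]) simp

lemma asym_exp: "asym 0 (%k. exp (\<i> * cx k * cx s)) 1 s"
  by (rule asymI[where C = 0]) simp

lemma asym_mult: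
  assumes "asym d \<phi> c s" "asym e \<psi> c' s'"
  shows "asym (d + e) (%k. \<phi> k * \<psi> k) (c * c') (s + s')"
proof -
  from assms(1)[unfolded asym_def] obtain C where C: "\<forall>k\<ge>1. norm (\<phi> k - c * exp (\<i> * k * s) / cx k ^ d) <= C / k ^ Suc d" ..
  from assms(2)[unfolded asym_def] obtain D where D: "\<forall>k\<ge>1. norm (\<psi> k - c' * exp (\<i> * k * s') / cx k ^ e) <= D / k ^ Suc e" ..
  have D0: "D >= 0" using order_trans[OF norm_ge_zero D[rule_format, of 1]] by simp
  have C0: "C >= 0" using order_trans[OF norm_ge_zero C[rule_format, of 1]] by simp
  show ?thesis
  proof (rule asymI)
    fix k :: real assume k: "k >= 1"
    let ?a = "c * exp (\<i> * k * s) / cx k ^ d" and ?b = "c' * exp (\<i> * k * s') / cx k ^ e"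
    have nb: "norm ?b = norm c' / k ^ e" "norm ?a = norm c / k ^ d"
      using k by (simp_all add: norm_mult norm_divide norm_power)
    have "D / k ^ Suc e <= D / k ^ e"
      using k D0 power_increasing[of e "Suc e" k] by (intro divide_left_mono) auto
    then have psi: "norm (\<psi> k) <= (norm c' + D) / k ^ e"
      using D[rule_format, OF k] norm_triangle_sub[of "\<psi> k" ?b] nb by (simp add: add_divide_distrib)
    have "\<phi> k * \<psi> k - ?a * ?b = (\<phi> k - ?a) * \<psi> k + ?a * (\<psi> k - ?b)" by (simp add: algebra_simps)
    then have "norm (\<phi> k * \<psi> k - ?a * ?b) <= norm (\<phi> k - ?a) * norm (\<psi> k) + norm ?a * norm (\<psi> k - ?b)"
      using norm_triangle_ineq[of "(\<phi> k - ?a) * \<psi> k" "?a * (\<psi> k - ?b)"] by (simp only: norm_mult)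
    also have "\<dots> <= C / k ^ Suc d * ((norm c' + D) / k ^ e) + norm c / k ^ d * (D / k ^ Suc e)"
      using k C[rule_format, OF k] D[rule_format, OF k] psi C0 D0 nb by (intro add_mono mult_mono) auto
    also have "\<dots> = (C * (norm c' + D) + norm c * D) / k ^ Suc (d + e)"
      using k by (simp add: field_simps power_add)
    also have "?a * ?b = c * c' * exp (\<i> * k * cx (s + s')) / cx k ^ (d + e)"
      by (simp add: exp_add power_add distrib_left)
    finally show "norm (\<phi> k * \<psi> k - c * c' * exp (\<i> * k * cx (s + s')) / cx k ^ (d + e))
        <= (C * (norm c' + D) + norm c * D) / k ^ Suc (d + e)" .
  qed
qed

lemma improper_half_asym:
  assumes m: "\<phi> \<in> borel_measurable borel" and b: "\<And>k. k >= 0 ==> norm (\<phi> k) <= B"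
    and a: "asym 1 \<phi>1 c1 s1" "asym 1 \<phi>2 c2 s2" "s1 \<noteq> 0" "s2 \<noteq> 0"
    and eq: "\<And>k. k >= 1 ==> \<phi> k = \<phi>1 k + \<phi>2 k"
  shows "improper_half \<phi>"
proof -
  from a(1)[unfolded asym_def] obtain C where C: "\<forall>k\<ge>1. norm (\<phi>1 k - c1 * exp (\<i> * k * s1) / cx k ^ 1) <= C / k ^ Suc 1" ..
  from a(2)[unfolded asym_def] obtain D where D: "\<forall>k\<ge>1. norm (\<phi>2 k - c2 * exp (\<i> * k * s2) / cx k ^ 1) <= D / k ^ Suc 1" ..
  show ?thesis
  proof (rule oscillatory_improper_half[OF m b a(3,4)])
    fix k :: real assume k: "k >= 1"
    have e: "\<phi> k - c1 * (exp (\<i> * k * s1) / k) - c2 * (exp (\<i> * k * s2) / k) =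
        (\<phi>1 k - c1 * exp (\<i> * k * s1) / cx k ^ 1) + (\<phi>2 k - c2 * exp (\<i> * k * s2) / cx k ^ 1)"
      by (simp add: eq[OF k])
    show "norm (\<phi> k - c1 * (exp (\<i> * k * s1) / k) - c2 * (exp (\<i> * k * s2) / k)) <= (C + D) / k\<^sup>2"
      unfolding e using norm_triangle_mono[OF C[rule_format, OF k] D[rule_format, OF k]]
      by (simp add: add_divide_distrib power2_eq_square)
  qed
qed

lemma rho_minus [simp]: "rho m (- k) = rho m k" by (simp add: rho_def)

lemma rho_asymptotics:
  assumes "k >= 1" shows "0 < rho m k" "\<bar>rho m k - k\<bar> <= m\<^sup>2 / k" (is ?B)
proof -
  have le: "k <= rho m k" using abs_le_rho(1)[of k m] assms by simp
  then show "0 < rho m k" using assms by simp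
  have "(rho m k - k) * (rho m k + k) = m\<^sup>2" using rho_squared[of m k] by (simp add: power2_eq_square algebra_simps)
  moreover have "(rho m k - k) * k <= (rho m k - k) * (rho m k + k)" using le assms by (intro mult_left_mono) auto
  ultimately have "(rho m k - k) * k <= m\<^sup>2" by simp
  then show ?B using le assms by (simp add: pos_le_divide_eq)
qed

lemma norm_exp_difference: "norm (exp (\<i> * cx a) - exp (\<i> * cx b)) <= \<bar>a - b\<bar>"
proof -
  have "exp (\<i> * cx a) - exp (\<i> * cx b) = exp (\<i> * cx b) * (exp (\<i> * cx (a - b)) - 1)"
    by (simp add: right_diff_distrib exp_add[symmetric] algebra_simps)
  then have "norm (exp (\<i> * cx a) - exp (\<i> * cx b)) = 2 * \<bar>sin ((a - b) / 2)\<bar>"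
    by (simp add: norm_mult dist_exp_i_1 del: of_real_diff)
  also have "\<dots> <= \<bar>a - b\<bar>" using abs_sin_x_le_abs_x[of "(a - b) / 2"] by simp
  finally show ?thesis .
qed

definition phase :: "real => real => real => complex" where
  "phase m u k = exp (\<i> * cx (rho m k * u))"

lemma norm_phase [simp]: "norm (phase m u k) = 1" by (simp add: phase_def norm_exp_eq_Re)

lemma phase_minus [simp]: "phase m u (- k) = phase m u k" by (simp add: phase_def)

lemma rho_continuous [continuous_intros]: "continuous_on S \<phi> ==> continuous_on S (%k. rho m (\<phi> k))"
  unfolding rho_def by (intro continuous_intros)

text \<open>The dispersion \<open>\<rho>(k) - k\<close> is \<open>O(1/k)\<close>, so at leading order the phase is that of the massless equation.\<close>

lemma asym_phase: "asym 0 (phase m u) 1 u"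
proof (rule asymI)
  fix k :: real assume k: "k >= 1"
  have "norm (exp (\<i> * cx (rho m k * u)) - exp (\<i> * cx (k * u))) <= \<bar>rho m k * u - k * u\<bar>"
    by (rule norm_exp_difference)
  also have "\<dots> = \<bar>rho m k - k\<bar> * \<bar>u\<bar>" unfolding left_diff_distrib[symmetric] by (rule abs_mult)
  also have "\<dots> <= m\<^sup>2 / k * \<bar>u\<bar>" by (intro mult_right_mono rho_asymptotics k) simp
  finally show "norm (phase m u k - 1 * exp (\<i> * cx k * cx u) / cx k ^ 0) <= (m\<^sup>2 * \<bar>u\<bar>) / k ^ Suc 0"
    by (simp add: phase_def mult_ac)
qed

lemma asym_inverse_rho: "asym 1 (%k. 1 / cx (rho m k)) 1 0"
proof (rule asymI)
  fix k :: real assume k: "k >= 1"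
  note r = rho_asymptotics[OF k, of m]
  have "1 / cx (rho m k) - 1 / cx k = cx ((k - rho m k) / (rho m k * k))"
    using r(1) k by (simp add: field_simps)
  then have "norm (1 / cx (rho m k) - 1 / cx k) = \<bar>rho m k - k\<bar> / (rho m k * k)"
    using r(1) k by (simp only: norm_of_real) (simp add: abs_minus_commute)
  also have "\<dots> <= m\<^sup>2 / (1 * (k * k))"
  proof (rule frac_le)
    have "m\<^sup>2 / k <= m\<^sup>2" using k by (simp add: divide_le_eq mult_right_le_one_le) (metis mult_left_mono[of 1 k "m\<^sup>2"] mult_1_right zero_le_power2)
    then show "\<bar>rho m k - k\<bar> <= m\<^sup>2" using r(2) by linarith
    show "1 * (k * k) <= rho m k * k" using abs_le_rho(1)[of k m] k by (simp add: mult_right_mono)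
  qed (use k in auto)
  finally show "norm (1 / cx (rho m k) - 1 * exp (\<i> * cx k * cx 0) / cx k ^ 1) <= m\<^sup>2 / k ^ Suc 1"
    by simp
qed

text \<open>All rational factors of the integrands have this shape. The weight \<open>m\<close> on \<open>\<gamma>\<close> keeps them bounded even where
\<open>\<rho>\<close> vanishes.\<close>

definition symb :: "real => complex => complex => complex => real => complex" where
  "symb m \<alpha> \<beta> \<gamma> k = (\<alpha> * k + \<beta> * rho m k + \<gamma> * m) / rho m k"

lemma symb_minus [simp]: "symb m \<alpha> \<beta> \<gamma> (- k) = symb m (- \<alpha>) \<beta> \<gamma> k"
  by (simp add: symb_def)

lemma norm_symb_le: "norm (symb m \<alpha> \<beta> \<gamma> k) <= norm \<alpha> + norm \<beta> + norm \<gamma>"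
proof (cases "rho m k = 0")
  case False
  then have r: "rho m k > 0" using rho_nonneg[of m k] by simp
  have "norm (\<alpha> * k + \<beta> * rho m k + \<gamma> * m) <= norm (\<alpha> * k) + norm (\<beta> * rho m k) + norm (\<gamma> * m)"
    by (meson add_mono norm_triangle_ineq order_refl order_trans)
  also have "\<dots> <= norm \<alpha> * rho m k + norm \<beta> * rho m k + norm \<gamma> * rho m k"
    using abs_le_rho[of k m] abs_le_rho(2)[of m k] r by (intro add_mono) (auto simp: norm_mult intro: mult_left_mono)
  finally show ?thesis using r by (simp add: symb_def norm_divide pos_divide_le_eq distrib_right)
qed (simp add: symb_def)

lemma asym_symb: "asym 0 (symb m \<alpha> \<beta> \<gamma>) (\<alpha> + \<beta>) 0"
proof (rule asymI)
  fix k :: real assume k: "k >= 1"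
  note r = rho_asymptotics[OF k, of m]
  have "symb m \<alpha> \<beta> \<gamma> k - (\<alpha> + \<beta>) = (\<alpha> * (k - rho m k) + \<gamma> * m) / rho m k"
    using r(1) by (simp add: symb_def field_simps)
  then have "norm (symb m \<alpha> \<beta> \<gamma> k - (\<alpha> + \<beta>)) = norm (\<alpha> * cx (k - rho m k) + \<gamma> * m) / rho m k"
    using r(1) by (simp add: norm_divide)
  also have "\<dots> <= (norm \<alpha> * m\<^sup>2 + norm \<gamma> * \<bar>m\<bar>) / k"
  proof (rule frac_le)
    have "m\<^sup>2 / k <= m\<^sup>2 / 1" using k by (intro divide_left_mono) auto
    then have "\<bar>k - rho m k\<bar> <= m\<^sup>2" using r(2) by linarith
    then have "norm (\<alpha> * cx (k - rho m k)) <= norm \<alpha> * m\<^sup>2"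
      unfolding norm_mult norm_of_real by (intro mult_left_mono) auto
    then show "norm (\<alpha> * cx (k - rho m k) + \<gamma> * m) <= norm \<alpha> * m\<^sup>2 + norm \<gamma> * \<bar>m\<bar>"
      by (intro norm_triangle_mono) (auto simp: norm_mult)
    show "k <= rho m k" using abs_le_rho(1)[of k m] by simp
  qed (use k in auto)
  finally show "norm (symb m \<alpha> \<beta> \<gamma> k - (\<alpha> + \<beta>) * exp (\<i> * cx k * cx 0) / cx k ^ 0)
     <= (norm \<alpha> * m\<^sup>2 + norm \<gamma> * \<bar>m\<bar>) / k ^ Suc 0" by simp
qed

lemma line_family_decaying:
  assumes "line_family g" shows "decaying (g n)"
proof -
  from line_family_bound[OF assms, of n] obtain C where "\<forall>y. norm (g n y) <= C / (1 + y\<^sup>2)" ..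
  then have "\<exists>C. \<forall>y\<ge>0. norm (g n y) <= C / (1 + y\<^sup>2)" by blast
  then show ?thesis unfolding decaying_def using continuous_on_subset[OF line_family_D(2)[OF assms]] by simp
qed

lemma line_family_hat_step:
  "line_family g ==> hat (g (Suc n)) k = - g n 0 + \<i> * k * hat (g n) k"
  by (rule hat_by_parts[OF line_family_D(1,2) line_family_decaying line_family_decaying])

lemma hat_bounded: "line_family g ==> \<exists>B\<ge>0. \<forall>k. norm (hat (g n) k) <= B"
proof -
  assume g: "line_family g"
  from line_family_bound[OF g, of n] obtain C where C: "\<forall>y. norm (g n y) <= C / (1 + y\<^sup>2)" ..
  have "\<forall>k. norm (hat (g n) k) <= C * (LINT y|lborel. 1 / (1 + y\<^sup>2))"
    by (intro allI norm_hat_le continuous_on_subset[OF line_family_D(2)[OF g]]) (use C in auto)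
  then show ?thesis using order_trans[OF norm_ge_zero] by blast
qed

text \<open>Two integrations by parts; the amplitude is the boundary value of the function.\<close>

lemma asym_hat:
  assumes g: "line_family g" and \<sigma>: "\<sigma> = 1 \<or> \<sigma> = - 1"
  shows "asym 1 (%k. hat (g 0) (\<sigma> * k)) (- \<i> * \<sigma> * g 0 0) 0"
proof -
  from hat_bounded[OF g, of 2] obtain B where B: "\<forall>k. norm (hat (g 2) k) <= B" by blast
  show ?thesis
  proof (rule asymI)
    fix k :: real assume k: "k >= 1"
    have ss: "cx \<sigma> * cx \<sigma> = 1" using \<sigma> by auto
    have k0: "cx k \<noteq> 0" using k by simp
    have 1: "hat (g 1) (\<sigma> * k) = - g 0 0 + \<i> * (\<sigma> * k) * hat (g 0) (\<sigma> * k)" using line_family_hat_step[OF g, of 0 "\<sigma> * k"] by simp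
    have 2: "hat (g 2) (\<sigma> * k) = - g 1 0 + \<i> * (\<sigma> * k) * hat (g 1) (\<sigma> * k)" using line_family_hat_step[OF g, of 1 "\<sigma> * k"] by (simp add: numeral_2_eq_2)
    have "hat (g 0) (\<sigma> * k) - (- \<i> * \<sigma> * g 0 0) / k = - \<i> * \<sigma> * hat (g 1) (\<sigma> * k) / k"
      unfolding 1 using k0 ss by (simp add: field_simps)
    also have "hat (g 1) (\<sigma> * k) = - \<i> * \<sigma> * (hat (g 2) (\<sigma> * k) + g 1 0) / k"
      unfolding 2 using k0 ss by (simp add: field_simps)
    finally have "norm (hat (g 0) (\<sigma> * k) - (- \<i> * \<sigma> * g 0 0) / k) = norm (hat (g 2) (\<sigma> * k) + g 1 0) / k\<^sup>2"
      using \<sigma> k by (auto simp: norm_mult norm_divide power2_eq_square)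
    also have "\<dots> <= (B + norm (g 1 0)) / k\<^sup>2"
      using B by (intro divide_right_mono norm_triangle_mono) auto
    finally show "norm (hat (g 0) (\<sigma> * k) - - \<i> * cx \<sigma> * g 0 0 * exp (\<i> * cx k * cx 0) / cx k ^ 1)
      <= (B + norm (g 1 0)) / k ^ Suc 1" by (simp add: power2_eq_square)
  qed
qed

lemma borel_measurable_parts:
  "phase m u \<in> borel_measurable borel" "symb m \<alpha> \<beta> \<gamma> \<in> borel_measurable borel"
  "(%k. exp (\<i> * cx k * cx x)) \<in> borel_measurable borel"
proof -
  have [measurable]: "rho m \<in> borel_measurable borel" unfolding rho_def[abs_def] by measurable
  show "phase m u \<in> borel_measurable borel" "symb m \<alpha> \<beta> \<gamma> \<in> borel_measurable borel"
    unfolding phase_def[abs_def] symb_def[abs_def] by measurable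
  show "(%k. exp (\<i> * cx k * cx x)) \<in> borel_measurable borel" by measurable
qed

lemma improper_half_transform:
  assumes g: "line_family g" and \<sigma>: "\<sigma> = 1 \<or> \<sigma> = - 1" and s: "x \<noteq> - u"
  shows "improper_half (%k. exp (\<i> * cx k * cx x) * phase m u k * symb m \<alpha> \<beta> \<gamma> k * hat (g 0) (\<sigma> * k))"
proof -
  have c: "continuous_on UNIV (%k. hat (g 0) (\<sigma> * k))"
    by (rule continuous_on_compose2[OF continuous_on_hat[OF line_family_decaying[OF g], of UNIV]]) (auto intro!: continuous_intros)
  from hat_bounded[OF g, of 0] obtain B where B: "B >= 0" "\<forall>k. norm (hat (g 0) k) <= B" by blast
  let ?\<phi> = "%k. exp (\<i> * cx k * cx x) * phase m u k * symb m \<alpha> \<beta> \<gamma> k * hat (g 0) (\<sigma> * k)"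
  have a: "asym (0 + 0 + 0 + 1) ?\<phi> (1 * 1 * (\<alpha> + \<beta>) * (- \<i> * \<sigma> * g 0 0)) (x + u + 0 + 0)"
    by (intro asym_mult asym_exp asym_phase asym_symb asym_hat g \<sigma>)
  have z: "asym 1 (%k. 0) 0 (x + u)" by (rule asymI[where C = 0]) simp
  show ?thesis
  proof (rule improper_half_asym[OF _ _ a[simplified, folded One_nat_def] z])
    show "?\<phi> \<in> borel_measurable borel"
      by (intro borel_measurable_times borel_measurable_parts borel_measurable_continuous_onI c)
    show "norm (?\<phi> k) <= 1 * 1 * (norm \<alpha> + norm \<beta> + norm \<gamma>) * B" for k
      unfolding norm_mult using B by (intro mult_mono norm_symb_le) auto
  qed (use s in auto)
qed

lemma improper_transform:
  assumes g: "line_family g" and \<sigma>: "\<sigma> = 1 \<or> \<sigma> = - 1" and s: "x \<noteq> - u" "x \<noteq> u"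
  shows "improper (%k. exp (\<i> * cx k * cx x) * phase m u k * symb m \<alpha> \<beta> \<gamma> k * hat (g 0) (\<sigma> * k))"
proof -
  have "improper_half (%k. exp (\<i> * cx k * cx (- x)) * phase m u k * symb m (- \<alpha>) \<beta> \<gamma> k * hat (g 0) ((- \<sigma>) * k))"
    by (rule improper_half_transform[OF g]) (use \<sigma> s in auto)
  then show ?thesis unfolding improper_def using improper_half_transform[OF g \<sigma> s(1)] by simp
qed

text \<open>The integral over past times with an exponential weight, the time factor of the boundary and force terms.\<close>

definition osc_int :: "(real => complex) => complex => real => complex" where
  "osc_int u \<omega> t = integral {0..t} (%\<tau>. exp (\<omega> * cx \<tau>) * u \<tau>)"

lemma osc_int_by_parts:
  assumes t: "t >= 0" and d: "\<And>\<tau>. \<tau> \<in> {0..t} ==> (u hvd u' \<tau>) (at \<tau> within {0..t})"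
    and c: "continuous_on {0..t} u'"
  shows "\<omega> * osc_int u \<omega> t = exp (\<omega> * cx t) * u t - u 0 - osc_int u' \<omega> t"
proof -
  have uc: "continuous_on {0..t} u"
    using has_vector_derivative_continuous[OF d] by (simp add: continuous_on_eq_continuous_within)
  have "((%\<tau>. exp (\<omega> * cx \<tau>) * u' \<tau> + \<omega> * exp (\<omega> * cx \<tau>) * u \<tau>) has_integral
      exp (\<omega> * cx t) * u t - exp (\<omega> * cx 0) * u 0) {0..t}"
    by (rule fundamental_theorem_of_calculus[OF t])
       (rule has_vector_derivative_mult[OF has_vector_derivative_cexp d])
  from integral_unique[OF this] have "exp (\<omega> * cx t) * u t - u 0 =
      integral {0..t} (%\<tau>. exp (\<omega> * cx \<tau>) * u' \<tau> + \<omega> * (exp (\<omega> * cx \<tau>) * u \<tau>))"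
    by (simp add: mult.assoc)
  also have "\<dots> = osc_int u' \<omega> t + integral {0..t} (%\<tau>. \<omega> * (exp (\<omega> * cx \<tau>) * u \<tau>))"
    unfolding osc_int_def by (intro integral_add integrable_continuous_real continuous_intros c uc)
  finally show ?thesis by (simp add: osc_int_def)
qed

lemma norm_osc_int_le:
  assumes t: "t >= 0" and c: "continuous_on {0..t} u" and le: "\<And>\<tau>. \<tau> \<in> {0..t} ==> norm (u \<tau>) <= B" and \<omega>: "Re \<omega> = 0"
  shows "norm (osc_int u \<omega> t) <= B * t"
proof -
  have "norm (osc_int u \<omega> t) <= B * (t - 0)"
    unfolding osc_int_def by (rule integral_bound[OF t])
      (use le \<omega> in \<open>auto simp: norm_mult norm_exp_eq_Re intro!: continuous_intros c\<close>)
  then show ?thesis by simp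
qed

lemma osc_int_continuous:
  assumes c: "continuous_on {0..t} u"
  shows "continuous_on UNIV (%k. osc_int u (\<i> * cx (\<epsilon> * rho m k)) t)"
proof -
  have "continuous_on (UNIV \<times> cbox 0 t) (%z. exp (\<i> * cx (\<epsilon> * rho m (fst z)) * cx (snd z)) * u (snd z))"
    by (intro continuous_intros continuous_on_compose2[OF c]) auto
  then have "continuous_on UNIV (%k. integral (cbox 0 t) (%\<tau>. exp (\<i> * cx (\<epsilon> * rho m k) * cx \<tau>) * u \<tau>))"
    by (intro integral_continuous_on_param) (simp add: case_prod_unfold)
  then show ?thesis unfolding osc_int_def by simp
qed

text \<open>One integration by parts in time gives the factor \<open>1/\<rho>\<close> and two waves: the upper limit cancels the phase
\<open>\<rho> t\<close> and leaves the phase \<open>x\<close>, the lower limit keeps \<open>x - \<epsilon> t\<close>. A second one controls the remainder.\<close>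

lemma improper_half_boundary:
  fixes h :: "nat => real => complex"
  assumes h: "\<And>i s. s >= 0 ==> (h i hvd h (Suc i) s) (at s within {0..})"
    and \<epsilon>: "\<epsilon> = 1 \<or> \<epsilon> = - 1" and t: "t > 0" and x: "x \<noteq> 0" "x \<noteq> \<epsilon> * t"
  shows "improper_half (%k. exp (\<i> * cx k * cx x) * phase m (- \<epsilon> * t) k * symb m \<alpha> \<beta> \<gamma> k * osc_int (h 0) (\<i> * cx (\<epsilon> * rho m k)) t)"
proof -
  let ?I = "%i k. osc_int (h i) (\<i> * cx (\<epsilon> * rho m k)) t"
  let ?e = "%k. exp (\<i> * cx k * cx x)" and ?q = "symb m \<alpha> \<beta> \<gamma>"
  have t0: "t >= 0" using t by simp
  have c: "continuous_on {0..t} (h i)" for i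
  proof -
    have "continuous_on {0..} (h i)" using has_vector_derivative_continuous[OF h] by (simp add: continuous_on_eq_continuous_within)
    then show ?thesis by (rule continuous_on_subset) auto
  qed
  have d: "(h i hvd h (Suc i) \<tau>) (at \<tau> within {0..t})" if "\<tau> \<in> {0..t}" for i \<tau>
    by (rule has_vector_derivative_within_subset[OF h]) (use that in auto)
  have bd: "\<exists>B\<ge>0. \<forall>k. norm (?I i k) <= B" for i
  proof -
    from compact_imp_bounded[OF compact_continuous_image[OF c compact_Icc]]
    obtain B where "\<forall>y\<in>h i ` {0..t}. norm y <= B" unfolding bounded_iff ..
    then have "\<forall>k. norm (?I i k) <= B * t" by (intro allI norm_osc_int_le t0 c) auto
    then show ?thesis using order_trans[OF norm_ge_zero] by blast
  qed
  from bd[of 0] obtain B0 where B0: "B0 >= 0" "\<forall>k. norm (?I 0 k) <= B0" by blast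
  from bd[of 2] obtain B2 where B2: "B2 >= 0" "\<forall>k. norm (?I 2 k) <= B2" by blast
  have ee: "cx \<epsilon> * cx \<epsilon> = 1" "norm (cx \<epsilon>) = 1" using \<epsilon> by auto
  have E: "exp (\<i> * cx (\<epsilon> * rho m k) * cx t) = phase m (\<epsilon> * t) k" for k
    by (simp add: phase_def mult_ac)
  have step: "?I i k = - \<i> * \<epsilon> * (phase m (\<epsilon> * t) k * h i t - h i 0 - ?I (Suc i) k) * (1 / cx (rho m k))" if "rho m k > 0" for i k
  proof -
    have e: "phase m (\<epsilon> * t) k * h i t - h i 0 - ?I (Suc i) k = \<i> * cx (\<epsilon> * rho m k) * ?I i k"
      using osc_int_by_parts[where u = "h i" and u' = "h (Suc i)" and \<omega> = "\<i> * cx (\<epsilon> * rho m k)", OF t0 d c]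
      unfolding E by simp
    have "- \<i> * \<epsilon> * (\<i> * cx (\<epsilon> * rho m k) * ?I i k) * (1 / cx (rho m k)) = (cx \<epsilon> * cx \<epsilon>) * ?I i k"
      using that by (simp add: mult.left_commute[of "cx \<epsilon>" "\<i>"])
    then show ?thesis unfolding e ee by simp
  qed
  have I1: "asym 0 (%k. - h 0 0 - ?I 1 k) (- h 0 0) 0"
  proof (rule asymI)
    fix k :: real assume k: "k >= 1"
    note r = rho_asymptotics(1)[OF k, of m]
    have le: "k <= rho m k" using abs_le_rho(1)[of k m] by simp
    have "norm (?I 1 k) = norm (phase m (\<epsilon> * t) k * h 1 t - h 1 0 - ?I 2 k) / rho m k"
      unfolding step[OF r, of 1] using ee(2) r by (simp add: norm_mult norm_divide numeral_2_eq_2)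
    also have "\<dots> <= (norm (h 1 t) + norm (h 1 0) + B2) / k"
    proof (rule frac_le)
      have "norm (phase m (\<epsilon> * t) k * h 1 t - h 1 0 - ?I 2 k) <= norm (phase m (\<epsilon> * t) k * h 1 t) + norm (h 1 0) + norm (?I 2 k)"
        using norm_triangle_ineq4 norm_triangle_ineq4 by (meson add_mono order_refl order_trans)
      then show "norm (phase m (\<epsilon> * t) k * h 1 t - h 1 0 - ?I 2 k) <= norm (h 1 t) + norm (h 1 0) + B2"
        using B2(2)[rule_format, of k] by (simp add: norm_mult)
    qed (use k le B2 in auto)
    finally show "norm (- h 0 0 - ?I 1 k - - h 0 0 * exp (\<i> * cx k * cx 0) / cx k ^ 0) <= (norm (h 1 t) + norm (h 1 0) + B2) / k ^ Suc 0"
      by simp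
  qed
  let ?\<phi>1 = "%k. ?e k * ?q k * (- \<i> * \<epsilon> * h 0 t) * (1 / cx (rho m k))"
  let ?\<phi>2 = "%k. ?e k * phase m (- \<epsilon> * t) k * ?q k * (- \<i> * \<epsilon>) * (- h 0 0 - ?I 1 k) * (1 / cx (rho m k))"
  have a1: "asym (0 + 0 + 0 + 1) ?\<phi>1 (1 * (\<alpha> + \<beta>) * (- \<i> * \<epsilon> * h 0 t) * 1) (x + 0 + 0 + 0)"
    by (intro asym_mult asym_exp asym_symb asym_const asym_inverse_rho)
  have a2: "asym (0 + 0 + 0 + 0 + 0 + 1) ?\<phi>2 (1 * 1 * (\<alpha> + \<beta>) * (- \<i> * \<epsilon>) * (- h 0 0) * 1) (x + - \<epsilon> * t + 0 + 0 + 0 + 0)"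
    by (intro asym_mult asym_exp asym_phase asym_symb asym_const asym_inverse_rho I1)
  show ?thesis
  proof (rule improper_half_asym)
    show "asym 1 ?\<phi>1 (1 * (\<alpha> + \<beta>) * (- \<i> * \<epsilon> * h 0 t) * 1) (x + 0 + 0 + 0)" using a1 by (simp only: add_0_left add_0)
    show "asym 1 ?\<phi>2 (1 * 1 * (\<alpha> + \<beta>) * (- \<i> * \<epsilon>) * (- h 0 0) * 1) (x + - \<epsilon> * t + 0 + 0 + 0 + 0)" using a2 by (simp only: add_0_left add_0)
    show "(%k. ?e k * phase m (- \<epsilon> * t) k * ?q k * ?I 0 k) \<in> borel_measurable borel"
      by (intro borel_measurable_times borel_measurable_parts borel_measurable_continuous_onI osc_int_continuous c)
    show "norm (?e k * phase m (- \<epsilon> * t) k * ?q k * ?I 0 k) <= 1 * 1 * (norm \<alpha> + norm \<beta> + norm \<gamma>) * B0" for k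
      unfolding norm_mult using B0 by (intro mult_mono norm_symb_le) auto
    show "?e k * phase m (- \<epsilon> * t) k * ?q k * ?I 0 k = ?\<phi>1 k + ?\<phi>2 k" if k: "k >= 1" for k
    proof -
      have PQ: "phase m (- \<epsilon> * t) k * phase m (\<epsilon> * t) k = 1" by (simp add: phase_def exp_add[symmetric])
      have alg: "e * P * q * (c * (Q * a - b - z) * r) = e * q * (c * a) * r + e * P * q * c * (- b - z) * r"
        if "P * Q = 1" for e P q c Q a b z r :: complex
      proof -
        have "e * P * q * (c * (Q * a - b - z) * r) = e * q * (c * a) * r * (P * Q) + e * P * q * c * (- b - z) * r"
          by (simp only: algebra_simps) simp
        then show ?thesis unfolding that by simp
      qed
      show ?thesis unfolding step[OF rho_asymptotics(1)[OF k], of 0] One_nat_def[symmetric]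
        by (rule alg[OF PQ])
    qed
  qed (use x in auto)
qed

lemma improper_boundary:
  fixes h :: "nat => real => complex"
  assumes h: "\<And>i s. s >= 0 ==> (h i hvd h (Suc i) s) (at s within {0..})"
    and \<epsilon>: "\<epsilon> = 1 \<or> \<epsilon> = - 1" and t: "t > 0" and x: "x > 0" "x \<noteq> t"
  shows "improper (%k. exp (\<i> * cx k * cx x) * phase m (- \<epsilon> * t) k * symb m \<alpha> \<beta> \<gamma> k * osc_int (h 0) (\<i> * cx (\<epsilon> * rho m k)) t)"
proof -
  have x': "x \<noteq> \<epsilon> * t" "- x \<noteq> \<epsilon> * t" "x \<noteq> 0" "- x \<noteq> 0" using \<epsilon> x t by auto
  note b = improper_half_boundary[where h = h, OF h \<epsilon> t]
  from b[OF _ x'(4,2), of m "- \<alpha>" \<beta> \<gamma>]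
  show ?thesis unfolding improper_def using b[OF _ x'(3,1)] by simp
qed

section \<open>The transforms of the forces\<close>

lemma force_hat_continuous:
  assumes f: "force_family f" and T: "T >= 0"
  shows "continuous_on {0..T} (%\<tau>. hat (%y. f 0 l y \<tau>) k)"
proof -
  have fb: "\<exists>C. \<forall>x t. 0 <= t --> t <= T --> norm (f 0 l x t) <= C / (1 + x\<^sup>2)" for l
    using f by (simp add: force_family_def)
  from fb[of l] obtain C where C: "\<forall>x t. 0 <= t --> t <= T --> norm (f 0 l x t) <= C / (1 + x\<^sup>2)" ..
  from fb[of "Suc l"] obtain C' where C': "\<forall>x t. 0 <= t --> t <= T --> norm (f 0 (Suc l) x t) <= C' / (1 + x\<^sup>2)" ..
  have "((%\<tau>. hat (%y. f 0 l y \<tau>) k) hvd hat (%y. f 0 (Suc l) y \<tau>) k) (at \<tau> within {0..T})" if \<tau>: "\<tau> \<in> {0..T}" for \<tau>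
  proof (rule hat_has_time_derivative[OF \<tau>])
    show "((%s. f 0 l y s) hvd f 0 (Suc l) y s) (at s within {0..T})" if "s \<in> {0..T}" for s y
      by (rule has_vector_derivative_within_subset[of _ _ _ "{0..}"]) (use f that in \<open>auto simp: force_family_def\<close>)
    show "continuous_on UNIV (%y. f 0 l y s)" "continuous_on UNIV (%y. f 0 (Suc l) y s)" if "s \<in> {0..T}" for s
      using that by (auto intro: line_family_D(2)[OF force_family_slice[OF f]])
  qed (use C C' in auto)
  then show ?thesis using has_vector_derivative_continuous by (fastforce simp: continuous_on_eq_continuous_within)
qed

definition force_transform :: "(nat => nat => real => real => complex) => real => real => real => real => real => complex" where
  "force_transform f m \<epsilon> t \<sigma> k = osc_int (%\<tau>. hat (%y. f 0 0 y \<tau>) (\<sigma> * k)) (\<i> * cx (\<epsilon> * rho m k)) t"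

text \<open>Two integrations by parts in \<open>y\<close> leave the boundary value \<open>f(0, \<tau>)\<close> multiplied by \<open>k\<close>; an integration
by parts in \<open>\<tau>\<close> compensates this factor by \<open>1/\<rho>\<close>.\<close>

lemma force_transform_decay:
  assumes f: "force_family f" and t: "t > 0" and \<epsilon>: "\<epsilon> = 1 \<or> \<epsilon> = - 1" and \<sigma>: "\<sigma> = 1 \<or> \<sigma> = - 1"
  shows "\<exists>C. \<forall>k. norm (force_transform f m \<epsilon> t \<sigma> k) <= C / (1 + k\<^sup>2)"
proof -
  have t0: "t >= 0" using t by simp
  have slice: "line_family (%n x. f n l x \<tau>)" if "\<tau> \<in> {0..t}" for l \<tau> using force_family_slice[OF f] that by simp
  have fb: "\<exists>C\<ge>0. \<forall>x. \<forall>\<tau>\<in>{0..t}. norm (f n l x \<tau>) <= C / (1 + x\<^sup>2)" for n l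
  proof -
    have "\<exists>C. \<forall>x s. 0 <= s --> s <= t --> norm (f n l x s) <= C / (1 + x\<^sup>2)"
      using f by (simp add: force_family_def)
    then obtain C where C: "\<forall>x s. 0 <= s --> s <= t --> norm (f n l x s) <= C / (1 + x\<^sup>2)" ..
    have "C >= 0" by (rule weight_const_nonneg[of "f n l 0 0" C 0]) (use C[rule_format, of 0 0] t in simp)
    then show ?thesis using C by (intro exI[of _ C]) simp
  qed
  have hb: "\<exists>B\<ge>0. \<forall>k. \<forall>\<tau>\<in>{0..t}. norm (hat (%y. f n 0 y \<tau>) k) <= B" for n
  proof -
    from fb[of n 0] obtain C where C: "C >= 0" "\<forall>x. \<forall>\<tau>\<in>{0..t}. norm (f n 0 x \<tau>) <= C / (1 + x\<^sup>2)" by blast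
    have "norm (hat (%y. f n 0 y \<tau>) k) <= C * (LINT y|lborel. 1 / (1 + y\<^sup>2))" if "\<tau> \<in> {0..t}" for k \<tau>
      by (rule norm_hat_le, rule continuous_on_subset[OF line_family_D(2)[OF slice[OF that]]]) (use C that in auto)
    moreover have "C * (LINT y|lborel. 1 / (1 + (y::real)\<^sup>2)) >= 0"
      by (intro mult_nonneg_nonneg C Bochner_Integration.integral_nonneg) auto
    ultimately show ?thesis by blast
  qed
  have edge: "\<exists>B\<ge>0. \<forall>\<tau>\<in>{0..t}. norm (f n l 0 \<tau>) <= B" for n l
  proof -
    from fb[of n l] obtain C where C: "C >= 0" "\<forall>x. \<forall>\<tau>\<in>{0..t}. norm (f n l x \<tau>) <= C / (1 + x\<^sup>2)" by blast
    then have "\<forall>\<tau>\<in>{0..t}. norm (f n l 0 \<tau>) <= C" using C(2)[rule_format, of _ 0] by simp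
    then show ?thesis using C(1) by blast
  qed
  from hb[of 0] obtain B0 where B0: "B0 >= 0" "\<forall>k. \<forall>\<tau>\<in>{0..t}. norm (hat (%y. f 0 0 y \<tau>) k) <= B0" by blast
  from hb[of 2] obtain B2 where B2: "B2 >= 0" "\<forall>k. \<forall>\<tau>\<in>{0..t}. norm (hat (%y. f 2 0 y \<tau>) k) <= B2" by blast
  from edge[of 0 0] obtain E0 where E0: "E0 >= 0" "\<forall>\<tau>\<in>{0..t}. norm (f 0 0 0 \<tau>) <= E0" by blast
  from edge[of 1 0] obtain E1 where E1: "E1 >= 0" "\<forall>\<tau>\<in>{0..t}. norm (f 1 0 0 \<tau>) <= E1" by blast
  from edge[of 0 1] obtain Et where Et: "Et >= 0" "\<forall>\<tau>\<in>{0..t}. norm (f 0 1 0 \<tau>) <= Et" by blast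
  have hc: "continuous_on {0..t} (%\<tau>. hat (%y. f 0 0 y \<tau>) k)" for k by (rule force_hat_continuous[OF f t0])
  have d: "((%\<tau>. f 0 l 0 \<tau>) hvd f 0 (Suc l) 0 \<tau>) (at \<tau> within {0..t})" if "\<tau> \<in> {0..t}" for l \<tau>
    by (rule has_vector_derivative_within_subset[of _ _ _ "{0..}"]) (use f that in \<open>auto simp: force_family_def\<close>)
  have ec: "continuous_on {0..t} (%\<tau>. f 0 l 0 \<tau>)" for l
    using has_vector_derivative_continuous[OF d] by (simp add: continuous_on_eq_continuous_within)
  have main: "(1 + k\<^sup>2) * norm (force_transform f m \<epsilon> t \<sigma> k) <= B0 * t + ((E0 + E0 + Et * t) + (B2 + E1) * t)" for k
  proof -
    let ?\<omega> = "\<i> * cx (\<epsilon> * rho m k)" and ?k = "\<sigma> * k"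
    have ss: "cx \<sigma> * cx \<sigma> = 1" "\<sigma>\<^sup>2 = 1" "\<bar>\<epsilon>\<bar> = 1" "\<bar>\<sigma>\<bar> = 1" using \<sigma> \<epsilon> by auto
    have "norm (force_transform f m \<epsilon> t \<sigma> k) <= B0 * t"
      unfolding force_transform_def by (rule norm_osc_int_le[OF t0 hc]) (use B0 in auto)
    moreover have "k\<^sup>2 * norm (force_transform f m \<epsilon> t \<sigma> k) <= (E0 + E0 + Et * t) + (B2 + E1) * t"
    proof -
      let ?r = "%\<tau>. - (hat (%y. f 2 0 y \<tau>) ?k + f 1 0 0 \<tau>)"
      have two: "?r \<tau> = \<i> * ?k * f 0 0 0 \<tau> + ?k\<^sup>2 * hat (%y. f 0 0 y \<tau>) ?k" if "\<tau> \<in> {0..t}" for \<tau>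
      proof -
        have 1: "hat (%y. f 1 0 y \<tau>) ?k = - f 0 0 0 \<tau> + \<i> * ?k * hat (%y. f 0 0 y \<tau>) ?k"
          using line_family_hat_step[OF slice[OF that, of 0], of 0 ?k] by simp
        have 2: "hat (%y. f 2 0 y \<tau>) ?k = - f 1 0 0 \<tau> + \<i> * ?k * hat (%y. f 1 0 y \<tau>) ?k"
          using line_family_hat_step[OF slice[OF that, of 0], of 1 ?k] by (simp add: numeral_2_eq_2)
        show ?thesis unfolding 2 1 by (simp add: algebra_simps power2_eq_square)
      qed
      have rc: "continuous_on {0..t} ?r"
        by (rule iffD2[OF continuous_on_cong[OF refl two]]) (intro continuous_intros hc ec | assumption)+
      have "osc_int ?r ?\<omega> t = \<i> * ?k * osc_int (f 0 0 0) ?\<omega> t + ?k\<^sup>2 * force_transform f m \<epsilon> t \<sigma> k"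
      proof -
        have "osc_int ?r ?\<omega> t = integral {0..t} (%\<tau>. \<i> * ?k * (exp (?\<omega> * cx \<tau>) * f 0 0 0 \<tau>) + ?k\<^sup>2 * (exp (?\<omega> * cx \<tau>) * hat (%y. f 0 0 y \<tau>) ?k))"
          unfolding osc_int_def by (rule integral_cong) (simp only: two, simp add: algebra_simps)
        also have "\<dots> = integral {0..t} (%\<tau>. \<i> * ?k * (exp (?\<omega> * cx \<tau>) * f 0 0 0 \<tau>)) + integral {0..t} (%\<tau>. ?k\<^sup>2 * (exp (?\<omega> * cx \<tau>) * hat (%y. f 0 0 y \<tau>) ?k))"
          by (intro integral_add integrable_continuous_real continuous_intros hc ec)
        finally show ?thesis unfolding osc_int_def force_transform_def by simp
      qed
      then have e: "cx (k\<^sup>2) * force_transform f m \<epsilon> t \<sigma> k = osc_int ?r ?\<omega> t - \<i> * ?k * osc_int (f 0 0 0) ?\<omega> t"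
        using ss(2) by (simp add: power_mult_distrib flip: of_real_power)
      have b1: "norm (osc_int ?r ?\<omega> t) <= (B2 + E1) * t"
      proof (rule norm_osc_int_le[OF t0 rc])
        show "norm (?r \<tau>) <= B2 + E1" if "\<tau> \<in> {0..t}" for \<tau>
          unfolding norm_minus_cancel by (intro norm_triangle_mono) (use B2 E1 that in auto)
      qed simp
      have b2: "norm (\<i> * ?k * osc_int (f 0 0 0) ?\<omega> t) <= E0 + E0 + Et * t"
      proof -
        have "norm (?\<omega> * osc_int (f 0 0 0) ?\<omega> t) <= E0 + E0 + Et * t"
        proof -
          have "norm (osc_int (f 0 1 0) ?\<omega> t) <= Et * t"
            by (rule norm_osc_int_le[OF t0 ec]) (use Et in auto)
          moreover have "norm (exp (?\<omega> * cx t) * f 0 0 0 t) <= E0" "norm (f 0 0 0 0) <= E0"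
            using E0 t by (auto simp: norm_mult norm_exp_eq_Re)
          moreover have e: "?\<omega> * osc_int (f 0 0 0) ?\<omega> t = exp (?\<omega> * cx t) * f 0 0 0 t - f 0 0 0 0 - osc_int (f 0 1 0) ?\<omega> t"
            using osc_int_by_parts[where u = "f 0 0 0" and u' = "f 0 1 0", OF t0 d[of _ 0, folded One_nat_def] ec] by simp
          ultimately show ?thesis unfolding e
            using norm_triangle_ineq4[of "exp (?\<omega> * cx t) * f 0 0 0 t - f 0 0 0 0" "osc_int (f 0 1 0) ?\<omega> t"]
              norm_triangle_ineq4[of "exp (?\<omega> * cx t) * f 0 0 0 t" "f 0 0 0 0"] by linarith
        qed
        moreover have "norm (\<i> * ?k * osc_int (f 0 0 0) ?\<omega> t) <= norm (?\<omega> * osc_int (f 0 0 0) ?\<omega> t)"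
          unfolding norm_mult using abs_le_rho(1)[of k m] rho_nonneg[of m k] ss
          by (intro mult_right_mono) (simp_all add: norm_mult)
        ultimately show ?thesis by linarith
      qed
      have "k\<^sup>2 * norm (force_transform f m \<epsilon> t \<sigma> k) = norm (cx (k\<^sup>2) * force_transform f m \<epsilon> t \<sigma> k)"
        by (simp add: norm_mult norm_power)
      also have "\<dots> <= norm (osc_int ?r ?\<omega> t) + norm (\<i> * ?k * osc_int (f 0 0 0) ?\<omega> t)"
        unfolding e by (rule norm_triangle_ineq4)
      finally show ?thesis using b1 b2 by linarith
    qed
    ultimately show ?thesis by (simp add: distrib_right)
  qed
  show ?thesis
  proof (intro exI allI)
    fix k
    show "norm (force_transform f m \<epsilon> t \<sigma> k) <= (B0 * t + ((E0 + E0 + Et * t) + (B2 + E1) * t)) / (1 + k\<^sup>2)"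
      using main[of k] by (simp add: pos_le_divide_eq add_pos_nonneg mult.commute)
  qed
qed

lemma force_transform_continuous:
  assumes f: "force_family f" and t: "t > 0"
  shows "continuous_on UNIV (force_transform f m \<epsilon> t \<sigma>)"
proof -
  have "\<exists>C. \<forall>x s. 0 <= s --> s <= t --> norm (f 0 0 x s) <= C / (1 + x\<^sup>2)"
    using f by (simp add: force_family_def)
  then obtain C where C: "\<forall>x s. 0 <= s --> s <= t --> norm (f 0 0 x s) <= C / (1 + x\<^sup>2)" ..
  have slice: "line_family (%n x. f n 0 x \<tau>)" if "\<tau> \<in> {0..t}" for \<tau> using force_family_slice[OF f] that by simp
  show ?thesis unfolding force_transform_def[abs_def] osc_int_def
  proof (rule continuous_integral_param)
    show "continuous_on UNIV (%k. exp (\<i> * cx (\<epsilon> * rho m k) * cx \<tau>) * hat (%y. f 0 0 y \<tau>) (\<sigma> * k))" if "\<tau> \<in> {0..t}" for \<tau>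
      by (intro continuous_intros continuous_on_compose2[OF continuous_on_hat[OF line_family_decaying[OF slice[OF that]], of UNIV]]) auto
    show "continuous_on {0..t} (%\<tau>. exp (\<i> * cx (\<epsilon> * rho m k) * cx \<tau>) * hat (%y. f 0 0 y \<tau>) (\<sigma> * k))" for k
      by (intro continuous_intros force_hat_continuous f) (use t in simp)
    show "norm (exp (\<i> * cx (\<epsilon> * rho m k) * cx \<tau>) * hat (%y. f 0 0 y \<tau>) (\<sigma> * k)) <= C * (LINT y|lborel. 1 / (1 + y\<^sup>2))"
      if "\<tau> \<in> {0..t}" for k \<tau>
    proof -
      have "norm (hat (%y. f 0 0 y \<tau>) (\<sigma> * k)) <= C * (LINT y|lborel. 1 / (1 + y\<^sup>2))"
        by (rule norm_hat_le, rule continuous_on_subset[OF line_family_D(2)[OF slice[OF that]]]) (use C that in auto)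
      then show ?thesis by (simp add: norm_mult norm_exp_eq_Re)
    qed
  qed
qed

lemma force_integrable:
  assumes f: "force_family f" and t: "t > 0" and \<epsilon>: "\<epsilon> = 1 \<or> \<epsilon> = - 1" and \<sigma>: "\<sigma> = 1 \<or> \<sigma> = - 1"
  shows "integrable lborel (%k. exp (\<i> * cx k * cx x) * phase m u k * symb m \<alpha> \<beta> \<gamma> k * force_transform f m \<epsilon> t \<sigma> k)"
proof -
  from force_transform_decay[OF assms, of m] obtain C where C: "\<forall>k. norm (force_transform f m \<epsilon> t \<sigma> k) <= C / (1 + k\<^sup>2)" ..
  show ?thesis
  proof (rule integrable_inverse_square_bound)
    show "(%k. exp (\<i> * cx k * cx x) * phase m u k * symb m \<alpha> \<beta> \<gamma> k * force_transform f m \<epsilon> t \<sigma> k) \<in> borel_measurable borel"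
      by (intro borel_measurable_times borel_measurable_parts borel_measurable_continuous_onI force_transform_continuous f t)
    have "norm (symb m \<alpha> \<beta> \<gamma> k) * norm (force_transform f m \<epsilon> t \<sigma> k) <= (norm \<alpha> + norm \<beta> + norm \<gamma>) * (C / (1 + k\<^sup>2))" for k
      by (intro mult_mono norm_symb_le) (use C in auto)
    then show "norm (exp (\<i> * cx k * cx x) * phase m u k * symb m \<alpha> \<beta> \<gamma> k * force_transform f m \<epsilon> t \<sigma> k)
        <= ((norm \<alpha> + norm \<beta> + norm \<gamma>) * C) / (1 + k\<^sup>2)" for k
      by (simp add: norm_mult)
  qed
qed

section \<open>The integral representation\<close>

lemma improper_add: "improper \<phi> ==> improper \<psi> ==> improper (%k. \<phi> k + \<psi> k)"
proof -
  have half: "improper_half (%k. \<phi> k + \<psi> k)" if "improper_half \<phi>" "improper_half \<psi>" for \<phi> \<psi> :: "real => complex"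
  proof -
    from that obtain L L' where L: "((%A. integral {0..A} \<phi>) \<longlongrightarrow> L) at_top" "((%A. integral {0..A} \<psi>) \<longlongrightarrow> L') at_top"
      unfolding improper_half_def by blast
    have i: "\<phi> integrable_on {0..A}" "\<psi> integrable_on {0..A}" for A using that by (simp_all add: improper_half_def)
    show ?thesis unfolding improper_half_def integral_add[OF i]
      using tendsto_add[OF L] i by (blast intro: integrable_add)
  qed
  show "improper \<phi> ==> improper \<psi> ==> improper (%k. \<phi> k + \<psi> k)" by (simp add: improper_def half)
qed

lemma pv_minus: "pv \<phi> L ==> pv (%k. - \<phi> k) (- L)"
  unfolding pv_def by (auto intro!: integrable_neg tendsto_minus)

lemma wave_phase:
  "wave (omega1 m) x t k = exp (\<i> * cx k * cx x) * phase m (- t) k"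
  "wave (omega2 m) x t k = exp (\<i> * cx k * cx x) * phase m t k"
  by (simp_all add: wave_def omega1_def omega2_def phase_def exp_add[symmetric] mult.assoc)

lemma symb_half:
  "(\<alpha> * cx k + \<beta> * cx (rho m k) + \<gamma> * cx m) / (2 * cx (rho m k)) = symb m (\<alpha> / 2) (\<beta> / 2) (\<gamma> / 2) k"
  by (simp add: symb_def add_divide_distrib)

lemma split_quotient:
  fixes E P a b r y z :: complex
  shows
  "E * P * (a * y + b * z) / r = E * P * (a / r) * y + E * P * (b / r) * (z :: complex)"
  by (simp add: algebra_simps add_divide_distrib)

lemma hat_line_extension: "hat (line_extension g 0) = hat g"
  unfolding fun_eq_iff by (intro allI hat_cong) (simp add: line_extension_eq iter_deriv_def)

text \<open>The coefficients cover all eight integrands of the initial data at once.\<close>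

lemma initial_improper:
  assumes g: "schwartz_half_line g" "schwartz_half_line g'" and \<sigma>: "\<sigma> = 1 \<or> \<sigma> = - 1" and u: "u = t \<or> u = - t"
    and x: "x > 0" "t > 0" "x \<noteq> t"
    and eq: "\<And>k. \<phi> k = exp (\<i> * cx k * cx x) * phase m u k *
      ((\<alpha> * cx k + \<beta> * cx (rho m k) + \<gamma> * cx m) * hat g (\<sigma> * k) +
       (\<alpha>' * cx k + \<beta>' * cx (rho m k) + \<gamma>' * cx m) * hat g' (\<sigma> * k)) / (2 * cx (rho m k))"
  shows "pv \<phi> (gen_integral \<phi>)"
proof (rule pv_gen_integral)
  have x': "x \<noteq> - u" "x \<noteq> u" using u x by auto
  have "\<phi> = (%k. exp (\<i> * cx k * cx x) * phase m u k * symb m (\<alpha> / 2) (\<beta> / 2) (\<gamma> / 2) k * hat (line_extension g 0) (\<sigma> * k) +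
      exp (\<i> * cx k * cx x) * phase m u k * symb m (\<alpha>' / 2) (\<beta>' / 2) (\<gamma>' / 2) k * hat (line_extension g' 0) (\<sigma> * k))"
    unfolding fun_eq_iff eq split_quotient symb_half hat_line_extension by simp
  then show "improper \<phi>"
    using improper_add[OF improper_transform[OF line_extension_family[OF g(1)] \<sigma> x'] improper_transform[OF line_extension_family[OF g(2)] \<sigma> x']]
    by simp
qed

lemma force_pv:
  assumes f: "rapidly_decreasing_force f" "rapidly_decreasing_force f'" and \<epsilon>: "\<epsilon> = 1 \<or> \<epsilon> = - 1" and \<sigma>: "\<sigma> = 1 \<or> \<sigma> = - 1"
    and t: "t > 0"
    and eq: "\<And>k. \<phi> k = exp (\<i> * cx k * cx x) * phase m u k *
      ((\<alpha> * cx k + \<beta> * cx (rho m k) + \<gamma> * cx m) * force_transform (force_extension f) m \<epsilon> t \<sigma> k +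
       (\<alpha>' * cx k + \<beta>' * cx (rho m k) + \<gamma>' * cx m) * force_transform (force_extension f') m \<epsilon> t \<sigma> k) / (2 * cx (rho m k))"
  shows "pv \<phi> (integral UNIV \<phi>)"
proof (rule pv_integral)
  have "\<phi> = (%k. exp (\<i> * cx k * cx x) * phase m u k * symb m (\<alpha> / 2) (\<beta> / 2) (\<gamma> / 2) k * force_transform (force_extension f) m \<epsilon> t \<sigma> k +
      exp (\<i> * cx k * cx x) * phase m u k * symb m (\<alpha>' / 2) (\<beta>' / 2) (\<gamma>' / 2) k * force_transform (force_extension f') m \<epsilon> t \<sigma> k)"
    unfolding fun_eq_iff eq split_quotient symb_half by simp
  then show "integrable lborel \<phi>"
    using Bochner_Integration.integrable_add[OF force_integrable[OF force_extension_family[OF f(1)] t \<epsilon> \<sigma>] force_integrable[OF force_extension_family[OF f(2)] t \<epsilon> \<sigma>]]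
    by simp
qed

lemma tilde_hat_force_transform:
  "tilde_hat f (omega1 m) t k = force_transform (force_extension f) m 1 t 1 k"
  "tilde_hat f (omega1 m) t (- k) = force_transform (force_extension f) m 1 t (- 1) k"
  "tilde_hat f (omega2 m) t k = force_transform (force_extension f) m (- 1) t 1 k"
  "tilde_hat f (omega2 m) t (- k) = force_transform (force_extension f) m (- 1) t (- 1) k"
proof -
  have "hat (%y. force_extension f 0 0 y \<tau>) k = hat (%y. f (y, \<tau>)) k" for \<tau> k
    by (rule hat_cong) (simp add: force_extension_eq pderivs_def)
  then show "tilde_hat f (omega1 m) t k = force_transform (force_extension f) m 1 t 1 k"
    "tilde_hat f (omega1 m) t (- k) = force_transform (force_extension f) m 1 t (- 1) k"
    "tilde_hat f (omega2 m) t k = force_transform (force_extension f) m (- 1) t 1 k"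
    "tilde_hat f (omega2 m) t (- k) = force_transform (force_extension f) m (- 1) t (- 1) k"
    by (simp_all add: tilde_hat_def force_transform_def osc_int_def omega1_def omega2_def)
qed

definition time_transform :: "(real => complex) => real => real => real => real => complex" where
  "time_transform h m \<epsilon> t k = osc_int h (\<i> * cx (\<epsilon> * rho m k)) t"

lemma boundary_pv:
  assumes h: "smooth1 {0..} h" and \<epsilon>: "\<epsilon> = 1 \<or> \<epsilon> = - 1" and x: "x > 0" "t > 0" "x \<noteq> t"
    and eq: "\<And>k. \<phi> k = exp (\<i> * cx k * cx x) * phase m (- \<epsilon> * t) k * time_transform h m \<epsilon> t k *
      (\<alpha> * cx k + \<beta> * cx (rho m k) + \<gamma> * cx m) / cx (rho m k)"
  shows "pv \<phi> (gen_integral \<phi>)"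
proof (rule pv_gen_integral)
  have "improper (%k. exp (\<i> * cx k * cx x) * phase m (- \<epsilon> * t) k * symb m \<alpha> \<beta> \<gamma> k * osc_int (iter_deriv {0..} 0 h) (\<i> * cx (\<epsilon> * rho m k)) t)"
    by (rule improper_boundary[where h = "%i. iter_deriv {0..} i h", OF smooth1_half_line_derivs(1)[OF h] \<epsilon> x(2,1,3)])
  moreover have "\<phi> = (%k. exp (\<i> * cx k * cx x) * phase m (- \<epsilon> * t) k * symb m \<alpha> \<beta> \<gamma> k * osc_int (iter_deriv {0..} 0 h) (\<i> * cx (\<epsilon> * rho m k)) t)"
    unfolding fun_eq_iff eq symb_def by (simp add: time_transform_def iter_deriv_def mult_ac)
  ultimately show "improper \<phi>" by simp
qed

lemma time_transform_eq:
  "integral {0..t} (%\<tau>. h \<tau> * exp (omega1 m k * cx \<tau>)) = time_transform h m 1 t k"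
  "integral {0..t} (%\<tau>. h \<tau> * exp (omega2 m k * cx \<tau>)) = time_transform h m (- 1) t k"
  by (simp_all add: time_transform_def osc_int_def omega1_def omega2_def mult.commute)

text \<open>The propagator split into the two frequencies \<open>\<plusminus> \<rho>\<close>, as in the integrals that define \<open>\<Psi>\<close>.\<close>

lemma prop_phase:
  fixes y z :: complex
  assumes r: "rho m k \<noteq> 0"
  shows "prop1 m k s y z = (phase m (- s) k * ((rho m k + m) * y + k * z) + phase m s k * ((rho m k - m) * y - k * z)) / (2 * cx (rho m k))"
    "prop2 m k s y z = (phase m (- s) k * (k * y + (rho m k - m) * z) + phase m s k * (- (k * y) + (rho m k + m) * z)) / (2 * cx (rho m k))"
proof -
  let ?P = "phase m (- s) k" and ?Q = "phase m s k" and ?r = "cx (rho m k)"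
  have c: "cx (pc m k s) = (?Q + ?P) / 2" by (simp add: pc_def phase_def complex_eq_iff Re_exp Im_exp)
  have s: "cx (sin (rho m k * s)) = \<i> * (?P - ?Q) / 2" by (simp add: phase_def complex_eq_iff Re_exp Im_exp)
  have ab: "cx (pa m k s) = m * (\<i> * (?P - ?Q) / 2) / ?r" "cx (pb m k s) = k * (\<i> * (?P - ?Q) / 2) / ?r"
    unfolding s[symmetric] by (simp_all add: pa_def pb_def)
  have r': "?r \<noteq> 0" using r by simp
  have i: "\<i> * (a * (\<i> * b / 2) / ?r) = - a * b / (2 * ?r)" for a b by (simp add: mult.left_commute[of a \<i>])
  show "prop1 m k s y z = (?P * ((rho m k + m) * y + k * z) + ?Q * ((rho m k - m) * y - k * z)) / (2 * ?r)"
    unfolding prop1_def c ab i using r' by (simp add: field_simps)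
  show "prop2 m k s y z = (?P * (k * y + (rho m k - m) * z) + ?Q * (- (k * y) + (rho m k + m) * z)) / (2 * ?r)"
    unfolding prop2_def c ab mult_minus_left i using r' by (simp add: field_simps)
qed

lemma prop_integral:
  fixes y z :: "real => complex"
  assumes r: "rho m k \<noteq> 0" and y: "continuous_on {0..t} y" and z: "continuous_on {0..t} z"
  shows "integral {0..t} (%\<tau>. prop1 m k (t - \<tau>) (y \<tau>) (z \<tau>)) =
      (phase m (- t) k * ((rho m k + m) * time_transform y m 1 t k + k * time_transform z m 1 t k) + phase m t k * ((rho m k - m) * time_transform y m (- 1) t k - k * time_transform z m (- 1) t k)) / (2 * cx (rho m k))" (is ?A)
    "integral {0..t} (%\<tau>. prop2 m k (t - \<tau>) (y \<tau>) (z \<tau>)) =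
      (phase m (- t) k * (k * time_transform y m 1 t k + (rho m k - m) * time_transform z m 1 t k) + phase m t k * (- (k * time_transform y m (- 1) t k) + (rho m k + m) * time_transform z m (- 1) t k)) / (2 * cx (rho m k))" (is ?B)
proof -
  let ?e = "%\<epsilon> \<tau>. exp (\<i> * cx (\<epsilon> * rho m k) * cx \<tau>)"
  have ph: "phase m (- (t - \<tau>)) k = phase m (- t) k * ?e 1 \<tau>" "phase m (t - \<tau>) k = phase m t k * ?e (- 1) \<tau>" for \<tau>
    by (simp_all add: phase_def exp_add[symmetric] algebra_simps)
  have I: "((%\<tau>. ?e \<epsilon> \<tau> * u \<tau>) has_integral time_transform u m \<epsilon> t k) {0..t}" if "continuous_on {0..t} u" for \<epsilon> u
    unfolding time_transform_def osc_int_def by (intro integrable_integral integrable_continuous_real continuous_intros that)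
  have comb: "((%\<tau>. (P * (a * (?e 1 \<tau> * y \<tau>) + b * (?e 1 \<tau> * z \<tau>)) + Q * (c * (?e (- 1) \<tau> * y \<tau>) + d * (?e (- 1) \<tau> * z \<tau>))) / R) has_integral
      (P * (a * time_transform y m 1 t k + b * time_transform z m 1 t k) + Q * (c * time_transform y m (- 1) t k + d * time_transform z m (- 1) t k)) / R) {0..t}" for P Q R a b c d
    unfolding divide_inverse
    by (intro has_integral_mult_left has_integral_add has_integral_mult_right I y z)
  show ?A
  proof -
    have "prop1 m k (t - \<tau>) (y \<tau>) (z \<tau>) = (phase m (- t) k * ((rho m k + m) * (?e 1 \<tau> * y \<tau>) + k * (?e 1 \<tau> * z \<tau>)) + phase m t k * ((rho m k - m) * (?e (- 1) \<tau> * y \<tau>) + - k * (?e (- 1) \<tau> * z \<tau>))) / (2 * cx (rho m k))" for \<tau>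
      unfolding prop_phase[OF r] ph by (simp add: algebra_simps)
    then show ?thesis using integral_unique[OF comb[of "phase m (- t) k" "rho m k + m" k "phase m t k" "rho m k - m" "- k" "2 * cx (rho m k)"]] by simp
  qed
  show ?B
  proof -
    have "prop2 m k (t - \<tau>) (y \<tau>) (z \<tau>) = (phase m (- t) k * (k * (?e 1 \<tau> * y \<tau>) + (rho m k - m) * (?e 1 \<tau> * z \<tau>)) + phase m t k * (- k * (?e (- 1) \<tau> * y \<tau>) + (rho m k + m) * (?e (- 1) \<tau> * z \<tau>))) / (2 * cx (rho m k))" for \<tau>
      unfolding prop_phase[OF r] ph by (simp add: algebra_simps)
    then show ?thesis using integral_unique[OF comb[of "phase m (- t) k" k "rho m k - m" "phase m t k" "- k" "rho m k + m" "2 * cx (rho m k)"]] by simp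
  qed
qed

text \<open>The coefficients of \<open>exp (\<plusminus> i \<rho> t)\<close> in the terms of \<open>\<Psi>\<^sub>1\<close> are those of the propagator.\<close>

lemma combine_first:
  fixes E P Q K R M a a' b b' h h' y y' z z' u u' v v' :: complex
  assumes "R \<noteq> 0"
  shows "E * ((P * ((R + M) * (a - a') + K * (b + b')) + Q * ((R - M) * (a - a') - K * (b + b'))) / (2 * R) +
      (P * ((R + M) * (y - y') + K * (z + z' + 2 * h)) + Q * ((R - M) * (u - u') - K * (v + v' + 2 * h'))) / (2 * R)) =
    E * P * (K * b + (R + M) * a) / (2 * R) + E * P * (K * b' - (R + M) * a') / (2 * R)
    - E * Q * (K * b + (- R + M) * a) / (2 * R) - E * Q * (K * b' - (- R + M) * a') / (2 * R)
    + E * P * h * K / R - E * Q * h' * K / R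
    + (E * P * (K * z + (R + M) * y) / (2 * R) + E * P * (K * z' - (R + M) * y') / (2 * R))
    + (- (E * Q * (K * v + (- R + M) * u) / (2 * R)) - E * Q * (K * v' - (- R + M) * u') / (2 * R))"
  using assms by (simp add: field_simps)

lemma combine_second:
  fixes E P Q K R M a a' b b' h h' y y' z z' u u' v v' :: complex
  assumes "R \<noteq> 0"
  shows "E * ((P * (K * (a - a') + (R - M) * (b + b')) + Q * (- (K * (a - a')) + (R + M) * (b + b'))) / (2 * R) +
      (P * (K * (y - y') + (R - M) * (z + z' + 2 * h)) + Q * (- (K * (u - u')) + (R + M) * (v + v' + 2 * h'))) / (2 * R)) =
    E * P * (K * a - (- R + M) * b) / (2 * R) - E * P * (K * a' + (- R + M) * b') / (2 * R)
    - E * Q * (K * a - (R + M) * b) / (2 * R) + E * Q * (K * a' + (R + M) * b') / (2 * R)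
    - E * P * h * (- R + M) / R + E * Q * h' * (R + M) / R
    + (E * P * (K * y - (- R + M) * z) / (2 * R) - E * P * (K * y' + (- R + M) * z') / (2 * R))
    + (- (E * Q * (K * u - (R + M) * v) / (2 * R)) + E * Q * (K * u' + (R + M) * v') / (2 * R))"
  using assms by (simp add: field_simps)

lemma omega_values:
  "\<i> * omega1 m k = - cx (rho m k)" "\<i> * omega2 m k = cx (rho m k)"
  by (simp_all add: omega1_def omega2_def)

lemma force_transform_minus: "force_transform f m \<epsilon> t 1 (- k) = force_transform f m \<epsilon> t (- 1) k"
  by (simp add: force_transform_def)

lemma source_time_transform:
  assumes f1: "force_family f1" and f2: "force_family f2" and h: "continuous_on {0..t} h" and t: "t > 0"
  shows "continuous_on {0..t} (%\<tau>. odd_hat (%y. f1 0 0 y \<tau>) k)" (is ?A)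
    "continuous_on {0..t} (%\<tau>. even_hat (%y. f2 0 0 y \<tau>) k + 2 * h \<tau>)"
    "time_transform (%\<tau>. odd_hat (%y. f1 0 0 y \<tau>) k) m \<epsilon> t k =
      force_transform f1 m \<epsilon> t 1 k - force_transform f1 m \<epsilon> t (- 1) k" (is ?C)
    "time_transform (%\<tau>. even_hat (%y. f2 0 0 y \<tau>) k + 2 * h \<tau>) m \<epsilon> t k =
      force_transform f2 m \<epsilon> t 1 k + force_transform f2 m \<epsilon> t (- 1) k + 2 * time_transform h m \<epsilon> t k" (is ?D)
proof -
  have c: "continuous_on {0..t} (%\<tau>. hat (%y. f1 0 0 y \<tau>) k)" "continuous_on {0..t} (%\<tau>. hat (%y. f2 0 0 y \<tau>) k)" for k
    by (rule force_hat_continuous[OF f1 less_imp_le[OF t]], rule force_hat_continuous[OF f2 less_imp_le[OF t]])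
  show ?A
    "continuous_on {0..t} (%\<tau>. even_hat (%y. f2 0 0 y \<tau>) k + 2 * h \<tau>)"
    unfolding odd_hat_def even_hat_def by (intro continuous_intros c h)+
  let ?e = "%\<tau>. exp (\<i> * cx (\<epsilon> * rho m k) * cx \<tau>)"
  have I: "((%\<tau>. ?e \<tau> * u \<tau>) has_integral osc_int u (\<i> * cx (\<epsilon> * rho m k)) t) {0..t}" if "continuous_on {0..t} u" for u
    unfolding osc_int_def by (intro integrable_integral integrable_continuous_real continuous_intros that)
  show ?C
    using integral_unique[OF has_integral_diff[OF I[OF c(1)[of k]] I[OF c(1)[of "- k"]]]]
    by (simp add: time_transform_def osc_int_def force_transform_def odd_hat_def right_diff_distrib)
  show ?D
    using integral_unique[OF has_integral_add[OF has_integral_add[OF I[OF c(2)[of k]] I[OF c(2)[of "- k"]]] has_integral_mult_right[OF I[OF h], of 2]]]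
    by (simp add: osc_int_def force_transform_def even_hat_def time_transform_def distrib_left mult.left_commute)
qed

text \<open>The separate convergence of all terms allows the integrands to be added; their sum is Duhamel's formula
by \<open>combine_first\<close> and \<open>combine_second\<close>.\<close>

lemma representation:
  assumes g: "schwartz_half_line g1" "schwartz_half_line g2" and h: "smooth1 {0..} h1"
    and f: "rapidly_decreasing_force f1" "rapidly_decreasing_force f2" and x: "x > 0" "t > 0" "x \<noteq> t"
  shows "pv (%k. exp (\<i> * k * x) * source1 m (line_extension g1 0) (line_extension g2 0)
        (%\<tau> y. force_extension f1 0 0 y \<tau>) (%\<tau> y. force_extension f2 0 0 y \<tau>) h1 t k) (2 * pi * Psi1 m g1 g2 h1 f1 f2 (x, t))" (is "pv ?S1 ?L1")
    and "pv (%k. exp (\<i> * k * x) * source2 m (line_extension g1 0) (line_extension g2 0)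
        (%\<tau> y. force_extension f1 0 0 y \<tau>) (%\<tau> y. force_extension f2 0 0 y \<tau>) h1 t k) (2 * pi * Psi2 m g1 g2 h1 f1 f2 (x, t))" (is "pv ?S2 ?L2")
proof -
  have u: "- t = t \<or> - t = - t" "t = t \<or> t = - t" by simp_all
  have s: "(1::real) = 1 \<or> (1::real) = - 1" "(- 1::real) = 1 \<or> (- 1::real) = - 1" by simp_all
  note I = initial_improper[where m = m, OF g(2) g(1) _ _ x] and I' = initial_improper[where m = m, OF g(1) g(2) _ _ x]
  note F = force_pv[where m = m and x = x, OF f(2) f(1) _ _ x(2)] and F' = force_pv[where m = m and x = x, OF f(1) f(2) _ _ x(2)]
  note defs = wave_phase omega_values tilde_hat_force_transform(1,3) force_transform_minus time_transform_eq
  have G1: "pv (%k. wave (omega1 m) x t k * (k * hat g2 k + (\<i> * omega2 m k + m) * hat g1 k) / (2 * rho m k)) (G11 m g1 g2 x t)"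
    "pv (%k. wave (omega1 m) x t k * (k * hat g2 (- k) - (\<i> * omega2 m k + m) * hat g1 (- k)) / (2 * rho m k)) (G12 m g1 g2 x t)"
    "pv (%k. wave (omega2 m) x t k * (k * hat g2 k + (\<i> * omega1 m k + m) * hat g1 k) / (2 * rho m k)) (G13 m g1 g2 x t)"
    "pv (%k. wave (omega2 m) x t k * (k * hat g2 (- k) - (\<i> * omega1 m k + m) * hat g1 (- k)) / (2 * rho m k)) (G14 m g1 g2 x t)"
    unfolding G11_def G12_def G13_def G14_def defs
    by (rule I[OF s(1) u(1), where \<alpha> = 1 and \<beta> = 0 and \<gamma> = 0 and \<alpha>' = 0 and \<beta>' = 1 and \<gamma>' = 1], simp add: algebra_simps)
       (rule I[OF s(2) u(1), where \<alpha> = 1 and \<beta> = 0 and \<gamma> = 0 and \<alpha>' = 0 and \<beta>' = "- 1" and \<gamma>' = "- 1"], simp add: algebra_simps,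
        rule I[OF s(1) u(2), where \<alpha> = 1 and \<beta> = 0 and \<gamma> = 0 and \<alpha>' = 0 and \<beta>' = "- 1" and \<gamma>' = 1], simp add: algebra_simps,
        rule I[OF s(2) u(2), where \<alpha> = 1 and \<beta> = 0 and \<gamma> = 0 and \<alpha>' = 0 and \<beta>' = 1 and \<gamma>' = "- 1"], simp add: algebra_simps)
  have G2: "pv (%k. wave (omega1 m) x t k * (k * hat g1 k - (\<i> * omega1 m k + m) * hat g2 k) / (2 * rho m k)) (G21 m g1 g2 x t)"
    "pv (%k. wave (omega1 m) x t k * (k * hat g1 (- k) + (\<i> * omega1 m k + m) * hat g2 (- k)) / (2 * rho m k)) (G22 m g1 g2 x t)"
    "pv (%k. wave (omega2 m) x t k * (k * hat g1 k - (\<i> * omega2 m k + m) * hat g2 k) / (2 * rho m k)) (G23 m g1 g2 x t)"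
    "pv (%k. wave (omega2 m) x t k * (k * hat g1 (- k) + (\<i> * omega2 m k + m) * hat g2 (- k)) / (2 * rho m k)) (G24 m g1 g2 x t)"
    unfolding G21_def G22_def G23_def G24_def defs
    by (rule I'[OF s(1) u(1), where \<alpha> = 1 and \<beta> = 0 and \<gamma> = 0 and \<alpha>' = 0 and \<beta>' = 1 and \<gamma>' = "- 1"], simp add: algebra_simps)
       (rule I'[OF s(2) u(1), where \<alpha> = 1 and \<beta> = 0 and \<gamma> = 0 and \<alpha>' = 0 and \<beta>' = "- 1" and \<gamma>' = 1], simp add: algebra_simps,
        rule I'[OF s(1) u(2), where \<alpha> = 1 and \<beta> = 0 and \<gamma> = 0 and \<alpha>' = 0 and \<beta>' = "- 1" and \<gamma>' = "- 1"], simp add: algebra_simps,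
        rule I'[OF s(2) u(2), where \<alpha> = 1 and \<beta> = 0 and \<gamma> = 0 and \<alpha>' = 0 and \<beta>' = 1 and \<gamma>' = 1], simp add: algebra_simps)
  have H1: "pv (%k. wave (omega1 m) x t k * integral {0..t} (%\<tau>. h1 \<tau> * exp (omega1 m k * \<tau>)) * k / rho m k) (H1 m (omega1 m) h1 x t)"
    "pv (%k. wave (omega2 m) x t k * integral {0..t} (%\<tau>. h1 \<tau> * exp (omega2 m k * \<tau>)) * k / rho m k) (H1 m (omega2 m) h1 x t)"
    unfolding H1_def defs
    by (rule boundary_pv[where m = m, OF h s(1) x, where \<alpha> = 1 and \<beta> = 0 and \<gamma> = 0], simp)
       (rule boundary_pv[where m = m, OF h s(2) x, where \<alpha> = 1 and \<beta> = 0 and \<gamma> = 0], simp)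
  have H2: "pv (%k. wave (omega1 m) x t k * integral {0..t} (%\<tau>. h1 \<tau> * exp (omega1 m k * \<tau>)) * (\<i> * omega1 m k + m) / rho m k) (H2 m (omega1 m) h1 x t)"
    "pv (%k. wave (omega2 m) x t k * integral {0..t} (%\<tau>. h1 \<tau> * exp (omega2 m k * \<tau>)) * (\<i> * omega2 m k + m) / rho m k) (H2 m (omega2 m) h1 x t)"
    unfolding H2_def defs
    by (rule boundary_pv[where m = m, OF h s(1) x, where \<alpha> = 0 and \<beta> = "- 1" and \<gamma> = 1], simp)
       (rule boundary_pv[where m = m, OF h s(2) x, where \<alpha> = 0 and \<beta> = 1 and \<gamma> = 1], simp)
  have F11: "pv (%k. wave (omega1 m) x t k * (k * tilde_hat f2 (omega1 m) t k + (\<i> * omega2 m k + m) * tilde_hat f1 (omega1 m) t k) / (2 * rho m k)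
      + wave (omega1 m) x t k * (k * tilde_hat f2 (omega1 m) t (- k) - (\<i> * omega2 m k + m) * tilde_hat f1 (omega1 m) t (- k)) / (2 * rho m k)) (F11 m f1 f2 x t)"
    unfolding F11_def defs
    by (rule pv_add, rule F[OF s(1) s(1), where u = "- t" and \<alpha> = 1 and \<beta> = 0 and \<gamma> = 0 and \<alpha>' = 0 and \<beta>' = 1 and \<gamma>' = 1], simp add: algebra_simps)
       (rule F[OF s(1) s(2), where u = "- t" and \<alpha> = 1 and \<beta> = 0 and \<gamma> = 0 and \<alpha>' = 0 and \<beta>' = "- 1" and \<gamma>' = "- 1"], simp add: algebra_simps)
  have F12: "pv (%k. - (wave (omega2 m) x t k * (k * tilde_hat f2 (omega2 m) t k + (\<i> * omega1 m k + m) * tilde_hat f1 (omega2 m) t k) / (2 * rho m k))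
      - wave (omega2 m) x t k * (k * tilde_hat f2 (omega2 m) t (- k) - (\<i> * omega1 m k + m) * tilde_hat f1 (omega2 m) t (- k)) / (2 * rho m k)) (F12 m f1 f2 x t)"
    unfolding F12_def defs
    by (rule pv_diff, rule pv_minus, rule F[OF s(2) s(1), where u = t and \<alpha> = 1 and \<beta> = 0 and \<gamma> = 0 and \<alpha>' = 0 and \<beta>' = "- 1" and \<gamma>' = 1], simp add: algebra_simps)
       (rule F[OF s(2) s(2), where u = t and \<alpha> = 1 and \<beta> = 0 and \<gamma> = 0 and \<alpha>' = 0 and \<beta>' = 1 and \<gamma>' = "- 1"], simp add: algebra_simps)
  have F21: "pv (%k. wave (omega1 m) x t k * (k * tilde_hat f1 (omega1 m) t k - (\<i> * omega1 m k + m) * tilde_hat f2 (omega1 m) t k) / (2 * rho m k)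
      - wave (omega1 m) x t k * (k * tilde_hat f1 (omega1 m) t (- k) + (\<i> * omega1 m k + m) * tilde_hat f2 (omega1 m) t (- k)) / (2 * rho m k)) (F21 m f1 f2 x t)"
    unfolding F21_def defs
    by (rule pv_diff, rule F'[OF s(1) s(1), where u = "- t" and \<alpha> = 1 and \<beta> = 0 and \<gamma> = 0 and \<alpha>' = 0 and \<beta>' = 1 and \<gamma>' = "- 1"], simp add: algebra_simps)
       (rule F'[OF s(1) s(2), where u = "- t" and \<alpha> = 1 and \<beta> = 0 and \<gamma> = 0 and \<alpha>' = 0 and \<beta>' = "- 1" and \<gamma>' = 1], simp add: algebra_simps)
  have F22: "pv (%k. - (wave (omega2 m) x t k * (k * tilde_hat f1 (omega2 m) t k - (\<i> * omega2 m k + m) * tilde_hat f2 (omega2 m) t k) / (2 * rho m k))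
      + wave (omega2 m) x t k * (k * tilde_hat f1 (omega2 m) t (- k) + (\<i> * omega2 m k + m) * tilde_hat f2 (omega2 m) t (- k)) / (2 * rho m k)) (F22 m f1 f2 x t)"
    unfolding F22_def defs
    by (rule pv_add, rule pv_minus, rule F'[OF s(2) s(1), where u = t and \<alpha> = 1 and \<beta> = 0 and \<gamma> = 0 and \<alpha>' = 0 and \<beta>' = "- 1" and \<gamma>' = "- 1"], simp add: algebra_simps)
       (rule F'[OF s(2) s(2), where u = t and \<alpha> = 1 and \<beta> = 0 and \<gamma> = 0 and \<alpha>' = 0 and \<beta>' = 1 and \<gamma>' = 1], simp add: algebra_simps)
  have hc: "continuous_on {0..t} h1"
  proof -
    have "(h1 hvd iter_deriv {0..} (Suc 0) h1 \<tau>) (at \<tau> within {0..})" if "\<tau> >= 0" for \<tau>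
      using smooth1_half_line_derivs(1)[OF h that, of 0] by (simp add: iter_deriv_def)
    from has_vector_derivative_continuous[OF this] have "continuous_on {0..} h1" by (simp add: continuous_on_eq_continuous_within)
    then show ?thesis by (rule continuous_on_subset) auto
  qed
  have r: "rho m k \<noteq> 0" if "k \<noteq> 0" for k using rho_zero[of m k] that by blast
  note S = source_time_transform[OF force_extension_family[OF f(1)] force_extension_family[OF f(2)] hc x(2)]
  have "2 * pi * Psi1 m g1 g2 h1 f1 f2 (x, t) = G11 m g1 g2 x t + G12 m g1 g2 x t - G13 m g1 g2 x t - G14 m g1 g2 x t
      + H1 m (omega1 m) h1 x t - H1 m (omega2 m) h1 x t + F11 m f1 f2 x t + F12 m f1 f2 x t" by (simp add: Psi1_def)
  moreover have "pv ?S1 (G11 m g1 g2 x t + G12 m g1 g2 x t - G13 m g1 g2 x t - G14 m g1 g2 x t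
      + H1 m (omega1 m) h1 x t - H1 m (omega2 m) h1 x t + F11 m f1 f2 x t + F12 m f1 f2 x t)"
  proof (rule pv_cong[OF pv_add[OF pv_add[OF pv_diff[OF pv_add[OF pv_diff[OF pv_diff[OF pv_add[OF G1(1,2)] G1(3)] G1(4)] H1(1)] H1(2)] F11] F12]], goal_cases)
    case (1 k)
    note r = r[OF 1]
    then have r': "cx (rho m k) \<noteq> 0" by simp
    note P = prop_integral(1)[OF r S(1,2)]
    show ?case
      unfolding source1_def P S(3,4)
      unfolding prop_phase[OF r] odd_hat_def even_hat_def hat_line_extension wave_phase omega_values tilde_hat_force_transform(1,3) force_transform_minus time_transform_eq
        of_real_add of_real_diff of_real_mult of_real_numeral
      by (rule combine_first[OF r'])
  qed
  ultimately show "pv ?S1 ?L1" by simp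
  have "2 * pi * Psi2 m g1 g2 h1 f1 f2 (x, t) = G21 m g1 g2 x t - G22 m g1 g2 x t - G23 m g1 g2 x t + G24 m g1 g2 x t
      - H2 m (omega1 m) h1 x t + H2 m (omega2 m) h1 x t + F21 m f1 f2 x t + F22 m f1 f2 x t" by (simp add: Psi2_def)
  moreover have "pv ?S2 (G21 m g1 g2 x t - G22 m g1 g2 x t - G23 m g1 g2 x t + G24 m g1 g2 x t
      - H2 m (omega1 m) h1 x t + H2 m (omega2 m) h1 x t + F21 m f1 f2 x t + F22 m f1 f2 x t)"
  proof (rule pv_cong[OF pv_add[OF pv_add[OF pv_add[OF pv_diff[OF pv_add[OF pv_diff[OF pv_diff[OF G2(1,2)] G2(3)] G2(4)] H2(1)] H2(2)] F21] F22]], goal_cases)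
    case (1 k)
    note r = r[OF 1]
    then have r': "cx (rho m k) \<noteq> 0" by simp
    note P = prop_integral(2)[OF r S(1,2)]
    show ?case
      unfolding source2_def P S(3,4)
      unfolding prop_phase[OF r] odd_hat_def even_hat_def hat_line_extension wave_phase omega_values tilde_hat_force_transform(1,3) force_transform_minus time_transform_eq
        of_real_add of_real_diff of_real_mult of_real_numeral
      by (rule combine_second[OF r'])
  qed
  ultimately show "pv ?S2 ?L2" by simp
qed

theorem theorem5:
  fixes m :: real
    and g1 g2 h1 :: "real \<Rightarrow> complex"
    and f1 f2 :: "real \<times> real \<Rightarrow> complex"
    and \<Psi>1 \<Psi>2 :: "real \<times> real \<Rightarrow> complex"
  assumes "m \<ge> 0"
    and "schwartz_half_line g1" and "schwartz_half_line g2"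
    and "smooth1 {0..} h1"
    and "rapidly_decreasing_force f1" and "rapidly_decreasing_force f2"
    and "\<Psi>1 = Psi1 m g1 g2 h1 f1 f2"
    and "\<Psi>2 = Psi2 m g1 g2 h1 f1 f2"
  shows
    "(\<forall>\<Psi>\<in>{\<Psi>1, \<Psi>2}. \<forall>n l. \<exists>\<phi>. smooth1 {0<..} \<phi> \<and>
        (\<forall>K. compact K \<and> K \<subseteq> {0<..} \<longrightarrow>
           uniform_limit K (\<lambda>t x. dPsi n l \<Psi> (x, t)) \<phi> (at_right 0)))
   \<and> (\<forall>\<Psi>\<in>{\<Psi>1, \<Psi>2}. \<forall>n l. \<exists>\<phi>. smooth1 {0<..} \<phi> \<and>
        (\<forall>K. compact K \<and> K \<subseteq> {0<..} \<longrightarrow>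
           uniform_limit K (\<lambda>x t. dPsi n l \<Psi> (x, t)) \<phi> (at_right 0)))
   \<and> (\<forall>\<Psi>\<in>{\<Psi>1, \<Psi>2}. extends_smoothly_near {(x, 0) | x. x > 0} \<Psi>
                       \<and> extends_smoothly_near {(0, t) | t. t > 0} \<Psi>)
   \<and> (\<forall>n. \<forall>x>0.
        ((\<lambda>t. dPsi n 0 \<Psi>1 (x, t)) \<longlongrightarrow> iter_deriv {0..} n g1 x) (at_right 0) \<and>
        ((\<lambda>t. dPsi n 0 \<Psi>2 (x, t)) \<longlongrightarrow> iter_deriv {0..} n g2 x) (at_right 0))
   \<and> (\<forall>l. \<forall>t>0.
        ((\<lambda>x. dPsi 0 l \<Psi>1 (x, t)) \<longlongrightarrow> iter_deriv {0..} l h1 t) (at_right 0))"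
proof -
  have g: "schwartz_half_line g1" "schwartz_half_line g2" "smooth1 {0..} g1" "smooth1 {0..} g2"
    using assms by (simp_all add: schwartz_half_line_def)
  note h = assms(4) and f = assms(5,6)
  let ?h = "%i. iter_deriv {0..} i h1"
  interpret D: dirac_half_line m "line_extension g1" "line_extension g2" "force_extension f1" "force_extension f2" ?h
    by unfold_locales (intro line_extension_family g force_extension_family f smooth1_half_line_derivs(1) h | assumption)+
  have h0: "?h 0 = h1" by (simp add: iter_deriv_def fun_eq_iff)
  have val: "\<Psi>1 (x, t) = (if x < t then D.near1 (x, t) else D.v1 0 0 x t)"
    "\<Psi>2 (x, t) = (if x < t then D.near2 (x, t) else D.v2 0 0 x t)" if x: "x > 0" "t > 0" "x \<noteq> t" for x t
    using pv_unique[OF representation(1)[OF g(1,2) h f x, of m] D.source_inversion(1)[OF x, unfolded h0]]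
      pv_unique[OF representation(2)[OF g(1,2) h f x, of m] D.source_inversion(2)[OF x, unfolded h0]]
    by (auto simp: assms(7,8) split: if_splits)
  have a1: "(%(x, t). D.v1 0 0 x t) p = \<Psi>1 p" "(%(x, t). D.v2 0 0 x t) p = \<Psi>2 p" if "p \<in> D.initial_side \<inter> offdiag_quadrant" for p
    using that val[of "fst p" "snd p"] by (auto simp: D.initial_side_def offdiag_quadrant_def)
  have b1: "D.near1 p = \<Psi>1 p" "D.near2 p = \<Psi>2 p" if "p \<in> D.boundary_side \<inter> offdiag_quadrant" for p
    using that val[of "fst p" "snd p"] by (auto simp: D.boundary_side_def offdiag_quadrant_def)
  have La: "(x, 0) \<in> D.initial_side" if "x > 0" for x using that by (simp add: D.initial_side_def)
  have Lb: "(0, t) \<in> D.boundary_side" if "t > 0" for t using that by (simp add: D.boundary_side_def)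
  have init: "(%(x, t). D.v1 0 0 x t) (x, 0) = g1 x" "(%(x, t). D.v2 0 0 x t) (x, 0) = g2 x" if "x > 0" for x
    using that by (simp_all add: D.v_initial line_extension_eq iter_deriv_def)
  have bdry: "D.near1 (0, t) = h1 t" if "t > 0" for t
    unfolding D.near1_boundary h0 ..
  have ext: "extends_smoothly_near L \<Psi>" if "open U" "L \<subseteq> U" "smooth2 U \<Phi>" "\<And>p. p \<in> U \<inter> offdiag_quadrant ==> \<Phi> p = \<Psi> p" for L U \<Phi> \<Psi>
    unfolding extends_smoothly_near_def using that by (intro exI[of _ U] exI[of _ \<Phi>]) simp
  have Sa: "{(x, 0) | x. x > 0} \<subseteq> D.initial_side" and Sb: "{(0, t) | t. t > 0} \<subseteq> D.boundary_side"
    using La Lb by auto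
  have both: "\<forall>\<Psi>\<in>{\<Psi>1, \<Psi>2}. R \<Psi>" if "R \<Psi>1" "R \<Psi>2" for R using that by simp
  show ?thesis
  proof (intro conjI)
    show "\<forall>\<Psi>\<in>{\<Psi>1, \<Psi>2}. \<forall>n l. \<exists>\<phi>. smooth1 {0<..} \<phi> \<and> (\<forall>K. compact K \<and> K \<subseteq> {0<..} -->
        uniform_limit K (%t x. dPsi n l \<Psi> (x, t)) \<phi> (at_right 0))"
      by (rule both; intro allI) ((rule limits_at_initial_axis(1)[OF D.open_sides(1) D.smooth_initial_side(1) La a1(1)]; assumption),
          (rule limits_at_initial_axis(1)[OF D.open_sides(1) D.smooth_initial_side(2) La a1(2)]; assumption))
    show "\<forall>\<Psi>\<in>{\<Psi>1, \<Psi>2}. \<forall>n l. \<exists>\<phi>. smooth1 {0<..} \<phi> \<and> (\<forall>K. compact K \<and> K \<subseteq> {0<..} -->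
        uniform_limit K (%x t. dPsi n l \<Psi> (x, t)) \<phi> (at_right 0))"
      by (rule both; intro allI) ((rule limits_at_boundary_axis(1)[OF D.open_sides(2) D.smooth_near(1) Lb b1(1)]; assumption),
          (rule limits_at_boundary_axis(1)[OF D.open_sides(2) D.smooth_near(2) Lb b1(2)]; assumption))
    show "\<forall>\<Psi>\<in>{\<Psi>1, \<Psi>2}. extends_smoothly_near {(x, 0) | x. x > 0} \<Psi> \<and> extends_smoothly_near {(0, t) | t. t > 0} \<Psi>"
      by (rule both; rule conjI)
         (rule ext[OF D.open_sides(1) Sa D.smooth_initial_side(1) a1(1)], assumption,
          rule ext[OF D.open_sides(2) Sb D.smooth_near(1) b1(1)], assumption,
          rule ext[OF D.open_sides(1) Sa D.smooth_initial_side(2) a1(2)], assumption,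
          rule ext[OF D.open_sides(2) Sb D.smooth_near(2) b1(2)], assumption)
    show "\<forall>n. \<forall>x>0.
        ((%t. dPsi n 0 \<Psi>1 (x, t)) \<longlongrightarrow> iter_deriv {0..} n g1 x) (at_right 0) \<and>
        ((%t. dPsi n 0 \<Psi>2 (x, t)) \<longlongrightarrow> iter_deriv {0..} n g2 x) (at_right 0)"
    proof (intro allI impI conjI)
      fix n and x :: real assume x: "x > 0"
      show "((%t. dPsi n 0 \<Psi>1 (x, t)) \<longlongrightarrow> iter_deriv {0..} n g1 x) (at_right 0)"
        by (rule limits_at_initial_axis(2)[OF D.open_sides(1) D.smooth_initial_side(1) La a1(1) g(3) init(1) x]; assumption)
      show "((%t. dPsi n 0 \<Psi>2 (x, t)) \<longlongrightarrow> iter_deriv {0..} n g2 x) (at_right 0)"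
        by (rule limits_at_initial_axis(2)[OF D.open_sides(1) D.smooth_initial_side(2) La a1(2) g(4) init(2) x]; assumption)
    qed
    show "\<forall>l. \<forall>t>0. ((%x. dPsi 0 l \<Psi>1 (x, t)) \<longlongrightarrow> iter_deriv {0..} l h1 t) (at_right 0)"
    proof (intro allI impI)
      fix l and t :: real assume t: "t > 0"
      show "((%x. dPsi 0 l \<Psi>1 (x, t)) \<longlongrightarrow> iter_deriv {0..} l h1 t) (at_right 0)"
        by (rule limits_at_boundary_axis(2)[OF D.open_sides(2) D.smooth_near(1) Lb b1(1) h bdry t]; assumption)
    qed
  qed
qed

end
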